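(* Let $\mathcal H=\{(x_1,x_2)\in\mathbb R^2\mid x_1(x_1^2-x_2^2)=1,\ x_1>0\}$ be the inhomogeneous complete PSR curve, with cubic polynomial $h=x_1^3-x_1x_2^2$, and let $(\overline N,g_{\overline N})$, $\overline N\to\mathcal H$, be the associated tree-level q-map space. After taking a quotient of $\overline N\to\mathcal H$ by a lattice in $\mathrm{SL}(2,\mathbb R)\ltimes\exp(\mathfrak n)\subset\mathrm{Iso}(\overline N,g_{\overline N})$, the fiber-wise volume increases exponentially as a function of the arc-length parameter $s$ along both ends of $\mathcal H$. In particular, the total volume is infinite.
   Context: Conventions: here $n=2$, the coordinates $(t^1,t^2)$ of $\mathbb R^2$ are written $(x_1,x_2)$; indices $a,b,c,\dots$ run from $1$ to $n$, indices $i,j,k,\dots$ from $0$ to $n$; repeated indices are summed. Write $h(t)=\frac16k_{abc}t^at^bt^c$ with $k_{abc}$ symmetric; $g_{\mathcal H}=-\partial^2h|_{T\mathcal H\times T\mathcal H}$. The arc-length parameter $s$ (with respect to $g_{\mathcal H}$) is measured from $(x_1,x_2)=(1,0)$ outward along each of the two ends of $\mathcal H$. Tree-level q-map space: put $U=\mathbb R_{>0}\cdot\mathcal H\subset\mathbb R^n$, $\overline M=\mathbb R^n+iU\subset\mathbb C^n$ with coordinates $z^a=b^a+it^a$, $z^0:=1$, $K(t)=8h(t)$, $\mathcal K=-\log K$, and $g_{\overline M}=\frac{\partial^2\mathcal K}{\partial z^a\partial\overline z^b}dz^ad\overline z^b=-\frac14\frac{\partial^2\log h}{\partial t^a\partial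 t^b}(db^adb^b+dt^adt^b)$. Let $\mathfrak F(X)=-h(X^1,\dots,X^n)/X^0$, $\tau_{ij}=\frac{\partial^2\mathfrak F}{\partial X^i\partial X^j}$ evaluated at $X=(1,z)$, $N_{ij}=-2\,\mathrm{Im}(\tau_{ij})$, $(N^{ij})=(N_{ij})^{-1}$, $W_i=d\widetilde\zeta_i-\tau_{ij}d\zeta^j$; then $K=N_{ij}z^i\overline z^j$. The tree-level q-map space is $\overline N=\overline M\times\mathbb R_{>0}\times\mathbb R^{2n+2}\times\mathbb R$ with global ("type IIA") coordinates $(z^a,\rho,\widetilde\zeta_i,\zeta^i,\sigma)$ and metric $$g_{\overline N}=g_{\overline M}+\frac{d\rho^2}{4\rho^2}-\frac1{4\rho}\Big(N^{ij}-\frac2Kz^i\overline z^j\Big)W_i\overline W_j+\frac1{64\rho^2}\big(d\sigma+\widetilde\zeta_id\zeta^i-\zeta^id\widetilde\zeta_i\big)^2 .$$ The projection $\overline N\to\mathcal H$ is $(z^a=b^a+it^a,\rho,\widetilde\zeta_i,\zeta^i,\sigma)\mapsto(t^a/h(t)^{1/3})$. For a lattice $\Gamma$, the fiber-wise volume is the volume of the fibers of $\overline N/\Gamma\to\mathcal H$ with respect to the metric induced by $g_{\overline N}$, as a function on $\mathcal H$. Group: $\mathfrak n=\mathrm{span}\{V_a,Z,P_a,X^i\}$ with $P_a=\partial_{\zeta^a}+\widetilde\zeta_a\partial_\sigma$, $X^i=\partial_{\widetilde\zeta_i}-\zeta^i\partial_\sigma$, $Z=\partial_\sigma$, $V_a=\partial_{b^a}+\zeta^0\partial_{\zeta^a}-\widetilde\zeta_a\partial_{\widetilde\zeta_0}-k_{abc}\zeta^c\partial_{\widetilde\zeta_b}$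 (Killing fields), and $\mathrm{SL}(2,\mathbb R)$ acts isometrically by S-duality: "type IIB" global coordinates $(b^a+it^a,\tau_1+i\tau_2,c^a,c_a,c_0,\psi)$ on $\overline N$ (with $\tau_2>0$) are defined by $\rho=\frac{\tau_2^2}{2}h(t)$, $z^a=b^a+it^a$, $\zeta^0=\tau_1$, $\zeta^a=-(c^a-\tau_1b^a)$, $\widetilde\zeta_a=c_a+\frac{k_{abc}}2b^b(c^c-\tau_1b^c)$, $\widetilde\zeta_0=c_0-\frac{k_{abc}}6b^ab^b(c^c-\tau_1b^c)$, $\sigma=-2(\psi+\frac12\tau_1c_0)+c_a(c^a-\tau_1b^a)-\frac{k_{abc}}6b^ac^b(c^c-\tau_1b^c)$, and $\begin{pmatrix}a&b\\ c&d\end{pmatrix}\in\mathrm{SL}(2,\mathbb R)$ acts, with $\tau=\tau_1+i\tau_2$, by $$\tau\mapsto\frac{a\tau+b}{c\tau+d},\quad t^a\mapsto|c\tau+d|t^a,\quad c_a\mapsto c_a,\quad\begin{pmatrix}c^a\\ b^a\end{pmatrix}\mapsto\begin{pmatrix}a&b\\ c&d\end{pmatrix}\begin{pmatrix}c^a\\ b^a\end{pmatrix},\quad\begin{pmatrix}c_0\\ \psi\end{pmatrix}\mapsto\begin{pmatrix}d&-c\\ -b&a\end{pmatrix}\begin{pmatrix}c_0\\ \psi\end{pmatrix}.$$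
   Formalization: The volume of a whole fiber is infinite for every lattice; the formal statement says fiber-wise volumes of all Borel parts scale by one exponentially increasing factor, and that the volume of the part ρ·h(t)^{1/3} ≥ ε is finite, positive and increases exponentially. *)

theory Defs
  imports "HOL-Analysis.Analysis" "HOL-Algebra.Group"
begin

section \<open>The cubic polynomial and the PSR curve\<close>

text \<open>Indices \<open>a, b, c\<close> are elements \<open>1, 2\<close> of the type \<open>2\<close>. Indices \<open>i, j\<close> running from
  \<open>0\<close> to \<open>2\<close> are elements of \<open>2 option\<close>, with \<open>None\<close> in the role of \<open>0\<close> and \<open>Some a\<close>
  in the role of \<open>a\<close>.\<close>

definition hcub :: "'a::real_normed_field ^ 2 \<Rightarrow> 'a" where
  "hcub x = (x $ 1) ^ 3 - x $ 1 * (x $ 2) ^ 2"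

definition kcub :: "2 \<Rightarrow> 2 \<Rightarrow> 2 \<Rightarrow> real" where
  "kcub a b c = (if (a, b, c) = (1, 1, 1) then 6
                 else if (a, b, c) \<in> {(1, 2, 2), (2, 1, 2), (2, 2, 1)} then - 2 else 0)"

lemma hcub_eq_kcub:
  "hcub t = 1 / 6 * (\<Sum>a\<in>UNIV. \<Sum>b\<in>UNIV. \<Sum>c\<in>UNIV. kcub a b c * t $ a * t $ b * t $ c)"
  by (simp add: UNIV_2 kcub_def hcub_def power2_eq_square power3_eq_cube)

text \<open>The partial derivative \<open>\<partial>f/\<partial>x\<^sup>i\<close>, real or complex according to the scalar field.\<close>

definition pd :: "'n \<Rightarrow> ('a::real_normed_field ^ 'n \<Rightarrow> 'a) \<Rightarrow> 'a ^ 'n \<Rightarrow> 'a" where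
  "pd i f x = deriv (\<lambda>w. f (\<chi> j. if j = i then w else x $ j)) (x $ i)"

definition psr_curve :: "(real ^ 2) set" where
  "psr_curve = {x. x $ 1 * ((x $ 1) ^ 2 - (x $ 2) ^ 2) = 1 \<and> x $ 1 > 0}"

definition psr_metric :: "real ^ 2 \<Rightarrow> real ^ 2 \<Rightarrow> real ^ 2 \<Rightarrow> real" where
  "psr_metric x v w = - (\<Sum>a\<in>UNIV. \<Sum>b\<in>UNIV. pd a (pd b hcub) x * v $ a * w $ b)"

text \<open>\<open>\<gamma>\<close> restricted to \<open>[0, \<infinity>)\<close> is the parametrization by arc length, starting at \<open>(1, 0)\<close>, of the
  end of the curve on which \<open>x\<^sub>2\<close> has the sign \<open>e\<close>.\<close>

definition arc_length_end :: "real \<Rightarrow> (real \<Rightarrow> real ^ 2) \<Rightarrow> bool" where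
  "arc_length_end e \<gamma> \<longleftrightarrow>
     \<gamma> 0 = vector [1, 0] \<and> (\<forall>s\<ge>0. \<gamma> s \<in> psr_curve) \<and> (\<forall>s>0. e * \<gamma> s $ 2 > 0) \<and>
     (\<exists>\<gamma>'. \<forall>s\<ge>0. (\<gamma> has_vector_derivative \<gamma>' s) (at s within {0..}) \<and>
                 psr_metric (\<gamma> s) (\<gamma>' s) (\<gamma>' s) = 1)"

section \<open>The tree-level q-map space\<close>

text \<open>Type IIA coordinates: \<open>B a\<close>, \<open>T a\<close> stand for \<open>b\<^sup>a\<close>, \<open>t\<^sup>a\<close>; \<open>Zt i\<close> for \<open>\<zeta>\<close> with tilde and
  lower index; \<open>Zl i\<close> for \<open>\<zeta>\<^sup>i\<close>.\<close>

datatype coord = B 2 | T 2 | Rho | Zt "2 option" | Zl "2 option" | Sig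

instance coord :: finite
proof
  have eq: "(UNIV :: coord set) = range B \<union> range T \<union> {Rho} \<union> range Zt \<union> range Zl \<union> {Sig}"
  proof (intro equalityI subsetI)
    fix i :: coord
    show "i \<in> range B \<union> range T \<union> {Rho} \<union> range Zt \<union> range Zl \<union> {Sig}"
      by (cases i) simp_all
  qed simp
  show "finite (UNIV :: coord set)"
    by (subst eq) simp
qed

definition tpart :: "real ^ coord \<Rightarrow> real ^ 2" where
  "tpart p = (\<chi> a. p $ T a)"

definition zpart :: "real ^ coord \<Rightarrow> complex ^ 2" where
  "zpart p = (\<chi> a. Complex (p $ B a) (p $ T a))"

definition psr_cone :: "(real ^ 2) set" where
  "psr_cone = {r *\<^sub>R x | r x. r > 0 \<and> x \<in> psr_curve}"

definition qmap_space :: "(real ^ coord) set" where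
  "qmap_space = {p. tpart p \<in> psr_cone \<and> p $ Rho > 0}"

definition qmap_proj :: "real ^ coord \<Rightarrow> real ^ 2" where
  "qmap_proj p = (1 / root 3 (hcub (tpart p))) *\<^sub>R tpart p"

definition prepot :: "complex ^ (2 option) \<Rightarrow> complex" where
  "prepot X = - hcub (\<chi> a. X $ Some a) / X $ None"

definition zext :: "complex ^ 2 \<Rightarrow> complex ^ (2 option)" where
  "zext z = (\<chi> i. case i of None \<Rightarrow> 1 | Some a \<Rightarrow> z $ a)"

definition period :: "complex ^ 2 \<Rightarrow> 2 option \<Rightarrow> 2 option \<Rightarrow> complex" where
  "period z i j = pd i (pd j prepot) (zext z)"

definition Nmat :: "complex ^ 2 \<Rightarrow> real ^ (2 option) ^ (2 option)" where
  "Nmat z = (\<chi> i j. - 2 * Im (period z i j))"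

definition Wform :: "complex ^ 2 \<Rightarrow> 2 option \<Rightarrow> real ^ coord \<Rightarrow> complex" where
  "Wform z i v = of_real (v $ Zt i) - (\<Sum>j\<in>UNIV. period z i j * of_real (v $ Zl j))"

definition sigma_form :: "real ^ coord \<Rightarrow> real ^ coord \<Rightarrow> real" where
  "sigma_form p v = v $ Sig + (\<Sum>i\<in>UNIV. p $ Zt i * v $ Zl i - p $ Zl i * v $ Zt i)"

text \<open>The bilinear form of the metric at \<open>p\<close>; the symmetric product of \<open>W\<^sub>i\<close> with the conjugate of
  \<open>W\<^sub>j\<close>, summed against a Hermitian matrix, is polarized by taking the real part.\<close>

definition qmap_metric :: "real ^ coord \<Rightarrow> real ^ coord \<Rightarrow> real ^ coord \<Rightarrow> real" where
  "qmap_metric p v w =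
     (let t = tpart p; z = zpart p; \<rho> = p $ Rho; K = 8 * hcub t in
        - 1 / 4 * (\<Sum>a\<in>UNIV. \<Sum>b\<in>UNIV. pd a (pd b (\<lambda>t. ln (hcub t))) t
                      * (v $ B a * w $ B b + v $ T a * w $ T b))
        + v $ Rho * w $ Rho / (4 * \<rho> ^ 2)
        - 1 / (4 * \<rho>) * Re (\<Sum>i\<in>UNIV. \<Sum>j\<in>UNIV.
              (of_real (matrix_inv (Nmat z) $ i $ j)
                 - of_real (2 / K) * zext z $ i * cnj (zext z $ j))
              * Wform z i v * cnj (Wform z j w))
        + 1 / (64 * \<rho> ^ 2) * sigma_form p v * sigma_form p w)"

section \<open>The isometry group\<close>

text \<open>Type IIB coordinates: \<open>BB a\<close>, \<open>BT a\<close> are \<open>b\<^sup>a\<close>, \<open>t\<^sup>a\<close>; \<open>Cu a\<close> is \<open>c\<^sup>a\<close>; \<open>Cl a\<close> is \<open>c\<^sub>a\<close>;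
  \<open>C0\<close> is \<open>c\<close> with lower index \<open>0\<close>.\<close>

datatype coordB = BB 2 | BT 2 | Tau1 | Tau2 | Cu 2 | Cl 2 | C0 | Psi

instance coordB :: finite
proof
  have eq: "(UNIV :: coordB set) =
      range BB \<union> range BT \<union> {Tau1, Tau2} \<union> range Cu \<union> range Cl \<union> {C0, Psi}"
  proof (intro equalityI subsetI)
    fix i :: coordB
    show "i \<in> range BB \<union> range BT \<union> {Tau1, Tau2} \<union> range Cu \<union> range Cl \<union> {C0, Psi}"
      by (cases i) simp_all
  qed simp
  show "finite (UNIV :: coordB set)"
    by (subst eq) simp
qed

definition kcontr :: "(2 \<Rightarrow> real) \<Rightarrow> (2 \<Rightarrow> real) \<Rightarrow> (2 \<Rightarrow> real) \<Rightarrow> real" where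
  "kcontr x y w = (\<Sum>a\<in>UNIV. \<Sum>b\<in>UNIV. \<Sum>c\<in>UNIV. kcub a b c * x a * y b * w c)"

definition iib_space :: "(real ^ coordB) set" where
  "iib_space = {q. (\<chi> a. q $ BT a) \<in> psr_cone \<and> q $ Tau2 > 0}"

definition mirror :: "real ^ coordB \<Rightarrow> real ^ coord" where
  "mirror q =
     (let b = (\<lambda>a. q $ BB a); c = (\<lambda>a. q $ Cu a); d = (\<lambda>a. q $ Cu a - q $ Tau1 * q $ BB a) in
      \<chi> i. case i of
          B a \<Rightarrow> q $ BB a
        | T a \<Rightarrow> q $ BT a
        | Rho \<Rightarrow> (q $ Tau2) ^ 2 / 2 * hcub (\<chi> a. q $ BT a)
        | Zl None \<Rightarrow> q $ Tau1
        | Zl (Some a) \<Rightarrow> - d a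
        | Zt None \<Rightarrow> q $ C0 - 1 / 6 * kcontr b b d
        | Zt (Some a) \<Rightarrow> q $ Cl a + 1 / 2 * (\<Sum>e\<in>UNIV. \<Sum>f\<in>UNIV. kcub a e f * b e * d f)
        | Sig \<Rightarrow> - 2 * (q $ Psi + 1 / 2 * q $ Tau1 * q $ C0) + (\<Sum>a\<in>UNIV. q $ Cl a * d a)
                   - 1 / 6 * kcontr b c d)"

definition sl2 :: "(real ^ 2 ^ 2) set" where
  "sl2 = {A. det A = 1}"

definition sl2_iib :: "real ^ 2 ^ 2 \<Rightarrow> real ^ coordB \<Rightarrow> real ^ coordB" where
  "sl2_iib A q =
     (let a = A $ 1 $ 1; b = A $ 1 $ 2; c = A $ 2 $ 1; d = A $ 2 $ 2;
          \<tau> = Complex (q $ Tau1) (q $ Tau2);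
          m = of_real c * \<tau> + of_real d; \<tau>' = (of_real a * \<tau> + of_real b) / m in
      \<chi> i. case i of
          BB e \<Rightarrow> c * q $ Cu e + d * q $ BB e
        | BT e \<Rightarrow> cmod m * q $ BT e
        | Tau1 \<Rightarrow> Re \<tau>'
        | Tau2 \<Rightarrow> Im \<tau>'
        | Cu e \<Rightarrow> a * q $ Cu e + b * q $ BB e
        | Cl e \<Rightarrow> q $ Cl e
        | C0 \<Rightarrow> d * q $ C0 - c * q $ Psi
        | Psi \<Rightarrow> - b * q $ C0 + a * q $ Psi)"

definition s_dual :: "real ^ 2 ^ 2 \<Rightarrow> real ^ coord \<Rightarrow> real ^ coord" where
  "s_dual A p = mirror (sl2_iib A (the_inv_into iib_space mirror p))"

datatype lie = LV 2 | LP 2 | LX "2 option" | LZ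

instance lie :: finite
proof
  have eq: "(UNIV :: lie set) = range LV \<union> range LP \<union> range LX \<union> {LZ}"
  proof (intro equalityI subsetI)
    fix i :: lie
    show "i \<in> range LV \<union> range LP \<union> range LX \<union> {LZ}"
      by (cases i) simp_all
  qed simp
  show "finite (UNIV :: lie set)"
    by (subst eq) simp
qed

abbreviation unit_vec :: "coord \<Rightarrow> real ^ coord" (\<open>\<partial>\<close>) where
  "\<partial> i \<equiv> axis i 1"

primrec vfield :: "lie \<Rightarrow> real ^ coord \<Rightarrow> real ^ coord" where
  "vfield (LV a) p = \<partial> (B a) + p $ Zl None *\<^sub>R \<partial> (Zl (Some a))
     - p $ Zt (Some a) *\<^sub>R \<partial> (Zt None)
     - (\<Sum>b\<in>UNIV. \<Sum>c\<in>UNIV. (kcub a b c * p $ Zl (Some c)) *\<^sub>R \<partial> (Zt (Some b)))"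
| "vfield (LP a) p = \<partial> (Zl (Some a)) + p $ Zt (Some a) *\<^sub>R \<partial> Sig"
| "vfield (LX i) p = \<partial> (Zt i) - p $ Zl i *\<^sub>R \<partial> Sig"
| "vfield LZ p = \<partial> Sig"

definition nfield :: "real ^ lie \<Rightarrow> real ^ coord \<Rightarrow> real ^ coord" where
  "nfield v p = (\<Sum>l\<in>UNIV. v $ l *\<^sub>R vfield l p)"

definition time_one_flow :: "(real ^ coord \<Rightarrow> real ^ coord) \<Rightarrow> real ^ coord \<Rightarrow> real ^ coord" where
  "time_one_flow V p = (THE q. \<exists>\<gamma>. \<gamma> 0 = p \<and> \<gamma> 1 = q \<and>
      (\<forall>s\<in>{0..1::real}. (\<gamma> has_vector_derivative V (\<gamma> s)) (at s within {0..1})))"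

text \<open>An element of the semidirect product of \<open>SL(2, \<real>)\<close> with the nilpotent group generated by the
  fields \<open>vfield\<close> is encoded by its factorization as a pair \<open>(A, v)\<close>, standing for the transformation
  \<open>act (A, v)\<close>. The encoding is a diffeomorphism from \<open>SL(2, \<real>) \<times> \<real>\<^sup>8\<close>, so that the Lie group
  topology is the subspace topology of \<open>sl2 \<times> UNIV\<close>. The group law is composition of
  transformations of the q-map space, on which the group acts effectively.\<close>

definition act :: "(real ^ 2 ^ 2) \<times> (real ^ lie) \<Rightarrow> real ^ coord \<Rightarrow> real ^ coord" where
  "act g p = s_dual (fst g) (time_one_flow (nfield (snd g)) p)"

definition qgroup :: "((real ^ 2 ^ 2) \<times> (real ^ lie)) monoid" where
  "qgroup = \<lparr>carrier = sl2 \<times> UNIV,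
     mult = (\<lambda>g h. THE k. k \<in> sl2 \<times> UNIV \<and> (\<forall>p\<in>qmap_space. act k p = act g (act h p))),
     one = (mat 1, 0)\<rparr>"

section \<open>Volumes of quotients and lattices\<close>

text \<open>The volume of the image of \<open>E\<close> in the quotient by the relation \<open>R\<close>, for a measure \<open>vol\<close> that
  is invariant under the countable group whose orbits are the classes of \<open>R\<close>: the quotient map
  preserves volume on Borel sets on which it is injective, and the supremum is the volume of any
  Borel fundamental domain.\<close>

definition quotient_volume ::
  "('a \<Rightarrow> 'a \<Rightarrow> bool) \<Rightarrow> ('a::topological_space set \<Rightarrow> ennreal) \<Rightarrow> 'a set \<Rightarrow> ennreal" where
  "quotient_volume R vol E =
     (SUP D\<in>{D \<in> sets borel. D \<subseteq> E \<and> (\<forall>p\<in>D. \<forall>q\<in>D. R p q \<longrightarrow> p = q)}. vol D)"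

definition left_haar :: "('g::topological_space) monoid \<Rightarrow> 'g measure \<Rightarrow> bool" where
  "left_haar G M \<longleftrightarrow>
     sets M = sets (restrict_space borel (carrier G)) \<and>
     emeasure M (carrier G) \<noteq> 0 \<and>
     (\<forall>C. compact C \<and> C \<subseteq> carrier G \<longrightarrow> emeasure M C < \<infinity>) \<and>
     (\<forall>g\<in>carrier G. \<forall>A\<in>sets M. emeasure M ((\<lambda>h. g \<otimes>\<^bsub>G\<^esub> h) ` A) = emeasure M A)"

text \<open>A lattice is a discrete subgroup of finite covolume. Haar measure being unique up to a factor,
  it does not matter whether \<open>M\<close> is quantified universally or existentially.\<close>

definition lattice_in :: "('g::topological_space) set \<Rightarrow> 'g monoid \<Rightarrow> bool" where
  "lattice_in \<Gamma> G \<longleftrightarrow> subgroup \<Gamma> G \<and> discrete \<Gamma> \<and>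
     (\<forall>M. left_haar G M \<longrightarrow>
        quotient_volume (\<lambda>g h. \<exists>c\<in>\<Gamma>. c \<otimes>\<^bsub>G\<^esub> g = h) (emeasure M) (carrier G) < \<infinity>)"

definition riem_volume ::
  "(real ^ 'n \<Rightarrow> real ^ 'n \<Rightarrow> real ^ 'n \<Rightarrow> real) \<Rightarrow> (real ^ 'n) set \<Rightarrow> ennreal" where
  "riem_volume g A =
     (\<integral>\<^sup>+u\<in>A. ennreal (sqrt (det (\<chi> i j. g u (axis i 1) (axis j 1)))) \<partial>lborel)"

definition pullback_metric ::
  "('a::real_normed_vector \<Rightarrow> 'b::real_normed_vector) \<Rightarrow> ('b \<Rightarrow> 'b \<Rightarrow> 'b \<Rightarrow> real)
     \<Rightarrow> 'a \<Rightarrow> 'a \<Rightarrow> 'a \<Rightarrow> real" where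
  "pullback_metric \<Phi> g u v w =
     g (\<Phi> u) (frechet_derivative \<Phi> (at u) v) (frechet_derivative \<Phi> (at u) w)"

definition total_volume :: "((real ^ 2 ^ 2) \<times> (real ^ lie)) set \<Rightarrow> (real ^ coord) set \<Rightarrow> ennreal"
  where "total_volume \<Gamma> E =
    quotient_volume (\<lambda>p q. \<exists>g\<in>\<Gamma>. act g p = q) (riem_volume qmap_metric) E"

section \<open>The fibers over the PSR curve\<close>

text \<open>The fiber over \<open>x\<close> has the global coordinates of the q-map space with \<open>t = r x\<close> replaced by
  \<open>r\<close> (the index \<open>FR\<close>). In these coordinates the action of the group does not depend on \<open>x\<close>.\<close>

datatype fcoord = FB 2 | FR | FRho | FZt "2 option" | FZl "2 option" | FSig

instance fcoord :: finite
proof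
  have eq: "(UNIV :: fcoord set) =
      range FB \<union> {FR, FRho} \<union> range FZt \<union> range FZl \<union> {FSig}"
  proof (intro equalityI subsetI)
    fix i :: fcoord
    show "i \<in> range FB \<union> {FR, FRho} \<union> range FZt \<union> range FZl \<union> {FSig}"
      by (cases i) simp_all
  qed simp
  show "finite (UNIV :: fcoord set)"
    by (subst eq) simp
qed

definition fiber_space :: "(real ^ fcoord) set" where
  "fiber_space = {u. u $ FR > 0 \<and> u $ FRho > 0}"

definition fiber_chart :: "real ^ 2 \<Rightarrow> real ^ fcoord \<Rightarrow> real ^ coord" where
  "fiber_chart x u = (\<chi> i. case i of B a \<Rightarrow> u $ FB a | T a \<Rightarrow> u $ FR * x $ a | Rho \<Rightarrow> u $ FRho
      | Zt i \<Rightarrow> u $ FZt i | Zl i \<Rightarrow> u $ FZl i | Sig \<Rightarrow> u $ FSig)"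

lemma hcub_scaleR: "hcub (r *\<^sub>R x) = r ^ 3 * hcub (x :: real ^ 2)"
  by (simp add: hcub_def algebra_simps power2_eq_square power3_eq_cube)

lemma hcub_psr_curve: "x \<in> psr_curve \<Longrightarrow> hcub x = 1"
  by (simp add: hcub_def psr_curve_def algebra_simps power2_eq_square power3_eq_cube)

lemma tpart_fiber_chart: "tpart (fiber_chart x u) = u $ FR *\<^sub>R x"
  by (simp add: tpart_def fiber_chart_def vec_eq_iff)

lemma bij_betw_fiber_chart:
  assumes x: "x \<in> psr_curve"
  shows "bij_betw (fiber_chart x) fiber_space {p \<in> qmap_space. qmap_proj p = x}"
proof (rule bij_betw_imageI)
  have x1: "x $ 1 > 0" using x by (simp add: psr_curve_def)
  show "inj_on (fiber_chart x) fiber_space"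
  proof (rule inj_onI)
    fix u w assume eq: "fiber_chart x u = fiber_chart x w"
    then have *: "fiber_chart x u $ i = fiber_chart x w $ i" for i by simp
    have "u $ i = w $ i" for i
      using *[of "B a" for a] *[of "T 1"] *[of Rho] *[of "Zt j" for j] *[of "Zl j" for j]
        *[of Sig] x1
      by (cases i) (auto simp: fiber_chart_def)
    then show "u = w" by (simp add: vec_eq_iff)
  qed
  show "fiber_chart x ` fiber_space = {p \<in> qmap_space. qmap_proj p = x}"
  proof (intro equalityI subsetI)
    fix p assume "p \<in> fiber_chart x ` fiber_space"
    then obtain u where u: "u $ FR > 0" "u $ FRho > 0" and p: "p = fiber_chart x u"
      by (auto simp: fiber_space_def)
    have t: "tpart p = u $ FR *\<^sub>R x" by (simp add: p tpart_fiber_chart)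
    have "p $ Rho = u $ FRho" by (simp add: p fiber_chart_def)
    moreover have "root 3 (hcub (tpart p)) = u $ FR"
      using u by (simp add: t hcub_scaleR hcub_psr_curve[OF x] real_root_power_cancel)
    ultimately show "p \<in> {p \<in> qmap_space. qmap_proj p = x}"
      using u x by (auto simp: qmap_space_def psr_cone_def qmap_proj_def t)
  next
    fix p assume "p \<in> {p \<in> qmap_space. qmap_proj p = x}"
    then have rho: "p $ Rho > 0" and px: "qmap_proj p = x" and cone: "tpart p \<in> psr_cone"
      by (auto simp: qmap_space_def)
    from cone obtain r y where r: "r > 0" and y: "y \<in> psr_curve" and t: "tpart p = r *\<^sub>R y"
      by (auto simp: psr_cone_def)
    have "root 3 (hcub (tpart p)) = r"
      using r by (simp add: t hcub_scaleR hcub_psr_curve[OF y] real_root_power_cancel)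
    then have "y = x" using px r by (simp add: qmap_proj_def t)
    then have tx: "p $ T a = r * x $ a" for a
      using t by (auto simp: tpart_def vec_eq_iff)
    define u :: "real ^ fcoord" where "u = (\<chi> i. case i of FB a \<Rightarrow> p $ B a | FR \<Rightarrow> r | FRho \<Rightarrow> p $ Rho
      | FZt i \<Rightarrow> p $ Zt i | FZl i \<Rightarrow> p $ Zl i | FSig \<Rightarrow> p $ Sig)"
    have "fiber_chart x u = p"
      by (auto simp: vec_eq_iff fiber_chart_def u_def tx split: coord.split)
    moreover have "u \<in> fiber_space" using r rho by (simp add: fiber_space_def u_def)
    ultimately show "p \<in> fiber_chart x ` fiber_space" by blast
  qed
qed

text \<open>The volume, for the metric induced by the q-map metric, of the image of the part \<open>E\<close> of the
  fiber over \<open>x\<close> in the quotient by \<open>\<Gamma>\<close>; the whole fiber is \<open>E = fiber_space\<close>.\<close>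

definition fiber_volume ::
  "((real ^ 2 ^ 2) \<times> (real ^ lie)) set \<Rightarrow> real ^ 2 \<Rightarrow> (real ^ fcoord) set \<Rightarrow> ennreal" where
  "fiber_volume \<Gamma> x E =
     quotient_volume (\<lambda>u w. \<exists>g\<in>\<Gamma>. act g (fiber_chart x u) = fiber_chart x w)
       (riem_volume (pullback_metric (fiber_chart x) qmap_metric)) E"

text \<open>The function \<open>\<rho> h(t)\<^bsup>1/3\<^esup>\<close> is invariant under the group and unbounded above and below on every
  fiber. The generic orbits in a fiber have codimension one, and the volume of a fiber modulo a
  lattice always diverges as this function tends to zero. Bounding the function below by \<open>e > 0\<close>
  cuts out parts of the fibers, and of the total space, which are preserved by the group and whose
  fiber-wise volume is finite.\<close>

definition fiber_part :: "real \<Rightarrow> (real ^ fcoord) set" where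
  "fiber_part e = {u \<in> fiber_space. u $ FRho * u $ FR \<ge> e}"

definition qmap_part :: "real \<Rightarrow> (real ^ coord) set" where
  "qmap_part e = {p \<in> qmap_space. p $ Rho * root 3 (hcub (tpart p)) \<ge> e}"

lemma fiber_chart_in_qmap_part_iff:
  assumes "x \<in> psr_curve" "u \<in> fiber_space"
  shows "fiber_chart x u \<in> qmap_part e \<longleftrightarrow> u \<in> fiber_part e"
proof -
  have "fiber_chart x u \<in> qmap_space"
    using bij_betw_fiber_chart[OF assms(1)] assms(2) by (auto simp: bij_betw_def)
  moreover have "root 3 (hcub (tpart (fiber_chart x u))) = u $ FR"
    using assms by (simp add: fiber_space_def tpart_fiber_chart hcub_scaleR hcub_psr_curve
        real_root_power_cancel)
  moreover have "fiber_chart x u $ Rho = u $ FRho" by (simp add: fiber_chart_def)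
  ultimately show ?thesis using assms by (simp add: qmap_part_def fiber_part_def)
qed

definition increases_exponentially :: "(real \<Rightarrow> real) \<Rightarrow> bool" where
  "increases_exponentially f \<longleftrightarrow>
     (\<forall>s\<ge>0. f s > 0) \<and> strict_mono_on {0..} f \<and>
     (\<exists>\<alpha>>0. \<exists>C>0. ((\<lambda>s. f s / exp (\<alpha> * s)) \<longlongrightarrow> C) at_top)"

end

theory Submission imports Defs "HOL-Real_Asymp.Real_Asymp" begin

text \<open>In the coordinates of a fiber the group acts in the same way over every base point \<open>x\<close>, and the
  volume density of the fiber over \<open>x\<close> is \<open>r\<^bsup>-3\<^esup> \<rho>\<^bsup>-5\<^esup>\<close> times a constant multiple of \<open>sqrt (3 x\<^sub>1\<^sup>2 + x\<^sub>2\<^sup>2)\<close>.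
  Fiber-wise volumes over different base points are therefore proportional, and in the arc length the
  factor grows like \<open>exp (s / sqrt 6)\<close>. The part of the fiber where \<open>\<rho> r \<ge> \<epsilon>\<close> has finite volume because
  it fibers into orbits whose invariant volume form is the image of Haar measure under an orbit map
  with compact stabilizers \<open>SO(2)\<close>, and positive volume because a lattice acts properly
  discontinuously. In the slope \<open>m = x\<^sub>2/x\<^sub>1\<close> of the base point, the total volume is bounded below by a multiple of the divergent
  integral of \<open>(1 - m\<^sup>2)\<^bsup>-4/3\<^esup>\<close> over \<open>]-1, 1[\<close>.\<close>

text \<open>Three obstacles shape the proof. The metric mixes all twelve coordinates; translating
  the coframe by \<open>b\<close> and completing squares writes it as L^T D L with L unitriangular,
  so its determinant is a product of pivots. Changes of variables are likewise carried out one
  coordinate at a time, by Tonelli and one-dimensional substitutions. Secondly, the product of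
  \<open>qgroup\<close> is a definite description. In type IIB coordinates the nilpotent factor acts
  by left translations of an explicit polynomial group, on which SL(2,R) acts linearly by
  automorphisms; effectiveness of the action then identifies the product. Thirdly, a lattice may
  contain elements such as (-1, 0) that fix points. Each nontrivial element fixes only a null set
  and the lattice is countable, so these points can be discarded. What remains of an injective set
  has injective preimages under all orbit maps; the covolume bounds them uniformly in the orbit
  invariant \<open>\<kappa>\<close>, and the integral of \<open>\<kappa>\<close> to the power -15
  converges away from 0.\<close>

lemma two_cases: "i = 1 \<or> i = (2::2)" using exhaust_2 by auto

lemma sum_option2: "(\<Sum>i\<in>(UNIV :: 2 option set). f i) = f None + f (Some 1) + f (Some 2)"
  for f :: "2 option \<Rightarrow> 'a::comm_monoid_add"
  by (simp add: UNIV_option_conv UNIV_2 add.assoc)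

lemma UNIV_option2: "(UNIV :: 2 option set) = {None, Some 1, Some 2}"
  by (simp add: UNIV_option_conv UNIV_2)

lemma UNIV_coord: "(UNIV :: coord set) = {B 1, B 2, T 1, T 2, Rho, Zt None, Zt (Some 1), Zt (Some 2),
    Zl None, Zl (Some 1), Zl (Some 2), Sig}"
proof -
  have "i \<in> B ` UNIV \<union> T ` UNIV \<union> {Rho} \<union> Zt ` UNIV \<union> Zl ` UNIV \<union> {Sig}" for i :: coord
    by (cases i) auto
  then have "(UNIV :: coord set) = B ` UNIV \<union> T ` UNIV \<union> {Rho} \<union> Zt ` UNIV \<union> Zl ` UNIV \<union> {Sig}"
    by auto
  then show ?thesis unfolding UNIV_2 UNIV_option2 by auto
qed

lemma UNIV_fcoord: "(UNIV :: fcoord set) = {FB 1, FB 2, FR, FRho, FZt None, FZt (Some 1), FZt (Some 2),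
    FZl None, FZl (Some 1), FZl (Some 2), FSig}"
proof -
  have "i \<in> FB ` UNIV \<union> {FR, FRho} \<union> FZt ` UNIV \<union> FZl ` UNIV \<union> {FSig}" for i :: fcoord
    by (cases i) auto
  then have "(UNIV :: fcoord set) = FB ` UNIV \<union> {FR, FRho} \<union> FZt ` UNIV \<union> FZl ` UNIV \<union> {FSig}"
    by auto
  then show ?thesis unfolding UNIV_2 UNIV_option2 by auto
qed

section \<open>Partial derivatives of the cubic, its logarithm and the prepotential\<close>

fun dhcub :: "2 \<Rightarrow> 'a::real_normed_field ^ 2 \<Rightarrow> 'a" where
  "dhcub a x = (if a = 1 then 3 * (x $ 1)\<^sup>2 - (x $ 2)\<^sup>2 else - 2 * x $ 1 * x $ 2)"

fun ddhcub :: "2 \<Rightarrow> 2 \<Rightarrow> 'a::real_normed_field ^ 2 \<Rightarrow> 'a" where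
  "ddhcub a b x = (if a = 1 then (if b = 1 then 6 * x $ 1 else - 2 * x $ 2)
     else (if b = 1 then - 2 * x $ 2 else - 2 * x $ 1))"

lemma hcub_has_derivative_line:
  fixes x :: "'a::real_normed_field ^ 2"
  shows "((\<lambda>w. hcub (\<chi> j. if j = a then w else x $ j)) has_field_derivative
     dhcub a (\<chi> j. if j = a then w else x $ j)) (at w)"
  using two_cases[of a]
  by (auto simp: hcub_def power2_eq_square intro!: derivative_eq_intros)

lemma dhcub_has_derivative_line:
  fixes x :: "'a::real_normed_field ^ 2"
  shows "((\<lambda>w. dhcub b (\<chi> j. if j = a then w else x $ j)) has_field_derivative
     ddhcub a b (\<chi> j. if j = a then w else x $ j)) (at w)"
  using two_cases[of a] two_cases[of b]
  by (auto intro!: derivative_eq_intros)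

lemma vec_line_self [simp]: "(\<chi> j. if j = a then x $ a else x $ j) = x"
  by (simp add: vec_eq_iff)

lemma pd_hcub: "pd a hcub x = dhcub a x"
  using DERIV_imp_deriv[OF hcub_has_derivative_line[of a x "x $ a"]] by (simp add: pd_def)

lemma pd_pd_hcub: "pd a (pd b hcub) x = ddhcub a b x"
  using DERIV_imp_deriv[OF dhcub_has_derivative_line[of b a x "x $ a"]]
  by (simp add: pd_def[of a] pd_hcub)

lemma pd_ln_hcub:
  fixes x :: "real ^ 2"
  assumes "hcub x > 0"
  shows "pd a (\<lambda>x. ln (hcub x)) x = dhcub a x / hcub x"
proof -
  have "((\<lambda>w. ln (hcub (\<chi> j. if j = a then w else x $ j))) has_field_derivative
     dhcub a x / hcub x) (at (x $ a))"
    using DERIV_chain2[where f = ln and g = "\<lambda>w. hcub (\<chi> j. if j = a then w else x $ j)" and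
        Da = "1 / hcub x", OF _ hcub_has_derivative_line[of a x "x $ a"]] DERIV_ln_divide assms
    by simp
  then show ?thesis unfolding pd_def by (rule DERIV_imp_deriv)
qed

lemma pd_pd_ln_hcub:
  fixes x :: "real ^ 2"
  assumes h: "hcub x > 0"
  shows "pd a (pd b (\<lambda>x. ln (hcub x))) x
    = (ddhcub a b x * hcub x - dhcub a x * dhcub b x) / (hcub x)\<^sup>2"
proof -
  let ?l = "\<lambda>w. \<chi> j. if j = a then w else x $ j"
  \<comment> \<open>The first derivative has its closed form only where \<open>hcub\<close> is
    positive, so positivity on a whole neighbourhood is needed before differentiating again.\<close>
  have "isCont (\<lambda>w. hcub (?l w)) (x $ a)"
    using hcub_has_derivative_line by (rule DERIV_isCont)
  then have "\<forall>\<^sub>F w in nhds (x $ a). hcub (?l w) > 0"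
    unfolding isCont_def tendsto_def
    using h eventually_nhds_x_imp_x
    by (auto simp: eventually_at_filter elim!: allE[of _ "{0<..}"] eventually_mono)
  then have ev: "\<forall>\<^sub>F w in nhds (x $ a). pd b (\<lambda>x. ln (hcub x)) (?l w) = dhcub b (?l w) / hcub (?l w)"
    by eventually_elim (rule pd_ln_hcub)
  have "((\<lambda>w. dhcub b (?l w) / hcub (?l w)) has_field_derivative
      (ddhcub a b x * hcub x - dhcub b x * dhcub a x) / (hcub x * hcub x)) (at (x $ a))"
    using DERIV_divide[OF dhcub_has_derivative_line[of b a x "x $ a"]
      hcub_has_derivative_line[of a x "x $ a"]] h by simp
  then have "deriv (\<lambda>w. dhcub b (?l w) / hcub (?l w)) (x $ a)
     = (ddhcub a b x * hcub x - dhcub b x * dhcub a x) / (hcub x * hcub x)"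
    by (rule DERIV_imp_deriv)
  then show ?thesis
    unfolding pd_def[of a] deriv_cong_ev[OF ev refl] by (simp add: power2_eq_square mult.commute)
qed

fun dprepot :: "2 option \<Rightarrow> complex ^ (2 option) \<Rightarrow> complex" where
  "dprepot None X = hcub (\<chi> a. X $ Some a) / (X $ None)\<^sup>2"
| "dprepot (Some a) X = - dhcub a (\<chi> a. X $ Some a) / X $ None"

fun period' :: "complex ^ 2 \<Rightarrow> 2 option \<Rightarrow> 2 option \<Rightarrow> complex" where
  "period' z None None = - 2 * hcub z"
| "period' z None (Some a) = dhcub a z"
| "period' z (Some a) None = dhcub a z"
| "period' z (Some a) (Some b) = - ddhcub a b z"

lemma pd_prepot:
  assumes "X $ None \<noteq> 0"
  shows "pd i prepot X = dprepot i X"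
proof (cases i)
  case None
  have "((\<lambda>w. prepot (\<chi> j. if j = i then w else X $ j)) has_field_derivative dprepot i X) (at (X $ i))"
    using assms unfolding prepot_def None
    by (auto intro!: derivative_eq_intros simp: power2_eq_square field_simps)
  then show ?thesis unfolding pd_def by (rule DERIV_imp_deriv)
next
  case (Some a)
  let ?X = "\<chi> a. X $ Some a"
  have *: "(\<lambda>w. prepot (\<chi> j. if j = i then w else X $ j))
      = (\<lambda>w. - hcub (\<chi> j. if j = a then w else ?X $ j) / X $ None)"
    by (simp add: prepot_def Some cong: if_cong)
  have "((\<lambda>w. prepot (\<chi> j. if j = i then w else X $ j)) has_field_derivative dprepot i X) (at (X $ i))"
    unfolding *
    using DERIV_cdivide[OF DERIV_minus[OF hcub_has_derivative_line[of a ?X "?X $ a"]], of "X $ None"]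
      vec_line_self[of a ?X]
    by (simp add: Some del: dhcub.simps)
  then show ?thesis unfolding pd_def by (rule DERIV_imp_deriv)
qed

lemma zext_nth [simp]: "zext z $ None = 1" "zext z $ Some a = z $ a"
  by (simp_all add: zext_def)

lemma period_eq: "period z i j = period' z i j"
proof -
  let ?l = "\<lambda>w. \<chi> k. if k = i then w else zext z $ k"
  \<comment> \<open>Same localization as for the logarithm: the closed form of the first derivative
    holds only off the hyperplane where the coordinate \<open>None\<close> vanishes.\<close>
  have "isCont (\<lambda>w. ?l w $ None) (zext z $ i)" by (cases i) auto
  then have "\<forall>\<^sub>F w in nhds (zext z $ i). ?l w $ None \<noteq> 0"
    unfolding isCont_def tendsto_def
    using eventually_nhds_x_imp_x
    by (cases i) (auto simp: eventually_at_filter elim!: allE[of _ "- {0}"] eventually_mono)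
  then have ev: "\<forall>\<^sub>F w in nhds (zext z $ i). pd j prepot (?l w) = dprepot j (?l w)"
    by eventually_elim (rule pd_prepot)
  have "((\<lambda>w. dprepot j (?l w)) has_field_derivative period' z i j) (at (zext z $ i))"
  proof (cases i)
    case None
    then show ?thesis
      by (cases j) (auto intro!: derivative_eq_intros simp: power2_eq_square simp del: dhcub.simps)
  next
    case (Some a)
    then show ?thesis
    proof (cases j)
      case None
      have *: "(\<lambda>w. dprepot j (?l w)) = (\<lambda>w. hcub (\<chi> j. if j = a then w else z $ j))"
        by (simp add: None Some cong: if_cong)
      show ?thesis unfolding *
        using hcub_has_derivative_line[of a z "z $ a"] by (simp add: None Some del: dhcub.simps)
    next
      case (Some b)
      have *: "(\<lambda>w. dprepot j (?l w)) = (\<lambda>w. - dhcub b (\<chi> j. if j = a then w else z $ j))"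
        by (simp add: \<open>i = Some a\<close> Some del: dhcub.simps cong: if_cong)
      show ?thesis unfolding *
        using DERIV_minus[OF dhcub_has_derivative_line[of b a z "z $ a"]]
        by (simp add: \<open>i = Some a\<close> Some del: dhcub.simps ddhcub.simps)
    qed
  qed
  then have "deriv (\<lambda>w. dprepot j (?l w)) (zext z $ i) = period' z i j"
    by (rule DERIV_imp_deriv)
  then show ?thesis
    unfolding period_def pd_def[of i] deriv_cong_ev[OF ev refl] .
qed

section \<open>Determinants of triangular matrices and congruences\<close>

text \<open>A nonzero term of the Leibniz sum belongs to a permutation that lowers the rank of every
  index it moves; since the total rank is invariant under permutations, no index is moved. A rank
  function stands in for a linear order on the index types.\<close>

lemma det_triangular_rank:
  fixes A :: "real ^ 'n ^ 'n" and rk :: "'n \<Rightarrow> nat"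
  assumes "\<And>i j. A $ i $ j \<noteq> 0 \<Longrightarrow> i = j \<or> rk j < rk i"
  shows "det A = (\<Prod>i\<in>UNIV. A $ i $ i)"
proof -
  have "of_int (sign p) * (\<Prod>i\<in>UNIV. A $ i $ p i) = 0"
    if p: "p permutes UNIV" "p \<noteq> id" for p :: "'n \<Rightarrow> 'n"
  proof (rule ccontr)
    assume "of_int (sign p) * (\<Prod>i\<in>UNIV. A $ i $ p i) \<noteq> 0"
    then have "A $ i $ p i \<noteq> 0" for i by auto
    then have le: "i = p i \<or> rk (p i) < rk i" for i using assms by blast
    from p obtain i where "p i \<noteq> i" by (auto simp: fun_eq_iff)
    then have "(\<Sum>i\<in>UNIV. rk (p i)) < (\<Sum>i\<in>UNIV. rk i)"
      using le by (intro sum_strict_mono_ex1) (simp_all, metis le_eq_less_or_eq, metis)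
    moreover have "(\<Sum>i\<in>UNIV. rk (p i)) = (\<Sum>i\<in>UNIV. rk i)"
      using sum.permute[OF p(1), of rk] by (simp add: comp_def)
    ultimately show False by simp
  qed
  then have "det A = (\<Sum>p\<in>{id}. of_int (sign p) * (\<Prod>i\<in>UNIV. A $ i $ p i))"
    unfolding det_def
    by (intro sum.mono_neutral_right) (auto simp: finite_permutations permutes_id)
  then show ?thesis by simp
qed

text \<open>The matrix is L^T D L with det L = 1. It is the Gram matrix of a sum of squares of
  linear forms \<open>L k\<close> with weights \<open>q k\<close>, the shape into which both metrics
  are brought.\<close>

lemma det_unitriangular_congruence:
  fixes L :: "'n::finite \<Rightarrow> 'n \<Rightarrow> real" and rk :: "'n \<Rightarrow> nat"
  assumes "\<And>k i. L k i \<noteq> 0 \<Longrightarrow> k = i \<or> rk i < rk k" "\<And>k. L k k = 1"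
  shows "det (\<chi> i j. \<Sum>k\<in>UNIV. q k * L k i * L k j) = (\<Prod>k\<in>UNIV. q k)"
proof -
  define A where "A = (\<chi> k i. L k i)"
  define D :: "real ^ 'n ^ 'n" where "D = (\<chi> k i. if k = i then q k else 0)"
  have "det A = 1" using det_triangular_rank[of A rk] assms by (auto simp: A_def)
  moreover have "det D = (\<Prod>k\<in>UNIV. q k)"
    using det_diagonal[of D] by (simp add: D_def)
  moreover have "(\<chi> i j. \<Sum>k\<in>UNIV. q k * L k i * L k j) = transpose A ** D ** A"
    by (simp add: vec_eq_iff matrix_matrix_mult_def transpose_def A_def D_def mult.commute
        mult.left_commute if_distrib[of "(*) _"] cong: if_cong)
  ultimately show ?thesis by (simp add: det_mul)
qed

section \<open>Triangular changes of variables\<close>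

lemma borel_measurable_vecI:
  fixes f :: "'a \<Rightarrow> real ^ 'n"
  assumes "\<And>i. (\<lambda>x. f x $ i) \<in> borel_measurable M"
  shows "f \<in> borel_measurable M"
  by (subst borel_measurable_euclidean_space) (auto simp: Basis_vec_def inner_axis assms)

lemma borel_measurable_vec_nth' [measurable (raw)]:
  fixes f :: "'a \<Rightarrow> 'b::euclidean_space ^ 'n"
  assumes "f \<in> borel_measurable M"
  shows "(\<lambda>x. f x $ i) \<in> borel_measurable M"
  by (rule borel_measurable_continuous_on[OF _ assms]) (intro continuous_intros)

lemma prod_Basis_vec:
  fixes f :: "real ^ 'n \<Rightarrow> 'b::comm_monoid_mult"
  shows "(\<Prod>b\<in>Basis. f b) = (\<Prod>i\<in>UNIV. f (axis i 1))"
proof -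
  have "Basis = range (\<lambda>i::'n. axis i (1::real))" by (auto simp: Basis_vec_def)
  moreover have "inj (\<lambda>i::'n. axis i (1::real))" by (auto simp: inj_on_def axis_eq_axis)
  ultimately show ?thesis by (metis prod.reindex_cong)
qed

definition vec_upd :: "'a ^ 'n \<Rightarrow> 'n \<Rightarrow> 'a \<Rightarrow> 'a ^ 'n" where
  "vec_upd x i t = (\<chi> j. if j = i then t else x $ j)"

lemma vec_upd_nth [simp]: "vec_upd x i t $ j = (if j = i then t else x $ j)"
  by (simp add: vec_upd_def)

lemma vec_upd_upd [simp]: "vec_upd (vec_upd x i t) i s = vec_upd x i s"
  by (simp add: vec_upd_def vec_eq_iff)

lemma measurable_vec_upd [measurable (raw)]:
  fixes f :: "'a \<Rightarrow> real ^ 'n"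
  assumes [measurable]: "f \<in> borel_measurable M" "g \<in> borel_measurable M"
  shows "(\<lambda>x. vec_upd (f x) i (g x)) \<in> borel_measurable M"
  by (rule borel_measurable_vecI) simp

lemma lborel_vec:
  "(lborel :: (real ^ 'n) measure)
     = distr (Pi\<^sub>M UNIV (\<lambda>_. lborel)) borel (\<lambda>f. \<chi> i. f i)"
proof (rule lborel_eqI)
  fix l u :: "real ^ 'n"
  assume le: "\<And>b. b \<in> Basis \<Longrightarrow> l \<bullet> b \<le> u \<bullet> b"
  have le': "l $ i \<le> u $ i" for i
    using le[of "axis i 1"] by (auto simp: inner_axis axis_in_Basis_iff)
  interpret finite_product_sigma_finite "\<lambda>_::'n. lborel :: real measure" UNIV
    by standard auto
  have m: "(\<lambda>f. \<chi> i. f i :: real ^ 'n) \<in> borel_measurable (Pi\<^sub>M UNIV (\<lambda>_. lborel))"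
    by (rule borel_measurable_vecI) simp
  have "emeasure (distr (Pi\<^sub>M UNIV (\<lambda>_. lborel)) borel (\<lambda>f. \<chi> i. f i)) (box l u)
    = emeasure (Pi\<^sub>M UNIV (\<lambda>_. lborel)) (Pi\<^sub>E UNIV (\<lambda>i. {l $ i<..<u $ i}))"
    by (subst emeasure_distr[OF m])
       (auto intro!: arg_cong[where f = "emeasure _"] simp: space_PiM mem_box_cart PiE_iff)
  also have "\<dots> = (\<Prod>i\<in>UNIV. emeasure lborel {l $ i<..<u $ i})"
    by (rule emeasure_PiM) auto
  also have "\<dots> = (\<Prod>b\<in>Basis. (u - l) \<bullet> b)"
    using le' by (simp add: prod_Basis_vec prod_ennreal inner_axis)
  finally show "emeasure (distr (Pi\<^sub>M UNIV (\<lambda>_. lborel)) borel (\<lambda>f. \<chi> i. f i)) (box l u)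
    = (\<Prod>b\<in>Basis. (u - l) \<bullet> b)" .
qed simp

lemma nn_integral_coord:
  fixes F :: "real ^ 'n \<Rightarrow> ennreal"
  assumes [measurable]: "F \<in> borel_measurable borel"
  shows "(\<integral>\<^sup>+x. F x \<partial>lborel) = (\<integral>\<^sup>+f. \<integral>\<^sup>+t. F (vec_upd (\<chi> j. f j) i t) \<partial>lborel
           \<partial>Pi\<^sub>M (UNIV - {i}) (\<lambda>_. lborel))"
proof -
  interpret product_sigma_finite "\<lambda>_::'n. lborel :: real measure" by standard
  have m [measurable]: "(\<lambda>f. \<chi> i. f i :: real ^ 'n) \<in> borel_measurable (Pi\<^sub>M UNIV (\<lambda>_. lborel))"
    by (rule borel_measurable_vecI) simp
  have "(\<integral>\<^sup>+x. F x \<partial>lborel) = (\<integral>\<^sup>+f. F (\<chi> j. f j) \<partial>Pi\<^sub>M (insert i (UNIV - {i})) (\<lambda>_. lborel))"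
    by (subst lborel_vec) (simp add: nn_integral_distr insert_absorb)
  also have "\<dots> = (\<integral>\<^sup>+f. \<integral>\<^sup>+t. F (\<chi> j. (f(i := t)) j) \<partial>lborel
           \<partial>Pi\<^sub>M (UNIV - {i}) (\<lambda>_. lborel))"
    by (rule product_nn_integral_insert) (auto simp: insert_absorb)
  finally show ?thesis by (simp add: vec_upd_def fun_upd_def if_distrib cong: if_cong)
qed

lemma nn_integral_coord_cong:
  fixes F G :: "real ^ 'n \<Rightarrow> ennreal"
  assumes "F \<in> borel_measurable borel" "G \<in> borel_measurable borel"
    and "\<And>x. (\<integral>\<^sup>+t. F (vec_upd x i t) \<partial>lborel) = (\<integral>\<^sup>+t. G (vec_upd x i t) \<partial>lborel)"
  shows "(\<integral>\<^sup>+x. F x \<partial>lborel) = (\<integral>\<^sup>+x. G x \<partial>lborel)"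
  by (simp add: nn_integral_coord[OF assms(1), of i] nn_integral_coord[OF assms(2), of i] assms(3))

text \<open>With the other coordinates frozen this is the one-dimensional affine substitution. The
  scale \<open>s\<close> may vary with them, which the coordinates on the cone over the curve
  require.\<close>

lemma nn_integral_coord_affine:
  fixes F :: "real ^ 'n \<Rightarrow> ennreal"
  assumes [measurable]: "F \<in> borel_measurable borel" "g \<in> borel_measurable borel"
      "s \<in> borel_measurable borel"
    and gi: "\<And>x t. g (vec_upd x i t) = g x" and si: "\<And>x t. s (vec_upd x i t) = s x"
    and s: "\<And>x. s x \<noteq> 0"
  shows "(\<integral>\<^sup>+x. ennreal \<bar>s x\<bar> * F (vec_upd x i (g x + s x * x $ i)) \<partial>lborel) = (\<integral>\<^sup>+x. F x \<partial>lborel)"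
proof (rule nn_integral_coord_cong[where i = i])
  fix x :: "real ^ 'n"
  have [measurable]: "(\<lambda>t. F (vec_upd x i t)) \<in> borel_measurable borel"
    by (intro measurable_compose[OF _ assms(1)] measurable_vec_upd) auto
  show "(\<integral>\<^sup>+t. ennreal \<bar>s (vec_upd x i t)\<bar> * F (vec_upd (vec_upd x i t) i
          (g (vec_upd x i t) + s (vec_upd x i t) * vec_upd x i t $ i)) \<partial>lborel)
      = (\<integral>\<^sup>+t. F (vec_upd x i t) \<partial>lborel)"
    by (subst nn_integral_real_affine[OF _ s[of x], of _ "g x"])
       (simp_all add: gi si nn_integral_cmult)
qed measurable

text \<open>Process the coordinates in the order of decreasing rank: updating one coordinate then leaves
  the coordinates on which the later updates depend untouched.\<close>

lemma nn_integral_triangular: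
  fixes F :: "real ^ 'n \<Rightarrow> ennreal" and f :: "real ^ 'n \<Rightarrow> real ^ 'n" and rk :: "'n \<Rightarrow> nat"
  assumes F: "F \<in> borel_measurable borel"
    and g: "\<And>i. g i \<in> borel_measurable borel"
    and f: "\<And>i x. f x $ i = g i x + s i * x $ i" and s: "\<And>i. s i \<noteq> 0"
    and gd: "\<And>i x y. (\<And>j. rk j < rk i \<Longrightarrow> x $ j = y $ j) \<Longrightarrow> g i x = g i y"
  shows "(\<Prod>i\<in>UNIV. ennreal \<bar>s i\<bar>) * (\<integral>\<^sup>+x. F (f x) \<partial>lborel) = (\<integral>\<^sup>+x. F x \<partial>lborel)"
proof -
  define fS where "fS S x = (\<chi> i. if i \<in> S then f x $ i else x $ i)" for S x
  have [measurable]: "f \<in> borel_measurable borel"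
    using g by (intro borel_measurable_vecI) (simp add: f)
  have [measurable]: "fS S \<in> borel_measurable borel" for S
    by (intro borel_measurable_vecI) (simp add: fS_def)
  have "(\<Prod>i\<in>S. ennreal \<bar>s i\<bar>) * (\<integral>\<^sup>+x. F (fS S x) \<partial>lborel) = (\<integral>\<^sup>+x. F x \<partial>lborel)" for S
    using finite[of S] F
  proof (induction "card S" arbitrary: S F)
    case 0
    then have "S = {}" by simp
    then show ?case by (simp add: fS_def)
  next
    case (Suc n)
    note [measurable] = Suc.prems(2)
    have "S \<noteq> {}" using Suc.hyps(2) by auto
    \<comment> \<open>The coordinate of least rank in \<open>S\<close> is updated last:
      \<open>g i\<close> reads only ranks below \<open>rk i\<close>, none of which occur in
      \<open>S\<close>, so the earlier updates have not changed its arguments.\<close>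
    define i where "i = arg_min_on rk S"
    have i: "i \<in> S" and imin: "\<And>j. j \<in> S \<Longrightarrow> rk i \<le> rk j"
      using arg_min_if_finite[of S rk] \<open>S \<noteq> {}\<close> Suc.prems(1)
      unfolding i_def by (auto simp: not_less)
    define S' where "S' = S - {i}"
    have S': "S = insert i S'" "i \<notin> S'" "finite S'" "card S' = n"
      using i Suc by (auto simp: S'_def)
    have *: "fS S x = vec_upd (fS S' x) i (g i (fS S' x) + s i * fS S' x $ i)" for x
    proof -
      have "g i (fS S' x) = g i x"
        by (rule gd) (use imin S' in \<open>auto simp: fS_def dest: leD\<close>)
      then show ?thesis using S' by (auto simp: vec_eq_iff fS_def f)
    qed
    define F' where "F' y = F (vec_upd y i (g i y + s i * y $ i))" for y
    have [measurable]: "F' \<in> borel_measurable borel"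
      using g unfolding F'_def by measurable
    have "(\<Prod>i\<in>S. ennreal \<bar>s i\<bar>) * (\<integral>\<^sup>+x. F (fS S x) \<partial>lborel)
      = ennreal \<bar>s i\<bar> * ((\<Prod>i\<in>S'. ennreal \<bar>s i\<bar>) * (\<integral>\<^sup>+x. F' (fS S' x) \<partial>lborel))"
      using S' by (simp add: *[unfolded S'(1)] F'_def mult.assoc)
    also have "\<dots> = ennreal \<bar>s i\<bar> * (\<integral>\<^sup>+x. F' x \<partial>lborel)"
      by (subst Suc.hyps(1)) (use S' in auto)
    also have "\<dots> = (\<integral>\<^sup>+x. ennreal \<bar>s i\<bar> * F (vec_upd x i (g i x + s i * x $ i)) \<partial>lborel)"
      using g[measurable] by (simp add: nn_integral_cmult F'_def)
    also have "\<dots> = (\<integral>\<^sup>+x. F x \<partial>lborel)"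
      by (rule nn_integral_coord_affine) (use g s in \<open>auto intro!: gd\<close>)
    finally show ?case .
  qed
  from this[of UNIV] show ?thesis by (simp add: fS_def)
qed

text \<open>Such a map preserves coordinates, so preimages of boxes are boxes with the same side
  lengths. It serves to regroup coordinates between nested vectors, tuples and index types.\<close>

lemma distr_lborel_Basis:
  fixes f :: "'a::euclidean_space \<Rightarrow> 'b::euclidean_space"
  assumes lin: "linear f" and bij: "bij_betw f Basis Basis"
  shows "distr lborel borel f = lborel"
proof (rule lborel_eqI[symmetric])
  have [measurable]: "f \<in> borel_measurable borel"
    using lin by (intro borel_measurable_continuous_onI linear_continuous_on)
      (simp add: linear_conv_bounded_linear)
  fix l u :: 'b assume le: "\<And>b. b \<in> Basis \<Longrightarrow> l \<bullet> b \<le> u \<bullet> b"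
  have fB: "f b \<in> Basis" if "b \<in> Basis" for b using bij that by (auto simp: bij_betw_def)
  have inj: "inj_on f Basis" using bij by (simp add: bij_betw_def)
  have inner: "f x \<bullet> f b = x \<bullet> b" if b: "b \<in> Basis" for x b
  proof -
    have "f x = f (\<Sum>c\<in>Basis. (x \<bullet> c) *\<^sub>R c)" by (simp add: euclidean_representation)
    also have "\<dots> = (\<Sum>c\<in>Basis. (x \<bullet> c) *\<^sub>R f c)"
      by (simp add: linear_sum[OF lin] linear_cmul[OF lin])
    also have "\<dots> \<bullet> f b = (\<Sum>c\<in>Basis. (x \<bullet> c) * (if c = b then 1 else 0))"
      unfolding inner_sum_left
      by (rule sum.cong) (use b fB inj in \<open>auto simp: inner_Basis inj_on_def\<close>)
    also have "\<dots> = x \<bullet> b"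
      using b by (simp add: if_distrib[of "(*) _"] sum.delta cong: if_cong)
    finally show ?thesis .
  qed
  define l' u' where "l' = (\<Sum>b\<in>Basis. (l \<bullet> f b) *\<^sub>R b)" and "u' = (\<Sum>b\<in>Basis. (u \<bullet> f b) *\<^sub>R b)"
  have lu': "l' \<bullet> b = l \<bullet> f b" "u' \<bullet> b = u \<bullet> f b" if "b \<in> Basis" for b
    using that by (simp_all add: l'_def u'_def)
  have img: "f ` Basis = Basis" using bij by (simp add: bij_betw_def)
  have "f x \<in> box l u \<longleftrightarrow> x \<in> box l' u'" for x
  proof -
    have "f x \<in> box l u \<longleftrightarrow> (\<forall>b\<in>f ` Basis. l \<bullet> b < f x \<bullet> b \<and> f x \<bullet> b < u \<bullet> b)"
      by (simp add: mem_box img)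
    also have "\<dots> \<longleftrightarrow> x \<in> box l' u'" by (auto simp: mem_box lu' inner)
    finally show ?thesis .
  qed
  then have "f -` box l u = box l' u'" by auto
  then have "emeasure (distr lborel borel f) (box l u) = emeasure lborel (box l' u')"
    by (subst emeasure_distr) auto
  also have "\<dots> = (\<Prod>b\<in>Basis. (u' - l') \<bullet> b)"
    by (rule emeasure_lborel_box) (simp add: lu' le fB)
  also have "\<dots> = (\<Prod>b\<in>Basis. (u - l) \<bullet> f b)"
    by (auto intro!: arg_cong[where f = ennreal] prod.cong simp: inner_diff_left lu')
  also have "\<dots> = (\<Prod>b\<in>f ` Basis. (u - l) \<bullet> b)"
    by (simp add: prod.reindex[OF inj])
  finally show "emeasure (distr lborel borel f) (box l u) = (\<Prod>b\<in>Basis. (u - l) \<bullet> b)"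
    by (simp add: img)
qed simp

lemma nn_integral_lborel_Basis:
  fixes f :: "'a::euclidean_space \<Rightarrow> 'b::euclidean_space"
  assumes lin: "linear f" and bij: "bij_betw f Basis Basis"
    and [measurable]: "F \<in> borel_measurable borel"
  shows "(\<integral>\<^sup>+x. F x \<partial>lborel) = (\<integral>\<^sup>+x. F (f x) \<partial>lborel)"
proof -
  have [measurable]: "f \<in> borel_measurable borel"
    using lin by (intro borel_measurable_continuous_onI linear_continuous_on)
      (simp add: linear_conv_bounded_linear)
  show ?thesis
    by (subst distr_lborel_Basis[OF lin bij, symmetric]) (simp add: nn_integral_distr)
qed

text \<open>Substitution on compact intervals starting at 0, then monotone convergence; the endpoint
  0 is a null set.\<close>

lemma nn_integral_square:
  fixes F :: "real \<Rightarrow> ennreal"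
  assumes [measurable]: "F \<in> borel_measurable borel"
  shows "(\<integral>\<^sup>+x. F x * indicator {0<..} x \<partial>lborel)
    = (\<integral>\<^sup>+t. F (t\<^sup>2) * ennreal (2 * t) * indicator {0<..} t \<partial>lborel)"
proof -
  have *: "(\<integral>\<^sup>+x. F x * indicator {0..(real n + 1)\<^sup>2} x \<partial>lborel)
    = (\<integral>\<^sup>+t. F (t\<^sup>2) * ennreal (2 * t) * indicator {0..real n + 1} t \<partial>lborel)" for n
  proof -
    have "((\<lambda>t. t\<^sup>2) has_real_derivative 2 * t) (at t)" for t :: real
      by (auto intro!: derivative_eq_intros)
    then show ?thesis
      using nn_integral_substitution_aux[of F 0 "real n + 1" "\<lambda>t. t\<^sup>2" "\<lambda>t. 2 * t"]
      by (simp add: continuous_intros)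
  qed
  have mono: "incseq (\<lambda>n x. G x * indicator {0..f n} x)" if "incseq f"
    for G :: "real \<Rightarrow> ennreal" and f :: "nat \<Rightarrow> real"
    using that by (auto simp: incseq_def le_fun_def indicator_def intro: order_trans)
  have sup: "(SUP n. (\<integral>\<^sup>+x. G x * indicator {0..f n} x \<partial>lborel)) = (\<integral>\<^sup>+x. G x * indicator {0<..} x \<partial>lborel)"
    if inc: "incseq f" and lim: "\<And>x. \<exists>n. x \<le> f n" and [measurable]: "G \<in> borel_measurable borel"
    for G :: "real \<Rightarrow> ennreal" and f :: "nat \<Rightarrow> real"
  proof -
    have eq: "(SUP n. G x * indicator {0..f n} x) = G x * indicator {0..} x" for x
    proof -
      obtain n where "x \<le> f n" using lim by auto
      then show ?thesis
        by (intro antisym SUP_least SUP_upper2[of n])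
           (auto simp: indicator_def)
    qed
    have "(SUP n. (\<integral>\<^sup>+x. G x * indicator {0..f n} x \<partial>lborel))
        = (\<integral>\<^sup>+x. (SUP n. G x * indicator {0..f n} x) \<partial>lborel)"
      by (rule nn_integral_monotone_convergence_SUP[symmetric, OF mono[OF inc]]) measurable
    also have "\<dots> = (\<integral>\<^sup>+x. G x * indicator {0..} x \<partial>lborel)" by (simp add: eq)
    also have "\<dots> = (\<integral>\<^sup>+x. G x * indicator {0<..} x \<partial>lborel)"
      by (rule nn_integral_cong_AE)
         (use AE_lborel_singleton[of "0::real"] in \<open>eventually_elim, auto simp: indicator_def\<close>)
    finally show ?thesis .
  qed
  have "\<exists>n. x \<le> real n + 1" for x
    by (meson real_arch_simple order_trans less_add_one less_imp_le)
  moreover have "\<exists>n. x \<le> (real n + 1)\<^sup>2" for x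
  proof -
    obtain n where "x \<le> real n" using real_arch_simple by auto
    also have "\<dots> \<le> (real n + 1)\<^sup>2" by (simp add: power2_eq_square algebra_simps)
    finally show ?thesis by auto
  qed
  moreover have "incseq (\<lambda>n. (real n + 1)\<^sup>2)" "incseq (\<lambda>n. real n + 1)"
    by (auto simp: incseq_def intro!: power_mono)
  ultimately show ?thesis
    using sup[of "\<lambda>n. (real n + 1)\<^sup>2" F] sup[of "\<lambda>n. real n + 1" "\<lambda>t. F (t\<^sup>2) * ennreal (2 * t)"]
    by (simp add: *)
qed

section \<open>The volume density\<close>

text \<open>Minus a quarter of the Hessian determinant of \<open>hcub\<close>.\<close>

definition gD :: "real ^ 2 \<Rightarrow> real" where "gD t = 3 * (t $ 1)\<^sup>2 + (t $ 2)\<^sup>2"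

fun ext1 :: "real ^ 2 \<Rightarrow> 2 option \<Rightarrow> real" where
  "ext1 b None = 1" | "ext1 b (Some a) = b $ a"

text \<open>On the indices \<open>Some a\<close> this is \<open>2 * gD t\<close> times the inverse
  Hessian of \<open>hcub\<close>, padded with zeros at \<open>None\<close>.\<close>

fun hinv :: "real ^ 2 \<Rightarrow> 2 option \<Rightarrow> 2 option \<Rightarrow> real" where
  "hinv t (Some a) (Some c) = (if a = 1 then (if c = 1 then t $ 1 else - t $ 2)
        else (if c = 1 then - t $ 2 else - 3 * t $ 1))"
| "hinv t _ _ = 0"

text \<open>At b = 0 the matrix \<open>Nmat\<close> is block diagonal, with blocks
  \<open>- 4 * hcub t\<close> and twice the Hessian, and is inverted blockwise. For general b only
  the vector in the rank-one part moves, from (1, 0) to (1, b).\<close>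

definition Ninv :: "real ^ 2 \<Rightarrow> real ^ 2 \<Rightarrow> 2 option \<Rightarrow> 2 option \<Rightarrow> real" where
  "Ninv b t i j = (1 / gD t * hinv t i j - 1 / hcub t * ext1 b i * ext1 b j) / 4"

lemma matrix_inv_eqI:
  fixes A B :: "real ^ 'n ^ 'n"
  assumes AB: "A ** B = mat 1"
  shows "matrix_inv A = B"
proof -
  have BA: "B ** A = mat 1" using AB by (simp add: matrix_left_right_inverse)
  have "\<exists>A'. A ** A' = mat 1 \<and> A' ** A = mat 1" using AB BA by blast
  then have "matrix_inv A ** A = mat 1" unfolding matrix_inv_def by (rule someI2_ex) simp
  then have "matrix_inv A ** (A ** B) = B" by (simp add: matrix_mul_assoc)
  then show ?thesis by (simp add: AB)
qed

lemma Nmat_Complex: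
  fixes b t :: "real ^ 2"
  defines "N \<equiv> Nmat (\<chi> a. Complex (b $ a) (t $ a))"
  shows "N $ None $ None = 4 * (3 * (b $ 1)\<^sup>2 * t $ 1 - (t $ 1) ^ 3
            - t $ 1 * ((b $ 2)\<^sup>2 - (t $ 2)\<^sup>2) - 2 * b $ 1 * b $ 2 * t $ 2)"
    and "N $ None $ Some 1 = - 12 * b $ 1 * t $ 1 + 4 * b $ 2 * t $ 2"
    and "N $ Some 1 $ None = - 12 * b $ 1 * t $ 1 + 4 * b $ 2 * t $ 2"
    and "N $ None $ Some 2 = 4 * b $ 1 * t $ 2 + 4 * b $ 2 * t $ 1"
    and "N $ Some 2 $ None = 4 * b $ 1 * t $ 2 + 4 * b $ 2 * t $ 1"
    and "N $ Some 1 $ Some 1 = 12 * t $ 1"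
    and "N $ Some 1 $ Some 2 = - 4 * t $ 2"
    and "N $ Some 2 $ Some 1 = - 4 * t $ 2"
    and "N $ Some 2 $ Some 2 = - 4 * t $ 1"
  unfolding N_def Nmat_def period_eq
  by (simp_all add: hcub_def power2_eq_square power3_eq_cube algebra_simps)

text \<open>The nine entries of \<open>Nmat\<close> times \<open>4 * Ninv\<close>. With
  \<open>H\<close> and \<open>E\<close> as abstract reciprocals of \<open>hcub\<close> and
  \<open>gD\<close>, each is a polynomial identity modulo the two defining relations, free of
  division.\<close>

lemma Nmat_inverse_identities:
  fixes b1 b2 t1 t2 H E :: real
  assumes H: "(t1 ^ 3 - t1 * t2\<^sup>2) * H = 1" and E: "(3 * t1\<^sup>2 + t2\<^sup>2) * E = 1"
  defines "n \<equiv> 4 * (3 * b1\<^sup>2 * t1 - t1 ^ 3 - t1 * (b2\<^sup>2 - t2\<^sup>2) - 2 * b1 * b2 * t2)"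
    and "p \<equiv> - 12 * b1 * t1 + 4 * b2 * t2" and "q \<equiv> 4 * b1 * t2 + 4 * b2 * t1"
  shows "n * (- H) + p * (- H * b1) + q * (- H * b2) = 4"
    and "n * (- H * b1) + p * (E * t1 - H * b1 * b1) + q * (- E * t2 - H * b2 * b1) = 0"
    and "n * (- H * b2) + p * (- E * t2 - H * b1 * b2) + q * (- 3 * E * t1 - H * b2 * b2) = 0"
    and "p * (- H) + 12 * t1 * (- H * b1) - 4 * t2 * (- H * b2) = 0"
    and "p * (- H * b1) + 12 * t1 * (E * t1 - H * b1 * b1) - 4 * t2 * (- E * t2 - H * b2 * b1) = 4"
    and "p * (- H * b2) + 12 * t1 * (- E * t2 - H * b1 * b2) - 4 * t2 * (- 3 * E * t1 - H * b2 * b2) = 0"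
    and "q * (- H) - 4 * t2 * (- H * b1) - 4 * t1 * (- H * b2) = 0"
    and "q * (- H * b1) - 4 * t2 * (E * t1 - H * b1 * b1) - 4 * t1 * (- E * t2 - H * b2 * b1) = 0"
    and "q * (- H * b2) - 4 * t2 * (- E * t2 - H * b1 * b2) - 4 * t1 * (- 3 * E * t1 - H * b2 * b2) = 4"
proof -
  let ?h = "t1 ^ 3 - t1 * t2\<^sup>2" and ?D = "3 * t1\<^sup>2 + t2\<^sup>2"
  note P = n_def p_def q_def algebra_simps power2_eq_square power3_eq_cube
  have "n * (- H) + p * (- H * b1) + q * (- H * b2) = 4 * (?h * H)" by (simp add: P)
  then show "n * (- H) + p * (- H * b1) + q * (- H * b2) = 4" by (simp only: H mult_1_right)
  have "n * (- H * b1) + p * (E * t1 - H * b1 * b1) + q * (- E * t2 - H * b2 * b1)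
      = 4 * b1 * (?h * H) - 4 * b1 * (?D * E)" by (simp add: P)
  then show "n * (- H * b1) + p * (E * t1 - H * b1 * b1) + q * (- E * t2 - H * b2 * b1) = 0"
    by (simp only: H E)
  have "n * (- H * b2) + p * (- E * t2 - H * b1 * b2) + q * (- 3 * E * t1 - H * b2 * b2)
      = 4 * b2 * (?h * H) - 4 * b2 * (?D * E)" by (simp add: P)
  then show "n * (- H * b2) + p * (- E * t2 - H * b1 * b2) + q * (- 3 * E * t1 - H * b2 * b2) = 0"
    by (simp only: H E)
  have "p * (- H * b1) + 12 * t1 * (E * t1 - H * b1 * b1) - 4 * t2 * (- E * t2 - H * b2 * b1)
      = 4 * (?D * E)" by (simp add: P)
  then show "p * (- H * b1) + 12 * t1 * (E * t1 - H * b1 * b1) - 4 * t2 * (- E * t2 - H * b2 * b1) = 4"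
    by (simp only: E mult_1_right)
  have "q * (- H * b2) - 4 * t2 * (- E * t2 - H * b1 * b2) - 4 * t1 * (- 3 * E * t1 - H * b2 * b2)
      = 4 * (?D * E)" by (simp add: P)
  then show "q * (- H * b2) - 4 * t2 * (- E * t2 - H * b1 * b2) - 4 * t1 * (- 3 * E * t1 - H * b2 * b2) = 4"
    by (simp only: E mult_1_right)
qed (simp_all add: p_def q_def algebra_simps)

lemma matrix_inv_Nmat:
  assumes h: "hcub t > 0" and D: "gD t > 0"
  shows "matrix_inv (Nmat (\<chi> a. Complex (b $ a) (t $ a))) $ i $ j = Ninv b t i j"
proof -
  have "Nmat (\<chi> a. Complex (b $ a) (t $ a)) ** (\<chi> i j. Ninv b t i j) = mat 1"
  proof -
    have "(\<Sum>k\<in>UNIV. Nmat (\<chi> a. Complex (b $ a) (t $ a)) $ i $ k * Ninv b t k j)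
        = (if i = j then 1 else 0)" for i j :: "2 option"
    proof -
      define H where "H = 1 / hcub t"
      define E where "E = 1 / gD t"
      have H: "((t $ 1) ^ 3 - t $ 1 * (t $ 2)\<^sup>2) * H = 1" using h by (simp add: H_def hcub_def)
      have E: "(3 * (t $ 1)\<^sup>2 + (t $ 2)\<^sup>2) * E = 1" using D by (simp add: E_def gD_def)
      note I = Nmat_inverse_identities[OF H E, of "b $ 1" "b $ 2"]
      note U = Ninv_def sum_option2 H_def[symmetric] E_def[symmetric] Nmat_Complex
      consider "i = None" "j = None" | "i = None" "j = Some 1" | "i = None" "j = Some 2"
        | "i = Some 1" "j = None" | "i = Some 1" "j = Some 1" | "i = Some 1" "j = Some 2"
        | "i = Some 2" "j = None" | "i = Some 2" "j = Some 1" | "i = Some 2" "j = Some 2"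
        using UNIV_option2 by auto
      then show ?thesis
      proof cases
        case 1 show ?thesis unfolding 1 U using I(1) by ((simp add: mult.assoc; fail) | (simp add: mult_ac; fail) | simp add: field_simps)
      next
        case 2 show ?thesis unfolding 2 U using I(2) by ((simp add: mult.assoc; fail) | (simp add: mult_ac; fail) | simp add: field_simps)
      next
        case 3 show ?thesis unfolding 3 U using I(3) by ((simp add: mult.assoc; fail) | (simp add: mult_ac; fail) | simp add: field_simps)
      next
        case 4 show ?thesis unfolding 4 U using I(4) by ((simp add: mult.assoc; fail) | (simp add: mult_ac; fail) | simp add: field_simps)
      next
        case 5 show ?thesis unfolding 5 U using I(5) by ((simp add: mult.assoc; fail) | (simp add: mult_ac; fail) | simp add: field_simps)
      next
        case 6 show ?thesis unfolding 6 U using I(6) by ((simp add: mult.assoc; fail) | (simp add: mult_ac; fail) | simp add: field_simps)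
      next
        case 7 show ?thesis unfolding 7 U using I(7) by ((simp add: mult.assoc; fail) | (simp add: mult_ac; fail) | simp add: field_simps)
      next
        case 8 show ?thesis unfolding 8 U using I(8) by ((simp add: mult.assoc; fail) | (simp add: mult_ac; fail) | simp add: field_simps)
      next
        case 9 show ?thesis unfolding 9 U using I(9) by ((simp add: mult.assoc; fail) | (simp add: mult_ac; fail) | simp add: field_simps)
      qed
    qed
    then show ?thesis by (simp add: vec_eq_iff matrix_matrix_mult_def mat_def)
  qed
  from matrix_inv_eqI[OF this] show ?thesis by simp
qed

text \<open>The coframe is dual to the left translates of the coordinate fields: \<open>exp(b\<^sup>a V\<^sub>a)\<close> carries it
  to the coframe at \<open>b = 0\<close>, where the real and imaginary parts of \<open>W\<^sub>i\<close> decouple.\<close>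

fun coframe :: "real ^ coord \<Rightarrow> coord \<Rightarrow> real ^ coord \<Rightarrow> real" where
  "coframe p (B a) v = v $ B a"
| "coframe p (T a) v = v $ T a"
| "coframe p Rho v = v $ Rho"
| "coframe p (Zl None) v = v $ Zl None"
| "coframe p (Zl (Some a)) v = v $ Zl (Some a) - p $ B a * v $ Zl None"
| "coframe p (Zt (Some a)) v = v $ Zt (Some a)
     + (\<Sum>c\<in>UNIV. ddhcub a c (\<chi> a. p $ B a) * v $ Zl (Some c)) - dhcub a (\<chi> a. p $ B a) * v $ Zl None"
| "coframe p (Zt None) v = v $ Zt None + (\<Sum>a\<in>UNIV. p $ B a * v $ Zt (Some a))
     + (\<Sum>a\<in>UNIV. dhcub a (\<chi> a. p $ B a) * v $ Zl (Some a)) - hcub (\<chi> a. p $ B a) * v $ Zl None"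
| "coframe p Sig v = sigma_form p v"

text \<open>The coframe absorbs b, so the remaining coefficients depend on t alone. Adding b^a W_a
  to W_0 is the b-part of the contraction z^i W_i.\<close>

lemma zext_Wform:
  fixes p v :: "real ^ coord"
  defines "t \<equiv> tpart p" and "W \<equiv> \<lambda>i. Wform (zpart p) i v" and "e \<equiv> \<lambda>i. coframe p i v"
  shows "Re (W (Some a)) = e (Zt (Some a)) + dhcub a t * e (Zl None)"
    and "Im (W (Some a)) = (\<Sum>c\<in>UNIV. ddhcub a c t * e (Zl (Some c)))"
    and "Re (W None + (\<Sum>a\<in>UNIV. of_real (p $ B a) * W (Some a)))
      = e (Zt None) + (\<Sum>a\<in>UNIV. dhcub a t * e (Zl (Some a)))"
    and "Im (W None + (\<Sum>a\<in>UNIV. of_real (p $ B a) * W (Some a))) = - 2 * hcub t * e (Zl None)"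
  using two_cases[of a]
  by (auto simp: W_def e_def t_def Wform_def period_eq sum_option2 UNIV_2 zpart_def tpart_def hcub_def
      power2_eq_square power3_eq_cube algebra_simps)

definition gmat :: "real ^ 2 \<Rightarrow> 2 \<Rightarrow> 2 \<Rightarrow> real" where
  "gmat t a c = (dhcub a t * dhcub c t - ddhcub a c t * hcub t) / (4 * (hcub t)\<^sup>2)"

text \<open>The inverse matrix of \<open>gmat t\<close>, by the Sherman-Morrison formula:
  \<open>gmat\<close> is a rank-one perturbation of a multiple of the Hessian, and by homogeneity
  the inverse Hessian sends the gradient of \<open>hcub\<close> to t / 2.\<close>

definition gmat_inv :: "real ^ 2 \<Rightarrow> 2 \<Rightarrow> 2 \<Rightarrow> real" where
  "gmat_inv t a c = 2 * (t $ a * t $ c - hcub t * hinv t (Some a) (Some c) / gD t)"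

text \<open>Here x and y are real and imaginary parts of the shifted W, while e and f are the
  coframe values at \<open>Zl\<close> and \<open>Zt\<close>. The point is that the terms mixing e0
  with t1 f1 + t2 f2 cancel: the \<open>E\<close> part produces them with coefficient D E = 1, the
  \<open>H\<close> parts with coefficient h H = 1 and the opposite sign.\<close>

lemma W_block_identity:
  fixes t1 t2 h D h1 h2 :: real
  assumes h: "h = t1 ^ 3 - t1 * t2\<^sup>2" and D: "D = 3 * t1\<^sup>2 + t2\<^sup>2"
    and h1: "h1 = 3 * t1\<^sup>2 - t2\<^sup>2" and h2: "h2 = - 2 * t1 * t2"
    and hH: "h * H = 1" and DE: "D * E = 1"
    and x: "x0 = f0 + (h1 * e1 + h2 * e2)" "x1 = f1 + h1 * e0" "x2 = f2 + h2 * e0"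
    and y: "y0 = - 2 * h * e0" "y1 = 6 * t1 * e1 - 2 * t2 * e2" "y2 = - 2 * t2 * e1 - 2 * t1 * e2"
    and x': "x0' = f0' + (h1 * e1' + h2 * e2')" "x1' = f1' + h1 * e0'" "x2' = f2' + h2 * e0'"
    and y': "y0' = - 2 * h * e0'" "y1' = 6 * t1 * e1' - 2 * t2 * e2'" "y2' = - 2 * t2 * e1' - 2 * t1 * e2'"
  shows "- (E * (t1 * (x1 * x1' + y1 * y1') - t2 * (x1 * x2' + y1 * y2') - t2 * (x2 * x1' + y2 * y1')
            - 3 * t1 * (x2 * x2' + y2 * y2'))
          - H * (x0 * x0' + y0 * y0')
          - H * ((x0 - (t1 * y1 + t2 * y2)) * (x0' - (t1 * y1' + t2 * y2'))
               + (y0 + (t1 * x1 + t2 * x2)) * (y0' + (t1 * x1' + t2 * x2'))))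
    = 2 * h * e0 * e0' + 2 * H * f0 * f0'
      + 2 * (H * ((h1 * e1 + h2 * e2) * (h1 * e1' + h2 * e2'))
         - (6 * t1 * e1 * e1' - 2 * t2 * (e1 * e2' + e2 * e1') - 2 * t1 * e2 * e2'))
      + (H * ((t1 * f1 + t2 * f2) * (t1 * f1' + t2 * f2'))
         - E * (t1 * f1 * f1' - t2 * (f1 * f2' + f2 * f1') - 3 * t1 * f2 * f2'))"
proof -
  note S = h D h1 h2 x y x' y'
  let ?q = "6 * t1 * e1 * e1' - 2 * t2 * (e1 * e2' + e2 * e1') - 2 * t1 * e2 * e2'"
  have "E * (t1 * (x1 * x1' + y1 * y1') - t2 * (x1 * x2' + y1 * y2') - t2 * (x2 * x1' + y2 * y1')
            - 3 * t1 * (x2 * x2' + y2 * y2'))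
      = E * (t1 * f1 * f1' - t2 * (f1 * f2' + f2 * f1') - 3 * t1 * f2 * f2')
        + (D * E) * ((t1 * f1 + t2 * f2) * e0' + (t1 * f1' + t2 * f2') * e0 + 3 * h * e0 * e0'
        + 2 * ?q)"
    unfolding S by (simp add: algebra_simps power2_eq_square power3_eq_cube)
  moreover have ty: "t1 * y1 + t2 * y2 = 2 * (h1 * e1 + h2 * e2)"
      "t1 * y1' + t2 * y2' = 2 * (h1 * e1' + h2 * e2')"
      "t1 * x1 + t2 * x2 = t1 * f1 + t2 * f2 + 3 * h * e0"
      "t1 * x1' + t2 * x2' = t1 * f1' + t2 * f2' + 3 * h * e0'"
    unfolding S by (simp_all add: algebra_simps power2_eq_square power3_eq_cube)
  moreover have "H * (x0 * x0' + y0 * y0')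
          + H * ((x0 - 2 * (h1 * e1 + h2 * e2)) * (x0' - 2 * (h1 * e1' + h2 * e2'))
               + (y0 + (t1 * f1 + t2 * f2 + 3 * h * e0)) * (y0' + (t1 * f1' + t2 * f2' + 3 * h * e0')))
     = 2 * H * f0 * f0' + 2 * H * ((h1 * e1 + h2 * e2) * (h1 * e1' + h2 * e2'))
       + H * ((t1 * f1 + t2 * f2) * (t1 * f1' + t2 * f2'))
       + (h * H) * (e0 * (t1 * f1' + t2 * f2') + e0' * (t1 * f1 + t2 * f2) + 5 * h * e0 * e0')"
    unfolding x(1) x'(1) y(1) y'(1) by (simp add: algebra_simps power2_eq_square)
  ultimately show ?thesis unfolding ty hH DE by (simp add: algebra_simps)
qed

lemma Re_W_form:
  fixes p v w :: "real ^ coord"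
  defines "t \<equiv> tpart p" and "z \<equiv> zpart p" and "e \<equiv> \<lambda>i. coframe p i v" and "e' \<equiv> \<lambda>i. coframe p i w"
  assumes h: "hcub t > 0" and D: "gD t > 0"
  shows "- (1 / 4) * Re (\<Sum>i\<in>UNIV. \<Sum>j\<in>UNIV.
              (of_real (matrix_inv (Nmat z) $ i $ j)
                 - of_real (2 / (8 * hcub t)) * zext z $ i * cnj (zext z $ j))
              * Wform z i v * cnj (Wform z j w))
    = hcub t / 8 * e (Zl None) * e' (Zl None) + 1 / (8 * hcub t) * e (Zt None) * e' (Zt None)
      + hcub t / 2 * (\<Sum>a\<in>UNIV. \<Sum>c\<in>UNIV. gmat t a c * e (Zl (Some a)) * e' (Zl (Some c)))
      + 1 / (32 * hcub t) * (\<Sum>a\<in>UNIV. \<Sum>c\<in>UNIV. gmat_inv t a c * e (Zt (Some a)) * e' (Zt (Some c)))"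
proof -
  define b where "b = (\<chi> a. p $ B a)"
  have z: "z = (\<chi> a. Complex (b $ a) (t $ a))"
    by (simp add: z_def zpart_def b_def t_def tpart_def)
  define H where "H = 1 / hcub t"
  define E where "E = 1 / gD t"
  have hH: "hcub t * H = 1" and DE: "gD t * E = 1" using h D by (simp_all add: H_def E_def)
  define W where "W = (\<lambda>i. Wform z i v)"
  define W' where "W' = (\<lambda>i. Wform z i w)"
  \<comment> \<open>Both z^i W_i = U + i t^a W_a and the rank-one part of \<open>Ninv\<close> see
    W_0 only through \<open>U\<close>, so b no longer occurs explicitly.\<close>
  define U where "U = W None + (\<Sum>a\<in>UNIV. of_real (b $ a) * W (Some a))"
  define U' where "U' = W' None + (\<Sum>a\<in>UNIV. of_real (b $ a) * W' (Some a))"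
  let ?V = "U + \<i> * (of_real (t $ 1) * W (Some 1) + of_real (t $ 2) * W (Some 2))"
  let ?V' = "U' + \<i> * (of_real (t $ 1) * W' (Some 1) + of_real (t $ 2) * W' (Some 2))"
  have zz: "z $ a = of_real (b $ a) + \<i> * of_real (t $ a)" for a
    by (simp add: z complex_eq_iff)
  {
  have "(\<Sum>i\<in>UNIV. \<Sum>j\<in>UNIV. (of_real (matrix_inv (Nmat z) $ i $ j)
                 - of_real (2 / (8 * hcub t)) * zext z $ i * cnj (zext z $ j)) * W i * cnj (W' j))
    = (\<Sum>i\<in>UNIV. \<Sum>j\<in>UNIV. of_real (Ninv b t i j) * W i * cnj (W' j))
      - of_real (H / 4) * ((\<Sum>i\<in>UNIV. zext z $ i * W i) * cnj (\<Sum>j\<in>UNIV. zext z $ j * W' j))"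
    unfolding z matrix_inv_Nmat[OF h D]
    by (simp add: H_def sum_option2 algebra_simps)
  also have "(\<Sum>i\<in>UNIV. zext z $ i * W i) = ?V"
    by (simp add: sum_option2 UNIV_2 zz U_def algebra_simps)
  also have "(\<Sum>i\<in>UNIV. zext z $ i * W' i) = ?V'"
    by (simp add: sum_option2 UNIV_2 zz U'_def algebra_simps)
  also have "(\<Sum>i\<in>UNIV. \<Sum>j\<in>UNIV. of_real (Ninv b t i j) * W i * cnj (W' j))
     = of_real (1 / 4) * (of_real E * (of_real (t $ 1) * (W (Some 1) * cnj (W' (Some 1)))
          - of_real (t $ 2) * (W (Some 1) * cnj (W' (Some 2)))
          - of_real (t $ 2) * (W (Some 2) * cnj (W' (Some 1)))
          - of_real (3 * t $ 1) * (W (Some 2) * cnj (W' (Some 2))))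
        - of_real H * (U * cnj U'))"
    unfolding Ninv_def H_def[symmetric] E_def[symmetric] U_def U'_def
    by (simp add: sum_option2 UNIV_2 algebra_simps add_divide_distrib diff_divide_distrib)
  also note calculation
  }
  note eq = this
  have *: "- (1 / 4) * Re (\<Sum>i\<in>UNIV. \<Sum>j\<in>UNIV.
              (of_real (matrix_inv (Nmat z) $ i $ j)
                 - of_real (2 / (8 * hcub t)) * zext z $ i * cnj (zext z $ j)) * W i * cnj (W' j))
    = 1 / 16 * - (E * (t $ 1 * (Re (W (Some 1)) * Re (W' (Some 1)) + Im (W (Some 1)) * Im (W' (Some 1)))
          - t $ 2 * (Re (W (Some 1)) * Re (W' (Some 2)) + Im (W (Some 1)) * Im (W' (Some 2)))
          - t $ 2 * (Re (W (Some 2)) * Re (W' (Some 1)) + Im (W (Some 2)) * Im (W' (Some 1)))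
          - 3 * t $ 1 * (Re (W (Some 2)) * Re (W' (Some 2)) + Im (W (Some 2)) * Im (W' (Some 2))))
        - H * (Re U * Re U' + Im U * Im U')
        - H * ((Re U - (t $ 1 * Im (W (Some 1)) + t $ 2 * Im (W (Some 2))))
              * (Re U' - (t $ 1 * Im (W' (Some 1)) + t $ 2 * Im (W' (Some 2))))
            + (Im U + (t $ 1 * Re (W (Some 1)) + t $ 2 * Re (W (Some 2))))
              * (Im U' + (t $ 1 * Re (W' (Some 1)) + t $ 2 * Re (W' (Some 2))))))"
    unfolding eq by (simp add: algebra_simps add_divide_distrib diff_divide_distrib)
  have V: "Re (W (Some a)) = e (Zt (Some a)) + dhcub a t * e (Zl None)"
      "Im (W (Some a)) = (\<Sum>c\<in>UNIV. ddhcub a c t * e (Zl (Some c)))"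
      "Re U = e (Zt None) + (\<Sum>a\<in>UNIV. dhcub a t * e (Zl (Some a)))"
      "Im U = - 2 * hcub t * e (Zl None)" for a
    unfolding W_def U_def e_def t_def z_def b_def vec_lambda_beta by (rule zext_Wform)+
  have V': "Re (W' (Some a)) = e' (Zt (Some a)) + dhcub a t * e' (Zl None)"
      "Im (W' (Some a)) = (\<Sum>c\<in>UNIV. ddhcub a c t * e' (Zl (Some c)))"
      "Re U' = e' (Zt None) + (\<Sum>a\<in>UNIV. dhcub a t * e' (Zl (Some a)))"
      "Im U' = - 2 * hcub t * e' (Zl None)" for a
    unfolding W'_def U'_def e'_def t_def z_def b_def vec_lambda_beta by (rule zext_Wform)+
  have "- (1 / 4) * Re (\<Sum>i\<in>UNIV. \<Sum>j\<in>UNIV.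
              (of_real (matrix_inv (Nmat z) $ i $ j)
                 - of_real (2 / (8 * hcub t)) * zext z $ i * cnj (zext z $ j)) * W i * cnj (W' j))
    = 1 / 16 * (2 * hcub t * e (Zl None) * e' (Zl None) + 2 * H * e (Zt None) * e' (Zt None)
      + 2 * (H * ((dhcub 1 t * e (Zl (Some 1)) + dhcub 2 t * e (Zl (Some 2)))
              * (dhcub 1 t * e' (Zl (Some 1)) + dhcub 2 t * e' (Zl (Some 2))))
         - (6 * t $ 1 * e (Zl (Some 1)) * e' (Zl (Some 1))
            - 2 * t $ 2 * (e (Zl (Some 1)) * e' (Zl (Some 2)) + e (Zl (Some 2)) * e' (Zl (Some 1)))
            - 2 * t $ 1 * e (Zl (Some 2)) * e' (Zl (Some 2))))
      + (H * ((t $ 1 * e (Zt (Some 1)) + t $ 2 * e (Zt (Some 2)))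
            * (t $ 1 * e' (Zt (Some 1)) + t $ 2 * e' (Zt (Some 2))))
         - E * (t $ 1 * e (Zt (Some 1)) * e' (Zt (Some 1))
            - t $ 2 * (e (Zt (Some 1)) * e' (Zt (Some 2)) + e (Zt (Some 2)) * e' (Zt (Some 1)))
            - 3 * t $ 1 * e (Zt (Some 2)) * e' (Zt (Some 2)))))"
    unfolding *
    by (rule arg_cong[where f = "\<lambda>x. 1 / 16 * x"],
        rule W_block_identity[where h = "hcub t" and D = "gD t"])
      (rule hH DE | (simp only: hcub_def gD_def; fail) | (simp add: V V' UNIV_2; fail))+
  also have "\<dots> = hcub t / 8 * e (Zl None) * e' (Zl None) + H / 8 * e (Zt None) * e' (Zt None)
      + (\<Sum>a\<in>UNIV. \<Sum>c\<in>UNIV. hcub t / 2 * gmat t a c * e (Zl (Some a)) * e' (Zl (Some c)))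
      + (\<Sum>a\<in>UNIV. \<Sum>c\<in>UNIV. H / 32 * gmat_inv t a c * e (Zt (Some a)) * e' (Zt (Some c)))"
  proof -
    have G1: "hcub t / 2 * gmat t a c = H * (dhcub a t * dhcub c t) / 8 - ddhcub a c t / 8" for a c
      using h by (simp add: gmat_def H_def field_simps power2_eq_square del: dhcub.simps ddhcub.simps)
    have G2: "H / 32 * gmat_inv t a c = H * (t $ a * t $ c) / 16 - E * hinv t (Some a) (Some c) / 16" for a c
      using h by (simp add: gmat_inv_def H_def E_def field_simps del: hinv.simps)
    show ?thesis unfolding G1 G2
      by (simp add: UNIV_2 algebra_simps add_divide_distrib diff_divide_distrib)
  qed
  also have "\<dots> = hcub t / 8 * e (Zl None) * e' (Zl None) + 1 / (8 * hcub t) * e (Zt None) * e' (Zt None)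
      + hcub t / 2 * (\<Sum>a\<in>UNIV. \<Sum>c\<in>UNIV. gmat t a c * e (Zl (Some a)) * e' (Zl (Some c)))
      + 1 / (32 * hcub t) * (\<Sum>a\<in>UNIV. \<Sum>c\<in>UNIV. gmat_inv t a c * e (Zt (Some a)) * e' (Zt (Some c)))"
    by (simp add: H_def sum_distrib_left mult_ac)
  finally show ?thesis unfolding W_def W'_def .
qed

text \<open>The coframe makes the coordinate blocks mutually orthogonal. That
  \<open>Zt (Some a)\<close> carries the inverse of the matrix found on \<open>B\<close>,
  \<open>T\<close> and \<open>Zl (Some a)\<close> is what simplifies the determinants below.\<close>

lemma qmap_metric_eq:
  fixes p v w :: "real ^ coord"
  defines "t \<equiv> tpart p" and "e \<equiv> \<lambda>i. coframe p i v" and "e' \<equiv> \<lambda>i. coframe p i w"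
  assumes h: "hcub t > 0" and D: "gD t > 0"
  shows "qmap_metric p v w
    = (\<Sum>a\<in>UNIV. \<Sum>c\<in>UNIV. gmat t a c * (v $ B a * w $ B c + v $ T a * w $ T c))
      + v $ Rho * w $ Rho / (4 * (p $ Rho)\<^sup>2)
      + 1 / p $ Rho * (hcub t / 8 * e (Zl None) * e' (Zl None) + 1 / (8 * hcub t) * e (Zt None) * e' (Zt None)
      + hcub t / 2 * (\<Sum>a\<in>UNIV. \<Sum>c\<in>UNIV. gmat t a c * e (Zl (Some a)) * e' (Zl (Some c)))
      + 1 / (32 * hcub t) * (\<Sum>a\<in>UNIV. \<Sum>c\<in>UNIV. gmat_inv t a c * e (Zt (Some a)) * e' (Zt (Some c))))
      + 1 / (64 * (p $ Rho)\<^sup>2) * e Sig * e' Sig"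
proof -
  have *: "- 1 / 4 * ((x - y) / z) = (y - x) / (4 * z)" for x y z :: real
    by (cases "z = 0") (simp_all add: field_simps)
  have "- 1 / 4 * pd a (pd c (\<lambda>t. ln (hcub t))) t = gmat t a c" for a c
    unfolding pd_pd_ln_hcub[OF h] gmat_def * ..
  then have first: "- 1 / 4 * (\<Sum>a\<in>UNIV. \<Sum>b\<in>UNIV. pd a (pd b (\<lambda>t. ln (hcub t))) t
                      * (v $ B a * w $ B b + v $ T a * w $ T b))
     = (\<Sum>a\<in>UNIV. \<Sum>c\<in>UNIV. gmat t a c * (v $ B a * w $ B c + v $ T a * w $ T c))"
    unfolding sum_distrib_left mult.assoc[symmetric] by simp
  have second: "x + y - 1 / (4 * r) * s + u = x + y + 1 / r * (- (1 / 4) * s) + u" for x y r s u :: real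
    by simp
  show ?thesis
    unfolding qmap_metric_def Let_def second t_def[symmetric] first
    unfolding t_def Re_W_form[OF h[unfolded t_def] D[unfolded t_def], of v w] e_def e'_def coframe.simps(8) ..
qed

lemma gD_scaleR: "gD (r *\<^sub>R t) = r\<^sup>2 * gD t"
  by (simp add: gD_def algebra_simps power2_eq_square)

lemma det_gmat:
  assumes h: "hcub t > 0"
  shows "gmat t 1 1 * gmat t 2 2 - (gmat t 1 2)\<^sup>2 = gD t / (8 * (hcub t)\<^sup>2)"
proof -
  have "((dhcub 1 t)\<^sup>2 - ddhcub 1 1 t * hcub t) * ((dhcub 2 t)\<^sup>2 - ddhcub 2 2 t * hcub t)
      - (dhcub 1 t * dhcub 2 t - ddhcub 1 2 t * hcub t)\<^sup>2 = 2 * gD t * (hcub t)\<^sup>2"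
    by (simp add: hcub_def gD_def algebra_simps power2_eq_square power3_eq_cube)
  then have "gmat t 1 1 * gmat t 2 2 - (gmat t 1 2)\<^sup>2 = 2 * gD t * (hcub t)\<^sup>2 / (16 * (hcub t) ^ 4)"
    unfolding gmat_def power_divide
    by (simp add: diff_divide_distrib[symmetric] power2_eq_square power4_eq_xxxx del: dhcub.simps ddhcub.simps)
  then show ?thesis using h by (simp add: field_simps power2_eq_square power4_eq_xxxx)
qed

lemma det_gmat_inv:
  assumes h: "hcub t > 0" and D: "gD t > 0"
  shows "gmat_inv t 1 1 * gmat_inv t 2 2 - (gmat_inv t 1 2)\<^sup>2 = 8 * (hcub t)\<^sup>2 / gD t"
proof -
  define E where "E = 1 / gD t"
  have DE: "(3 * (t $ 1)\<^sup>2 + (t $ 2)\<^sup>2) * E = 1" using D by (simp add: E_def gD_def)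
  have dE: "x / gD t = x * E" for x by (simp add: E_def)
  have "gmat_inv t 1 1 * gmat_inv t 2 2 - (gmat_inv t 1 2)\<^sup>2
      = 4 * (3 * hcub t * E * ((t $ 1) ^ 3 - t $ 1 * (t $ 2)\<^sup>2)
          - (hcub t)\<^sup>2 * E * ((3 * (t $ 1)\<^sup>2 + (t $ 2)\<^sup>2) * E))"
    unfolding gmat_inv_def hinv.simps dE
    by (simp add: algebra_simps power2_eq_square power3_eq_cube)
  also have "\<dots> = 8 * (hcub t)\<^sup>2 * E"
    unfolding DE hcub_def[symmetric] by (simp add: algebra_simps power2_eq_square)
  finally show ?thesis by (simp add: E_def)
qed

lemma gmat_sym: "gmat t 2 1 = gmat t 1 2" and gmat_inv_sym: "gmat_inv t 2 1 = gmat_inv t 1 2"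
  by (simp_all add: gmat_def gmat_inv_def mult.commute)

lemma gmat_pos:
  assumes h: "hcub t > 0" and t: "t $ 1 > 0"
  shows "gmat t 1 1 > 0" and "gmat t 2 2 > 0"
proof -
  have "(dhcub 1 t)\<^sup>2 - ddhcub 1 1 t * hcub t = 3 * (t $ 1) ^ 4 + (t $ 2) ^ 4"
    by (simp add: hcub_def algebra_simps power2_eq_square power3_eq_cube power4_eq_xxxx)
  moreover have "(dhcub 2 t)\<^sup>2 - ddhcub 2 2 t * hcub t = 2 * (t $ 1) ^ 4 + 2 * (t $ 1 * t $ 2)\<^sup>2"
    by (simp add: hcub_def algebra_simps power2_eq_square power3_eq_cube power4_eq_xxxx)
  moreover have "3 * (t $ 1) ^ 4 + (t $ 2) ^ 4 > 0" "2 * (t $ 1) ^ 4 + 2 * (t $ 1 * t $ 2)\<^sup>2 > 0"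
    using t by (auto intro!: add_pos_nonneg)
  ultimately show "gmat t 1 1 > 0" "gmat t 2 2 > 0"
    using h unfolding gmat_def by (simp_all add: power2_eq_square del: dhcub.simps ddhcub.simps)
qed

text \<open>By Euler's relations the first and second derivatives of \<open>hcub\<close> along t are
  3 h and 6 h, hence (9 - 6) / 4. This is the coefficient of dr^2 / r^2 in the metric of a
  fiber.\<close>

lemma gmat_radial:
  assumes h: "hcub t > 0"
  shows "(\<Sum>a\<in>UNIV. \<Sum>c\<in>UNIV. gmat t a c * (t $ a * t $ c)) = 3 / 4"
proof -
  have "(\<Sum>a\<in>UNIV. \<Sum>c\<in>UNIV. (dhcub a t * dhcub c t - ddhcub a c t * hcub t) * (t $ a * t $ c))
      = 3 * (hcub t)\<^sup>2"
    by (simp add: UNIV_2 hcub_def algebra_simps power2_eq_square power3_eq_cube)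
  then have "(\<Sum>a\<in>UNIV. \<Sum>c\<in>UNIV. gmat t a c * (t $ a * t $ c)) = 3 * (hcub t)\<^sup>2 / (4 * (hcub t)\<^sup>2)"
    unfolding gmat_def times_divide_eq_left sum_divide_distrib[symmetric] by simp
  then show ?thesis using h by simp
qed

section \<open>Pivots of the metrics and the two volume densities\<close>

definition pivot2 :: "(2 \<Rightarrow> 2 \<Rightarrow> real) \<Rightarrow> 2 \<Rightarrow> real" where
  "pivot2 m a = (if a = 1 then m 1 1 else m 2 2 - (m 1 2)\<^sup>2 / m 1 1)"

definition reduce2 :: "(2 \<Rightarrow> 2 \<Rightarrow> real) \<Rightarrow> (2 \<Rightarrow> real) \<Rightarrow> 2 \<Rightarrow> real" where
  "reduce2 m x a = (if a = 1 then x 1 + m 1 2 / m 1 1 * x 2 else x 2)"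

lemma quadratic_form_pivot2:
  assumes "m 1 1 \<noteq> 0" "m 2 1 = m 1 2"
  shows "(\<Sum>a\<in>UNIV. \<Sum>c\<in>UNIV. m a c * x a * y c)
    = pivot2 m 1 * reduce2 m x 1 * reduce2 m y 1 + pivot2 m 2 * reduce2 m x 2 * reduce2 m y 2"
  using assms by (simp add: UNIV_2 pivot2_def reduce2_def field_simps power2_eq_square)

lemma pivot2_mult: "m 1 1 \<noteq> 0 \<Longrightarrow> pivot2 m 1 * pivot2 m 2 = m 1 1 * m 2 2 - (m 1 2)\<^sup>2"
  by (simp add: pivot2_def field_simps)

fun pivot :: "real ^ coord \<Rightarrow> coord \<Rightarrow> real" where
  "pivot p (B a) = pivot2 (gmat (tpart p)) a"
| "pivot p (T a) = pivot2 (gmat (tpart p)) a"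
| "pivot p Rho = 1 / (4 * (p $ Rho)\<^sup>2)"
| "pivot p (Zl None) = hcub (tpart p) / (8 * p $ Rho)"
| "pivot p (Zl (Some a)) = hcub (tpart p) / (2 * p $ Rho) * pivot2 (gmat (tpart p)) a"
| "pivot p (Zt None) = 1 / (8 * hcub (tpart p) * p $ Rho)"
| "pivot p (Zt (Some a)) = 1 / (32 * hcub (tpart p) * p $ Rho) * pivot2 (gmat_inv (tpart p)) a"
| "pivot p Sig = 1 / (64 * (p $ Rho)\<^sup>2)"

fun ldl :: "real ^ coord \<Rightarrow> coord \<Rightarrow> real ^ coord \<Rightarrow> real" where
  "ldl p (B a) v = reduce2 (gmat (tpart p)) (\<lambda>a. coframe p (B a) v) a"
| "ldl p (T a) v = reduce2 (gmat (tpart p)) (\<lambda>a. coframe p (T a) v) a"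
| "ldl p (Zl (Some a)) v = reduce2 (gmat (tpart p)) (\<lambda>a. coframe p (Zl (Some a)) v) a"
| "ldl p (Zt (Some a)) v = reduce2 (gmat_inv (tpart p)) (\<lambda>a. coframe p (Zt (Some a)) v) a"
| "ldl p k v = coframe p k v"

text \<open>Chosen so that the linear form \<open>ldl p k\<close> involves, besides coordinate k,
  only coordinates of smaller rank. Within a pair the index 1 ranks above 2, because
  \<open>reduce2\<close> adds a multiple of the second component to the first.\<close>

fun coord_rank :: "coord \<Rightarrow> nat" where
  "coord_rank (B a) = (if a = 1 then 1 else 0)"
| "coord_rank (T a) = (if a = 1 then 1 else 0)"
| "coord_rank Rho = 0"
| "coord_rank (Zl None) = 0"
| "coord_rank (Zl (Some a)) = (if a = 1 then 2 else 1)"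
| "coord_rank (Zt (Some a)) = (if a = 1 then 4 else 3)"
| "coord_rank (Zt None) = 5"
| "coord_rank Sig = 6"

lemma gmat_inv_pos:
  assumes h: "hcub t > 0" and t: "t $ 1 > 0"
  shows "gmat_inv t 1 1 > 0"
proof -
  have D: "gD t > 0" using t by (auto simp: gD_def intro!: add_pos_nonneg)
  have "gmat_inv t 1 1 = 2 * (t $ 1 * (t $ 1 * gD t - hcub t)) / gD t"
    using D by (simp add: gmat_inv_def field_simps)
  also have "t $ 1 * gD t - hcub t = 2 * (t $ 1) ^ 3 + 2 * t $ 1 * (t $ 2)\<^sup>2"
    by (simp add: gD_def hcub_def algebra_simps power2_eq_square power3_eq_cube)
  finally show ?thesis using D t by (auto intro!: divide_pos_pos mult_pos_pos add_pos_nonneg)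
qed

lemma qmap_metric_ldl:
  assumes h: "hcub (tpart p) > 0" and t: "tpart p $ 1 > 0"
  shows "qmap_metric p v w = (\<Sum>k\<in>UNIV. pivot p k * ldl p k v * ldl p k w)"
proof -
  have D: "gD (tpart p) > 0" using t by (auto simp: gD_def intro!: add_pos_nonneg)
  note Q = quadratic_form_pivot2[of "gmat (tpart p)", OF less_imp_neq[OF gmat_pos(1)[OF h t], symmetric] gmat_sym]
  note Q' = quadratic_form_pivot2[of "gmat_inv (tpart p)", OF less_imp_neq[OF gmat_inv_pos[OF h t], symmetric] gmat_inv_sym]
  show ?thesis
    unfolding qmap_metric_eq[OF h D] Q Q' distrib_left sum.distrib mult.assoc[symmetric]
    by (simp add: UNIV_coord del: coframe.simps) (simp add: algebra_simps)
qed

lemma ldl_triangular: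
  "ldl p k (axis i 1) \<noteq> 0 \<Longrightarrow> k = i \<or> coord_rank i < coord_rank k" "ldl p k (axis k 1) = 1"
proof -
  have "k \<in> UNIV" "i \<in> UNIV" by auto
  then show "ldl p k (axis i 1) \<noteq> 0 \<Longrightarrow> k = i \<or> coord_rank i < coord_rank k"
    unfolding UNIV_coord
    by (elim insertE emptyE; simp add: reduce2_def axis_def sigma_form_def sum_option2 UNIV_2)
  have "k \<in> UNIV" by auto
  then show "ldl p k (axis k 1) = 1"
    unfolding UNIV_coord
    by (elim insertE emptyE; simp add: reduce2_def axis_def sigma_form_def sum_option2 UNIV_2)
qed

text \<open>The determinant of \<open>gmat\<close> enters three times and that of its inverse once,
  so the determinant of the metric is a perfect square and the density is rational.\<close>

lemma det_qmap_metric: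
  assumes h: "hcub (tpart p) > 0" and t: "tpart p $ 1 > 0" and rho: "p $ Rho > 0"
  shows "sqrt (det (\<chi> i j. qmap_metric p (axis i 1) (axis j 1)))
    = gD (tpart p) / (8 * (hcub (tpart p))\<^sup>2) / (2 ^ 13 * (p $ Rho) ^ 5)"
proof -
  let ?t = "tpart p"
  have D: "gD ?t > 0" using t by (auto simp: gD_def intro!: add_pos_nonneg)
  have g: "pivot2 (gmat ?t) 1 * pivot2 (gmat ?t) 2 = gD ?t / (8 * (hcub ?t)\<^sup>2)"
    using pivot2_mult[of "gmat ?t"] gmat_pos(1)[OF h t] det_gmat[OF h] by simp
  have gi: "pivot2 (gmat_inv ?t) 1 * pivot2 (gmat_inv ?t) 2 = 8 * (hcub ?t)\<^sup>2 / gD ?t"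
    using pivot2_mult[of "gmat_inv ?t"] gmat_inv_pos[OF h t] det_gmat_inv[OF h D] by simp
  have "det (\<chi> i j. qmap_metric p (axis i 1) (axis j 1)) = (\<Prod>k\<in>UNIV. pivot p k)"
    unfolding qmap_metric_ldl[OF h t]
    by (rule det_unitriangular_congruence[of _ coord_rank]) (fact ldl_triangular)+
  also have "\<dots> = (pivot2 (gmat ?t) 1 * pivot2 (gmat ?t) 2) ^ 3 * (pivot2 (gmat_inv ?t) 1 * pivot2 (gmat_inv ?t) 2)
      / (4 * (p $ Rho)\<^sup>2) * (hcub ?t / (8 * p $ Rho)) * (hcub ?t / (2 * p $ Rho))\<^sup>2
      * (1 / (8 * hcub ?t * p $ Rho)) * (1 / (32 * hcub ?t * p $ Rho))\<^sup>2 * (1 / (64 * (p $ Rho)\<^sup>2))"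
    by (simp add: UNIV_coord power2_eq_square power3_eq_cube mult_ac)
  also have "\<dots> = (gD ?t / (8 * (hcub ?t)\<^sup>2) / (2 ^ 13 * (p $ Rho) ^ 5))\<^sup>2"
    unfolding g gi using h D rho by (simp add: field_simps) (simp add: eval_nat_numeral)?
  finally show ?thesis using h D rho by simp
qed

lemma linear_fiber_chart: "linear (fiber_chart x)"
  by (rule linearI) (auto simp: fiber_chart_def vec_eq_iff algebra_simps split: coord.split)

lemma frechet_derivative_fiber_chart: "frechet_derivative (fiber_chart x) (at u) = fiber_chart x"
proof -
  have "(fiber_chart x has_derivative fiber_chart x) (at u)"
    using linear_fiber_chart by (intro bounded_linear_imp_has_derivative) (simp add: linear_conv_bounded_linear)
  then show ?thesis by (rule frechet_derivative_at[symmetric])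
qed

lemma psr_curve_pos:
  assumes "x \<in> psr_curve"
  shows "x $ 1 > 0" "hcub x = 1" "gD x > 0"
  using assms hcub_psr_curve[OF assms]
  by (auto simp: psr_curve_def gD_def intro!: add_pos_nonneg)

fun fcoord_embed :: "fcoord \<Rightarrow> coord" where
  "fcoord_embed (FB a) = B a" | "fcoord_embed FR = T 1" | "fcoord_embed FRho = Rho"
| "fcoord_embed (FZt i) = Zt i" | "fcoord_embed (FZl i) = Zl i" | "fcoord_embed FSig = Sig"

definition fpivot :: "real ^ 2 \<Rightarrow> real ^ fcoord \<Rightarrow> fcoord \<Rightarrow> real" where
  "fpivot x u k = (if k = FR then 3 / (4 * (u $ FR)\<^sup>2) else pivot (fiber_chart x u) (fcoord_embed k))"

definition fldl :: "real ^ 2 \<Rightarrow> real ^ fcoord \<Rightarrow> fcoord \<Rightarrow> real ^ fcoord \<Rightarrow> real" where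
  "fldl x u k v = (if k = FR then v $ FR else ldl (fiber_chart x u) (fcoord_embed k) (fiber_chart x v))"

text \<open>Along a fiber dt = (dr / r) t, so by \<open>gmat_radial\<close> the two-dimensional
  \<open>T\<close> block collapses to the single pivot 3 / (4 r^2); the other blocks are
  unchanged.\<close>

lemma pullback_metric_fldl:
  assumes x: "x \<in> psr_curve" and u: "u \<in> fiber_space"
  shows "pullback_metric (fiber_chart x) qmap_metric u v w = (\<Sum>k\<in>UNIV. fpivot x u k * fldl x u k v * fldl x u k w)"
proof -
  let ?p = "fiber_chart x u" and ?v = "fiber_chart x v" and ?w = "fiber_chart x w"
  let ?t = "tpart ?p"
  have r: "u $ FR > 0" using u by (simp add: fiber_space_def)
  have t: "?t = u $ FR *\<^sub>R x" by (rule tpart_fiber_chart)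
  have h: "hcub ?t > 0" "?t $ 1 > 0"
    using r psr_curve_pos[OF x] by (simp_all add: t hcub_scaleR)
  note g0 = less_imp_neq[OF gmat_pos(1)[OF h], symmetric]
  have T: "?v $ T a = v $ FR / u $ FR * ?t $ a" "?w $ T a = w $ FR / u $ FR * ?t $ a" for a
    using r by (simp_all add: t) (simp_all add: fiber_chart_def)
  have "pivot ?p (T 1) * ldl ?p (T 1) ?v * ldl ?p (T 1) ?w + pivot ?p (T 2) * ldl ?p (T 2) ?v * ldl ?p (T 2) ?w
      = (\<Sum>a\<in>UNIV. \<Sum>c\<in>UNIV. gmat ?t a c * ?v $ T a * ?w $ T c)"
    using quadratic_form_pivot2[of "gmat ?t", OF g0 gmat_sym] by simp
  also have "\<dots> = v $ FR / u $ FR * (w $ FR / u $ FR) * (\<Sum>a\<in>UNIV. \<Sum>c\<in>UNIV. gmat ?t a c * (?t $ a * ?t $ c))"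
    unfolding T sum_distrib_left by (simp add: mult_ac)
  also have "\<dots> = 3 / (4 * (u $ FR)\<^sup>2) * v $ FR * w $ FR"
    unfolding gmat_radial[OF h(1)] by (simp add: power2_eq_square)
  finally have TT: "pivot ?p (T 1) * ldl ?p (T 1) ?v * ldl ?p (T 1) ?w
     + pivot ?p (T 2) * ldl ?p (T 2) ?v * ldl ?p (T 2) ?w = 3 / (4 * (u $ FR)\<^sup>2) * v $ FR * w $ FR" .
  show ?thesis
    unfolding pullback_metric_def frechet_derivative_fiber_chart qmap_metric_ldl[OF h]
    using TT by (simp add: UNIV_coord UNIV_fcoord fpivot_def fldl_def del: ldl.simps pivot.simps)
qed

lemma fldl_triangular:
  "fldl x u k (axis i 1) \<noteq> 0 \<Longrightarrow> k = i \<or> coord_rank (fcoord_embed i) < coord_rank (fcoord_embed k)"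
  "fldl x u k (axis k 1) = 1"
proof -
  have "k \<in> UNIV" "i \<in> UNIV" by auto
  then show "fldl x u k (axis i 1) \<noteq> 0 \<Longrightarrow> k = i \<or> coord_rank (fcoord_embed i) < coord_rank (fcoord_embed k)"
    unfolding UNIV_fcoord
    by (elim insertE emptyE; simp add: fldl_def fiber_chart_def reduce2_def axis_def sigma_form_def sum_option2 UNIV_2)
  have "k \<in> UNIV" by auto
  then show "fldl x u k (axis k 1) = 1"
    unfolding UNIV_fcoord
    by (elim insertE emptyE; simp add: fldl_def fiber_chart_def reduce2_def axis_def sigma_form_def sum_option2 UNIV_2)
qed

text \<open>Two determinants of \<open>gmat\<close> now stand against one of its inverse, so one
  power of \<open>gD\<close> survives; its square root is the whole dependence on the base point.
  Homogeneity, of degree 2 for \<open>gD\<close> and 3 for \<open>hcub\<close>, accounts for the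
  power of r.\<close>

lemma det_pullback_metric:
  assumes x: "x \<in> psr_curve" and u: "u \<in> fiber_space"
  shows "sqrt (det (\<chi> i j. pullback_metric (fiber_chart x) qmap_metric u (axis i 1) (axis j 1)))
    = sqrt (3 * gD x / 32) / (2 ^ 13 * (u $ FR) ^ 3 * (u $ FRho) ^ 5)"
proof -
  let ?p = "fiber_chart x u"
  let ?t = "tpart ?p"
  have r: "u $ FR > 0" "u $ FRho > 0" using u by (simp_all add: fiber_space_def)
  have p: "?p $ Rho = u $ FRho" by (simp add: fiber_chart_def)
  have t: "?t = u $ FR *\<^sub>R x" by (rule tpart_fiber_chart)
  have h: "hcub ?t > 0" "?t $ 1 > 0"
    using r psr_curve_pos[OF x] by (simp_all add: t hcub_scaleR)
  have D: "gD ?t > 0" using h by (auto simp: gD_def intro!: add_pos_nonneg)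
  have g: "pivot2 (gmat ?t) 1 * pivot2 (gmat ?t) 2 = gD ?t / (8 * (hcub ?t)\<^sup>2)"
    using pivot2_mult[of "gmat ?t"] gmat_pos(1)[OF h] det_gmat[OF h(1)] by simp
  have gi: "pivot2 (gmat_inv ?t) 1 * pivot2 (gmat_inv ?t) 2 = 8 * (hcub ?t)\<^sup>2 / gD ?t"
    using pivot2_mult[of "gmat_inv ?t"] gmat_inv_pos[OF h] det_gmat_inv[OF h(1) D] by simp
  have "det (\<chi> i j. pullback_metric (fiber_chart x) qmap_metric u (axis i 1) (axis j 1)) = (\<Prod>k\<in>UNIV. fpivot x u k)"
    unfolding pullback_metric_fldl[OF x u]
    by (rule det_unitriangular_congruence[of _ "\<lambda>k. coord_rank (fcoord_embed k)"]) (fact fldl_triangular)+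
  also have "\<dots> = 3 / (4 * (u $ FR)\<^sup>2) *
      (pivot2 (gmat ?t) 1 * pivot2 (gmat ?t) 2) ^ 2 * (pivot2 (gmat_inv ?t) 1 * pivot2 (gmat_inv ?t) 2)
      / (4 * (?p $ Rho)\<^sup>2) * (hcub ?t / (8 * ?p $ Rho)) * (hcub ?t / (2 * ?p $ Rho))\<^sup>2
      * (1 / (8 * hcub ?t * ?p $ Rho)) * (1 / (32 * hcub ?t * ?p $ Rho))\<^sup>2 * (1 / (64 * (?p $ Rho)\<^sup>2))"
    by (simp add: UNIV_fcoord fpivot_def power2_eq_square power3_eq_cube mult_ac)
  also have "\<dots> = 3 / (4 * (u $ FR)\<^sup>2) * (gD ?t / (8 * (hcub ?t)\<^sup>2)) / (2 ^ 13 * (?p $ Rho) ^ 5)\<^sup>2"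
    unfolding g gi using h(1) D r p by (simp add: field_simps) (simp add: eval_nat_numeral)?
  also have "\<dots> = (3 * gD x / 32) / (2 ^ 13 * (u $ FR) ^ 3 * (u $ FRho) ^ 5)\<^sup>2"
    using r psr_curve_pos[OF x] by (simp add: p t hcub_scaleR gD_scaleR field_simps) (simp add: eval_nat_numeral)?
  finally have eq: "det (\<chi> i j. pullback_metric (fiber_chart x) qmap_metric u (axis i 1) (axis j 1)) = \<dots>" .
  have "sqrt (a / c\<^sup>2) = sqrt a / c" if "c \<ge> 0" for a c :: real
    using that by (simp add: real_sqrt_divide)
  then show ?thesis unfolding eq by this (use r in simp)
qed

section \<open>The group action\<close>

lemma UNIV_lie: "(UNIV :: lie set) = {LV 1, LV 2, LP 1, LP 2, LX None, LX (Some 1), LX (Some 2), LZ}"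
proof -
  have "i \<in> LV ` UNIV \<union> LP ` UNIV \<union> LX ` UNIV \<union> {LZ}" for i :: lie
    by (cases i) auto
  then have "(UNIV :: lie set) = LV ` UNIV \<union> LP ` UNIV \<union> LX ` UNIV \<union> {LZ}" by auto
  then show ?thesis unfolding UNIV_2 UNIV_option2 by auto
qed

text \<open>Points of a fiber in type IIB coordinates: \<open>t = r x\<close>, \<open>\<tau>\<close>, and the remaining coordinates
  \<open>b\<^sup>a, c\<^sup>a, c\<^sub>a, c\<^sub>0, \<psi>\<close>, which are placed at the indices \<open>LV a, LP a, LX (Some a), LX None, LZ\<close>.\<close>

definition fpt :: "real \<Rightarrow> complex \<Rightarrow> real ^ lie \<Rightarrow> real ^ fcoord" where
  "fpt r \<tau> y = (let b = (\<lambda>a. y $ LV a); c = (\<lambda>a. y $ LP a); d = (\<lambda>a. c a - Re \<tau> * b a) in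
     \<chi> i. case i of FB a \<Rightarrow> b a | FR \<Rightarrow> r | FRho \<Rightarrow> (Im \<tau>)\<^sup>2 / 2 * r ^ 3
      | FZl j \<Rightarrow> (case j of None \<Rightarrow> Re \<tau> | Some a \<Rightarrow> - d a)
      | FZt j \<Rightarrow> (case j of None \<Rightarrow> y $ LX None - 1 / 6 * kcontr b b d
         | Some a \<Rightarrow> y $ LX (Some a) + 1 / 2 * (\<Sum>e\<in>UNIV. \<Sum>f\<in>UNIV. kcub a e f * b e * d f))
      | FSig \<Rightarrow> - 2 * (y $ LZ + 1 / 2 * Re \<tau> * y $ LX None) + (\<Sum>a\<in>UNIV. y $ LX (Some a) * d a)
                   - 1 / 6 * kcontr b c d)"

definition iib_pt :: "real ^ 2 \<Rightarrow> real \<Rightarrow> complex \<Rightarrow> real ^ lie \<Rightarrow> real ^ coordB" where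
  "iib_pt x r \<tau> y = (\<chi> i. case i of BB a \<Rightarrow> y $ LV a | BT a \<Rightarrow> r * x $ a | Tau1 \<Rightarrow> Re \<tau> | Tau2 \<Rightarrow> Im \<tau>
     | Cu a \<Rightarrow> y $ LP a | Cl a \<Rightarrow> y $ LX (Some a) | C0 \<Rightarrow> y $ LX None | Psi \<Rightarrow> y $ LZ)"

lemma fpt_nth:
  "fpt r \<tau> y $ FB a = y $ LV a" "fpt r \<tau> y $ FR = r" "fpt r \<tau> y $ FRho = (Im \<tau>)\<^sup>2 / 2 * r ^ 3"
  "fpt r \<tau> y $ FZl None = Re \<tau>" "fpt r \<tau> y $ FZl (Some a) = - (y $ LP a - Re \<tau> * y $ LV a)"
  by (simp_all add: fpt_def Let_def)

lemma mirror_iib_pt: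
  assumes "x \<in> psr_curve"
  shows "mirror (iib_pt x r \<tau> y) = fiber_chart x (fpt r \<tau> y)"
proof -
  have "(\<chi> a. r * x $ a) = r *\<^sub>R x" by (simp add: vec_eq_iff)
  then have "hcub (\<chi> a. r * x $ a) = r ^ 3"
    using assms by (simp add: hcub_scaleR hcub_psr_curve)
  then show ?thesis
    by (auto simp: vec_eq_iff mirror_def iib_pt_def fiber_chart_def fpt_def Let_def
        split: coord.split option.split)
qed

lemma iib_pt_in_iib_space:
  assumes "x \<in> psr_curve" "r > 0" "Im \<tau> > 0"
  shows "iib_pt x r \<tau> y \<in> iib_space"
proof -
  have "(\<chi> a. r * x $ a) = r *\<^sub>R x" by (simp add: vec_eq_iff)
  then show ?thesis using assms by (auto simp: iib_space_def iib_pt_def psr_cone_def)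
qed

text \<open>The coordinates can be recovered one after another because \<open>mirror\<close> is
  triangular. Only \<open>Tau2\<close> enters through its square, and there positivity decides. This
  gives meaning to \<open>the_inv_into\<close> in \<open>s_dual\<close>.\<close>

lemma inj_on_mirror: "inj_on mirror iib_space"
proof (rule inj_onI)
  fix q q' assume q: "q \<in> iib_space" "q' \<in> iib_space" and eq: "mirror q = mirror q'"
  have eq: "mirror q $ i = mirror q' $ i" for i using eq by simp
  have BB: "q $ BB a = q' $ BB a" and BT: "q $ BT a = q' $ BT a" and T1: "q $ Tau1 = q' $ Tau1" for a
    using eq[of "B a"] eq[of "T a"] eq[of "Zl None"] by (simp_all add: mirror_def Let_def)
  have Cu: "q $ Cu a = q' $ Cu a" for a
    using eq[of "Zl (Some a)"] BB T1 by (simp add: mirror_def Let_def)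
  have Cl: "q $ Cl a = q' $ Cl a" for a
    using eq[of "Zt (Some a)"] BB T1 Cu by (simp add: mirror_def Let_def)
  have C0: "q $ C0 = q' $ C0"
    using eq[of "Zt None"] BB T1 Cu by (simp add: mirror_def Let_def)
  have Psi: "q $ Psi = q' $ Psi"
    using eq[of Sig] BB T1 Cu Cl C0 by (simp add: mirror_def Let_def)
  obtain r x where r: "r > 0" "x \<in> psr_curve" "(\<chi> a. q' $ BT a) = r *\<^sub>R x"
    using q by (auto simp: iib_space_def psr_cone_def)
  then have "hcub (\<chi> a. q' $ BT a) > 0" by (simp add: hcub_scaleR hcub_psr_curve)
  then have "(q $ Tau2)\<^sup>2 = (q' $ Tau2)\<^sup>2"
    using eq[of Rho] BT by (simp add: mirror_def Let_def)
  then have "q $ Tau2 = q' $ Tau2" using q by (simp add: iib_space_def power2_eq_iff)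
  then have "q $ i = q' $ i" for i
    using BB BT T1 Cu Cl C0 Psi by (cases i) auto
  then show "q = q'" by (simp add: vec_eq_iff)
qed

definition mob_denom :: "real ^ 2 ^ 2 \<Rightarrow> complex \<Rightarrow> complex" where
  "mob_denom A \<tau> = of_real (A $ 2 $ 1) * \<tau> + of_real (A $ 2 $ 2)"

definition mob :: "real ^ 2 ^ 2 \<Rightarrow> complex \<Rightarrow> complex" where
  "mob A \<tau> = (of_real (A $ 1 $ 1) * \<tau> + of_real (A $ 1 $ 2)) / mob_denom A \<tau>"

definition sl2_lie :: "real ^ 2 ^ 2 \<Rightarrow> real ^ lie \<Rightarrow> real ^ lie" where
  "sl2_lie A y = (\<chi> i. case i of LV e \<Rightarrow> A $ 2 $ 1 * y $ LP e + A $ 2 $ 2 * y $ LV e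
     | LP e \<Rightarrow> A $ 1 $ 1 * y $ LP e + A $ 1 $ 2 * y $ LV e
     | LX j \<Rightarrow> (case j of None \<Rightarrow> A $ 2 $ 2 * y $ LX None - A $ 2 $ 1 * y $ LZ | Some e \<Rightarrow> y $ LX (Some e))
     | LZ \<Rightarrow> - A $ 1 $ 2 * y $ LX None + A $ 1 $ 1 * y $ LZ)"

lemma Im_mob:
  assumes "A \<in> sl2" shows "Im (mob A \<tau>) = Im \<tau> / (cmod (mob_denom A \<tau>))\<^sup>2"
proof -
  have det: "A $ 1 $ 1 * A $ 2 $ 2 - A $ 1 $ 2 * A $ 2 $ 1 = 1"
    using assms by (simp add: sl2_def det_2)
  have "Im (mob A \<tau>) = (A $ 1 $ 1 * A $ 2 $ 2 - A $ 1 $ 2 * A $ 2 $ 1) * Im \<tau> / (cmod (mob_denom A \<tau>))\<^sup>2"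
    unfolding mob_def Im_divide cmod_power2
    by (simp add: mob_denom_def algebra_simps diff_divide_distrib add_divide_distrib)
  then show ?thesis by (simp add: det)
qed

lemma mob_denom_nonzero:
  assumes "A \<in> sl2" "Im \<tau> > 0" shows "mob_denom A \<tau> \<noteq> 0"
proof
  assume "mob_denom A \<tau> = 0"
  then have "A $ 2 $ 1 * Im \<tau> = 0" "A $ 2 $ 1 * Re \<tau> + A $ 2 $ 2 = 0"
    by (simp_all add: mob_denom_def complex_eq_iff)
  then show False using assms by (auto simp: sl2_def det_2)
qed

lemma Im_mob_pos: "A \<in> sl2 \<Longrightarrow> Im \<tau> > 0 \<Longrightarrow> Im (mob A \<tau>) > 0"
  using mob_denom_nonzero[of A \<tau>] by (simp add: Im_mob)

text \<open>S-duality rescales t by a positive number, hence moves r and keeps the base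
  point.\<close>

lemma s_dual_fiber:
  assumes x: "x \<in> psr_curve" and r: "r > 0" "Im \<tau> > 0"
  shows "s_dual A (fiber_chart x (fpt r \<tau> y))
    = fiber_chart x (fpt (cmod (mob_denom A \<tau>) * r) (mob A \<tau>) (sl2_lie A y))"
proof -
  have "the_inv_into iib_space mirror (mirror (iib_pt x r \<tau> y)) = iib_pt x r \<tau> y"
    by (rule the_inv_into_f_f[OF inj_on_mirror iib_pt_in_iib_space[OF x r]])
  moreover have "sl2_iib A (iib_pt x r \<tau> y) = iib_pt x (cmod (mob_denom A \<tau>) * r) (mob A \<tau>) (sl2_lie A y)"
    by (auto simp: vec_eq_iff sl2_iib_def iib_pt_def sl2_lie_def mob_def mob_denom_def Let_def
        split: coordB.split)
  ultimately show ?thesis by (simp add: s_dual_def mirror_iib_pt[OF x, symmetric])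
qed

section \<open>The nilpotent group in type IIB coordinates\<close>

text \<open>The determinant pairing of the doublets (b^a, c^a), contracted with the cubic form; as a
  determinant it is invariant under SL(2,R).\<close>

definition kap :: "real ^ lie \<Rightarrow> real ^ lie \<Rightarrow> 2 \<Rightarrow> real" where
  "kap y z a = (\<Sum>b\<in>UNIV. \<Sum>c\<in>UNIV. kcub a b c * (y $ LV b * z $ LP c - y $ LP b * z $ LV c))"

text \<open>A three-step nilpotent group law, with the doublets at step one,
  \<open>LX (Some a)\<close> at step two, and \<open>LX None\<close>, \<open>LZ\<close> central. It
  is adapted to \<open>vfield\<close>: the time-one flow of v becomes left translation by
  \<open>yexp v\<close>.\<close>

definition ymul :: "real ^ lie \<Rightarrow> real ^ lie \<Rightarrow> real ^ lie" where
  "ymul y z = (\<chi> i. case i of LV a \<Rightarrow> y $ LV a + z $ LV a | LP a \<Rightarrow> y $ LP a + z $ LP a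
     | LX j \<Rightarrow> (case j of Some a \<Rightarrow> y $ LX (Some a) + z $ LX (Some a) + kap y z a / 2
         | None \<Rightarrow> y $ LX None + z $ LX None
              - (\<Sum>a\<in>UNIV. y $ LV a * z $ LX (Some a) + (y $ LV a / 3 + z $ LV a / 6) * kap y z a))
     | LZ \<Rightarrow> y $ LZ + z $ LZ
              + (\<Sum>a\<in>UNIV. y $ LP a * z $ LX (Some a) + (y $ LP a / 3 + z $ LP a / 6) * kap y z a))"

text \<open>The exponential map in these coordinates. The sign at \<open>LP\<close> and the factor
  1/2 at \<open>LZ\<close> come from \<open>\<zeta>\<^sup>a\<close> = - c^a + ... and
  \<open>\<sigma>\<close> = - 2 \<open>\<psi>\<close> + ... in the mirror map.\<close>

definition yexp :: "real ^ lie \<Rightarrow> real ^ lie" where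
  "yexp v = (\<chi> i. case i of LV a \<Rightarrow> v $ LV a | LP a \<Rightarrow> - v $ LP a
     | LX j \<Rightarrow> (case j of Some a \<Rightarrow> v $ LX (Some a)
         | None \<Rightarrow> v $ LX None - 1 / 2 * (\<Sum>a\<in>UNIV. v $ LV a * v $ LX (Some a)))
     | LZ \<Rightarrow> - 1 / 2 * v $ LZ - 1 / 2 * (\<Sum>a\<in>UNIV. v $ LP a * v $ LX (Some a)))"

lemma nfield_nth:
  "nfield v p $ B a = v $ LV a" "nfield v p $ T a = 0" "nfield v p $ Rho = 0" "nfield v p $ Zl None = 0"
  "nfield v p $ Zl (Some a) = v $ LV a * p $ Zl None + v $ LP a"
  "nfield v p $ Zt (Some a) = v $ LX (Some a) - (\<Sum>b\<in>UNIV. \<Sum>c\<in>UNIV. v $ LV b * kcub a b c * p $ Zl (Some c))"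
  "nfield v p $ Zt None = v $ LX None - (\<Sum>a\<in>UNIV. v $ LV a * p $ Zt (Some a))"
  "nfield v p $ Sig = v $ LZ + (\<Sum>a\<in>UNIV. v $ LP a * p $ Zt (Some a)) - (\<Sum>i\<in>UNIV. v $ LX i * p $ Zl i)"
  using two_cases[of a]
  by (auto simp: nfield_def UNIV_lie UNIV_2 UNIV_option2 axis_def kcub_def algebra_simps)

lemma has_vector_derivative_vec_iff:
  fixes f :: "real \<Rightarrow> real ^ 'n"
  shows "(f has_vector_derivative d) (at s within S)
     \<longleftrightarrow> (\<forall>i. ((\<lambda>s. f s $ i) has_real_derivative d $ i) (at s within S))"
proof
  assume "(f has_vector_derivative d) (at s within S)"
  then show "\<forall>i. ((\<lambda>s. f s $ i) has_real_derivative d $ i) (at s within S)"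
    by (auto simp: has_real_derivative_iff_has_vector_derivative
        intro: bounded_linear.has_vector_derivative[OF bounded_linear_vec_nth])
next
  assume *: "\<forall>i. ((\<lambda>s. f s $ i) has_real_derivative d $ i) (at s within S)"
  show "(f has_vector_derivative d) (at s within S)"
    unfolding has_vector_derivative_def
  proof (subst has_derivative_componentwise_within, intro ballI)
    fix b :: "real ^ 'n" assume "b \<in> Basis"
    then obtain i where b: "b = axis i 1" by (auto simp: Basis_vec_def)
    show "((\<lambda>x. f x \<bullet> b) has_derivative (\<lambda>x. x *\<^sub>R d \<bullet> b)) (at s within S)"
      using *[rule_format, of i] by (simp add: b inner_axis has_field_derivative_def mult.commute[of _ "d $ i"])
  qed
qed

lemma ymul_nth:
  "ymul y z $ LV a = y $ LV a + z $ LV a" "ymul y z $ LP a = y $ LP a + z $ LP a"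
  "ymul y z $ LX (Some a) = y $ LX (Some a) + z $ LX (Some a) + kap y z a / 2"
  "ymul y z $ LX None = y $ LX None + z $ LX None
              - (\<Sum>a\<in>UNIV. y $ LV a * z $ LX (Some a) + (y $ LV a / 3 + z $ LV a / 6) * kap y z a)"
  "ymul y z $ LZ = y $ LZ + z $ LZ
              + (\<Sum>a\<in>UNIV. y $ LP a * z $ LX (Some a) + (y $ LP a / 3 + z $ LP a / 6) * kap y z a)"
  by (simp_all add: ymul_def)

lemma yexp_nth:
  "yexp v $ LV a = v $ LV a" "yexp v $ LP a = - v $ LP a" "yexp v $ LX (Some a) = v $ LX (Some a)"
  "yexp v $ LX None = v $ LX None - 1 / 2 * (\<Sum>a\<in>UNIV. v $ LV a * v $ LX (Some a))"
  "yexp v $ LZ = - 1 / 2 * v $ LZ - 1 / 2 * (\<Sum>a\<in>UNIV. v $ LP a * v $ LX (Some a))"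
  by (simp_all add: yexp_def)

text \<open>Every coordinate of the curve is polynomial in s, so that left translation by
  \<open>yexp (s *\<^sub>R v)\<close> is the flow can be checked coordinate by coordinate.\<close>

lemma nfield_flow_deriv:
  fixes s r :: real and x :: "real ^ 2" and \<tau> :: complex and v y :: "real ^ lie"
  defines "\<gamma> \<equiv> \<lambda>s. fiber_chart x (fpt r \<tau> (ymul (yexp (s *\<^sub>R v)) y))"
  shows "((\<lambda>s. \<gamma> s $ i) has_real_derivative nfield v (\<gamma> s) $ i) (at s within S)"
proof -
  note S = \<gamma>_def fiber_chart_def fpt_def Let_def ymul_nth yexp_nth kap_def kcontr_def
  note E = UNIV_2 UNIV_option2 kcub_def
  show ?thesis
  proof (cases i)
    case (B a) then show ?thesis by (auto simp: S nfield_nth intro!: derivative_eq_intros)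
  next
    case (T a) then show ?thesis by (auto simp: S nfield_nth intro!: derivative_eq_intros)
  next
    case Rho then show ?thesis by (auto simp: S nfield_nth intro!: derivative_eq_intros)
  next
    case (Zl j)
    then show ?thesis
      by (cases j) (auto simp: S nfield_nth algebra_simps intro!: derivative_eq_intros)
  next
    case (Zt j)
    show ?thesis
    proof (cases j)
      case None
      show ?thesis unfolding Zt None nfield_nth
        by (simp add: S E) (auto intro!: derivative_eq_intros simp: algebra_simps power2_eq_square add_divide_distrib diff_divide_distrib)
    next
      case (Some a)
      show ?thesis unfolding Zt Some nfield_nth using two_cases[of a]
        by (auto simp: S E) (auto intro!: derivative_eq_intros simp: algebra_simps power2_eq_square add_divide_distrib diff_divide_distrib)
    qed
  next
    case Sig
    show ?thesis unfolding Sig nfield_nth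
      by (simp add: S E) (auto intro!: derivative_eq_intros simp: algebra_simps power2_eq_square add_divide_distrib diff_divide_distrib)
  qed
qed

lemma lie_eqI:
  fixes y z :: "real ^ lie"
  assumes "\<And>a. y $ LV a = z $ LV a" "\<And>a. y $ LP a = z $ LP a" "\<And>a. y $ LX (Some a) = z $ LX (Some a)"
    "y $ LX None = z $ LX None" "y $ LZ = z $ LZ"
  shows "y = z"
proof -
  have "y $ i = z $ i" for i
  proof (cases i)
    case (LX j) then show ?thesis using assms by (cases j) auto
  qed (use assms in auto)
  then show ?thesis by (simp add: vec_eq_iff)
qed

lemma kap_ymul_left: "kap (ymul x y) z a = kap x z a + kap y z a"
  and kap_ymul_right: "kap x (ymul y z) a = kap x y a + kap x z a"
  by (simp_all add: kap_def ymul_nth sum.distrib[symmetric] algebra_simps)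

text \<open>The terms cancel in pairs by total symmetry of the cubic form. This is the identity that
  associativity of \<open>ymul\<close> requires in its two central components.\<close>

lemma kap_cocycle:
  "(\<Sum>a\<in>UNIV. x $ LV a * kap y z a) - (\<Sum>a\<in>UNIV. y $ LV a * kap x z a)
     + (\<Sum>a\<in>UNIV. z $ LV a * kap x y a) = 0"
  "(\<Sum>a\<in>UNIV. x $ LP a * kap y z a) - (\<Sum>a\<in>UNIV. y $ LP a * kap x z a)
     + (\<Sum>a\<in>UNIV. z $ LP a * kap x y a) = 0"
  by (simp_all add: kap_def UNIV_2 kcub_def algebra_simps)

lemma ymul_assoc: "ymul (ymul x y) z = ymul x (ymul y z)"
proof (rule lie_eqI, goal_cases)
  case 4
  show ?case
    using kap_cocycle(1)[of x y z]
    by (simp add: ymul_nth kap_ymul_left kap_ymul_right UNIV_2 algebra_simps add_divide_distrib)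
next
  case 5
  show ?case
    using kap_cocycle(2)[of x y z]
    by (simp add: ymul_nth kap_ymul_left kap_ymul_right UNIV_2 algebra_simps add_divide_distrib)
qed (simp_all add: ymul_nth kap_ymul_left kap_ymul_right add_divide_distrib)

lemma ymul_0_left [simp]: "ymul 0 y = y" and ymul_0_right [simp]: "ymul y 0 = y"
  by (rule lie_eqI; simp add: ymul_nth kap_def)+

definition yinv :: "real ^ lie \<Rightarrow> real ^ lie" where
  "yinv y = (\<chi> i. case i of LV a \<Rightarrow> - y $ LV a | LP a \<Rightarrow> - y $ LP a
     | LX j \<Rightarrow> (case j of Some a \<Rightarrow> - y $ LX (Some a)
         | None \<Rightarrow> - y $ LX None - (\<Sum>a\<in>UNIV. y $ LV a * y $ LX (Some a)))
     | LZ \<Rightarrow> - y $ LZ + (\<Sum>a\<in>UNIV. y $ LP a * y $ LX (Some a)))"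

lemma yinv_nth:
  "yinv y $ LV a = - y $ LV a" "yinv y $ LP a = - y $ LP a" "yinv y $ LX (Some a) = - y $ LX (Some a)"
  "yinv y $ LX None = - y $ LX None - (\<Sum>a\<in>UNIV. y $ LV a * y $ LX (Some a))"
  "yinv y $ LZ = - y $ LZ + (\<Sum>a\<in>UNIV. y $ LP a * y $ LX (Some a))"
  by (simp_all add: yinv_def)

lemma kap_yinv: "kap (yinv y) y a = 0" "kap y (yinv y) a = 0"
  using two_cases[of a] by (auto simp: kap_def yinv_nth UNIV_2 kcub_def)

lemma ymul_yinv [simp]: "ymul (yinv y) y = 0" "ymul y (yinv y) = 0"
  by (rule lie_eqI; simp add: ymul_nth yinv_nth kap_yinv sum_negf)+

definition ylog :: "real ^ lie \<Rightarrow> real ^ lie" where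
  "ylog y = (\<chi> i. case i of LV a \<Rightarrow> y $ LV a | LP a \<Rightarrow> - y $ LP a
     | LX j \<Rightarrow> (case j of Some a \<Rightarrow> y $ LX (Some a)
         | None \<Rightarrow> y $ LX None + 1 / 2 * (\<Sum>a\<in>UNIV. y $ LV a * y $ LX (Some a)))
     | LZ \<Rightarrow> - 2 * y $ LZ + (\<Sum>a\<in>UNIV. y $ LP a * y $ LX (Some a)))"

lemma ylog_nth:
  "ylog y $ LV a = y $ LV a" "ylog y $ LP a = - y $ LP a" "ylog y $ LX (Some a) = y $ LX (Some a)"
  "ylog y $ LX None = y $ LX None + 1 / 2 * (\<Sum>a\<in>UNIV. y $ LV a * y $ LX (Some a))"
  "ylog y $ LZ = - 2 * y $ LZ + (\<Sum>a\<in>UNIV. y $ LP a * y $ LX (Some a))"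
  by (simp_all add: ylog_def)

lemma yexp_ylog [simp]: "yexp (ylog y) = y" and ylog_yexp [simp]: "ylog (yexp v) = v"
  by (rule lie_eqI; simp add: yexp_nth ylog_nth UNIV_2 algebra_simps add_divide_distrib diff_divide_distrib)+

lemma yexp_0 [simp]: "yexp 0 = 0" and ylog_0 [simp]: "ylog 0 = 0"
  by (rule lie_eqI; simp add: yexp_nth ylog_nth)+

lemma sl2_lie_nth:
  "sl2_lie A y $ LV a = A $ 2 $ 1 * y $ LP a + A $ 2 $ 2 * y $ LV a"
  "sl2_lie A y $ LP a = A $ 1 $ 1 * y $ LP a + A $ 1 $ 2 * y $ LV a"
  "sl2_lie A y $ LX (Some a) = y $ LX (Some a)"
  "sl2_lie A y $ LX None = A $ 2 $ 2 * y $ LX None - A $ 2 $ 1 * y $ LZ"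
  "sl2_lie A y $ LZ = - A $ 1 $ 2 * y $ LX None + A $ 1 $ 1 * y $ LZ"
  by (simp_all add: sl2_lie_def)

lemma matrix_mult_2_nth: "(A ** C) $ i $ j = A $ i $ 1 * C $ 1 $ j + A $ i $ 2 * C $ 2 $ j"
  for A C :: "real ^ 2 ^ 2"
  by (simp add: matrix_matrix_mult_def UNIV_2)

lemma sl2_lie_mult: "sl2_lie (A ** C) y = sl2_lie A (sl2_lie C y)"
  by (rule lie_eqI; simp add: sl2_lie_nth matrix_mult_2_nth algebra_simps)

lemma sl2_lie_1 [simp]: "sl2_lie (mat 1) y = y"
  by (rule lie_eqI; simp add: sl2_lie_nth mat_def)

lemma sl2_det: "A \<in> sl2 \<Longrightarrow> A $ 1 $ 1 * A $ 2 $ 2 - A $ 1 $ 2 * A $ 2 $ 1 = 1"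
  by (simp add: sl2_def det_2)

lemma kap_sl2_lie:
  assumes "A \<in> sl2"
  shows "kap (sl2_lie A y) (sl2_lie A z) a = kap y z a"
proof -
  have "kap (sl2_lie A y) (sl2_lie A z) a = (A $ 1 $ 1 * A $ 2 $ 2 - A $ 1 $ 2 * A $ 2 $ 1) * kap y z a"
    using two_cases[of a] by (auto simp: kap_def sl2_lie_nth UNIV_2 kcub_def algebra_simps)
  then show ?thesis by (simp add: sl2_det[OF assms])
qed

text \<open>SL(2,R) acts by automorphisms: \<open>kap\<close> is invariant, and the pair (- b^a,
  c^a), which multiplies the invariant terms in the central components, transforms in the same way
  as the pair at \<open>LX None\<close> and \<open>LZ\<close>.\<close>

lemma sl2_lie_ymul:
  assumes "A \<in> sl2"
  shows "sl2_lie A (ymul y z) = ymul (sl2_lie A y) (sl2_lie A z)"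
  by (rule lie_eqI; simp add: ymul_nth kap_sl2_lie[OF assms] sl2_lie_nth UNIV_2 algebra_simps add_divide_distrib)

definition sl2_inv :: "real ^ 2 ^ 2 \<Rightarrow> real ^ 2 ^ 2" where
  "sl2_inv A = (\<chi> i j. if i = 1 then (if j = 1 then A $ 2 $ 2 else - A $ 1 $ 2)
                        else (if j = 1 then - A $ 2 $ 1 else A $ 1 $ 1))"

lemma sl2_inv_nth: "sl2_inv A $ 1 $ 1 = A $ 2 $ 2" "sl2_inv A $ 1 $ 2 = - A $ 1 $ 2"
  "sl2_inv A $ 2 $ 1 = - A $ 2 $ 1" "sl2_inv A $ 2 $ 2 = A $ 1 $ 1"
  by (simp_all add: sl2_inv_def)

lemma matrix_2_eqI:
  fixes A C :: "real ^ 2 ^ 2"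
  assumes "A $ 1 $ 1 = C $ 1 $ 1" "A $ 1 $ 2 = C $ 1 $ 2" "A $ 2 $ 1 = C $ 2 $ 1" "A $ 2 $ 2 = C $ 2 $ 2"
  shows "A = C"
  using assms by (simp add: vec_eq_iff forall_2)

lemma sl2_inv_mult [simp]: assumes "A \<in> sl2" shows "sl2_inv A ** A = mat 1" "A ** sl2_inv A = mat 1"
  by (rule matrix_2_eqI; use sl2_det[OF assms] in \<open>simp add: matrix_mult_2_nth sl2_inv_nth mat_def algebra_simps\<close>)+

lemma sl2_closed [simp]:
  "A \<in> sl2 \<Longrightarrow> C \<in> sl2 \<Longrightarrow> A ** C \<in> sl2" "A \<in> sl2 \<Longrightarrow> sl2_inv A \<in> sl2" "mat 1 \<in> sl2"
  by (simp_all add: sl2_def det_mul) (simp add: det_2 sl2_inv_nth algebra_simps)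

lemma sl2_lie_inv [simp]:
  assumes "A \<in> sl2" shows "sl2_lie (sl2_inv A) (sl2_lie A y) = y" "sl2_lie A (sl2_lie (sl2_inv A) y) = y"
  using assms by (simp_all add: sl2_lie_mult[symmetric])

lemma mob_denom_mult:
  assumes "C \<in> sl2" "Im \<tau> > 0"
  shows "mob_denom (A ** C) \<tau> = mob_denom A (mob C \<tau>) * mob_denom C \<tau>"
  using mob_denom_nonzero[OF assms]
  by (simp add: mob_def mob_denom_def[of A] mob_denom_def[of "A ** C"] matrix_mult_2_nth field_simps)
     (simp add: mob_denom_def algebra_simps)

lemma mob_mult:
  assumes "A \<in> sl2" "C \<in> sl2" "Im \<tau> > 0"
  shows "mob (A ** C) \<tau> = mob A (mob C \<tau>)"
proof -
  have C: "mob_denom C \<tau> \<noteq> 0" using assms by (simp add: mob_denom_nonzero)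
  have "of_real ((A ** C) $ 1 $ 1) * \<tau> + of_real ((A ** C) $ 1 $ 2)
      = (of_real (A $ 1 $ 1) * mob C \<tau> + of_real (A $ 1 $ 2)) * mob_denom C \<tau>"
    using C by (simp add: mob_def[of C] matrix_mult_2_nth field_simps) (simp add: mob_denom_def algebra_simps)
  then show ?thesis
    unfolding mob_def[of "A ** C"] mob_def[of A] mob_denom_mult[OF assms(2,3)] using C by simp
qed

lemma mob_1 [simp]: "mob (mat 1) \<tau> = \<tau>" "mob_denom (mat 1) \<tau> = 1"
  by (simp_all add: mob_def mob_denom_def mat_def)

lemma eq_on_unit_interval:
  fixes f g :: "real \<Rightarrow> real"
  assumes "\<And>s. s \<in> {0..1} \<Longrightarrow> (f has_real_derivative d s) (at s within {0..1})"
    and "\<And>s. s \<in> {0..1} \<Longrightarrow> (g has_real_derivative d s) (at s within {0..1})"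
    and "f 0 = g 0" and s: "s \<in> {0..1}"
  shows "f s = g s"
proof -
  have "((\<lambda>s. f s - g s) has_real_derivative 0) (at s within {0..1})" if "s \<in> {0..1}" for s
    using DERIV_diff[OF assms(1)[OF that] assms(2)[OF that]] by simp
  from has_field_derivative_zero_constant[OF _ this] obtain c where "\<And>s. s \<in> {0..1} \<Longrightarrow> f s - g s = c"
    by (metis convex_closed_interval)
  from this[of 0] this[OF s] show ?thesis using assms(3) by simp
qed

text \<open>The field is triangular: each component depends only on coordinates already shown to
  agree, taken in the order \<open>Zl None\<close>, \<open>Zl\<close>, \<open>Zt (Some a)\<close>,
  \<open>Zt None\<close>, \<open>Sig\<close>. So uniqueness reduces to functions of one variable
  with equal derivatives.\<close>

lemma nfield_flow_unique:
  assumes \<gamma>: "\<And>s. s \<in> {0..1} \<Longrightarrow> (\<gamma> has_vector_derivative nfield v (\<gamma> s)) (at s within {0..1})"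
    and \<delta>: "\<And>s. s \<in> {0..1} \<Longrightarrow> (\<delta> has_vector_derivative nfield v (\<delta> s)) (at s within {0..1})"
    and eq: "\<gamma> 0 = \<delta> 0" and s: "s \<in> {0..1}"
  shows "\<gamma> s = \<delta> s"
proof -
  have *: "\<gamma> s $ i = \<delta> s $ i"
    if c: "\<And>s. s \<in> {0..1} \<Longrightarrow> nfield v (\<gamma> s) $ i = nfield v (\<delta> s) $ i" and s: "s \<in> {0..1}" for i s
  proof (rule eq_on_unit_interval[where f = "\<lambda>s. \<gamma> s $ i" and g = "\<lambda>s. \<delta> s $ i" and d = "\<lambda>s. nfield v (\<gamma> s) $ i"])
    show "((\<lambda>s. \<gamma> s $ i) has_real_derivative nfield v (\<gamma> s) $ i) (at s within {0..1})"
      if s: "s \<in> {0..1}" for s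
      using \<gamma>[OF s] by (simp add: has_vector_derivative_vec_iff)
    show "((\<lambda>s. \<delta> s $ i) has_real_derivative nfield v (\<gamma> s) $ i) (at s within {0..1})"
      if s: "s \<in> {0..1}" for s
      using \<delta>[OF s] by (simp add: has_vector_derivative_vec_iff c[OF s])
  qed (use eq s in auto)
  have Zl0: "\<gamma> s $ Zl None = \<delta> s $ Zl None" if "s \<in> {0..1}" for s
    by (rule *[OF _ that]) (simp add: nfield_nth)
  have Zlj: "\<gamma> s $ Zl j = \<delta> s $ Zl j" if "s \<in> {0..1}" for s j
    by (cases j) (auto intro!: *[OF _ that] simp: Zl0 nfield_nth that)
  have Zta: "\<gamma> s $ Zt (Some a) = \<delta> s $ Zt (Some a)" if "s \<in> {0..1}" for s a
    by (rule *[OF _ that]) (simp add: nfield_nth Zlj)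
  have Ztj: "\<gamma> s $ Zt j = \<delta> s $ Zt j" if "s \<in> {0..1}" for s j
  proof (cases j)
    case None
    show ?thesis unfolding None by (rule *[OF _ that]) (simp add: nfield_nth Zta)
  next
    case (Some a) then show ?thesis using Zta[OF \<open>s \<in> {0..1}\<close>] by simp
  qed
  have "\<gamma> s $ i = \<delta> s $ i" for i
  proof (cases i)
    case (Zl j) then show ?thesis using Zlj s by simp
  next
    case (Zt j) then show ?thesis using Ztj s by simp
  qed (auto intro!: *[OF _ s] simp: nfield_nth Zlj Zta)
  then show ?thesis by (simp add: vec_eq_iff)
qed

lemma time_one_flow_fiber:
  "time_one_flow (nfield v) (fiber_chart x (fpt r \<tau> y)) = fiber_chart x (fpt r \<tau> (ymul (yexp v) y))"
proof -
  let ?\<gamma> = "\<lambda>s::real. fiber_chart x (fpt r \<tau> (ymul (yexp (s *\<^sub>R v)) y))"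
  have \<gamma>: "(?\<gamma> has_vector_derivative nfield v (?\<gamma> s)) (at s within {0..1})" for s
    unfolding has_vector_derivative_vec_iff by (intro allI nfield_flow_deriv)
  show ?thesis
    unfolding time_one_flow_def
  proof (rule the_equality)
    show "\<exists>\<gamma>. \<gamma> 0 = fiber_chart x (fpt r \<tau> y) \<and> \<gamma> 1 = fiber_chart x (fpt r \<tau> (ymul (yexp v) y)) \<and>
        (\<forall>s\<in>{0..1::real}. (\<gamma> has_vector_derivative nfield v (\<gamma> s)) (at s within {0..1}))"
      using \<gamma> by (intro exI[of _ ?\<gamma>]) simp
  next
    fix q
    assume "\<exists>\<gamma>. \<gamma> 0 = fiber_chart x (fpt r \<tau> y) \<and> \<gamma> 1 = q \<and>
        (\<forall>s\<in>{0..1::real}. (\<gamma> has_vector_derivative nfield v (\<gamma> s)) (at s within {0..1}))"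
    then obtain \<delta> where \<delta>: "\<delta> 0 = fiber_chart x (fpt r \<tau> y)" "\<delta> 1 = q"
        "\<And>s. s \<in> {0..1::real} \<Longrightarrow> (\<delta> has_vector_derivative nfield v (\<delta> s)) (at s within {0..1})" by auto
    have "\<delta> 1 = ?\<gamma> 1"
      by (rule nfield_flow_unique[OF \<delta>(3) \<gamma>]) (simp_all add: \<delta>(1))
    then show "q = fiber_chart x (fpt r \<tau> (ymul (yexp v) y))" by (simp add: \<delta>)
  qed
qed

lemma act_fiber:
  assumes "x \<in> psr_curve" "r > 0" "Im \<tau> > 0"
  shows "act g (fiber_chart x (fpt r \<tau> y)) = fiber_chart x
    (fpt (cmod (mob_denom (fst g) \<tau>) * r) (mob (fst g) \<tau>) (sl2_lie (fst g) (ymul (yexp (snd g)) y)))"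
  by (simp add: act_def time_one_flow_fiber s_dual_fiber[OF assms])

section \<open>The action in fiber coordinates\<close>

definition ftau :: "real ^ fcoord \<Rightarrow> complex" where
  "ftau u = Complex (u $ FZl None) (sqrt (2 * u $ FRho / (u $ FR) ^ 3))"

definition fy :: "real ^ fcoord \<Rightarrow> real ^ lie" where
  "fy u = (let b = (\<lambda>a. u $ FB a); d = (\<lambda>a. - u $ FZl (Some a)); c = (\<lambda>a. d a + u $ FZl None * b a);
       x = (\<lambda>a. u $ FZt (Some a) - 1 / 2 * (\<Sum>e\<in>UNIV. \<Sum>f\<in>UNIV. kcub a e f * b e * d f));
       c0 = u $ FZt None + 1 / 6 * kcontr b b d in
     \<chi> i. case i of LV a \<Rightarrow> b a | LP a \<Rightarrow> c a
      | LX j \<Rightarrow> (case j of Some a \<Rightarrow> x a | None \<Rightarrow> c0)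
      | LZ \<Rightarrow> - 1 / 2 * (u $ FSig + u $ FZl None * c0 - (\<Sum>a\<in>UNIV. x a * d a) + 1 / 6 * kcontr b c d))"

lemma fcoord_eqI:
  fixes u w :: "real ^ fcoord"
  assumes "\<And>a. u $ FB a = w $ FB a" "u $ FR = w $ FR" "u $ FRho = w $ FRho"
    "\<And>j. u $ FZl j = w $ FZl j" "\<And>j. u $ FZt j = w $ FZt j" "u $ FSig = w $ FSig"
  shows "u = w"
proof -
  have "u $ i = w $ i" for i by (cases i) (use assms in auto)
  then show ?thesis by (simp add: vec_eq_iff)
qed

lemma fpt_fiber_space: "r > 0 \<Longrightarrow> Im \<tau> > 0 \<Longrightarrow> fpt r \<tau> y \<in> fiber_space"
  by (simp add: fiber_space_def fpt_nth)

lemma fy_fpt [simp]: "fy (fpt r \<tau> y) = y"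
  by (rule lie_eqI; simp add: fy_def fpt_def Let_def)

lemma ftau_fpt [simp]: "r > 0 \<Longrightarrow> Im \<tau> > 0 \<Longrightarrow> ftau (fpt r \<tau> y) = \<tau>"
  by (simp add: ftau_def fpt_nth complex_eq_iff)

lemma ftau_pos: "u \<in> fiber_space \<Longrightarrow> Im (ftau u) > 0"
  by (simp add: ftau_def fiber_space_def)

lemma fpt_cases:
  assumes "u \<in> fiber_space"
  shows "u = fpt (u $ FR) (ftau u) (fy u)"
proof (rule fcoord_eqI)
  show "u $ FZl j = fpt (u $ FR) (ftau u) (fy u) $ FZl j" for j
    by (cases j) (simp_all add: fpt_def fy_def ftau_def Let_def)
  show "u $ FZt j = fpt (u $ FR) (ftau u) (fy u) $ FZt j" for j
    by (cases j) (simp_all add: fpt_def fy_def ftau_def Let_def)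
  show "u $ FSig = fpt (u $ FR) (ftau u) (fy u) $ FSig"
    by (simp add: fpt_def fy_def ftau_def Let_def algebra_simps add_divide_distrib diff_divide_distrib)
qed (use assms in \<open>simp_all add: fpt_def fy_def ftau_def Let_def fiber_space_def\<close>)

definition fiber_act :: "(real ^ 2 ^ 2) \<times> (real ^ lie) \<Rightarrow> real ^ fcoord \<Rightarrow> real ^ fcoord" where
  "fiber_act g u = fpt (cmod (mob_denom (fst g) (ftau u)) * u $ FR) (mob (fst g) (ftau u))
     (sl2_lie (fst g) (ymul (yexp (snd g)) (fy u)))"

lemma act_fiber_chart:
  assumes "x \<in> psr_curve" "u \<in> fiber_space"
  shows "act g (fiber_chart x u) = fiber_chart x (fiber_act g u)"
proof -
  have "u $ FR > 0" using assms by (simp add: fiber_space_def)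
  then show ?thesis
    using act_fiber[OF assms(1) _ ftau_pos[OF assms(2)], of "u $ FR" g "fy u"] fpt_cases[OF assms(2)]
    by (simp add: fiber_act_def)
qed

lemma fiber_act_closed:
  assumes "g \<in> sl2 \<times> UNIV" "u \<in> fiber_space" shows "fiber_act g u \<in> fiber_space"
proof -
  have "u $ FR > 0" using assms by (simp add: fiber_space_def)
  then show ?thesis
    using assms mob_denom_nonzero[of "fst g", OF _ ftau_pos[OF assms(2)]]
    by (auto simp: fiber_act_def mem_Times_iff intro!: fpt_fiber_space Im_mob_pos ftau_pos)
qed

lemma fiber_act_fpt:
  assumes "g \<in> sl2 \<times> UNIV" "r > 0" "Im \<tau> > 0"
  shows "fiber_act g (fpt r \<tau> y) = fpt (cmod (mob_denom (fst g) \<tau>) * r) (mob (fst g) \<tau>)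
     (sl2_lie (fst g) (ymul (yexp (snd g)) y))"
  using assms by (simp add: fiber_act_def fpt_nth)

lemma inj_on_fiber_chart: "x \<in> psr_curve \<Longrightarrow> inj_on (fiber_chart x) fiber_space"
  using bij_betw_fiber_chart by (auto simp: bij_betw_def)

lemma act_fiber_chart_eq_iff:
  assumes "x \<in> psr_curve" "u \<in> fiber_space" "w \<in> fiber_space" "g \<in> sl2 \<times> UNIV"
  shows "act g (fiber_chart x u) = fiber_chart x w \<longleftrightarrow> fiber_act g u = w"
  using inj_on_fiber_chart[OF assms(1)] fiber_act_closed[OF assms(4,2)] assms(3)
  by (auto simp: act_fiber_chart[OF assms(1,2)] inj_on_def)

lemma qmap_space_fiber:
  assumes "p \<in> qmap_space"
  obtains x u where "x \<in> psr_curve" "u \<in> fiber_space" "p = fiber_chart x u" "qmap_proj p = x"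
proof -
  obtain r y where r: "r > 0" "y \<in> psr_curve" "tpart p = r *\<^sub>R y"
    using assms by (auto simp: qmap_space_def psr_cone_def)
  have "qmap_proj p = y"
    using r by (simp add: qmap_proj_def hcub_scaleR hcub_psr_curve real_root_power_cancel)
  then have "p \<in> fiber_chart y ` fiber_space"
    using bij_betw_fiber_chart[OF r(2)] assms by (auto simp: bij_betw_def)
  then show ?thesis using that r(2) \<open>qmap_proj p = y\<close> by auto
qed

lemma fiber_chart_in_qmap_space: "x \<in> psr_curve \<Longrightarrow> u \<in> fiber_space \<Longrightarrow> fiber_chart x u \<in> qmap_space"
  and qmap_proj_fiber_chart: "x \<in> psr_curve \<Longrightarrow> u \<in> fiber_space \<Longrightarrow> qmap_proj (fiber_chart x u) = x"
  using bij_betw_fiber_chart by (auto simp: bij_betw_def)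

section \<open>The product of the group made explicit\<close>

text \<open>The composition A exp(v) C exp(w) is rewritten as (A C) (C^-1 exp(v)) exp(w), where C^-1
  acts through the automorphism \<open>sl2_lie\<close>.\<close>

definition gmul :: "(real ^ 2 ^ 2) \<times> (real ^ lie) \<Rightarrow> (real ^ 2 ^ 2) \<times> (real ^ lie) \<Rightarrow> (real ^ 2 ^ 2) \<times> (real ^ lie)" where
  "gmul g h = (fst g ** fst h, ylog (ymul (sl2_lie (sl2_inv (fst h)) (yexp (snd g))) (yexp (snd h))))"

definition ginv :: "(real ^ 2 ^ 2) \<times> (real ^ lie) \<Rightarrow> (real ^ 2 ^ 2) \<times> (real ^ lie)" where
  "ginv g = (sl2_inv (fst g), ylog (sl2_lie (fst g) (yinv (yexp (snd g)))))"

lemma gmul_closed: "g \<in> sl2 \<times> UNIV \<Longrightarrow> h \<in> sl2 \<times> UNIV \<Longrightarrow> gmul g h \<in> sl2 \<times> UNIV"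
  by (auto simp: gmul_def)

lemma ginv_closed: "g \<in> sl2 \<times> UNIV \<Longrightarrow> ginv g \<in> sl2 \<times> UNIV"
  by (auto simp: ginv_def)

lemma ginv_gmul: "g \<in> sl2 \<times> UNIV \<Longrightarrow> gmul (ginv g) g = (mat 1, 0)"
  by (auto simp: gmul_def ginv_def)

lemma fiber_act_gmul:
  assumes g: "g \<in> sl2 \<times> UNIV" and h: "h \<in> sl2 \<times> UNIV" and u: "u \<in> fiber_space"
  shows "fiber_act (gmul g h) u = fiber_act g (fiber_act h u)"
proof -
  let ?\<tau> = "ftau u" and ?y = "fy u" and ?A = "fst g" and ?C = "fst h"
  have A: "?A \<in> sl2" "?C \<in> sl2" using g h by auto
  have r: "u $ FR > 0" and \<tau>: "Im ?\<tau> > 0" using u by (auto simp: fiber_space_def ftau_pos)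
  have d: "mob_denom ?C ?\<tau> \<noteq> 0" using A \<tau> by (simp add: mob_denom_nonzero)
  have "sl2_lie (?A ** ?C) (ymul (ymul (sl2_lie (sl2_inv ?C) (yexp (snd g))) (yexp (snd h))) ?y)
      = sl2_lie ?A (ymul (yexp (snd g)) (sl2_lie ?C (ymul (yexp (snd h)) ?y)))"
    using A by (simp add: sl2_lie_mult sl2_lie_ymul ymul_assoc)
  then have "fiber_act (gmul g h) u = fpt (cmod (mob_denom ?A (mob ?C ?\<tau>)) * (cmod (mob_denom ?C ?\<tau>) * u $ FR))
     (mob ?A (mob ?C ?\<tau>)) (sl2_lie ?A (ymul (yexp (snd g)) (sl2_lie ?C (ymul (yexp (snd h)) ?y))))"
    unfolding fiber_act_def[of "gmul g h"] using A \<tau> by (simp add: gmul_def mob_mult mob_denom_mult norm_mult mult.assoc)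
  also have "\<dots> = fiber_act g (fiber_act h u)"
    unfolding fiber_act_def[of h] using d r A \<tau>
    by (subst fiber_act_fpt[OF g]) (simp_all add: Im_mob_pos)
  finally show ?thesis .
qed

lemma fiber_act_one: "u \<in> fiber_space \<Longrightarrow> fiber_act (mat 1, 0) u = u"
  using fpt_cases[of u] by (simp add: fiber_act_def)

text \<open>The components \<open>LV 1\<close> and \<open>LP 1\<close> of the transformed y are
  affine in y, so their values at 0 and at two unit vectors give the matrix; then y = 0 gives the
  nilpotent part. This makes the definite description in \<open>qgroup\<close> determinate.\<close>

lemma fiber_act_effective:
  assumes g: "g \<in> sl2 \<times> UNIV" and h: "h \<in> sl2 \<times> UNIV"
    and eq: "\<And>u. u \<in> fiber_space \<Longrightarrow> fiber_act g u = fiber_act h u"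
  shows "g = h"
proof -
  have A: "fst g \<in> sl2" "fst h \<in> sl2" using g h by auto
  have *: "sl2_lie (fst g) (ymul (yexp (snd g)) y) = sl2_lie (fst h) (ymul (yexp (snd h)) y)" for y
  proof -
    have "fiber_act g (fpt 1 \<i> y) = fiber_act h (fpt 1 \<i> y)" by (rule eq) (simp add: fpt_fiber_space)
    then have "fy (fiber_act g (fpt 1 \<i> y)) = fy (fiber_act h (fpt 1 \<i> y))" by simp
    then show ?thesis using g h by (simp add: fiber_act_fpt)
  qed
  have LV: "sl2_lie (fst g) (ymul (yexp (snd g)) y) $ LV 1 = sl2_lie (fst h) (ymul (yexp (snd h)) y) $ LV 1"
    and LP: "sl2_lie (fst g) (ymul (yexp (snd g)) y) $ LP 1 = sl2_lie (fst h) (ymul (yexp (snd h)) y) $ LP 1" for y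
    by (simp_all add: *)
  have "fst g = fst h"
    using LV[of 0] LP[of 0] LV[of "axis (LP 1) 1"] LP[of "axis (LP 1) 1"]
      LV[of "axis (LV 1) 1"] LP[of "axis (LV 1) 1"]
    by (intro matrix_2_eqI) (simp_all add: sl2_lie_nth ymul_nth axis_def algebra_simps)
  then have "yexp (snd g) = yexp (snd h)" using *[of 0] A by (metis sl2_lie_inv(1) ymul_0_right)
  then show ?thesis using \<open>fst g = fst h\<close> by (metis prod.expand ylog_yexp)
qed

lemma psr_curve_base: "vector [1, 0] \<in> psr_curve"
  by (simp add: psr_curve_def)

lemma carrier_qgroup [simp]: "carrier qgroup = sl2 \<times> UNIV"
  and one_qgroup [simp]: "\<one>\<^bsub>qgroup\<^esub> = (mat 1, 0)"
  by (simp_all add: qgroup_def)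

lemma mult_qgroup:
  assumes g: "g \<in> sl2 \<times> UNIV" and h: "h \<in> sl2 \<times> UNIV"
  shows "g \<otimes>\<^bsub>qgroup\<^esub> h = gmul g h"
proof -
  have "(THE k. k \<in> sl2 \<times> UNIV \<and> (\<forall>p\<in>qmap_space. act k p = act g (act h p))) = gmul g h"
  proof (rule the_equality, intro conjI ballI)
    show "gmul g h \<in> sl2 \<times> UNIV" using g h by (rule gmul_closed)
    fix p assume "p \<in> qmap_space"
    then obtain x u where "x \<in> psr_curve" "u \<in> fiber_space" "p = fiber_chart x u"
      by (rule qmap_space_fiber)
    then show "act (gmul g h) p = act g (act h p)"
      using g h by (simp add: act_fiber_chart fiber_act_closed fiber_act_gmul)
  next
    fix k assume k: "k \<in> sl2 \<times> UNIV \<and> (\<forall>p\<in>qmap_space. act k p = act g (act h p))"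
    show "k = gmul g h"
    proof (rule fiber_act_effective)
      fix u assume u: "u \<in> fiber_space"
      have "act k (fiber_chart (vector [1, 0]) u) = act g (act h (fiber_chart (vector [1, 0]) u))"
        using k fiber_chart_in_qmap_space[OF psr_curve_base u] by blast
      then have "fiber_chart (vector [1, 0]) (fiber_act k u) = fiber_chart (vector [1, 0]) (fiber_act g (fiber_act h u))"
        using u h by (simp add: act_fiber_chart[OF psr_curve_base] fiber_act_closed)
      then show "fiber_act k u = fiber_act (gmul g h) u"
        using inj_on_fiber_chart[OF psr_curve_base] k u g h
        by (simp add: inj_on_def fiber_act_closed fiber_act_gmul)
    qed (use k g h gmul_closed in auto)
  qed
  then show ?thesis by (simp add: qgroup_def)
qed

text \<open>Associativity and the unit law are inherited from composition of transformations through
  \<open>fiber_act_effective\<close>; for inverses \<open>ginv\<close> is the witness.\<close>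

lemma group_qgroup: "group qgroup"
proof (rule groupI)
  show "x \<otimes>\<^bsub>qgroup\<^esub> y \<in> carrier qgroup" if "x \<in> carrier qgroup" "y \<in> carrier qgroup" for x y
    using that by (simp add: mult_qgroup gmul_closed)
  show "\<one>\<^bsub>qgroup\<^esub> \<in> carrier qgroup" by simp
  show "\<exists>y\<in>carrier qgroup. y \<otimes>\<^bsub>qgroup\<^esub> x = \<one>\<^bsub>qgroup\<^esub>" if "x \<in> carrier qgroup" for x
    using that by (intro bexI[of _ "ginv x"]) (simp_all add: mult_qgroup ginv_closed ginv_gmul)
  fix x y z assume xyz: "x \<in> carrier qgroup" "y \<in> carrier qgroup" "z \<in> carrier qgroup"
  then show "x \<otimes>\<^bsub>qgroup\<^esub> y \<otimes>\<^bsub>qgroup\<^esub> z = x \<otimes>\<^bsub>qgroup\<^esub> (y \<otimes>\<^bsub>qgroup\<^esub> z)"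
    by (simp add: mult_qgroup gmul_closed)
       (rule fiber_act_effective; simp add: gmul_closed fiber_act_gmul fiber_act_closed)
next
  fix x assume x: "x \<in> carrier qgroup"
  have 1: "(mat 1, 0) \<in> sl2 \<times> (UNIV :: (real ^ lie) set)" by simp
  have x': "x \<in> sl2 \<times> UNIV" using x by simp
  have "gmul (mat 1, 0) x = x"
    by (rule fiber_act_effective)
       (use 1 x' in \<open>simp_all add: gmul_closed fiber_act_gmul[OF 1] fiber_act_one fiber_act_closed\<close>)
  then show "\<one>\<^bsub>qgroup\<^esub> \<otimes>\<^bsub>qgroup\<^esub> x = x"
    unfolding one_qgroup mult_qgroup[OF 1 x'] .
qed

lemma inv_qgroup:
  assumes "g \<in> sl2 \<times> UNIV" shows "inv\<^bsub>qgroup\<^esub> g = ginv g"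
  using assms by (intro group.inv_equality[OF group_qgroup]) (simp_all add: mult_qgroup ginv_closed ginv_gmul)

section \<open>Haar measure\<close>

lemma continuous_on_vecI:
  fixes f :: "'a::topological_space \<Rightarrow> 'b::topological_space ^ 'n"
  shows "(\<And>i. continuous_on S (\<lambda>x. f x $ i)) \<Longrightarrow> continuous_on S f"
  unfolding continuous_on_def by (auto intro: vec_tendstoI)

lemma continuous_on_lieI:
  fixes f :: "'a::topological_space \<Rightarrow> real ^ lie"
  assumes "\<And>a. continuous_on S (\<lambda>x. f x $ LV a)" "\<And>a. continuous_on S (\<lambda>x. f x $ LP a)"
    "\<And>a. continuous_on S (\<lambda>x. f x $ LX (Some a))" "continuous_on S (\<lambda>x. f x $ LX None)"
    "continuous_on S (\<lambda>x. f x $ LZ)"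
  shows "continuous_on S f"
proof (rule continuous_on_vecI)
  fix i show "continuous_on S (\<lambda>x. f x $ i)"
  proof (cases i)
    case (LX j) then show ?thesis using assms by (cases j) auto
  qed (use assms in auto)
qed

lemma continuous_on_sl2_lie [continuous_intros]:
  assumes "continuous_on S A" "continuous_on S y"
  shows "continuous_on S (\<lambda>x. sl2_lie (A x) (y x))"
  by (rule continuous_on_lieI; unfold sl2_lie_nth; intro continuous_intros assms)

lemma continuous_on_ymul [continuous_intros]:
  assumes "continuous_on S y" "continuous_on S z"
  shows "continuous_on S (\<lambda>x. ymul (y x) (z x))"
  by (rule continuous_on_lieI; unfold ymul_nth kap_def; intro continuous_intros assms; simp)

lemma continuous_on_yexp [continuous_intros]:
  assumes "continuous_on S y" shows "continuous_on S (\<lambda>x. yexp (y x))"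
  by (rule continuous_on_lieI; unfold yexp_nth; intro continuous_intros assms; simp)

lemma continuous_on_ylog [continuous_intros]:
  assumes "continuous_on S y" shows "continuous_on S (\<lambda>x. ylog (y x))"
  by (rule continuous_on_lieI; unfold ylog_nth; intro continuous_intros assms; simp)

lemma continuous_on_yinv [continuous_intros]:
  assumes "continuous_on S y" shows "continuous_on S (\<lambda>x. yinv (y x))"
  by (rule continuous_on_lieI; unfold yinv_nth; intro continuous_intros assms; simp)

lemma continuous_on_matrix_2I:
  fixes f :: "'a::topological_space \<Rightarrow> real ^ 2 ^ 2"
  assumes "continuous_on S (\<lambda>x. f x $ 1 $ 1)" "continuous_on S (\<lambda>x. f x $ 1 $ 2)"
    "continuous_on S (\<lambda>x. f x $ 2 $ 1)" "continuous_on S (\<lambda>x. f x $ 2 $ 2)"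
  shows "continuous_on S f"
proof (intro continuous_on_vecI)
  fix i j show "continuous_on S (\<lambda>x. f x $ i $ j)"
    using assms two_cases[of i] two_cases[of j] by auto
qed

lemma continuous_on_sl2_inv [continuous_intros]:
  assumes "continuous_on S A" shows "continuous_on S (\<lambda>x. sl2_inv (A x))"
  by (rule continuous_on_matrix_2I; unfold sl2_inv_nth; intro continuous_intros assms)

lemma continuous_on_matrix_mult_2 [continuous_intros]:
  fixes A C :: "'a::topological_space \<Rightarrow> real ^ 2 ^ 2"
  assumes "continuous_on S A" "continuous_on S C" shows "continuous_on S (\<lambda>x. A x ** C x)"
  by (rule continuous_on_matrix_2I; unfold matrix_mult_2_nth; intro continuous_intros assms)

lemma continuous_on_det_2 [continuous_intros]:
  fixes A :: "'a::topological_space \<Rightarrow> real ^ 2 ^ 2"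
  assumes "continuous_on S A" shows "continuous_on S (\<lambda>x. det (A x))"
  unfolding det_2 by (intro continuous_intros assms)

lemma continuous_on_gmul [continuous_intros]:
  assumes "continuous_on S g" "continuous_on S h"
  shows "continuous_on S (\<lambda>x. gmul (g x) (h x))"
  unfolding gmul_def by (intro continuous_intros assms)

lemma continuous_on_ginv [continuous_intros]:
  assumes "continuous_on S g" shows "continuous_on S (\<lambda>x. ginv (g x))"
  unfolding ginv_def by (intro continuous_intros assms)

lemma closed_sl2: "closed sl2"
  unfolding sl2_def by (intro closed_Collect_eq continuous_intros)

lemma closed_carrier: "closed (sl2 \<times> (UNIV :: (real ^ lie) set))"
  by (intro closed_Times closed_sl2 closed_UNIV)

section \<open>Invariance of Lebesgue measure under both factors\<close>

definition upper_unip :: "real \<Rightarrow> real ^ 2 ^ 2" where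
  "upper_unip x = (\<chi> i j. if i = j then 1 else if i = 1 then x else 0)"

definition lower_unip :: "real \<Rightarrow> real ^ 2 ^ 2" where
  "lower_unip x = (\<chi> i j. if i = j then 1 else if i = 1 then 0 else x)"

lemma unip_nth:
  "upper_unip x $ 1 $ 1 = 1" "upper_unip x $ 1 $ 2 = x" "upper_unip x $ 2 $ 1 = 0" "upper_unip x $ 2 $ 2 = 1"
  "lower_unip x $ 1 $ 1 = 1" "lower_unip x $ 1 $ 2 = 0" "lower_unip x $ 2 $ 1 = x" "lower_unip x $ 2 $ 2 = 1"
  by (simp_all add: upper_unip_def lower_unip_def)

lemma sl2_unip [simp]: "upper_unip x \<in> sl2" "lower_unip x \<in> sl2"
  by (simp_all add: sl2_def det_2 unip_nth)

text \<open>Generation by elementary matrices. With a nonzero lower left entry A is a product upper,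
  lower, upper; otherwise its lower right entry is nonzero, and multiplication by
  \<open>lower_unip 1\<close> leads back to that case. Multiplicative properties thereby reduce to
  shears.\<close>

lemma sl2_induct [consumes 1, case_names upper lower mult]:
  assumes A: "A \<in> sl2" and up: "\<And>x. P (upper_unip x)" and low: "\<And>x. P (lower_unip x)"
    and mult: "\<And>A C. A \<in> sl2 \<Longrightarrow> C \<in> sl2 \<Longrightarrow> P A \<Longrightarrow> P C \<Longrightarrow> P (A ** C)"
  shows "P A"
proof -
  have *: "P A" if A: "A \<in> sl2" and c: "A $ 2 $ 1 \<noteq> 0" for A
  proof -
    let ?c = "A $ 2 $ 1"
    have "A = (upper_unip ((A $ 1 $ 1 - 1) / ?c) ** lower_unip ?c) ** upper_unip ((A $ 2 $ 2 - 1) / ?c)"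
      by (rule matrix_2_eqI) (use c sl2_det[OF A] in \<open>simp_all add: matrix_mult_2_nth unip_nth field_simps\<close>)
    then show ?thesis using up low mult by (metis sl2_closed(1) sl2_unip)
  qed
  show ?thesis
  proof (cases "A $ 2 $ 1 = 0")
    case True
    have "A $ 2 $ 2 \<noteq> 0" using sl2_det[OF A] True by auto
    then have "P (A ** lower_unip 1)"
      using A True by (intro *) (simp_all add: matrix_mult_2_nth unip_nth)
    then have "P ((A ** lower_unip 1) ** lower_unip (- 1))"
      using A low mult by simp
    also have "(A ** lower_unip 1) ** lower_unip (- 1) = A"
      by (rule matrix_2_eqI) (simp_all add: matrix_mult_2_nth unip_nth)
    finally show ?thesis .
  qed (use * A in blast)
qed

lemma measurable_matrix_mult_2 [measurable]: "(\<lambda>C :: real ^ 2 ^ 2. U ** C) \<in> borel_measurable borel" for U :: "real ^ 2 ^ 2"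
  using continuous_on_matrix_mult_2[of UNIV "\<lambda>_. U" "\<lambda>C. C"]
  by (intro borel_measurable_continuous_onI) simp

text \<open>The generators add a multiple of one row to the other, a shear of the four-dimensional
  space of matrices.\<close>

lemma nn_integral_sl2_mult:
  fixes F :: "real ^ 2 ^ 2 \<Rightarrow> ennreal"
  assumes "A \<in> sl2" and "F \<in> borel_measurable borel"
  shows "(\<integral>\<^sup>+C. F (A ** C) \<partial>lborel) = (\<integral>\<^sup>+C. F C \<partial>lborel)"
  using assms
proof (induction A arbitrary: F rule: sl2_induct)
  \<comment> \<open>Flattening the nested vector to pairs of indices brings matrices into the scope
    of \<open>nn_integral_triangular\<close>.\<close>
  define m :: "real ^ (2 \<times> 2) \<Rightarrow> real ^ 2 ^ 2" where "m w = (\<chi> i j. w $ (i, j))" for w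
  have lin: "linear m" by (rule linearI) (simp_all add: m_def vec_eq_iff)
  have max: "m (axis (i, j) 1) = axis i (axis j 1)" for i j
    by (simp add: m_def vec_eq_iff axis_def)
  have bij: "bij_betw m Basis Basis"
    unfolding bij_betw_def
  proof
    show "inj_on m Basis"
      by (rule inj_onI) (auto simp: Basis_vec_def max axis_eq_axis)
    show "m ` Basis = Basis"
      by (auto simp: Basis_vec_def max image_iff) blast+
  qed
  have mm [measurable]: "m \<in> borel_measurable borel"
    using lin by (intro borel_measurable_continuous_onI linear_continuous_on)
      (simp add: linear_conv_bounded_linear)
  have m_nth: "m w $ i $ j = w $ (i, j)" for w i j by (simp add: m_def)
  have key: "(\<integral>\<^sup>+C. F (U ** C) \<partial>lborel) = (\<integral>\<^sup>+C. F C \<partial>lborel)"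
    if F [measurable]: "F \<in> borel_measurable borel"
      and U: "\<And>w. U ** m w = m (f w)" "\<And>w i. f w $ i = g i w + 1 * w $ i"
      and g: "\<And>i. g i \<in> borel_measurable borel"
      and gd: "\<And>i x y. (\<And>j. rk j < rk i \<Longrightarrow> x $ j = y $ j) \<Longrightarrow> g i x = g i y"
    for F :: "real ^ 2 ^ 2 \<Rightarrow> ennreal" and U f g and rk :: "2 \<times> 2 \<Rightarrow> nat"
  proof -
    have "(\<integral>\<^sup>+C. F (U ** C) \<partial>lborel) = (\<integral>\<^sup>+w. F (m (f w)) \<partial>lborel)"
      by (subst nn_integral_lborel_Basis[OF lin bij]) (simp_all add: U)
    also have "\<dots> = (\<Prod>i::2 \<times> 2\<in>UNIV. ennreal \<bar>1\<bar>) * (\<integral>\<^sup>+w. F (m (f w)) \<partial>lborel)"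
      by simp
    also have "\<dots> = (\<integral>\<^sup>+w. F (m w) \<partial>lborel)"
      by (rule nn_integral_triangular[of "\<lambda>w. F (m w)" g f "\<lambda>_. 1" rk, OF _ g U(2) _ gd]) simp_all
    also have "\<dots> = (\<integral>\<^sup>+C. F C \<partial>lborel)"
      by (subst nn_integral_lborel_Basis[OF lin bij]) simp_all
    finally show ?thesis .
  qed
  {
    case (upper x)
    show ?case
    proof (rule key[OF upper, of _ "\<lambda>w. \<chi> p. w $ p + (if fst p = 1 then x * w $ (2, snd p) else 0)"
          "\<lambda>p w. if fst p = 1 then x * w $ (2, snd p) else 0" "\<lambda>p. if fst p = 1 then 1 else 0"])
      show "upper_unip x ** m w = m (\<chi> p. w $ p + (if fst p = 1 then x * w $ (2, snd p) else 0))" for w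
        by (rule matrix_2_eqI) (simp_all add: matrix_mult_2_nth unip_nth m_nth)
    qed (auto split: if_splits)
  next
    case (lower x)
    show ?case
    proof (rule key[OF lower, of _ "\<lambda>w. \<chi> p. w $ p + (if fst p = 2 then x * w $ (1, snd p) else 0)"
          "\<lambda>p w. if fst p = 2 then x * w $ (1, snd p) else 0" "\<lambda>p. if fst p = 2 then 1 else 0"])
      show "lower_unip x ** m w = m (\<chi> p. w $ p + (if fst p = 2 then x * w $ (1, snd p) else 0))" for w
        by (rule matrix_2_eqI) (simp_all add: matrix_mult_2_nth unip_nth m_nth)
    qed (auto split: if_splits)
  next
    case (mult A C)
    have "(\<lambda>D. F (A ** D)) \<in> borel_measurable borel"
      using mult.prems by measurable
    then show ?case
      using mult.IH(2)[of "\<lambda>D. F (A ** D)"] mult.IH(1) mult.prems by (simp add: matrix_mul_assoc[symmetric])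
  }
qed

lemma measurable_lie_polys [measurable]:
  "ymul y \<in> borel_measurable borel" "yexp \<in> borel_measurable borel" "ylog \<in> borel_measurable borel"
  "sl2_lie A \<in> borel_measurable borel"
  by (intro borel_measurable_continuous_onI continuous_intros)+

text \<open>In each component \<open>ymul y z\<close> differs from z by a function of the components
  of z at lower steps, so left translation is unitriangular.\<close>

lemma nn_integral_ymul:
  fixes F :: "real ^ lie \<Rightarrow> ennreal"
  assumes F: "F \<in> borel_measurable borel"
  shows "(\<integral>\<^sup>+z. F (ymul y z) \<partial>lborel) = (\<integral>\<^sup>+z. F z \<partial>lborel)"
proof -
  define rk where "rk i = (case i of LV _ \<Rightarrow> 0 | LP _ \<Rightarrow> 0 | LX j \<Rightarrow> (case j of None \<Rightarrow> 2 | Some _ \<Rightarrow> 1) | LZ \<Rightarrow> (2::nat))" for i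
  have d: "ymul y z $ i - z $ i = ymul y w $ i - w $ i" if eq: "\<And>j. rk j < rk i \<Longrightarrow> z $ j = w $ j" for i z w
  proof -
    have 1: "z $ LV a = w $ LV a" "z $ LP a = w $ LP a" if "rk i > 0" for a
      using that by (auto intro!: eq simp: rk_def)
    moreover have "z $ LX (Some a) = w $ LX (Some a)" if "rk i > 1" for a
      using that by (auto intro!: eq simp: rk_def)
    ultimately show ?thesis
      by (cases i) (auto simp: ymul_def kap_def rk_def split: option.splits)
  qed
  have "(\<Prod>i::lie\<in>UNIV. ennreal \<bar>1\<bar>) * (\<integral>\<^sup>+z. F (ymul y z) \<partial>lborel) = (\<integral>\<^sup>+z. F z \<partial>lborel)"
    by (rule nn_integral_triangular[OF F, of "\<lambda>i z. ymul y z $ i - z $ i" "ymul y" "\<lambda>_. 1" rk, OF _ _ _ d]) simp_all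
  then show ?thesis by simp
qed

text \<open>The map is triangular with diagonal entries 1 or -1, except for -1/2 at
  \<open>LZ\<close>, which is the origin of the factor 2.\<close>

lemma nn_integral_yexp:
  fixes F :: "real ^ lie \<Rightarrow> ennreal"
  assumes F: "F \<in> borel_measurable borel"
  shows "(\<integral>\<^sup>+v. F (yexp v) \<partial>lborel) = 2 * (\<integral>\<^sup>+y. F y \<partial>lborel)"
proof -
  define rk where "rk i = (case i of LV _ \<Rightarrow> 0 | LP _ \<Rightarrow> 0 | LX j \<Rightarrow> (case j of None \<Rightarrow> 2 | Some _ \<Rightarrow> 1) | LZ \<Rightarrow> (2::nat))" for i
  define s where "s i = (case i of LP _ \<Rightarrow> - 1 | LZ \<Rightarrow> - 1 / 2 | _ \<Rightarrow> (1::real))" for i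
  have d: "yexp z $ i - s i * z $ i = yexp w $ i - s i * w $ i" if eq: "\<And>j. rk j < rk i \<Longrightarrow> z $ j = w $ j" for i z w
  proof -
    have 1: "z $ LV a = w $ LV a" "z $ LP a = w $ LP a" if "rk i > 0" for a
      using that by (auto intro!: eq simp: rk_def)
    moreover have "z $ LX (Some a) = w $ LX (Some a)" if "rk i > 1" for a
      using that by (auto intro!: eq simp: rk_def)
    ultimately show ?thesis
      by (cases i) (auto simp: yexp_def s_def rk_def split: option.splits)
  qed
  have "(\<Prod>i\<in>UNIV. ennreal \<bar>s i\<bar>) * (\<integral>\<^sup>+v. F (yexp v) \<partial>lborel) = (\<integral>\<^sup>+y. F y \<partial>lborel)"
    by (rule nn_integral_triangular[OF F, of "\<lambda>i z. yexp z $ i - s i * z $ i" yexp s rk, OF _ _ _ d])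
       (simp_all add: s_def split: lie.split)
  moreover have "(\<Prod>i\<in>UNIV. ennreal \<bar>s i\<bar>) = ennreal (1 / 2)"
    by (simp add: prod_ennreal UNIV_lie s_def)
  ultimately have "ennreal (1 / 2) * (\<integral>\<^sup>+v. F (yexp v) \<partial>lborel) = (\<integral>\<^sup>+y. F y \<partial>lborel)" by simp
  then have "ennreal 2 * ennreal (1 / 2) * (\<integral>\<^sup>+v. F (yexp v) \<partial>lborel) = ennreal 2 * (\<integral>\<^sup>+y. F y \<partial>lborel)"
    by (simp only: mult.assoc)
  moreover have "ennreal 2 * ennreal (1 / 2) = 1"
    by (subst ennreal_mult[symmetric]) simp_all
  ultimately show ?thesis by simp
qed

lemma nn_integral_sl2_lie:
  fixes F :: "real ^ lie \<Rightarrow> ennreal"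
  assumes "A \<in> sl2" "F \<in> borel_measurable borel"
  shows "(\<integral>\<^sup>+z. F (sl2_lie A z) \<partial>lborel) = (\<integral>\<^sup>+z. F z \<partial>lborel)"
  using assms
proof (induction A arbitrary: F rule: sl2_induct)
  case (upper x)
  define rk where "rk i = (case i of LP _ \<Rightarrow> 1 | LZ \<Rightarrow> 1 | _ \<Rightarrow> (0::nat))" for i
  have d: "sl2_lie (upper_unip x) z $ i - z $ i = sl2_lie (upper_unip x) w $ i - w $ i"
    if eq: "\<And>j. rk j < rk i \<Longrightarrow> z $ j = w $ j" for i z w
    using eq by (cases i) (auto simp: sl2_lie_def unip_nth rk_def split: option.splits)
  have "(\<Prod>i::lie\<in>UNIV. ennreal \<bar>1\<bar>) * (\<integral>\<^sup>+z. F (sl2_lie (upper_unip x) z) \<partial>lborel) = (\<integral>\<^sup>+z. F z \<partial>lborel)"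
    by (rule nn_integral_triangular[OF upper, of "\<lambda>i z. sl2_lie (upper_unip x) z $ i - z $ i" "sl2_lie (upper_unip x)" "\<lambda>_. 1" rk, OF _ _ _ d]) simp_all
  then show ?case by simp
next
  case (lower x)
  define rk where "rk i = (case i of LV _ \<Rightarrow> 1 | LX j \<Rightarrow> (case j of None \<Rightarrow> 1 | Some _ \<Rightarrow> 0) | _ \<Rightarrow> (0::nat))" for i
  have d: "sl2_lie (lower_unip x) z $ i - z $ i = sl2_lie (lower_unip x) w $ i - w $ i"
    if eq: "\<And>j. rk j < rk i \<Longrightarrow> z $ j = w $ j" for i z w
    using eq by (cases i) (auto simp: sl2_lie_def unip_nth rk_def split: option.splits)
  have "(\<Prod>i::lie\<in>UNIV. ennreal \<bar>1\<bar>) * (\<integral>\<^sup>+z. F (sl2_lie (lower_unip x) z) \<partial>lborel) = (\<integral>\<^sup>+z. F z \<partial>lborel)"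
    by (rule nn_integral_triangular[OF lower, of "\<lambda>i z. sl2_lie (lower_unip x) z $ i - z $ i" "sl2_lie (lower_unip x)" "\<lambda>_. 1" rk, OF _ _ _ d]) simp_all
  then show ?case by simp
next
  case (mult A C)
  have "(\<lambda>D. F (sl2_lie A D)) \<in> borel_measurable borel"
    using mult.prems by measurable
  then show ?case using mult.IH(2)[of "\<lambda>D. F (sl2_lie A D)"] mult.IH(1) mult.prems by (simp add: sl2_lie_mult)
qed

text \<open>Radial projection to determinant one. The default \<open>mat 1\<close> keeps the map
  total with values in \<open>sl2\<close>; it concerns only matrices outside
  \<open>sl2_cone\<close>.\<close>

definition sl2_normalize :: "real ^ 2 ^ 2 \<Rightarrow> real ^ 2 ^ 2" where
  "sl2_normalize C = (if det C > 0 then (1 / sqrt (det C)) *\<^sub>R C else mat 1)"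

lemma det_scaleR_2: "det (r *\<^sub>R C) = r\<^sup>2 * det C" for C :: "real ^ 2 ^ 2"
  by (simp add: det_2 algebra_simps power2_eq_square)

lemma sl2_normalize_in [simp]: "sl2_normalize C \<in> sl2"
  by (simp add: sl2_normalize_def det_scaleR_2 sl2_def power_divide)

lemma sl2_normalize_mult:
  assumes "A \<in> sl2" "det C > 0" shows "sl2_normalize (A ** C) = A ** sl2_normalize C"
proof -
  have "det (A ** C) = det C" using assms by (simp add: det_mul sl2_def)
  then show ?thesis
    using assms by (intro matrix_2_eqI) (simp_all add: sl2_normalize_def matrix_mult_2_nth add_divide_distrib)
qed

lemma measurable_det_2 [measurable]: "(det :: real ^ 2 ^ 2 \<Rightarrow> real) \<in> borel_measurable borel"
  unfolding det_2[abs_def] by measurable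

lemma measurable_sl2_normalize [measurable]: "sl2_normalize \<in> borel_measurable borel"
  unfolding sl2_normalize_def[abs_def] by measurable

text \<open>Haar measure on \<open>SL(2, \<real>)\<close> is Lebesgue measure of the cone over a subset, with apex at the
  origin of the space of matrices: left multiplication by \<open>SL(2, \<real>)\<close> is linear with determinant \<open>1\<close>.\<close>

definition sl2_cone :: "(real ^ 2 ^ 2) set" where
  "sl2_cone = {C. 0 < det C \<and> det C \<le> 1}"

lemma sl2_cone_measurable [measurable]: "sl2_cone \<in> sets borel"
  unfolding sl2_cone_def by measurable

text \<open>Lebesgue measure of the cone is projected radially to \<open>sl2\<close>. On the second
  factor Lebesgue measure in v agrees up to a constant with the invariant measure of the nilpotent
  group, because \<open>yexp\<close> has constant Jacobian.\<close>

definition haar :: "((real ^ 2 ^ 2) \<times> (real ^ lie)) measure" where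
  "haar = distr (density lborel (\<lambda>p. indicator sl2_cone (fst p))) (restrict_space borel (sl2 \<times> UNIV))
     (\<lambda>p. (sl2_normalize (fst p), snd p))"

lemma measurable_fst_snd_borel [measurable]:
  "fst \<in> borel_measurable (borel :: ('a::second_countable_topology \<times> 'b::second_countable_topology) measure)"
  "snd \<in> borel_measurable (borel :: ('a::second_countable_topology \<times> 'b::second_countable_topology) measure)"
  by (intro borel_measurable_continuous_onI continuous_intros)+

lemma measurable_Pair_borel [measurable (raw)]:
  fixes f :: "'a \<Rightarrow> 'b::second_countable_topology" and g :: "'a \<Rightarrow> 'c::second_countable_topology"
  assumes "f \<in> borel_measurable M" "g \<in> borel_measurable M"
  shows "(\<lambda>x. (f x, g x)) \<in> borel_measurable M"
  using assms by (rule borel_measurable_Pair)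

lemma sets_haar: "sets haar = sets (restrict_space borel (sl2 \<times> UNIV))"
  by (simp add: haar_def)

lemma sets_haar_iff: "S \<in> sets haar \<longleftrightarrow> S \<in> sets borel \<and> S \<subseteq> sl2 \<times> UNIV"
  using closed_carrier by (auto simp: sets_haar sets_restrict_space_iff)

lemma nn_integral_lborel_Pair:
  fixes F :: "'a::euclidean_space \<times> 'b::euclidean_space \<Rightarrow> ennreal"
  assumes "F \<in> borel_measurable borel"
  shows "(\<integral>\<^sup>+p. F p \<partial>lborel) = (\<integral>\<^sup>+x. \<integral>\<^sup>+y. F (x, y) \<partial>lborel \<partial>lborel)"
  using assms by (subst lborel_prod[symmetric], subst lborel.nn_integral_fst) (simp_all add: borel_prod lborel_prod)

lemma emeasure_haar:
  assumes S: "S \<in> sets borel" "S \<subseteq> sl2 \<times> UNIV"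
  shows "emeasure haar S
    = (\<integral>\<^sup>+C. indicator sl2_cone C * (\<integral>\<^sup>+v. indicator S (sl2_normalize C, v) \<partial>lborel) \<partial>lborel)"
proof -
  note [measurable] = S(1)
  have m: "(\<lambda>p. (sl2_normalize (fst p), snd p)) \<in> density lborel (\<lambda>p. indicator sl2_cone (fst p)) \<rightarrow>\<^sub>M
      restrict_space borel (sl2 \<times> (UNIV :: (real ^ lie) set))"
    by (rule measurable_restrict_space2) (auto simp: space_density)
  have "emeasure haar S = (\<integral>\<^sup>+p. indicator S p \<partial>haar)"
    using sets_haar_iff S by simp
  also have "\<dots> = (\<integral>\<^sup>+p. indicator S (sl2_normalize (fst p), snd p) \<partial>density lborel (\<lambda>p. indicator sl2_cone (fst p)))"
    unfolding haar_def
    by (rule nn_integral_distr[OF m]) (auto intro!: borel_measurable_indicator simp: sets_restrict_space_iff closed_carrier S)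
  also have "\<dots> = (\<integral>\<^sup>+p. indicator sl2_cone (fst p) * indicator S (sl2_normalize (fst p), snd p) \<partial>lborel)"
    by (subst nn_integral_density) (simp_all add: mult.commute)
  also have "\<dots> = (\<integral>\<^sup>+C. \<integral>\<^sup>+v. indicator sl2_cone C * indicator S (sl2_normalize C, v) \<partial>lborel \<partial>lborel)"
    by (subst nn_integral_lborel_Pair) simp_all
  also have "\<dots> = (\<integral>\<^sup>+C. indicator sl2_cone C * (\<integral>\<^sup>+v. indicator S (sl2_normalize C, v) \<partial>lborel) \<partial>lborel)"
    by (simp add: nn_integral_cmult)
  finally show ?thesis .
qed

lemma gmul_cancel:
  assumes g: "g \<in> sl2 \<times> UNIV" and h: "h \<in> sl2 \<times> UNIV"
  shows "gmul (ginv g) (gmul g h) = h" "gmul g (gmul (ginv g) h) = h"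
proof -
  interpret group qgroup by (rule group_qgroup)
  have gc: "g \<in> carrier qgroup" "h \<in> carrier qgroup" "ginv g \<in> carrier qgroup"
    using g h ginv_closed by auto
  have "inv\<^bsub>qgroup\<^esub> g = ginv g" using g by (rule inv_qgroup)
  then have "(ginv g \<otimes>\<^bsub>qgroup\<^esub> g) \<otimes>\<^bsub>qgroup\<^esub> h = h" "(g \<otimes>\<^bsub>qgroup\<^esub> ginv g) \<otimes>\<^bsub>qgroup\<^esub> h = h"
    using l_inv[OF gc(1)] r_inv[OF gc(1)] l_one[OF gc(2)] by simp_all
  then show "gmul (ginv g) (gmul g h) = h" "gmul g (gmul (ginv g) h) = h"
    unfolding m_assoc[OF gc(3,1,2)] m_assoc[OF gc(1,3,2)]
    using g h by (simp_all add: mult_qgroup ginv_closed gmul_closed)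
qed

lemma measurable_gmul [measurable]: "gmul g \<in> borel_measurable borel"
  by (intro borel_measurable_continuous_onI continuous_on_gmul continuous_on_const continuous_on_id)

lemma gmul_image:
  assumes g: "g \<in> sl2 \<times> UNIV" and S: "S \<subseteq> sl2 \<times> UNIV"
  shows "gmul g ` S = (gmul (ginv g) -` S) \<inter> (sl2 \<times> UNIV)"
proof
  show "gmul g ` S \<subseteq> (gmul (ginv g) -` S) \<inter> (sl2 \<times> UNIV)"
  proof (rule image_subsetI)
    fix h assume "h \<in> S"
    moreover from this have "h \<in> sl2 \<times> UNIV" using S by blast
    ultimately show "gmul g h \<in> (gmul (ginv g) -` S) \<inter> (sl2 \<times> UNIV)"
      using gmul_closed[OF g] gmul_cancel(1)[OF g] by auto
  qed
  show "(gmul (ginv g) -` S) \<inter> (sl2 \<times> UNIV) \<subseteq> gmul g ` S"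
  proof
    fix h assume h: "h \<in> (gmul (ginv g) -` S) \<inter> (sl2 \<times> UNIV)"
    then have "h = gmul g (gmul (ginv g) h)" using gmul_cancel(2)[OF g] by simp
    then show "h \<in> gmul g ` S" using h by blast
  qed
qed

text \<open>For a fixed matrix C the element g acts on v by a left translation of the nilpotent
  group; on C itself it acts by left multiplication. Each preserves its Lebesgue measure, and the
  cone is stable because determinants are.\<close>

lemma emeasure_haar_gmul:
  assumes g: "g \<in> sl2 \<times> UNIV" and S: "S \<in> sets borel" "S \<subseteq> sl2 \<times> UNIV"
  shows "emeasure haar (gmul g ` S) = emeasure haar S"
proof -
  let ?S = "gmul g ` S" and ?A = "fst g"
  have A: "?A \<in> sl2" using g by auto
  have sub: "?S \<subseteq> sl2 \<times> UNIV" using g S gmul_closed by blast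
  have [measurable]: "?S \<in> sets borel"
    unfolding gmul_image[OF g S(2)]
    using measurable_sets[OF measurable_gmul S(1), of "ginv g"] closed_carrier by auto
  note [measurable] = S(1)
  define G where "G C = (\<integral>\<^sup>+v. indicator ?S (sl2_normalize C, v) \<partial>lborel)" for C
  have [measurable]: "G \<in> borel_measurable borel" unfolding G_def by measurable
  have GA: "G (?A ** C) = (\<integral>\<^sup>+v. indicator S (sl2_normalize C, v) \<partial>lborel)" if "det C > 0" for C
  proof -
    let ?y = "sl2_lie (sl2_inv (sl2_normalize C)) (yexp (snd g))"
    \<comment> \<open>The factor 2 of \<open>nn_integral_yexp\<close> is placed on both sides in
      order to pass from the group variable to its logarithm.\<close>
    have "2 * (\<integral>\<^sup>+v. indicator ?S (?A ** sl2_normalize C, ylog v) \<partial>lborel)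
        = 2 * (\<integral>\<^sup>+v. indicator ?S (?A ** sl2_normalize C, ylog (ymul ?y v)) \<partial>lborel)"
      by (subst nn_integral_ymul) simp_all
    then have "(\<integral>\<^sup>+v. indicator ?S (?A ** sl2_normalize C, ylog (yexp v)) \<partial>lborel)
        = (\<integral>\<^sup>+v. indicator ?S (?A ** sl2_normalize C, ylog (ymul ?y (yexp v))) \<partial>lborel)"
      by (subst (1 2) nn_integral_yexp) simp_all
    then have "G (?A ** C) = (\<integral>\<^sup>+v. indicator ?S (gmul g (sl2_normalize C, v)) \<partial>lborel)"
      using A that by (simp add: G_def sl2_normalize_mult gmul_def)
    also have "\<dots> = (\<integral>\<^sup>+v. indicator S (sl2_normalize C, v) \<partial>lborel)"
    proof (intro nn_integral_cong)
      fix v :: "real ^ lie"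
      have 1: "(sl2_normalize C, v) \<in> sl2 \<times> UNIV" by simp
      have "gmul g (sl2_normalize C, v) \<in> ?S \<longleftrightarrow> (sl2_normalize C, v) \<in> S"
        unfolding gmul_image[OF g S(2)] using gmul_cancel(1)[OF g 1] gmul_closed[OF g 1] by simp
      then show "indicator ?S (gmul g (sl2_normalize C, v)) = (indicator S (sl2_normalize C, v) :: ennreal)"
        by (simp add: indicator_def)
    qed
    finally show ?thesis .
  qed
  have "emeasure haar ?S = (\<integral>\<^sup>+C. indicator sl2_cone C * G C \<partial>lborel)"
    by (subst emeasure_haar) (simp_all add: sub G_def)
  also have "\<dots> = (\<integral>\<^sup>+C. indicator sl2_cone (?A ** C) * G (?A ** C) \<partial>lborel)"
    by (rule nn_integral_sl2_mult[OF A, symmetric]) measurable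
  also have "\<dots> = (\<integral>\<^sup>+C. indicator sl2_cone C * (\<integral>\<^sup>+v. indicator S (sl2_normalize C, v) \<partial>lborel) \<partial>lborel)"
    using A by (intro nn_integral_cong) (simp add: indicator_def sl2_cone_def det_mul sl2_def GA)
  also have "\<dots> = emeasure haar S" by (rule emeasure_haar[OF S, symmetric])
  finally show ?thesis .
qed

lemma emeasure_lborel_open_pos:
  fixes S :: "'a::euclidean_space set"
  assumes "open S" "S \<noteq> {}" shows "emeasure lborel S > 0"
proof (rule ccontr)
  assume "\<not> emeasure lborel S > 0"
  then have "S \<in> null_sets lebesgue"
    using assms by (auto simp: null_sets_def not_less)
  then show False using open_not_negligible[OF assms] by (simp add: negligible_iff_null_sets)
qed

lemma haar_carrier: "emeasure haar (sl2 \<times> UNIV) \<noteq> 0"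
proof -
  let ?U = "{C. 0 < det C \<and> det C < 1} :: (real ^ 2 ^ 2) set"
  have op: "open (?U \<times> (UNIV :: (real ^ lie) set))"
    by (intro open_Times open_UNIV open_Collect_conj open_Collect_less continuous_intros)
  have "(1 / 2) *\<^sub>R mat 1 \<in> ?U" by (simp add: det_scaleR_2 power2_eq_square)
  then have "?U \<times> (UNIV :: (real ^ lie) set) \<noteq> {}" by blast
  with op have "0 < emeasure lborel (?U \<times> (UNIV :: (real ^ lie) set))"
    by (rule emeasure_lborel_open_pos)
  also have "\<dots> = (\<integral>\<^sup>+p. indicator (?U \<times> (UNIV :: (real ^ lie) set)) p \<partial>lborel)"
    by (rule nn_integral_indicator[symmetric]) (use op in auto)
  also have "\<dots> = (\<integral>\<^sup>+C. \<integral>\<^sup>+v. indicator (?U \<times> (UNIV :: (real ^ lie) set)) (C, v) \<partial>lborel \<partial>lborel)"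
    using op by (intro nn_integral_lborel_Pair) simp
  also have "\<dots> \<le> (\<integral>\<^sup>+C. indicator sl2_cone C * (\<integral>\<^sup>+v. indicator (sl2 \<times> UNIV) (sl2_normalize C, v :: real ^ lie) \<partial>lborel) \<partial>lborel)"
    by (intro nn_integral_mono) (auto simp: indicator_def sl2_cone_def)
  also have "\<dots> = emeasure haar (sl2 \<times> UNIV)"
    using closed_carrier by (subst emeasure_haar) auto
  finally show ?thesis by simp
qed

text \<open>A point of the cone is its projection shrunk by sqrt (det C) \<le> 1, so whatever
  projects into \<open>K\<close> stays in a ball around 0 that contains \<open>K\<close>.\<close>

lemma haar_compact:
  assumes K: "compact K" "K \<subseteq> sl2 \<times> UNIV" shows "emeasure haar K < \<infinity>"
proof -
  have Kb [measurable]: "K \<in> sets borel" using compact_imp_closed[OF K(1)] by auto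
  obtain r where r: "\<And>p. p \<in> K \<Longrightarrow> norm p \<le> r" using compact_imp_bounded[OF K(1)] by (auto simp: bounded_iff)
  have "emeasure haar K = (\<integral>\<^sup>+C. \<integral>\<^sup>+v. indicator sl2_cone C * indicator K (sl2_normalize C, v) \<partial>lborel \<partial>lborel)"
    by (simp add: emeasure_haar[OF Kb K(2)] nn_integral_cmult)
  also have "\<dots> \<le> (\<integral>\<^sup>+C. \<integral>\<^sup>+v. indicator (cball (0 :: (real ^ 2 ^ 2) \<times> (real ^ lie)) r) (C, v) \<partial>lborel \<partial>lborel)"
  proof (intro nn_integral_mono)
    fix C :: "real ^ 2 ^ 2" and v :: "real ^ lie"
    have "norm (C, v) \<le> r" if C: "C \<in> sl2_cone" and "(sl2_normalize C, v) \<in> K"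
    proof -
      have d: "0 < det C" "det C \<le> 1" using C by (auto simp: sl2_cone_def)
      then have "C = sqrt (det C) *\<^sub>R sl2_normalize C" by (simp add: sl2_normalize_def)
      then have "norm C \<le> norm (sl2_normalize C)"
        using d by (metis abs_of_nonneg less_imp_le mult_left_le_one_le norm_ge_zero norm_scaleR real_sqrt_ge_zero real_sqrt_le_1_iff)
      then have "norm (C, v) \<le> norm (sl2_normalize C, v)" by (simp add: norm_Pair power_mono)
      also have "\<dots> \<le> r" using that r by blast
      finally show ?thesis .
    qed
    then show "indicator sl2_cone C * indicator K (sl2_normalize C, v) \<le> (indicator (cball (0 :: (real ^ 2 ^ 2) \<times> (real ^ lie)) r) (C, v) :: ennreal)"
      by (auto simp: indicator_def)
  qed
  also have "\<dots> = (\<integral>\<^sup>+p. indicator (cball 0 r) p \<partial>(lborel :: ((real ^ 2 ^ 2) \<times> (real ^ lie)) measure))"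
    by (intro nn_integral_lborel_Pair[symmetric] borel_measurable_indicator) simp
  also have "\<dots> = emeasure lborel (cball (0 :: (real ^ 2 ^ 2) \<times> (real ^ lie)) r)" by simp
  also have "\<dots> < \<infinity>" by (rule emeasure_bounded_finite) simp
  finally show ?thesis .
qed

text \<open>The covolume condition of \<open>lattice_in\<close> ranges over all left Haar measures;
  exhibiting one turns it into an actual finite bound.\<close>

lemma left_haar_haar: "left_haar qgroup haar"
  unfolding left_haar_def
proof (intro conjI allI impI ballI)
  show "sets haar = sets (restrict_space borel (carrier qgroup))" by (simp add: sets_haar)
  show "emeasure haar (carrier qgroup) \<noteq> 0" by (simp add: haar_carrier)
  fix K assume "compact K \<and> K \<subseteq> carrier qgroup"
  then show "emeasure haar K < \<infinity>" by (intro haar_compact) auto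
next
  fix g S assume g: "g \<in> carrier qgroup" and S: "S \<in> sets haar"
  have "(\<lambda>h. g \<otimes>\<^bsub>qgroup\<^esub> h) ` S = gmul g ` S"
    using g S by (intro image_cong) (auto simp: sets_haar_iff intro!: mult_qgroup)
  then show "emeasure haar ((\<lambda>h. g \<otimes>\<^bsub>qgroup\<^esub> h) ` S) = emeasure haar S"
    using g S by (simp add: sets_haar_iff emeasure_haar_gmul)
qed

section \<open>Invariant coordinates on the fibers\<close>

definition fiber_density :: "real ^ fcoord \<Rightarrow> ennreal" where
  "fiber_density u = ennreal (1 / ((u $ FR) ^ 3 * (u $ FRho) ^ 5))"

lemma fiber_density_measurable [measurable]: "fiber_density \<in> borel_measurable borel"
  unfolding fiber_density_def[abs_def] by measurable

text \<open>\<open>fpt_shear\<close> is the change from type IIB to type IIA coordinates on the level of the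
  coordinates other than \<open>r\<close> and \<open>\<rho>\<close>, with \<open>y\<close> stored at the indices of its type IIA counterparts.\<close>

definition fshear_y :: "real ^ fcoord \<Rightarrow> real ^ lie" where
  "fshear_y w = (\<chi> i. case i of LV a \<Rightarrow> w $ FB a | LP a \<Rightarrow> w $ FZl (Some a) | LX j \<Rightarrow> w $ FZt j | LZ \<Rightarrow> w $ FSig)"

definition fpt_shear :: "real ^ fcoord \<Rightarrow> real ^ fcoord" where
  "fpt_shear w = vec_upd (fpt (w $ FR) (Complex (w $ FZl None) 1) (fshear_y w)) FRho (w $ FRho)"

lemma fpt_shear_eq_fpt:
  assumes "w $ FRho = t\<^sup>2 / 2 * (w $ FR) ^ 3"
  shows "fpt_shear w = fpt (w $ FR) (Complex (w $ FZl None) t) (fshear_y w)"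
  using assms by (auto simp: fpt_shear_def vec_eq_iff fpt_def Let_def split: fcoord.split)

lemma kcontr_alt: "kcontr x y w = 6 * x 1 * y 1 * w 1 - 2 * (x 1 * y 2 * w 2 + x 2 * y 1 * w 2 + x 2 * y 2 * w 1)"
  by (simp add: kcontr_def UNIV_2 kcub_def)

lemma fpt_shear_measurable [measurable]: "fpt_shear \<in> borel_measurable borel"
proof (rule borel_measurable_vecI)
  fix i show "(\<lambda>w. fpt_shear w $ i) \<in> borel_measurable borel"
  proof (cases i)
    case (FZl j) then show ?thesis
      by (cases j) (simp_all add: fpt_shear_def fpt_def Let_def fshear_y_def)
  next
    case (FZt j) then show ?thesis
      by (cases j) (simp_all add: fpt_shear_def fpt_def Let_def fshear_y_def kcontr_alt)
  qed (simp_all add: fpt_shear_def fpt_def Let_def fshear_y_def kcontr_alt)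
qed

text \<open>All diagonal coefficients have absolute value 1 except -2 at \<open>FSig\<close>, which
  comes from \<open>\<sigma>\<close> = - 2 \<open>\<psi>\<close> + ... .\<close>

lemma nn_integral_fpt_shear:
  fixes F :: "real ^ fcoord \<Rightarrow> ennreal"
  assumes F: "F \<in> borel_measurable borel"
  shows "2 * (\<integral>\<^sup>+w. F (fpt_shear w) \<partial>lborel) = (\<integral>\<^sup>+u. F u \<partial>lborel)"
proof -
  define rk :: "fcoord \<Rightarrow> nat" where "rk i = (case i of FZl j \<Rightarrow> (case j of None \<Rightarrow> 0 | Some _ \<Rightarrow> 1)
    | FZt j \<Rightarrow> (case j of None \<Rightarrow> 3 | Some _ \<Rightarrow> 2) | FSig \<Rightarrow> 4 | _ \<Rightarrow> 0)" for i
  define s where "s i = (case i of FZl j \<Rightarrow> (case j of None \<Rightarrow> 1 | Some _ \<Rightarrow> - 1) | FSig \<Rightarrow> - 2 | _ \<Rightarrow> (1::real))" for i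
  have d: "fpt_shear z $ i - s i * z $ i = fpt_shear w $ i - s i * w $ i"
    if eq: "\<And>j. rk j < rk i \<Longrightarrow> z $ j = w $ j" for i z w
  proof -
    have 1: "z $ FB a = w $ FB a" "z $ FZl None = w $ FZl None" if "rk i > 0" for a
      using that by (auto intro!: eq simp: rk_def)
    moreover have 2: "z $ FZl (Some a) = w $ FZl (Some a)" if "rk i > 1" for a
      using that by (auto intro!: eq simp: rk_def)
    moreover have 3: "z $ FZt (Some a) = w $ FZt (Some a)" if "rk i > 2" for a
      using that by (auto intro!: eq simp: rk_def)
    moreover have 4: "z $ FZt None = w $ FZt None" if "rk i > 3"
      using that by (auto intro!: eq simp: rk_def)
    ultimately show ?thesis
      by (cases i) (auto simp: fpt_shear_def fpt_def Let_def fshear_y_def s_def rk_def split: option.splits)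
  qed
  have "(\<Prod>i\<in>UNIV. ennreal \<bar>s i\<bar>) * (\<integral>\<^sup>+w. F (fpt_shear w) \<partial>lborel) = (\<integral>\<^sup>+u. F u \<partial>lborel)"
    by (rule nn_integral_triangular[OF F, of "\<lambda>i z. fpt_shear z $ i - s i * z $ i" fpt_shear s rk, OF _ _ _ d])
       (simp_all add: s_def split: fcoord.split option.split)
  moreover have "(\<Prod>i\<in>UNIV. ennreal \<bar>s i\<bar>) = 2"
    by (simp add: prod_ennreal UNIV_fcoord s_def)
  ultimately show ?thesis by simp
qed

lemma measurable_fshear_y [measurable]: "fshear_y \<in> borel_measurable borel"
proof (rule borel_measurable_vecI)
  fix i show "(\<lambda>w. fshear_y w $ i) \<in> borel_measurable borel"
    by (cases i) (simp_all add: fshear_y_def)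
qed

lemma measurable_fpt [measurable (raw)]:
  assumes [measurable]: "r \<in> borel_measurable M" "t1 \<in> borel_measurable M" "t2 \<in> borel_measurable M"
    "y \<in> borel_measurable M"
  shows "(\<lambda>x. fpt (r x) (Complex (t1 x) (t2 x)) (y x)) \<in> borel_measurable M"
proof (rule borel_measurable_vecI)
  fix i show "(\<lambda>x. fpt (r x) (Complex (t1 x) (t2 x)) (y x) $ i) \<in> borel_measurable M"
  proof (cases i)
    case (FZl j) then show ?thesis by (cases j) (simp_all add: fpt_def Let_def)
  next
    case (FZt j) then show ?thesis by (cases j) (simp_all add: fpt_def Let_def kcontr_alt)
  qed (simp_all add: fpt_def Let_def kcontr_alt)
qed

text \<open>The slots \<open>FR\<close> and \<open>FRho\<close> hold \<open>\<kappa>\<close> and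
  \<open>\<tau>\<^sub>2\<close>, which by then have replaced r and \<open>\<rho>\<close>. The order
  of the tuple makes \<open>\<kappa>\<close> the outermost and the nilpotent coordinate the
  innermost variable of integration.\<close>

definition fcoord_of :: "real \<times> real \<times> real \<times> (real ^ lie) \<Rightarrow> real ^ fcoord" where
  "fcoord_of = (\<lambda>(k, t1, t, y). \<chi> i. case i of FR \<Rightarrow> k | FRho \<Rightarrow> t | FB a \<Rightarrow> y $ LV a
     | FZl j \<Rightarrow> (case j of None \<Rightarrow> t1 | Some a \<Rightarrow> y $ LP a) | FZt j \<Rightarrow> y $ LX j | FSig \<Rightarrow> y $ LZ)"

lemma fcoord_of_nth:
  "fcoord_of (k, t1, t, y) $ FR = k" "fcoord_of (k, t1, t, y) $ FRho = t" "fcoord_of (k, t1, t, y) $ FZl None = t1"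
  by (simp_all add: fcoord_of_def)

lemma fshear_y_fcoord_of: "fshear_y (fcoord_of (k, t1, t, y)) = y"
  by (auto simp: fshear_y_def fcoord_of_def vec_eq_iff split: lie.split)

lemma Basis_real_vec: "(Basis :: (real ^ 'n) set) = range (\<lambda>i. axis i 1)"
  by (auto simp: Basis_vec_def)

lemma nn_integral_fcoord_split:
  fixes F :: "real ^ fcoord \<Rightarrow> ennreal"
  assumes F: "F \<in> borel_measurable borel"
  shows "(\<integral>\<^sup>+w. F w \<partial>lborel)
    = (\<integral>\<^sup>+k. \<integral>\<^sup>+t1. \<integral>\<^sup>+t. \<integral>\<^sup>+y. F (fcoord_of (k, t1, t, y)) \<partial>lborel \<partial>lborel \<partial>lborel \<partial>lborel)"
proof -
  have lin: "linear fcoord_of"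
    by (rule linearI) (auto simp: fcoord_of_def vec_eq_iff split: fcoord.split option.split)
  have [measurable]: "fcoord_of \<in> borel_measurable borel"
    using lin by (intro borel_measurable_continuous_onI linear_continuous_on)
      (simp add: linear_conv_bounded_linear)
  note [measurable] = F
  let ?g = "\<lambda>w. (w $ FR, w $ FZl None, w $ FRho, fshear_y w)"
  have ax: "fcoord_of (1, 0, 0, 0) = axis FR 1" "fcoord_of (0, 1, 0, 0) = axis (FZl None) 1"
    "fcoord_of (0, 0, 1, 0) = axis FRho 1"
    "fcoord_of (0, 0, 0, axis i 1) = axis (case i of LV a \<Rightarrow> FB a | LP a \<Rightarrow> FZl (Some a) | LX j \<Rightarrow> FZt j | LZ \<Rightarrow> FSig) 1" for i
    by (auto simp: fcoord_of_def vec_eq_iff axis_def split: fcoord.split option.split lie.split)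
  have mem: "(1, 0, 0, 0) \<in> (Basis :: (real \<times> real \<times> real \<times> (real ^ lie)) set)"
    "(0, 1, 0, 0) \<in> (Basis :: (real \<times> real \<times> real \<times> (real ^ lie)) set)"
    "(0, 0, 1, 0) \<in> (Basis :: (real \<times> real \<times> real \<times> (real ^ lie)) set)"
    "(0, 0, 0, axis i 1) \<in> (Basis :: (real \<times> real \<times> real \<times> (real ^ lie)) set)" for i
    by (auto simp: Basis_prod_def Basis_real_vec zero_prod_def)
  have bij: "bij_betw fcoord_of Basis Basis"
  proof (rule bij_betw_imageI)
    show "inj_on fcoord_of Basis"
      by (rule inj_on_inverseI[where g = ?g]) (auto simp: fcoord_of_nth fshear_y_fcoord_of)
    have "fcoord_of ` Basis \<subseteq> Basis"
      by (auto simp: Basis_prod_def Basis_real_vec zero_prod_def ax)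
    moreover have "axis i 1 \<in> fcoord_of ` Basis" for i
    proof (cases i)
      case (FB a) then show ?thesis using ax(4)[of "LV a"] mem(4)[of "LV a"] by (auto intro: image_eqI[OF sym])
    next
      case (FZt j) then show ?thesis using ax(4)[of "LX j"] mem(4)[of "LX j"] by (auto intro: image_eqI[OF sym])
    next
      case FSig then show ?thesis using ax(4)[of LZ] mem(4)[of LZ] by (auto intro: image_eqI[OF sym])
    next
      case (FZl j) then show ?thesis
      proof (cases j)
        case None then show ?thesis using FZl ax(2) mem(2) by (auto intro: image_eqI[OF sym])
      next
        case (Some a) then show ?thesis using FZl ax(4)[of "LP a"] mem(4)[of "LP a"] by (auto intro: image_eqI[OF sym])
      qed
    qed (use ax(1,3) mem(1,3) in \<open>auto intro: image_eqI[OF sym]\<close>)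
    ultimately show "fcoord_of ` Basis = Basis" unfolding Basis_real_vec by blast
  qed
  have "(\<integral>\<^sup>+w. F w \<partial>lborel) = (\<integral>\<^sup>+q. F (fcoord_of q) \<partial>lborel)"
    by (rule nn_integral_lborel_Basis[OF lin bij F])
  also have "\<dots> = (\<integral>\<^sup>+k. \<integral>\<^sup>+q. F (fcoord_of (k, q)) \<partial>lborel \<partial>lborel)"
    by (rule nn_integral_lborel_Pair) measurable
  also have "\<dots> = (\<integral>\<^sup>+k. \<integral>\<^sup>+t1. \<integral>\<^sup>+q. F (fcoord_of (k, t1, q)) \<partial>lborel \<partial>lborel \<partial>lborel)"
    by (subst nn_integral_lborel_Pair) measurable
  also have "\<dots> = (\<integral>\<^sup>+k. \<integral>\<^sup>+t1. \<integral>\<^sup>+t. \<integral>\<^sup>+y. F (fcoord_of (k, t1, t, y)) \<partial>lborel \<partial>lborel \<partial>lborel \<partial>lborel)"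
    by (subst nn_integral_lborel_Pair) measurable
  finally show ?thesis .
qed

text \<open>With c = r^3 this passes from \<open>\<rho>\<close> to \<open>\<tau>\<^sub>2\<close>, as
  \<open>\<rho>\<close> is half the square of \<open>\<tau>\<^sub>2\<close> times r^3.\<close>

lemma nn_integral_rho_substitution:
  fixes F :: "real \<Rightarrow> ennreal"
  assumes [measurable]: "F \<in> borel_measurable borel" and c: "c > 0"
  shows "(\<integral>\<^sup>+x. F x * indicator {0<..} x \<partial>lborel)
    = (\<integral>\<^sup>+t. F (t\<^sup>2 / 2 * c) * ennreal (t * c) * indicator {0<..} t \<partial>lborel)"
proof -
  have "(\<integral>\<^sup>+x. F x * indicator {0<..} x \<partial>lborel)
     = ennreal (c / 2) * (\<integral>\<^sup>+x. F (c / 2 * x) * indicator {0<..} (c / 2 * x) \<partial>lborel)"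
    using c by (subst nn_integral_real_affine[of _ "c / 2" 0]) simp_all
  also have "(\<integral>\<^sup>+x. F (c / 2 * x) * indicator {0<..} (c / 2 * x) \<partial>lborel)
     = (\<integral>\<^sup>+x. F (c / 2 * x) * indicator {0<..} x \<partial>lborel)"
    using c by (intro nn_integral_cong) (simp add: indicator_def zero_less_mult_iff)
  also have "\<dots> = (\<integral>\<^sup>+t. F (c / 2 * t\<^sup>2) * ennreal (2 * t) * indicator {0<..} t \<partial>lborel)"
    by (rule nn_integral_square) measurable
  also have "ennreal (c / 2) * \<dots> = (\<integral>\<^sup>+t. ennreal (c / 2) * (F (c / 2 * t\<^sup>2) * ennreal (2 * t) * indicator {0<..} t) \<partial>lborel)"
    by (rule nn_integral_cmult[symmetric]) measurable
  also have "\<dots> = (\<integral>\<^sup>+t. F (t\<^sup>2 / 2 * c) * ennreal (t * c) * indicator {0<..} t \<partial>lborel)"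
  proof (intro nn_integral_cong)
    fix t :: real
    have "ennreal (c / 2) * ennreal (2 * t) = ennreal (t * c)" if "t > 0"
      using that c by (subst ennreal_mult[symmetric]) (simp_all add: mult.commute)
    then show "ennreal (c / 2) * (F (c / 2 * t\<^sup>2) * ennreal (2 * t) * indicator {0<..} t)
        = F (t\<^sup>2 / 2 * c) * ennreal (t * c) * indicator {0<..} t"
      by (auto simp: indicator_def mult_ac) (simp add: mult.assoc[symmetric])?
  qed
  finally show ?thesis .
qed

text \<open>With \<open>\<kappa> = r \<tau>\<^sub>2\<^bsup>1/2\<^esup>\<close>, the group invariant \<open>\<rho> r\<close> becomes \<open>\<kappa>\<^bsup>4\<^esup>/2\<close>, and the volume form is the product of a
  power of \<open>\<kappa>\<close> and the invariant volume form of the generic orbits.\<close>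

lemma nn_integral_fiber_coordinates:
  fixes F :: "real ^ fcoord \<Rightarrow> ennreal"
  assumes [measurable]: "F \<in> borel_measurable borel"
  shows "(\<integral>\<^sup>+u. F u * fiber_density u * indicator fiber_space u \<partial>lborel)
    = 2 * (\<integral>\<^sup>+\<kappa>. 32 * (ennreal (1 / \<kappa> ^ 15) * indicator {0<..} \<kappa>
        * (\<integral>\<^sup>+t1. \<integral>\<^sup>+t. indicator {0<..} t * ennreal (1 / t\<^sup>2) * (\<integral>\<^sup>+y. F (fpt (\<kappa> / sqrt t) (Complex t1 t) y) \<partial>lborel)
          \<partial>lborel \<partial>lborel)) \<partial>lborel)"
proof -
  let ?P = "\<lambda>w :: real ^ fcoord. indicator {0<..} (w $ FR) * indicator {0<..} (w $ FRho) :: ennreal"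
  have P: "indicator fiber_space w = ?P w" for w by (simp add: fiber_space_def indicator_def)
  have "(\<integral>\<^sup>+u. F u * fiber_density u * indicator fiber_space u \<partial>lborel)
      = 2 * (\<integral>\<^sup>+w. F (fpt_shear w) * fiber_density w * ?P w \<partial>lborel)"
    by (subst nn_integral_fpt_shear[symmetric])
       (simp_all add: P, simp add: fpt_shear_def fiber_density_def fpt_nth)
  \<comment> \<open>The variable \<open>\<rho>\<close> is replaced by t, its second type IIB
    counterpart: 1 / (r^3 \<open>\<rho>\<close>^5) times the Jacobian t r^3 is 32 / (t^9
    r^15).\<close>
  also have "(\<integral>\<^sup>+w. F (fpt_shear w) * fiber_density w * ?P w \<partial>lborel)
      = (\<integral>\<^sup>+w. F (fpt_shear (vec_upd w FRho ((w $ FRho)\<^sup>2 / 2 * (w $ FR) ^ 3)))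
          * ennreal (32 / ((w $ FRho) ^ 9 * (w $ FR) ^ 15)) * ?P w \<partial>lborel)"
  proof (rule nn_integral_coord_cong[where i = FRho])
    fix w :: "real ^ fcoord"
    show "(\<integral>\<^sup>+t. F (fpt_shear (vec_upd w FRho t)) * fiber_density (vec_upd w FRho t) * ?P (vec_upd w FRho t) \<partial>lborel)
      = (\<integral>\<^sup>+t. F (fpt_shear (vec_upd (vec_upd w FRho t) FRho ((vec_upd w FRho t $ FRho)\<^sup>2 / 2 * (vec_upd w FRho t $ FR) ^ 3)))
          * ennreal (32 / ((vec_upd w FRho t $ FRho) ^ 9 * (vec_upd w FRho t $ FR) ^ 15)) * ?P (vec_upd w FRho t) \<partial>lborel)"
    proof (cases "w $ FR > 0")
      case True
      then have c: "(w $ FR) ^ 3 > 0" by simp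
      have [measurable]: "(\<lambda>t. vec_upd w FRho t) \<in> borel_measurable borel"
        by (intro measurable_vec_upd) auto
      have "(\<integral>\<^sup>+t. (F (fpt_shear (vec_upd w FRho t)) * fiber_density (vec_upd w FRho t)) * indicator {0<..} t \<partial>lborel)
        = (\<integral>\<^sup>+t. (F (fpt_shear (vec_upd w FRho (t\<^sup>2 / 2 * (w $ FR) ^ 3))) * fiber_density (vec_upd w FRho (t\<^sup>2 / 2 * (w $ FR) ^ 3)))
             * ennreal (t * (w $ FR) ^ 3) * indicator {0<..} t \<partial>lborel)"
        by (rule nn_integral_rho_substitution[OF _ c]) measurable
      also have "\<dots> = (\<integral>\<^sup>+t. F (fpt_shear (vec_upd w FRho (t\<^sup>2 / 2 * (w $ FR) ^ 3)))
             * ennreal (32 / (t ^ 9 * (w $ FR) ^ 15)) * indicator {0<..} t \<partial>lborel)"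
      proof (intro nn_integral_cong)
        fix t :: real
        have "fiber_density (vec_upd w FRho (t\<^sup>2 / 2 * (w $ FR) ^ 3)) * ennreal (t * (w $ FR) ^ 3)
          = ennreal (32 / (t ^ 9 * (w $ FR) ^ 15))" if "t > 0"
          unfolding fiber_density_def using that True
          by (subst ennreal_mult[symmetric]) (auto simp: field_simps eval_nat_numeral)
        then show "F (fpt_shear (vec_upd w FRho (t\<^sup>2 / 2 * (w $ FR) ^ 3))) * fiber_density (vec_upd w FRho (t\<^sup>2 / 2 * (w $ FR) ^ 3))
             * ennreal (t * (w $ FR) ^ 3) * indicator {0<..} t
          = F (fpt_shear (vec_upd w FRho (t\<^sup>2 / 2 * (w $ FR) ^ 3))) * ennreal (32 / (t ^ 9 * (w $ FR) ^ 15)) * indicator {0<..} t"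
          by (auto simp: indicator_def mult.assoc)
      qed
      finally show ?thesis using True by simp
    qed simp
  qed measurable
  \<comment> \<open>Now r = \<open>\<kappa>\<close> / sqrt t. The exponent of t drops from 9 to 9 -
    15/2 + 1/2 = 2, which leaves the hyperbolic area density 1 / t^2.\<close>
  also have "\<dots> = (\<integral>\<^sup>+w. F (fpt (w $ FR / sqrt (w $ FRho)) (Complex (w $ FZl None) (w $ FRho)) (fshear_y w))
      * ennreal (32 / ((w $ FRho)\<^sup>2 * (w $ FR) ^ 15)) * ?P w \<partial>lborel)"
  proof (rule nn_integral_coord_cong[where i = FR])
    fix w :: "real ^ fcoord"
    show "(\<integral>\<^sup>+r. F (fpt_shear (vec_upd (vec_upd w FR r) FRho ((vec_upd w FR r $ FRho)\<^sup>2 / 2 * (vec_upd w FR r $ FR) ^ 3)))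
          * ennreal (32 / ((vec_upd w FR r $ FRho) ^ 9 * (vec_upd w FR r $ FR) ^ 15)) * ?P (vec_upd w FR r) \<partial>lborel)
      = (\<integral>\<^sup>+r. F (fpt (vec_upd w FR r $ FR / sqrt (vec_upd w FR r $ FRho)) (Complex (vec_upd w FR r $ FZl None) (vec_upd w FR r $ FRho)) (fshear_y (vec_upd w FR r)))
      * ennreal (32 / ((vec_upd w FR r $ FRho)\<^sup>2 * (vec_upd w FR r $ FR) ^ 15)) * ?P (vec_upd w FR r) \<partial>lborel)"
    proof (cases "w $ FRho > 0")
      case True
      let ?t = "w $ FRho"
      have sh: "fshear_y (vec_upd w FR r) = fshear_y w" "fshear_y (vec_upd (vec_upd w FR r) FRho s) = fshear_y w" for r s
        by (auto simp: fshear_y_def vec_eq_iff split: lie.split)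
      have *: "fpt_shear (vec_upd (vec_upd w FR r) FRho (?t\<^sup>2 / 2 * r ^ 3)) = fpt r (Complex (w $ FZl None) ?t) (fshear_y w)" for r
        by (subst fpt_shear_eq_fpt[of _ ?t]) (simp_all add: sh)
      have [measurable]: "(\<lambda>r. vec_upd w FR r) \<in> borel_measurable borel"
        by (intro measurable_vec_upd) auto
      have [measurable]: "(\<lambda>r. fpt r (Complex (w $ FZl None) ?t) (fshear_y w)) \<in> borel_measurable borel"
        unfolding *[symmetric] by measurable
      have "(\<integral>\<^sup>+r. F (fpt r (Complex (w $ FZl None) ?t) (fshear_y w)) * ennreal (32 / (?t ^ 9 * r ^ 15)) * indicator {0<..} r \<partial>lborel)
        = ennreal (1 / sqrt ?t) * (\<integral>\<^sup>+r. F (fpt (r / sqrt ?t) (Complex (w $ FZl None) ?t) (fshear_y w))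
            * ennreal (32 / (?t ^ 9 * (r / sqrt ?t) ^ 15)) * indicator {0<..} (r / sqrt ?t) \<partial>lborel)"
        using True by (subst nn_integral_real_affine[of _ "1 / sqrt ?t" 0]) simp_all
      also have "\<dots> = (\<integral>\<^sup>+r. ennreal (1 / sqrt ?t) * (F (fpt (r / sqrt ?t) (Complex (w $ FZl None) ?t) (fshear_y w))
            * ennreal (32 / (?t ^ 9 * (r / sqrt ?t) ^ 15)) * indicator {0<..} (r / sqrt ?t)) \<partial>lborel)"
        by (rule nn_integral_cmult[symmetric]) measurable
      also have "\<dots> = (\<integral>\<^sup>+r. F (fpt (r / sqrt ?t) (Complex (w $ FZl None) ?t) (fshear_y w))
            * ennreal (32 / (?t\<^sup>2 * r ^ 15)) * indicator {0<..} r \<partial>lborel)"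
      proof (intro nn_integral_cong)
        fix r :: real
        have "ennreal (1 / sqrt ?t) * ennreal (32 / (?t ^ 9 * (r / sqrt ?t) ^ 15)) = ennreal (32 / (?t\<^sup>2 * r ^ 15))" if "r > 0"
        proof -
          define q where "q = sqrt ?t"
          have q: "q > 0" "?t = q\<^sup>2" using True by (simp_all add: q_def)
          have "1 / q * (32 / ((q\<^sup>2) ^ 9 * (r / q) ^ 15)) = 32 / ((q\<^sup>2)\<^sup>2 * r ^ 15)"
            using q that by (simp add: field_simps power_mult[symmetric]) (simp add: eval_nat_numeral)?
          then show ?thesis unfolding q_def[symmetric] unfolding q(2)
            using that q by (subst ennreal_mult[symmetric]) simp_all
        qed
        moreover have "r / sqrt ?t > 0 \<longleftrightarrow> r > 0" using True by (simp add: zero_less_divide_iff)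
        ultimately show "ennreal (1 / sqrt ?t) * (F (fpt (r / sqrt ?t) (Complex (w $ FZl None) ?t) (fshear_y w))
            * ennreal (32 / (?t ^ 9 * (r / sqrt ?t) ^ 15)) * indicator {0<..} (r / sqrt ?t))
          = F (fpt (r / sqrt ?t) (Complex (w $ FZl None) ?t) (fshear_y w)) * ennreal (32 / (?t\<^sup>2 * r ^ 15)) * indicator {0<..} r"
          by (cases "r > 0") (simp_all add: indicator_def mult.left_commute[of "ennreal (1 / sqrt ?t)" "F _"])
      qed
      finally show ?thesis using True by (simp add: *[simplified] sh)
    qed simp
  next
    show "(\<lambda>w. F (fpt (w $ FR / sqrt (w $ FRho)) (Complex (w $ FZl None) (w $ FRho)) (fshear_y w))
      * ennreal (32 / ((w $ FRho)\<^sup>2 * (w $ FR) ^ 15)) * ?P w) \<in> borel_measurable borel" by measurable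
  qed measurable
  also have "\<dots> = (\<integral>\<^sup>+\<kappa>. \<integral>\<^sup>+t1. \<integral>\<^sup>+t. \<integral>\<^sup>+y. F (fpt (\<kappa> / sqrt t) (Complex t1 t) y)
      * ennreal (32 / (t\<^sup>2 * \<kappa> ^ 15)) * (indicator {0<..} \<kappa> * indicator {0<..} t) \<partial>lborel \<partial>lborel \<partial>lborel \<partial>lborel)"
    by (subst nn_integral_fcoord_split) (simp_all add: fshear_y_fcoord_of fcoord_of_nth)
  also have "\<dots> = (\<integral>\<^sup>+\<kappa>. 32 * (ennreal (1 / \<kappa> ^ 15) * indicator {0<..} \<kappa>
        * (\<integral>\<^sup>+t1. \<integral>\<^sup>+t. indicator {0<..} t * ennreal (1 / t\<^sup>2) * (\<integral>\<^sup>+y. F (fpt (\<kappa> / sqrt t) (Complex t1 t) y) \<partial>lborel)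
          \<partial>lborel \<partial>lborel)) \<partial>lborel)"
  proof (intro nn_integral_cong)
    fix \<kappa> :: real
    have "(\<integral>\<^sup>+y. F (fpt (\<kappa> / sqrt t) (Complex t1 t) y) * ennreal (32 / (t\<^sup>2 * \<kappa> ^ 15))
          * (indicator {0<..} \<kappa> * indicator {0<..} t) \<partial>lborel)
      = 32 * (ennreal (1 / \<kappa> ^ 15) * indicator {0<..} \<kappa>) * (indicator {0<..} t * ennreal (1 / t\<^sup>2)
          * (\<integral>\<^sup>+y. F (fpt (\<kappa> / sqrt t) (Complex t1 t) y) \<partial>lborel))" for t1 t
    proof (cases "\<kappa> > 0 \<and> t > 0")
      case True
      then have "ennreal (32 / (t\<^sup>2 * \<kappa> ^ 15)) = ennreal 32 * (ennreal (1 / \<kappa> ^ 15) * ennreal (1 / t\<^sup>2))"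
        by (subst ennreal_mult[symmetric], simp, simp, subst ennreal_mult[symmetric]) (simp_all add: mult.commute)
      then show ?thesis using True by (simp add: nn_integral_cmult mult_ac)
    qed (auto simp: indicator_def)
    then show "(\<integral>\<^sup>+t1. \<integral>\<^sup>+t. \<integral>\<^sup>+y. F (fpt (\<kappa> / sqrt t) (Complex t1 t) y)
      * ennreal (32 / (t\<^sup>2 * \<kappa> ^ 15)) * (indicator {0<..} \<kappa> * indicator {0<..} t) \<partial>lborel \<partial>lborel \<partial>lborel)
      = 32 * (ennreal (1 / \<kappa> ^ 15) * indicator {0<..} \<kappa>
        * (\<integral>\<^sup>+t1. \<integral>\<^sup>+t. indicator {0<..} t * ennreal (1 / t\<^sup>2) * (\<integral>\<^sup>+y. F (fpt (\<kappa> / sqrt t) (Complex t1 t) y) \<partial>lborel)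
          \<partial>lborel \<partial>lborel))"
      by (simp add: nn_integral_cmult mult.assoc)
  qed
  finally show ?thesis .
qed

section \<open>From matrices to the orbit of i in the upper half plane\<close>

lemma nn_integral_swap:
  fixes F :: "'a::euclidean_space \<Rightarrow> 'b::euclidean_space \<Rightarrow> ennreal"
  assumes "(\<lambda>p. F (fst p) (snd p)) \<in> borel_measurable borel"
  shows "(\<integral>\<^sup>+x. \<integral>\<^sup>+y. F x y \<partial>lborel \<partial>lborel) = (\<integral>\<^sup>+y. \<integral>\<^sup>+x. F x y \<partial>lborel \<partial>lborel)"
proof -
  have "case_prod F \<in> borel_measurable (lborel \<Otimes>\<^sub>M lborel)"
    using assms by (simp add: lborel_prod case_prod_beta')
  then show ?thesis by (rule lborel_pair.Fubini'[symmetric])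
qed

text \<open>For a fixed second row (c, d) the first row goes to the real and imaginary part of (a i
  + b) / (c i + d), a reflection scaled by the inverse length of (c, d). For d = 0 it is diagonal;
  otherwise one substitutes for b, exchanges the integrals and substitutes for a.\<close>

lemma nn_integral_reflection:
  fixes F :: "real \<times> real \<Rightarrow> ennreal"
  assumes [measurable]: "F \<in> borel_measurable borel" and n: "c\<^sup>2 + d\<^sup>2 > 0"
  shows "(\<integral>\<^sup>+a. \<integral>\<^sup>+b. F ((a * c + b * d) / (c\<^sup>2 + d\<^sup>2), (a * d - b * c) / (c\<^sup>2 + d\<^sup>2)) \<partial>lborel \<partial>lborel)
    = ennreal (c\<^sup>2 + d\<^sup>2) * (\<integral>\<^sup>+x. \<integral>\<^sup>+y. F (x, y) \<partial>lborel \<partial>lborel)"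
proof (cases "d = 0")
  case True
  then have c: "c \<noteq> 0" using n by auto
  have "(\<integral>\<^sup>+a. \<integral>\<^sup>+b. F ((a * c + b * d) / (c\<^sup>2 + d\<^sup>2), (a * d - b * c) / (c\<^sup>2 + d\<^sup>2)) \<partial>lborel \<partial>lborel)
      = (\<integral>\<^sup>+a. \<integral>\<^sup>+b. F (a / c, - b / c) \<partial>lborel \<partial>lborel)"
    using c True by (simp add: power2_eq_square)
  also have "\<dots> = (\<integral>\<^sup>+a. ennreal \<bar>c\<bar> * (\<integral>\<^sup>+b. F (a / c, b) \<partial>lborel) \<partial>lborel)"
    using c by (intro nn_integral_cong, subst nn_integral_real_affine[of _ "- c" 0]) simp_all
  also have "\<dots> = ennreal \<bar>c\<bar> * (\<integral>\<^sup>+a. \<integral>\<^sup>+b. F (a / c, b) \<partial>lborel \<partial>lborel)"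
    by (simp add: nn_integral_cmult)
  also have "(\<integral>\<^sup>+a. \<integral>\<^sup>+b. F (a / c, b) \<partial>lborel \<partial>lborel) = ennreal \<bar>c\<bar> * (\<integral>\<^sup>+a. \<integral>\<^sup>+b. F (a, b) \<partial>lborel \<partial>lborel)"
    using c by (subst nn_integral_real_affine[of _ c 0]) simp_all
  also have "ennreal \<bar>c\<bar> * (ennreal \<bar>c\<bar> * X) = ennreal (c\<^sup>2 + d\<^sup>2) * X" for X
    by (simp add: True mult.assoc[symmetric] ennreal_mult[symmetric] abs_mult_self_eq power2_eq_square)
  finally show ?thesis .
next
  case d: False
  let ?n = "c\<^sup>2 + d\<^sup>2"
  have "(\<integral>\<^sup>+a. \<integral>\<^sup>+b. F ((a * c + b * d) / ?n, (a * d - b * c) / ?n) \<partial>lborel \<partial>lborel)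
      = (\<integral>\<^sup>+a. ennreal \<bar>?n / d\<bar> * (\<integral>\<^sup>+x. F (x, (a - c * x) / d) \<partial>lborel) \<partial>lborel)"
  proof (rule nn_integral_cong)
    fix a :: real
    have 1: "(a * c + (- (c * a) / d + ?n / d * x) * d) / ?n = x" for x
    proof -
      have "a * c + (- (c * a) / d + ?n / d * x) * d = ?n * x" using d by (simp add: field_simps)
      then show ?thesis using nonzero_mult_div_cancel_left[OF less_imp_neq[OF n, symmetric]] by simp
    qed
    have 2: "(a * d - (- (c * a) / d + ?n / d * x) * c) / ?n = (a - c * x) / d" for x
    proof -
      have "(a * d - (- (c * a) / d + ?n / d * x) * c) = ?n * (a - c * x) / d"
        using d by (simp add: field_simps power2_eq_square)
      then show ?thesis using n by simp
    qed
    have "(\<integral>\<^sup>+b. F ((a * c + b * d) / ?n, (a * d - b * c) / ?n) \<partial>lborel)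
      = ennreal \<bar>?n / d\<bar> * (\<integral>\<^sup>+x. F ((a * c + (- (c * a) / d + ?n / d * x) * d) / ?n,
           (a * d - (- (c * a) / d + ?n / d * x) * c) / ?n) \<partial>lborel)"
      using d n by (intro nn_integral_real_affine) auto
    then show "(\<integral>\<^sup>+b. F ((a * c + b * d) / ?n, (a * d - b * c) / ?n) \<partial>lborel)
      = ennreal \<bar>?n / d\<bar> * (\<integral>\<^sup>+x. F (x, (a - c * x) / d) \<partial>lborel)"
      unfolding 1 2 .
  qed
  also have "\<dots> = ennreal \<bar>?n / d\<bar> * (\<integral>\<^sup>+a. \<integral>\<^sup>+x. F (x, (a - c * x) / d) \<partial>lborel \<partial>lborel)"
    by (simp add: nn_integral_cmult)
  also have "(\<integral>\<^sup>+a. \<integral>\<^sup>+x. F (x, (a - c * x) / d) \<partial>lborel \<partial>lborel)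
      = (\<integral>\<^sup>+x. \<integral>\<^sup>+a. F (x, (a - c * x) / d) \<partial>lborel \<partial>lborel)"
    by (rule nn_integral_swap) measurable
  also have "\<dots> = (\<integral>\<^sup>+x. ennreal \<bar>d\<bar> * (\<integral>\<^sup>+y. F (x, y) \<partial>lborel) \<partial>lborel)"
  proof (rule nn_integral_cong)
    fix x :: real
    show "(\<integral>\<^sup>+a. F (x, (a - c * x) / d) \<partial>lborel) = ennreal \<bar>d\<bar> * (\<integral>\<^sup>+y. F (x, y) \<partial>lborel)"
      using d by (subst nn_integral_real_affine[of _ d "c * x"]) simp_all
  qed
  also have "\<dots> = ennreal \<bar>d\<bar> * (\<integral>\<^sup>+x. \<integral>\<^sup>+y. F (x, y) \<partial>lborel \<partial>lborel)"
    by (simp add: nn_integral_cmult)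
  also have "ennreal \<bar>?n / d\<bar> * (ennreal \<bar>d\<bar> * X) = ennreal ?n * X" for X
    using d n by (simp add: mult.assoc[symmetric] ennreal_mult[symmetric] abs_mult[symmetric])
  finally show ?thesis .
qed

text \<open>The second row comes first, so that it is held fixed while the first row is
  integrated.\<close>

definition mat2 :: "(real \<times> real) \<times> (real \<times> real) \<Rightarrow> real ^ 2 ^ 2" where
  "mat2 = (\<lambda>((c, d), (a, b)). \<chi> i j. if i = 1 then (if j = 1 then a else b) else (if j = 1 then c else d))"

lemma mat2_nth [simp]: "mat2 ((c, d), (a, b)) $ 1 $ 1 = a" "mat2 ((c, d), (a, b)) $ 1 $ 2 = b"
  "mat2 ((c, d), (a, b)) $ 2 $ 1 = c" "mat2 ((c, d), (a, b)) $ 2 $ 2 = d"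
  by (simp_all add: mat2_def)

lemma linear_mat2: "linear mat2"
  by (rule linearI) (auto intro!: matrix_2_eqI simp: mat2_def)

lemma measurable_mat2 [measurable]: "mat2 \<in> borel_measurable borel"
  using linear_mat2 by (intro borel_measurable_continuous_onI linear_continuous_on)
    (simp add: linear_conv_bounded_linear)

lemma nn_integral_mat2:
  fixes F :: "real ^ 2 ^ 2 \<Rightarrow> ennreal"
  assumes F: "F \<in> borel_measurable borel"
  shows "(\<integral>\<^sup>+C. F C \<partial>lborel) = (\<integral>\<^sup>+p. \<integral>\<^sup>+q. F (mat2 (p, q)) \<partial>lborel \<partial>lborel)"
proof -
  note [measurable] = F
  have ax: "mat2 ((1, 0), 0) = axis 2 (axis 1 1)" "mat2 ((0, 1), 0) = axis 2 (axis 2 1)"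
    "mat2 (0, (1, 0)) = axis 1 (axis 1 1)" "mat2 (0, (0, 1)) = axis 1 (axis 2 1)"
    by (auto intro!: matrix_2_eqI simp: axis_def zero_prod_def)
  have Bm: "(Basis :: (real ^ 2 ^ 2) set)
     = {axis 1 (axis 1 1), axis 1 (axis 2 1), axis 2 (axis 1 1), axis 2 (axis 2 1)}"
    by (auto simp: Basis_vec_def UNIV_2 image_iff)
  have Bp: "(Basis :: ((real \<times> real) \<times> (real \<times> real)) set) = {((1, 0), 0), ((0, 1), 0), (0, (1, 0)), (0, (0, 1))}"
    by (auto simp: Basis_prod_def zero_prod_def)
  have bij: "bij_betw mat2 Basis Basis"
  proof (rule bij_betw_imageI)
    show "inj_on mat2 Basis" 
      by (rule inj_on_inverseI[where g = "\<lambda>C. ((C $ 2 $ 1, C $ 2 $ 2), (C $ 1 $ 1, C $ 1 $ 2))"]) (auto simp: mat2_def)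
    show "mat2 ` Basis = Basis" unfolding Bm Bp by (auto simp: ax)
  qed
  have "(\<integral>\<^sup>+C. F C \<partial>lborel) = (\<integral>\<^sup>+p. F (mat2 p) \<partial>lborel)"
    by (rule nn_integral_lborel_Basis[OF linear_mat2 bij F])
  also have "\<dots> = (\<integral>\<^sup>+p. \<integral>\<^sup>+q. F (mat2 (p, q)) \<partial>lborel \<partial>lborel)"
    by (rule nn_integral_lborel_Pair) measurable
  finally show ?thesis .
qed

text \<open>The volume form \<open>d\<tau>\<^sub>1 d\<tau>\<^sub>2 / \<tau>\<^sub>2\<^sup>2\<close> on the orbit of \<open>\<i>\<close>: for a fixed second row \<open>(c, d)\<close>, the first row
  depends linearly on \<open>\<tau>\<close>, with determinant \<open>c\<^sup>2 + d\<^sup>2\<close>.\<close>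

definition cone_const :: ennreal where
  "cone_const = (\<integral>\<^sup>+p. ennreal ((fst p)\<^sup>2 + (snd p)\<^sup>2) * indicator {0..1} ((fst p)\<^sup>2 + (snd p)\<^sup>2) \<partial>(lborel :: (real \<times> real) measure))"

lemma cone_const_pos: "cone_const > 0"
proof -
  let ?S = "{p :: real \<times> real. 0 < (fst p)\<^sup>2 + (snd p)\<^sup>2 \<and> (fst p)\<^sup>2 + (snd p)\<^sup>2 < 1}"
  let ?f = "\<lambda>p :: real \<times> real. ennreal ((fst p)\<^sup>2 + (snd p)\<^sup>2) * indicator {0..1} ((fst p)\<^sup>2 + (snd p)\<^sup>2)"
  have op: "open ?S" by (intro open_Collect_conj open_Collect_less continuous_intros)
  have "(1 / 2, 0) \<in> ?S" by (simp add: power2_eq_square)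
  then have pos: "emeasure lborel ?S > 0" using op emeasure_lborel_open_pos[of ?S] by blast
  show ?thesis
  proof (rule ccontr)
    assume "\<not> cone_const > 0"
    then have "(\<integral>\<^sup>+p. ?f p \<partial>lborel) = 0" by (simp add: cone_const_def not_less)
    then have "AE p in lborel. ?f p = 0" by (subst (asm) nn_integral_0_iff_AE) auto
    then have "AE p in lborel. p \<notin> ?S" by (rule AE_mp) (auto intro!: AE_I2 simp: indicator_def)
    then have "emeasure lborel ?S = 0"
      using op by (subst (asm) AE_iff_measurable[where N = ?S]) auto
    then show False using pos by simp
  qed
qed

text \<open>Scaling by 1 / sqrt t: the weight is homogeneous of degree two and the plane has
  dimension two, which gives t^-2, the density of hyperbolic area.\<close>

lemma cone_const_scale:
  assumes t: "t > 0"
  shows "(\<integral>\<^sup>+p. ennreal ((fst p)\<^sup>2 + (snd p)\<^sup>2) * indicator {0..1} (((fst p)\<^sup>2 + (snd p)\<^sup>2) * t) \<partial>(lborel :: (real \<times> real) measure))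
    = ennreal (1 / t\<^sup>2) * cone_const"
proof -
  define q where "q = 1 / sqrt t"
  have q: "q > 0" and tq: "t = 1 / q\<^sup>2" using t by (simp_all add: q_def power_divide)
  let ?f = "\<lambda>p :: real \<times> real. ennreal ((fst p)\<^sup>2 + (snd p)\<^sup>2) * indicator {0..1} (((fst p)\<^sup>2 + (snd p)\<^sup>2) * t)"
  let ?g = "\<lambda>p :: real \<times> real. ennreal ((fst p)\<^sup>2 + (snd p)\<^sup>2) * indicator {0..1} ((fst p)\<^sup>2 + (snd p)\<^sup>2)"
  have f: "?f (q * c, q * d) = ennreal (q\<^sup>2) * ?g (c, d)" for c d
  proof -
    have "(q * c)\<^sup>2 + (q * d)\<^sup>2 = q\<^sup>2 * (c\<^sup>2 + d\<^sup>2)" by (simp add: algebra_simps power2_eq_square)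
    then show ?thesis using q by (simp add: tq ennreal_mult mult.assoc)
  qed
  have "(\<integral>\<^sup>+p. ?f p \<partial>lborel) = (\<integral>\<^sup>+c. \<integral>\<^sup>+d. ?f (c, d) \<partial>lborel \<partial>lborel)"
    by (rule nn_integral_lborel_Pair) measurable
  also have "\<dots> = ennreal q * (\<integral>\<^sup>+c. \<integral>\<^sup>+d. ?f (q * c, d) \<partial>lborel \<partial>lborel)"
    using q by (subst nn_integral_real_affine[of _ q 0]) simp_all
  also have "(\<integral>\<^sup>+c. \<integral>\<^sup>+d. ?f (q * c, d) \<partial>lborel \<partial>lborel) = (\<integral>\<^sup>+c. ennreal q * (\<integral>\<^sup>+d. ?f (q * c, q * d) \<partial>lborel) \<partial>lborel)"
    using q by (intro nn_integral_cong, subst nn_integral_real_affine[of _ q 0]) simp_all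
  also have "\<dots> = ennreal q * (ennreal (q\<^sup>2) * (\<integral>\<^sup>+c. \<integral>\<^sup>+d. ?g (c, d) \<partial>lborel \<partial>lborel))"
    unfolding f by (simp add: nn_integral_cmult)
  also have "(\<integral>\<^sup>+c. \<integral>\<^sup>+d. ?g (c, d) \<partial>lborel \<partial>lborel) = cone_const"
    unfolding cone_const_def by (rule nn_integral_lborel_Pair[symmetric]) measurable
  also have "ennreal q * (ennreal q * (ennreal (q\<^sup>2) * X)) = ennreal (1 / t\<^sup>2) * X" for X
    using q by (simp add: tq mult.assoc[symmetric] ennreal_mult[symmetric] power2_eq_square)
  finally show ?thesis .
qed

text \<open>Since det C is Im (C i) times c^2 + d^2, lying in the cone becomes, for a fixed image
  point, a condition on (c, d). The Jacobian of the first row is c^2 + d^2 as well, so after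
  exchanging the integrals the second row contributes \<open>cone_const\<close> over t^2.\<close>

lemma nn_integral_cone:
  fixes G :: "real \<times> real \<Rightarrow> ennreal"
  assumes [measurable]: "G \<in> borel_measurable borel"
  shows "(\<integral>\<^sup>+C. indicator sl2_cone C * G (Re (mob C \<i>), Im (mob C \<i>)) \<partial>lborel)
    = cone_const * (\<integral>\<^sup>+t1. \<integral>\<^sup>+t. indicator {0<..} t * ennreal (1 / t\<^sup>2) * G (t1, t) \<partial>lborel \<partial>lborel)"
proof -
  have mob: "Re (mob (mat2 ((c, d), (a, b))) \<i>) = (a * c + b * d) / (c\<^sup>2 + d\<^sup>2)"
    "Im (mob (mat2 ((c, d), (a, b))) \<i>) = (a * d - b * c) / (c\<^sup>2 + d\<^sup>2)" for a b c d
    by (simp_all add: mob_def mob_denom_def Re_divide Im_divide algebra_simps)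
  have mob_m [measurable]: "(\<lambda>C. Re (mob C \<i>)) \<in> borel_measurable borel" "(\<lambda>C. Im (mob C \<i>)) \<in> borel_measurable borel"
    by (simp_all add: mob_def mob_denom_def Re_divide Im_divide)
  let ?n = "\<lambda>p :: real \<times> real. (fst p)\<^sup>2 + (snd p)\<^sup>2"
  let ?H = "\<lambda>p q :: real \<times> real. indicator {0<..1} (snd q * ?n p) * G q :: ennreal"
  have cone: "indicator sl2_cone (mat2 ((c, d), (a, b))) * G ((a * c + b * d) / (c\<^sup>2 + d\<^sup>2), (a * d - b * c) / (c\<^sup>2 + d\<^sup>2))
      = ?H (c, d) ((a * c + b * d) / (c\<^sup>2 + d\<^sup>2), (a * d - b * c) / (c\<^sup>2 + d\<^sup>2))"
    if "c\<^sup>2 + d\<^sup>2 > 0" for a b c d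
    using that by (simp add: sl2_cone_def det_2 indicator_def)
  have "(\<integral>\<^sup>+C. indicator sl2_cone C * G (Re (mob C \<i>), Im (mob C \<i>)) \<partial>lborel)
     = (\<integral>\<^sup>+p. \<integral>\<^sup>+q. indicator sl2_cone (mat2 (p, q)) * G (Re (mob (mat2 (p, q)) \<i>), Im (mob (mat2 (p, q)) \<i>)) \<partial>lborel \<partial>lborel)"
    by (rule nn_integral_mat2) measurable
  also have "\<dots> = (\<integral>\<^sup>+p. ennreal (?n p) * (\<integral>\<^sup>+q. ?H p q \<partial>lborel) \<partial>lborel)"
  proof (rule nn_integral_cong_AE)
    have "AE p in lborel. p \<noteq> (0 :: real \<times> real)" by (rule AE_lborel_singleton)
    then show "AE p in lborel. (\<integral>\<^sup>+q. indicator sl2_cone (mat2 (p, q)) * G (Re (mob (mat2 (p, q)) \<i>), Im (mob (mat2 (p, q)) \<i>)) \<partial>lborel)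
      = ennreal (?n p) * (\<integral>\<^sup>+q. ?H p q \<partial>lborel)"
    proof eventually_elim
      case (elim p)
      obtain c d where p: "p = (c, d)" by (cases p)
      have n: "c\<^sup>2 + d\<^sup>2 > 0" using elim by (auto simp: p zero_prod_def sum_power2_gt_zero_iff)
      have [measurable]: "(\<lambda>q. ?H (c, d) q) \<in> borel_measurable borel" by measurable
      have "(\<integral>\<^sup>+q. indicator sl2_cone (mat2 (p, q)) * G (Re (mob (mat2 (p, q)) \<i>), Im (mob (mat2 (p, q)) \<i>)) \<partial>lborel)
        = (\<integral>\<^sup>+a. \<integral>\<^sup>+b. indicator sl2_cone (mat2 (p, (a, b))) * G (Re (mob (mat2 (p, (a, b))) \<i>), Im (mob (mat2 (p, (a, b))) \<i>)) \<partial>lborel \<partial>lborel)"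
        unfolding p by (rule nn_integral_lborel_Pair) measurable
      also have "\<dots> = (\<integral>\<^sup>+a. \<integral>\<^sup>+b. ?H (c, d) ((a * c + b * d) / (c\<^sup>2 + d\<^sup>2), (a * d - b * c) / (c\<^sup>2 + d\<^sup>2)) \<partial>lborel \<partial>lborel)"
        unfolding p mob cone[OF n] ..
      also have "\<dots> = ennreal (c\<^sup>2 + d\<^sup>2) * (\<integral>\<^sup>+x. \<integral>\<^sup>+y. ?H (c, d) (x, y) \<partial>lborel \<partial>lborel)"
        by (rule nn_integral_reflection[OF _ n]) measurable
      also have "(\<integral>\<^sup>+x. \<integral>\<^sup>+y. ?H (c, d) (x, y) \<partial>lborel \<partial>lborel) = (\<integral>\<^sup>+q. ?H (c, d) q \<partial>lborel)"
        by (rule nn_integral_lborel_Pair[symmetric]) measurable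
      finally show ?case by (simp add: p)
    qed
  qed
  also have "\<dots> = (\<integral>\<^sup>+p. \<integral>\<^sup>+q. ennreal (?n p) * ?H p q \<partial>lborel \<partial>lborel)"
    by (simp add: nn_integral_cmult)
  also have "\<dots> = (\<integral>\<^sup>+q. \<integral>\<^sup>+p. ennreal (?n p) * ?H p q \<partial>lborel \<partial>lborel)"
    by (rule nn_integral_swap) measurable
  also have "\<dots> = (\<integral>\<^sup>+q. cone_const * (indicator {0<..} (snd q) * ennreal (1 / (snd q)\<^sup>2) * G q) \<partial>lborel)"
  proof (rule nn_integral_cong)
    fix q :: "real \<times> real"
    show "(\<integral>\<^sup>+p. ennreal (?n p) * ?H p q \<partial>lborel) = cone_const * (indicator {0<..} (snd q) * ennreal (1 / (snd q)\<^sup>2) * G q)"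
    proof (cases "snd q > 0")
      case True
      have "ennreal (?n p) * ?H p q = ennreal (?n p) * indicator {0..1} (?n p * snd q) * G q" for p
      proof (cases "?n p > 0")
        case True
        then show ?thesis using \<open>snd q > 0\<close> by (simp add: indicator_def mult.commute)
      next
        case False
        then have "?n p = 0" by (smt (verit) sum_power2_ge_zero)
        then show ?thesis by simp
      qed
      then have "(\<integral>\<^sup>+p. ennreal (?n p) * ?H p q \<partial>lborel) = (\<integral>\<^sup>+p. ennreal (?n p) * indicator {0..1} (?n p * snd q) \<partial>lborel) * G q"
        by (simp add: nn_integral_multc)
      then show ?thesis unfolding cone_const_scale[OF True] using True by (simp add: mult_ac)
    next
      case False
      have z: "ennreal (?n p) * ?H p q = 0" for p
      proof -
        have "snd q * ?n p \<le> 0" using False by (intro mult_nonpos_nonneg) auto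
        then show ?thesis by (simp add: indicator_def)
      qed
      show ?thesis unfolding z using False by simp
    qed
  qed
  also have "\<dots> = cone_const * (\<integral>\<^sup>+q. indicator {0<..} (snd q) * ennreal (1 / (snd q)\<^sup>2) * G q \<partial>lborel)"
    by (rule nn_integral_cmult) measurable
  also have "(\<integral>\<^sup>+q. indicator {0<..} (snd q) * ennreal (1 / (snd q)\<^sup>2) * G q \<partial>lborel)
     = (\<integral>\<^sup>+t1. \<integral>\<^sup>+t. indicator {0<..} t * ennreal (1 / t\<^sup>2) * G (t1, t) \<partial>lborel \<partial>lborel)"
  proof -
    have "(\<lambda>q. indicator {0<..} (snd q) * ennreal (1 / (snd q)\<^sup>2) * G q) \<in> borel_measurable borel" by measurable
    from nn_integral_lborel_Pair[OF this] show ?thesis by simp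
  qed
  finally show ?thesis .
qed

section \<open>Lattices\<close>

text \<open>Each point receives a basic open set that meets \<open>S\<close> in it alone; this
  choice is injective into a countable basis.\<close>

lemma countable_discrete:
  fixes S :: "'a::second_countable_topology set"
  assumes "discrete S" shows "countable S"
proof -
  obtain \<B> :: "'a set set" where \<B>: "countable \<B>" "topological_basis \<B>"
    using ex_countable_basis by auto
  have "\<exists>V\<in>\<B>. V \<inter> S = {x}" if x: "x \<in> S" for x
  proof -
    obtain U where U: "open U" "U \<inter> S = {x}"
      using assms x by (auto simp: discrete_def isolated_in_def)
    then have "x \<in> U" by auto
    obtain V where V: "V \<in> \<B>" "x \<in> V" "V \<subseteq> U" using topological_basisE[OF \<B>(2) U(1) \<open>x \<in> U\<close>] .
    then show ?thesis using U x by (intro bexI[of _ V]) auto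
  qed
  then obtain f where f: "\<And>x. x \<in> S \<Longrightarrow> f x \<in> \<B>" "\<And>x. x \<in> S \<Longrightarrow> f x \<inter> S = {x}" by metis
  have "inj_on f S" using f(2) by (metis inj_onI the_elem_eq)
  moreover have "countable (f ` S)" using \<B>(1) f(1) by (meson countable_subset image_subsetI)
  ultimately show ?thesis by (rule countable_image_inj_on[rotated])
qed

section \<open>Points with nontrivial stabilizer\<close>

text \<open>Tonelli in direction i: every line in this direction meets \<open>N\<close> in at most
  one point.\<close>

lemma null_sets_coordI:
  fixes N :: "(real ^ 'n) set"
  assumes [measurable]: "N \<in> sets borel"
    and N: "\<And>x. \<exists>t0. \<forall>t. vec_upd x i t \<in> N \<longrightarrow> t = t0"
  shows "N \<in> null_sets lborel"
proof -
  have "emeasure lborel N = (\<integral>\<^sup>+x. indicator N x \<partial>lborel)" by simp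
  also have "\<dots> = (\<integral>\<^sup>+x. 0 \<partial>(lborel :: (real ^ 'n) measure))"
  proof (rule nn_integral_coord_cong[where i = i])
    fix x :: "real ^ 'n"
    obtain t0 where t0: "\<And>t. vec_upd x i t \<in> N \<Longrightarrow> t = t0" using N by blast
    have "(\<integral>\<^sup>+t. indicator N (vec_upd x i t) \<partial>lborel) \<le> (\<integral>\<^sup>+t. indicator {t0} t \<partial>lborel)"
      using t0 by (intro nn_integral_mono) (auto simp: indicator_def)
    then show "(\<integral>\<^sup>+t. indicator N (vec_upd x i t) \<partial>lborel) = (\<integral>\<^sup>+t. 0 \<partial>(lborel :: real measure))" by simp
  qed simp_all
  finally show ?thesis by (simp add: null_sets_def)
qed

lemma fixed_hyperplane_null:
  assumes "\<alpha> \<noteq> 0 \<or> \<beta> \<noteq> 0"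
  shows "{u :: real ^ fcoord. \<alpha> * (u $ FZl None * u $ FB 1 - u $ FZl (Some 1)) + \<beta> * u $ FB 1 = \<gamma>} \<in> null_sets lborel"
proof (cases "\<alpha> = 0")
  case False
  show ?thesis
  proof (rule null_sets_coordI[where i = "FZl (Some 1)"])
    fix x :: "real ^ fcoord"
    show "\<exists>t0. \<forall>t. vec_upd x (FZl (Some 1)) t \<in> {u. \<alpha> * (u $ FZl None * u $ FB 1 - u $ FZl (Some 1)) + \<beta> * u $ FB 1 = \<gamma>} \<longrightarrow> t = t0"
      using False by (intro exI[of _ "(\<alpha> * x $ FZl None * x $ FB 1 + \<beta> * x $ FB 1 - \<gamma>) / \<alpha>"]) (auto simp: field_simps)
  qed measurable
next
  case True
  show ?thesis
  proof (rule null_sets_coordI[where i = "FB 1"])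
    fix x :: "real ^ fcoord"
    show "\<exists>t0. \<forall>t. vec_upd x (FB 1) t \<in> {u. \<alpha> * (u $ FZl None * u $ FB 1 - u $ FZl (Some 1)) + \<beta> * u $ FB 1 = \<gamma>} \<longrightarrow> t = t0"
      using True assms by (intro exI[of _ "\<gamma> / \<beta>"]) (auto simp: field_simps)
  qed measurable
qed

text \<open>A nontrivial left translation has no fixed points, so the matrix A may be taken
  different from 1. Then fixing u imposes, in one of the components \<open>LP 1\<close> and
  \<open>LV 1\<close>, a nontrivial affine equation on (c^1, b^1).\<close>

lemma fixed_points_null:
  assumes c: "c \<in> sl2 \<times> UNIV" "c \<noteq> (mat 1, 0)"
  obtains N where "N \<in> null_sets lborel" "\<And>u. u \<in> fiber_space \<Longrightarrow> fiber_act c u = u \<Longrightarrow> u \<in> N"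
proof -
  let ?A = "fst c" and ?y = "yexp (snd c)"
  have A: "?A \<in> sl2" using c by auto
  have fx: "sl2_lie ?A (ymul ?y (fy u)) = fy u" if "u \<in> fiber_space" "fiber_act c u = u" for u
  proof -
    have r: "u $ FR > 0" using that by (simp add: fiber_space_def)
    have "fy (fiber_act c u) = fy u" using that by simp
    then show ?thesis by (simp add: fiber_act_def)
  qed
  have fy1: "fy u $ LP 1 = u $ FZl None * u $ FB 1 - u $ FZl (Some 1)" "fy u $ LV 1 = u $ FB 1" for u
    by (simp_all add: fy_def Let_def)
  show ?thesis
  proof (cases "?A = mat 1")
    case True
    have "False" if "u \<in> fiber_space" "fiber_act c u = u" for u
    proof -
      have "ymul ?y (fy u) = fy u" using fx[OF that] True by simp
      then have "ymul (ymul ?y (fy u)) (yinv (fy u)) = ymul (fy u) (yinv (fy u))" by simp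
      then have "?y = 0" by (simp add: ymul_assoc)
      then have "snd c = 0" by (metis ylog_0 ylog_yexp)
      then show False using True c(2) by (metis prod.collapse)
    qed
    then show ?thesis using that[of "{}"] by auto
  next
    case False
    then consider "?A $ 1 $ 1 - 1 \<noteq> 0 \<or> ?A $ 1 $ 2 \<noteq> 0" | "?A $ 2 $ 1 \<noteq> 0 \<or> ?A $ 2 $ 2 - 1 \<noteq> 0"
      using matrix_2_eqI[of ?A "mat 1"] by (auto simp: mat_def)
    then show ?thesis
    proof cases
      case 1
      show ?thesis
      proof (rule that[OF fixed_hyperplane_null[OF 1, of "- (?A $ 1 $ 1 * ?y $ LP 1 + ?A $ 1 $ 2 * ?y $ LV 1)"]])
        fix u assume u: "u \<in> fiber_space" "fiber_act c u = u"
        have "sl2_lie ?A (ymul ?y (fy u)) $ LP 1 = fy u $ LP 1" using fx[OF u] by simp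
        then show "u \<in> {u. (?A $ 1 $ 1 - 1) * (u $ FZl None * u $ FB 1 - u $ FZl (Some 1)) + ?A $ 1 $ 2 * u $ FB 1
           = - (?A $ 1 $ 1 * ?y $ LP 1 + ?A $ 1 $ 2 * ?y $ LV 1)}"
          by (simp add: sl2_lie_nth ymul_nth fy1 algebra_simps)
      qed
    next
      case 2
      show ?thesis
      proof (rule that[OF fixed_hyperplane_null[OF 2, of "- (?A $ 2 $ 1 * ?y $ LP 1 + ?A $ 2 $ 2 * ?y $ LV 1)"]])
        fix u assume u: "u \<in> fiber_space" "fiber_act c u = u"
        have "sl2_lie ?A (ymul ?y (fy u)) $ LV 1 = fy u $ LV 1" using fx[OF u] by simp
        then show "u \<in> {u. ?A $ 2 $ 1 * (u $ FZl None * u $ FB 1 - u $ FZl (Some 1)) + (?A $ 2 $ 2 - 1) * u $ FB 1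
           = - (?A $ 2 $ 1 * ?y $ LP 1 + ?A $ 2 $ 2 * ?y $ LV 1)}"
          by (simp add: sl2_lie_nth ymul_nth fy1 algebra_simps)
      qed
    qed
  qed
qed

lemma fixed_points_countable_null:
  assumes "countable \<Gamma>" "\<Gamma> \<subseteq> sl2 \<times> UNIV"
  obtains N where "N \<in> null_sets lborel"
    "\<And>c u. c \<in> \<Gamma> \<Longrightarrow> c \<noteq> (mat 1, 0) \<Longrightarrow> u \<in> fiber_space \<Longrightarrow> fiber_act c u = u \<Longrightarrow> u \<in> N"
proof -
  have "\<exists>N. N \<in> null_sets lborel \<and> (\<forall>u\<in>fiber_space. fiber_act c u = u \<longrightarrow> u \<in> N)"
    if "c \<in> \<Gamma> - {(mat 1, 0)}" for c
  proof -
    have "c \<in> sl2 \<times> UNIV" "c \<noteq> (mat 1, 0)" using that assms by blast+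
    then obtain N where "N \<in> null_sets lborel" "\<And>u. u \<in> fiber_space \<Longrightarrow> fiber_act c u = u \<Longrightarrow> u \<in> N"
      by (rule fixed_points_null) blast
    then show ?thesis by (intro exI[of _ N]) simp
  qed
  then obtain N where N: "\<And>c. c \<in> \<Gamma> - {(mat 1, 0)} \<Longrightarrow> N c \<in> null_sets lborel"
      "\<And>c u. c \<in> \<Gamma> - {(mat 1, 0)} \<Longrightarrow> u \<in> fiber_space \<Longrightarrow> fiber_act c u = u \<Longrightarrow> u \<in> N c" by metis
  show ?thesis
  proof (rule that)
    show "(\<Union>c\<in>\<Gamma> - {(mat 1, 0)}. N c) \<in> null_sets lborel"
      using assms N by (intro null_sets_UN') auto
  qed (use N in blast)
qed

lemma mob_sl2_normalize:
  assumes "det C > 0" shows "mob (sl2_normalize C) \<tau> = mob C \<tau>"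
proof -
  define s where "s = complex_of_real (1 / sqrt (det C))"
  have "s \<noteq> 0" using assms by (simp add: s_def)
  moreover have "complex_of_real (sl2_normalize C $ i $ j) = s * of_real (C $ i $ j)" for i j
    using assms by (simp add: sl2_normalize_def s_def)
  ultimately show ?thesis
    by (simp only: mob_def mob_denom_def mult.assoc distrib_left[symmetric] mult_divide_mult_cancel_left not_False_eq_True)
qed

section \<open>Orbit volume and Haar measure\<close>

text \<open>This is the orbit map used for the comparison with Haar measure. The modulus of c i + d
  is the inverse square root of the imaginary part of the image of i, which is why r times the
  square root of that part stays equal to \<open>\<kappa>\<close>.\<close>

lemma fiber_act_base:
  assumes "g \<in> sl2 \<times> UNIV" "\<kappa> > 0"
  shows "fiber_act g (fpt \<kappa> \<i> 0)
    = fpt (\<kappa> / sqrt (Im (mob (fst g) \<i>))) (mob (fst g) \<i>) (sl2_lie (fst g) (yexp (snd g)))"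
proof -
  have A: "fst g \<in> sl2" using assms by auto
  have "sqrt (Im (mob (fst g) \<i>)) = 1 / cmod (mob_denom (fst g) \<i>)"
    by (simp add: Im_mob[OF A] real_sqrt_divide)
  then show ?thesis using assms by (simp add: fiber_act_fpt mult.commute)
qed

lemma measurable_mob_i [measurable]:
  "(\<lambda>C. Re (mob C \<i>)) \<in> borel_measurable borel" "(\<lambda>C. Im (mob C \<i>)) \<in> borel_measurable borel"
  by (simp_all add: mob_def mob_denom_def Re_divide Im_divide)

lemma measurable_orbit_map:
  "(\<lambda>g. fpt (\<kappa> / sqrt (Im (mob (fst g) \<i>))) (Complex (Re (mob (fst g) \<i>)) (Im (mob (fst g) \<i>)))
      (sl2_lie (fst g) (yexp (snd g)))) \<in> borel_measurable borel"
proof -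
  have [measurable]: "(\<lambda>g. sl2_lie (fst g) (yexp (snd g))) \<in> borel_measurable borel"
    by (intro borel_measurable_continuous_onI continuous_intros)
  show ?thesis by measurable
qed

text \<open>\<open>nn_integral_cone\<close> turns the integral over the half plane into one over the
  matrix cone; there the inner integral over y is moved by \<open>sl2_lie\<close> and
  \<open>yexp\<close> to the encoding variable v, so the result is a Haar integral over the preimage
  of \<open>D\<close>.\<close>

lemma orbit_slice_le_haar:
  assumes D [measurable]: "D \<in> sets borel" and \<kappa>: "\<kappa> > 0"
  defines "D' \<equiv> {g \<in> sl2 \<times> UNIV. fiber_act g (fpt \<kappa> \<i> 0) \<in> D}"
  shows "D' \<in> sets borel"
    and "cone_const * (\<integral>\<^sup>+t1. \<integral>\<^sup>+t. indicator {0<..} t * ennreal (1 / t\<^sup>2) *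
      (\<integral>\<^sup>+y. indicator D (fpt (\<kappa> / sqrt t) (Complex t1 t) y) \<partial>lborel) \<partial>lborel \<partial>lborel) \<le> emeasure haar D'"
proof -
  let ?o = "\<lambda>g. fpt (\<kappa> / sqrt (Im (mob (fst g) \<i>))) (Complex (Re (mob (fst g) \<i>)) (Im (mob (fst g) \<i>)))
      (sl2_lie (fst g) (yexp (snd g)))"
  have D'_eq: "D' = (sl2 \<times> UNIV) \<inter> (?o -` D)"
    using fiber_act_base[OF _ \<kappa>] by (auto simp: D'_def)
  show D': "D' \<in> sets borel"
    unfolding D'_eq using measurable_sets[OF measurable_orbit_map D, of \<kappa>] closed_carrier by auto
  define G where "G q = (\<integral>\<^sup>+y. indicator D (fpt (\<kappa> / sqrt (snd q)) (Complex (fst q) (snd q)) y) \<partial>lborel)" for q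
  have Gm [measurable]: "G \<in> borel_measurable borel"
  proof -
    have "(\<lambda>p. indicator D (fpt (\<kappa> / sqrt (snd (fst p))) (Complex (fst (fst p)) (snd (fst p))) (snd p)))
       \<in> borel_measurable (borel :: ((real \<times> real) \<times> (real ^ lie)) measure)" by measurable
    then have "(\<lambda>p. indicator D (fpt (\<kappa> / sqrt (snd (fst p))) (Complex (fst (fst p)) (snd (fst p))) (snd p)))
       \<in> borel_measurable ((lborel :: (real \<times> real) measure) \<Otimes>\<^sub>M (lborel :: (real ^ lie) measure))"
      by (simp add: lborel_prod)
    from lborel.borel_measurable_nn_integral_fst[OF this] show ?thesis by (simp add: G_def[abs_def])
  qed
  have "cone_const * (\<integral>\<^sup>+t1. \<integral>\<^sup>+t. indicator {0<..} t * ennreal (1 / t\<^sup>2) * G (t1, t) \<partial>lborel \<partial>lborel)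
    = (\<integral>\<^sup>+C. indicator sl2_cone C * G (Re (mob C \<i>), Im (mob C \<i>)) \<partial>lborel)"
    by (rule nn_integral_cone[symmetric]) measurable
  also have "\<dots> \<le> (\<integral>\<^sup>+C. indicator sl2_cone C * (\<integral>\<^sup>+v. indicator D' (sl2_normalize C, v) \<partial>lborel) \<partial>lborel)"
  proof (rule nn_integral_mono)
    fix C :: "real ^ 2 ^ 2"
    show "indicator sl2_cone C * G (Re (mob C \<i>), Im (mob C \<i>))
      \<le> indicator sl2_cone C * (\<integral>\<^sup>+v. indicator D' (sl2_normalize C, v) \<partial>lborel)"
    proof (cases "C \<in> sl2_cone")
      case True
      then have d: "det C > 0" by (simp add: sl2_cone_def)
      let ?f = "\<lambda>y. indicator D (fpt (\<kappa> / sqrt (Im (mob C \<i>))) (Complex (Re (mob C \<i>)) (Im (mob C \<i>))) y) :: ennreal"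
      have f [measurable]: "?f \<in> borel_measurable borel" by measurable
      have "G (Re (mob C \<i>), Im (mob C \<i>)) = (\<integral>\<^sup>+y. ?f (sl2_lie (sl2_normalize C) y) \<partial>lborel)"
        unfolding G_def by (subst nn_integral_sl2_lie[OF _ f]) simp_all
      \<comment> \<open>The Jacobian factor 2 of \<open>yexp\<close> is absorbed into the
        inequality.\<close>
      also have "\<dots> \<le> 2 * (\<integral>\<^sup>+y. ?f (sl2_lie (sl2_normalize C) y) \<partial>lborel)"
        using mult_right_mono[of 1 2 "(\<integral>\<^sup>+y. ?f (sl2_lie (sl2_normalize C) y) \<partial>lborel)"] by simp
      also have "\<dots> = (\<integral>\<^sup>+v. ?f (sl2_lie (sl2_normalize C) (yexp v)) \<partial>lborel)"
        by (rule nn_integral_yexp[symmetric]) measurable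
      also have "\<dots> = (\<integral>\<^sup>+v. indicator D' (sl2_normalize C, v) \<partial>lborel)"
        by (rule nn_integral_cong) (simp add: D'_eq indicator_def mob_sl2_normalize[OF d])
      finally show ?thesis using True by simp
    qed simp
  qed
  also have "\<dots> = emeasure haar D'"
    by (rule emeasure_haar[symmetric, OF D']) (auto simp: D'_def)
  finally show "cone_const * (\<integral>\<^sup>+t1. \<integral>\<^sup>+t. indicator {0<..} t * ennreal (1 / t\<^sup>2) *
      (\<integral>\<^sup>+y. indicator D (fpt (\<kappa> / sqrt t) (Complex t1 t) y) \<partial>lborel) \<partial>lborel \<partial>lborel) \<le> emeasure haar D'"
    by (simp add: G_def)
qed

lemma nn_integral_inverse_power_15:
  assumes "\<delta> > 0"
  shows "(\<integral>\<^sup>+\<kappa>. ennreal (1 / \<kappa> ^ 15) * indicator {\<delta>..} \<kappa> \<partial>lborel) < \<infinity>"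
proof -
  have "(\<integral>\<^sup>+\<kappa>. ennreal (1 / \<kappa> ^ 15) * indicator {\<delta>..} \<kappa> \<partial>lborel) = ennreal (0 - (- 1 / (14 * \<delta> ^ 14)))"
  proof (rule nn_integral_FTC_atLeast)
    fix x :: real assume "\<delta> \<le> x"
    then have x: "x > 0" using assms by simp
    show "((\<lambda>x. - 1 / (14 * x ^ 14)) has_real_derivative 1 / x ^ 15) (at x)"
      using x by (auto intro!: derivative_eq_intros simp: field_simps eval_nat_numeral)
    show "0 \<le> 1 / x ^ 15" using x by simp
  next
    show "((\<lambda>x::real. - 1 / (14 * x ^ 14)) \<longlongrightarrow> 0) at_top" by real_asymp
  qed measurable
  then show ?thesis by simp
qed

lemma lattice_qgroup:
  assumes "lattice_in \<Gamma> qgroup"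
  shows "\<Gamma> \<subseteq> sl2 \<times> UNIV" and "(mat 1, 0) \<in> \<Gamma>" and "discrete \<Gamma>" and "countable \<Gamma>"
    and "\<And>g h. g \<in> \<Gamma> \<Longrightarrow> h \<in> \<Gamma> \<Longrightarrow> gmul g h \<in> \<Gamma>" and "\<And>g. g \<in> \<Gamma> \<Longrightarrow> ginv g \<in> \<Gamma>"
    and "quotient_volume (\<lambda>g h. \<exists>c\<in>\<Gamma>. c \<otimes>\<^bsub>qgroup\<^esub> g = h) (emeasure haar) (sl2 \<times> UNIV) < \<infinity>"
proof -
  have sub: "subgroup \<Gamma> qgroup" and disc: "discrete \<Gamma>"
    using assms by (auto simp: lattice_in_def)
  show \<Gamma>: "\<Gamma> \<subseteq> sl2 \<times> UNIV" using subgroup.subset[OF sub] by simp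
  show "(mat 1, 0) \<in> \<Gamma>" using subgroup.one_closed[OF sub] by simp
  show "discrete \<Gamma>" by fact
  show "countable \<Gamma>" using disc by (rule countable_discrete)
  show "gmul g h \<in> \<Gamma>" if "g \<in> \<Gamma>" "h \<in> \<Gamma>" for g h
  proof -
    have "g \<otimes>\<^bsub>qgroup\<^esub> h \<in> \<Gamma>" using subgroup.m_closed[OF sub] that by blast
    moreover have "g \<otimes>\<^bsub>qgroup\<^esub> h = gmul g h" using that \<Gamma> by (intro mult_qgroup) auto
    ultimately show ?thesis by simp
  qed
  show "ginv g \<in> \<Gamma>" if "g \<in> \<Gamma>" for g
  proof -
    have "inv\<^bsub>qgroup\<^esub> g \<in> \<Gamma>" using subgroup.m_inv_closed[OF sub] that by blast
    moreover have "inv\<^bsub>qgroup\<^esub> g = ginv g" using that \<Gamma> by (intro inv_qgroup) auto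
    ultimately show ?thesis by simp
  qed
  show "quotient_volume (\<lambda>g h. \<exists>c\<in>\<Gamma>. c \<otimes>\<^bsub>qgroup\<^esub> g = h) (emeasure haar) (sl2 \<times> UNIV) < \<infinity>"
    using assms left_haar_haar unfolding lattice_in_def by simp
qed

definition fiber_injective :: "((real ^ 2 ^ 2) \<times> (real ^ lie)) set \<Rightarrow> (real ^ fcoord) set \<Rightarrow> bool" where
  "fiber_injective \<Gamma> D \<longleftrightarrow> (\<forall>u\<in>D. \<forall>w\<in>D. (\<exists>g\<in>\<Gamma>. fiber_act g u = w) \<longrightarrow> u = w)"

text \<open>Removing the points with a nontrivial stabilizer makes the preimage under the orbit map of an
  injective set injective in the group.\<close>

lemma fiber_volume_bound:
  assumes lat: "lattice_in \<Gamma> qgroup" and \<epsilon>: "\<epsilon> > 0"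
  obtains C where "C < \<infinity>"
    "\<And>D. D \<in> sets borel \<Longrightarrow> D \<subseteq> fiber_part \<epsilon> \<Longrightarrow> fiber_injective \<Gamma> D
      \<Longrightarrow> (\<integral>\<^sup>+u. indicator D u * fiber_density u \<partial>lborel) \<le> C"
proof -
  note \<Gamma> = lattice_qgroup[OF lat]
  define Q where "Q = quotient_volume (\<lambda>g h. \<exists>c\<in>\<Gamma>. c \<otimes>\<^bsub>qgroup\<^esub> g = h) (emeasure haar) (sl2 \<times> UNIV)"
  have Q: "Q < \<infinity>" unfolding Q_def by (rule \<Gamma>(7))
  \<comment> \<open>A real number below \<open>cone_const\<close>, by which one can divide in
    \<open>ennreal\<close>.\<close>
  obtain k where k: "k > 0" "ennreal k \<le> cone_const"
  proof (cases cone_const)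
    case (real r)
    moreover have "0 < r" using cone_const_pos unfolding real(2) by simp
    ultimately show ?thesis using that[of r] by simp
  next
    case top
    then show ?thesis using that[of 1] by simp
  qed
  \<comment> \<open>In the part considered, the invariant \<open>\<kappa>\<close>^4 / 2 is at least
    \<epsilon>. For \<open>\<kappa>\<close> < 1 one has \<open>\<kappa>\<close>^4 \<le>
    \<open>\<kappa>\<close>, so \<open>\<kappa>\<close> is at least the minimum of 1 and 2
    \<epsilon>.\<close>
  define \<delta> where "\<delta> = min 1 (2 * \<epsilon>)"
  have \<delta>: "\<delta> > 0" using \<epsilon> by (simp add: \<delta>_def)
  have \<delta>4: "\<delta> \<le> \<kappa>" if "\<kappa> > 0" "\<kappa> ^ 4 \<ge> 2 * \<epsilon>" for \<kappa>
  proof (rule ccontr)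
    assume "\<not> \<delta> \<le> \<kappa>"
    then have "\<kappa> < 1" "\<kappa> < 2 * \<epsilon>" by (auto simp: \<delta>_def)
    moreover have "\<kappa> ^ 4 \<le> \<kappa> ^ 1" using \<open>\<kappa> < 1\<close> that by (intro power_decreasing) auto
    ultimately show False using that by simp
  qed
  define I where "I = (\<integral>\<^sup>+\<kappa>. ennreal (1 / \<kappa> ^ 15) * indicator {\<delta>..} \<kappa> \<partial>lborel)"
  have I: "I < \<infinity>" unfolding I_def by (rule nn_integral_inverse_power_15[OF \<delta>])
  define C where "C = 2 * (32 * (I * (ennreal (1 / k) * Q)))"
  obtain N where N: "N \<in> null_sets lborel"
    "\<And>c u. c \<in> \<Gamma> \<Longrightarrow> c \<noteq> (mat 1, 0) \<Longrightarrow> u \<in> fiber_space \<Longrightarrow> fiber_act c u = u \<Longrightarrow> u \<in> N"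
    using fixed_points_countable_null[OF \<Gamma>(4,1)] by blast
  show ?thesis
  proof (rule that)
    show "C < \<infinity>" using Q I by (simp add: C_def ennreal_mult_less_top)
    fix D assume D: "D \<in> sets borel" "D \<subseteq> fiber_part \<epsilon>" "fiber_injective \<Gamma> D"
    define D0 where "D0 = D - N"
    have D0 [measurable]: "D0 \<in> sets borel" using D N(1) by (auto simp: D0_def)
    have D0sub: "D0 \<subseteq> fiber_part \<epsilon>" "D0 \<subseteq> fiber_space" using D by (auto simp: D0_def fiber_part_def)
    define X where "X \<kappa> = (\<integral>\<^sup>+t1. \<integral>\<^sup>+t. indicator {0<..} t * ennreal (1 / t\<^sup>2) *
      (\<integral>\<^sup>+y. indicator D0 (fpt (\<kappa> / sqrt t) (Complex t1 t) y) \<partial>lborel) \<partial>lborel \<partial>lborel)" for \<kappa>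
    have X_bound: "X \<kappa> \<le> ennreal (1 / k) * Q" if \<kappa>: "\<kappa> > 0" for \<kappa>
    proof -
      let ?D' = "{g \<in> sl2 \<times> UNIV. fiber_act g (fpt \<kappa> \<i> 0) \<in> D0}"
      have base: "fpt \<kappa> \<i> 0 \<in> fiber_space" using \<kappa> by (simp add: fpt_fiber_space)
      \<comment> \<open>Here c moves one point of \<open>D0\<close> to another, hence fixes it by
        injectivity of \<open>D\<close>; outside \<open>N\<close> only the identity does so.\<close>
      have "g = h" if gh: "g \<in> ?D'" "h \<in> ?D'" and c: "c \<in> \<Gamma>" "c \<otimes>\<^bsub>qgroup\<^esub> g = h" for g h c
      proof -
        have cG: "c \<in> sl2 \<times> UNIV" using c(1) \<Gamma>(1) by blast
        have gG: "g \<in> sl2 \<times> UNIV" using gh by simp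
        have h: "h = gmul c g" using c(2) mult_qgroup[OF cG gG] by simp
        have act: "fiber_act h (fpt \<kappa> \<i> 0) = fiber_act c (fiber_act g (fpt \<kappa> \<i> 0))"
          unfolding h by (rule fiber_act_gmul[OF cG gG base])
        moreover have "fiber_act g (fpt \<kappa> \<i> 0) \<in> D0" "fiber_act h (fpt \<kappa> \<i> 0) \<in> D0" using gh by auto
        ultimately have "fiber_act c (fiber_act g (fpt \<kappa> \<i> 0)) = fiber_act g (fpt \<kappa> \<i> 0)"
          using D(3) c(1) unfolding fiber_injective_def D0_def by (metis DiffD1)
        then have "c = (mat 1, 0)"
          using N(2)[OF c(1) _ fiber_act_closed[OF gG base]] \<open>fiber_act g (fpt \<kappa> \<i> 0) \<in> D0\<close>
          unfolding D0_def by blast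
        then have "c \<otimes>\<^bsub>qgroup\<^esub> g = g"
          using monoid.l_one[OF group.is_monoid[OF group_qgroup], of g] gG by simp
        then show ?thesis using c by simp
      qed
      then have inj: "\<forall>g\<in>?D'. \<forall>h\<in>?D'. (\<exists>c\<in>\<Gamma>. c \<otimes>\<^bsub>qgroup\<^esub> g = h) \<longrightarrow> g = h"
        by (intro ballI impI) (elim bexE)
      have "ennreal k * X \<kappa> \<le> cone_const * X \<kappa>" using k by (intro mult_right_mono) auto
      also have "\<dots> \<le> emeasure haar ?D'"
        unfolding X_def by (rule orbit_slice_le_haar(2)[OF D0 \<kappa>])
      also have "\<dots> \<le> Q"
        unfolding Q_def quotient_volume_def
        by (intro SUP_upper CollectI conjI orbit_slice_le_haar(1)[OF D0 \<kappa>] inj) blast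
      finally have "ennreal (1 / k) * (ennreal k * X \<kappa>) \<le> ennreal (1 / k) * Q" by (rule mult_left_mono) simp
      then show ?thesis using k by (simp add: mult.assoc[symmetric] ennreal_mult[symmetric])
    qed
    have X_zero: "X \<kappa> = 0" if \<kappa>: "\<kappa> > 0" "\<kappa> < \<delta>" for \<kappa>
    proof -
      have z: "indicator {0<..} t * ennreal (1 / t\<^sup>2) * (\<integral>\<^sup>+y. indicator D0 (fpt (\<kappa> / sqrt t) (Complex t1 t) y) \<partial>lborel) = 0" for t t1
      proof (cases "t > 0")
        case True
        have "t\<^sup>2 / 2 * (\<kappa> / sqrt t) ^ 3 * (\<kappa> / sqrt t) = \<kappa> ^ 4 / 2"
        proof -
          define q where "q = sqrt t"
          have "q > 0" "t = q\<^sup>2" using True by (simp_all add: q_def)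
          then show ?thesis unfolding q_def[symmetric] by (simp add: field_simps eval_nat_numeral)
        qed
        moreover have "\<kappa> ^ 4 < 2 * \<epsilon>" using \<delta>4[of \<kappa>] \<kappa> by force
        ultimately have "fpt (\<kappa> / sqrt t) (Complex t1 t) y \<notin> fiber_part \<epsilon>" for y
          by (simp only: fiber_part_def mem_Collect_eq fpt_nth complex.sel) linarith
        then have "indicator D0 (fpt (\<kappa> / sqrt t) (Complex t1 t) y) = (0 :: ennreal)" for y
          using D0sub by (auto simp: indicator_def)
        then show ?thesis by simp
      qed simp
      show ?thesis unfolding X_def z by simp
    qed
    have "(\<integral>\<^sup>+u. indicator D u * fiber_density u \<partial>lborel)
      = (\<integral>\<^sup>+u. indicator D0 u * fiber_density u * indicator fiber_space u \<partial>lborel)"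
    proof (rule nn_integral_cong_AE)
      have "AE u in lborel. u \<notin> N" using N(1) by (rule AE_not_in)
      then show "AE u in lborel. indicator D u * fiber_density u = indicator D0 u * fiber_density u * indicator fiber_space u"
        by eventually_elim (use D0sub in \<open>auto simp: D0_def indicator_def\<close>)
    qed
    also have "\<dots> = 2 * (\<integral>\<^sup>+\<kappa>. 32 * (ennreal (1 / \<kappa> ^ 15) * indicator {0<..} \<kappa> * X \<kappa>) \<partial>lborel)"
      unfolding X_def by (rule nn_integral_fiber_coordinates) measurable
    also have "\<dots> \<le> 2 * (\<integral>\<^sup>+\<kappa>. 32 * (ennreal (1 / \<kappa> ^ 15) * indicator {\<delta>..} \<kappa> * (ennreal (1 / k) * Q)) \<partial>lborel)"
    proof (intro mult_left_mono nn_integral_mono)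
      fix \<kappa> :: real
      show "ennreal (1 / \<kappa> ^ 15) * indicator {0<..} \<kappa> * X \<kappa> \<le> ennreal (1 / \<kappa> ^ 15) * indicator {\<delta>..} \<kappa> * (ennreal (1 / k) * Q)"
      proof (cases "\<kappa> > 0")
        case True
        show ?thesis
        proof (cases "\<delta> \<le> \<kappa>")
          case True
          then show ?thesis using X_bound[OF \<open>\<kappa> > 0\<close>] \<open>\<kappa> > 0\<close> by (simp add: mult_left_mono)
        next
          case False
          then show ?thesis using X_zero[OF \<open>\<kappa> > 0\<close>] by simp
        qed
      qed simp
    qed simp_all
    also have "\<dots> = C"
      unfolding C_def I_def by (subst nn_integral_cmult, measurable, subst nn_integral_multc) measurable
    finally show "(\<integral>\<^sup>+u. indicator D u * fiber_density u \<partial>lborel) \<le> C" .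
  qed
qed

section \<open>Proper discontinuity of the lattice action\<close>

lemma tendsto_continuous_2:
  fixes H :: "'b::topological_space \<Rightarrow> 'c::topological_space \<Rightarrow> 'd::topological_space"
  assumes "continuous_on UNIV (\<lambda>p. H (fst p) (snd p))" "(f \<longlongrightarrow> a) F" "(g \<longlongrightarrow> b) F"
  shows "((\<lambda>x. H (f x) (g x)) \<longlongrightarrow> H a b) F"
  using continuous_on_tendsto_compose[OF assms(1) tendsto_Pair[OF assms(2,3)]] by simp

lemma tendsto_continuous_1:
  assumes "continuous_on UNIV H" "(f \<longlongrightarrow> a) F"
  shows "((\<lambda>x. H (f x)) \<longlongrightarrow> H a) F"
  using continuous_on_tendsto_compose[OF assms] by simp

lemma continuous_on_fy: "continuous_on UNIV fy"
proof -
  have fy: "fy u $ LV a = u $ FB a" "fy u $ LP a = - u $ FZl (Some a) + u $ FZl None * u $ FB a"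
    "fy u $ LX (Some a) = u $ FZt (Some a) - 1 / 2 * (\<Sum>e\<in>UNIV. \<Sum>f\<in>UNIV. kcub a e f * u $ FB e * - u $ FZl (Some f))"
    "fy u $ LX None = u $ FZt None + 1 / 6 * kcontr (\<lambda>a. u $ FB a) (\<lambda>a. u $ FB a) (\<lambda>a. - u $ FZl (Some a))"
    "fy u $ LZ = - 1 / 2 * (u $ FSig + u $ FZl None * fy u $ LX None - (\<Sum>a\<in>UNIV. fy u $ LX (Some a) * - u $ FZl (Some a))
       + 1 / 6 * kcontr (\<lambda>a. u $ FB a) (\<lambda>a. fy u $ LP a) (\<lambda>a. - u $ FZl (Some a)))" for u a
    by (simp_all add: fy_def Let_def)
  have 0: "continuous_on UNIV (\<lambda>u :: real ^ fcoord. u $ i)" for i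
    by (intro continuous_intros)
  have 1: "continuous_on UNIV (\<lambda>u. fy u $ LP a)" for a
    unfolding fy by (intro continuous_intros)
  have 2: "continuous_on UNIV (\<lambda>u. fy u $ LX (Some a))" for a
    unfolding fy by (intro continuous_intros)
  have 3: "continuous_on UNIV (\<lambda>u. fy u $ LX None)"
    unfolding fy kcontr_alt by (intro continuous_intros)
  show ?thesis
  proof (rule continuous_on_lieI)
    show "continuous_on UNIV (\<lambda>u. fy u $ LV a)" for a
      unfolding fy by (intro continuous_intros)
    show "continuous_on UNIV (\<lambda>u. fy u $ LZ)"
      unfolding fy(5) kcontr_alt
      by (intro 0 1 2 3 continuous_on_add continuous_on_diff continuous_on_mult continuous_on_const
          continuous_on_sum continuous_on_minus)
  qed (fact 1 2 3)+
qed

lemma tendsto_ftau: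
  assumes "(f \<longlongrightarrow> u) F" "u \<in> fiber_space"
  shows "((\<lambda>x. ftau (f x)) \<longlongrightarrow> ftau u) F"
  using assms(2) unfolding ftau_def
  by (intro tendsto_Complex tendsto_real_sqrt tendsto_divide tendsto_mult tendsto_power tendsto_vec_nth assms(1) tendsto_const)
     (simp add: fiber_space_def)

lemma isolated_sequence:
  fixes S :: "'a::topological_space set"
  assumes "discrete S" "a \<in> S" "f \<longlonglongrightarrow> a" "\<And>n. f n \<in> S"
  shows "eventually (\<lambda>n. f n = a) sequentially"
proof -
  obtain U where U: "open U" "U \<inter> S = {a}" using assms(1,2) by (auto simp: discrete_def isolated_in_def)
  then have "eventually (\<lambda>n. f n \<in> U) sequentially"
    using assms(3) by (intro topological_tendstoD) auto
  then show ?thesis by eventually_elim (use U assms(4) in blast)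
qed

text \<open>The quotients of consecutive terms belong to \<Gamma> and tend to the identity, which is
  isolated in \<Gamma>, so they are eventually trivial.\<close>

lemma discrete_subgroup_convergent:
  assumes disc: "discrete \<Gamma>" and one: "(mat 1, 0) \<in> \<Gamma>" and sub: "\<Gamma> \<subseteq> sl2 \<times> UNIV"
    and mul: "\<And>g h. g \<in> \<Gamma> \<Longrightarrow> h \<in> \<Gamma> \<Longrightarrow> gmul g h \<in> \<Gamma>" and inv: "\<And>g. g \<in> \<Gamma> \<Longrightarrow> ginv g \<in> \<Gamma>"
    and g: "\<And>n. g n \<in> \<Gamma>" and lim: "g \<longlonglongrightarrow> l" and l: "l \<in> sl2 \<times> UNIV"
  obtains m where "\<And>n. n \<ge> m \<Longrightarrow> g n = g m"
proof -
  have "(\<lambda>n. gmul (ginv (g n)) (g (Suc n))) \<longlonglongrightarrow> gmul (ginv l) l"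
    using lim LIMSEQ_Suc[OF lim]
    by (intro tendsto_continuous_2[where H = gmul] tendsto_continuous_1[where H = ginv]) (auto intro!: continuous_intros)
  then have "(\<lambda>n. gmul (ginv (g n)) (g (Suc n))) \<longlonglongrightarrow> (mat 1, 0)" by (simp add: ginv_gmul[OF l])
  from isolated_sequence[OF disc one this] mul inv g
  obtain m where m: "\<And>n. n \<ge> m \<Longrightarrow> gmul (ginv (g n)) (g (Suc n)) = (mat 1, 0)"
    by (auto simp: eventually_sequentially)
  have G: "g n \<in> sl2 \<times> UNIV" for n using g sub by blast
  have step: "g (Suc n) = g n" if "n \<ge> m" for n
  proof -
    have "gmul (g n) (gmul (ginv (g n)) (g (Suc n))) = gmul (g n) (mat 1, 0)" using m[OF that] by simp
    then have "g (Suc n) = gmul (g n) (mat 1, 0)" using gmul_cancel(2)[OF G G] by simp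
    also have "\<dots> = g n"
      using monoid.r_one[OF group.is_monoid[OF group_qgroup], of "g n"] G mult_qgroup[OF G, of "(mat 1, 0)" n] by simp
    finally show ?thesis .
  qed
  have "g n = g m" if "n \<ge> m" for n
    using that by (induction n rule: dec_induct) (simp_all add: step)
  then show ?thesis using that by blast
qed

text \<open>Around a point p outside the null set of fixed points some ball must be injective.
  Otherwise elements g_n of \<Gamma> move points u_n to different points w_n, both sequences tending
  to p; properness yields a convergent subsequence, which is eventually constant and whose limit
  fixes p. So it is the identity, against u_n \<noteq> w_n.\<close>

lemma injective_open_subset:
  assumes lat: "lattice_in \<Gamma> qgroup" and U: "open U" "U \<noteq> {}" "U \<subseteq> fiber_space"
  obtains D where "open D" "D \<noteq> {}" "D \<subseteq> U" "fiber_injective \<Gamma> D"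
proof -
  note \<Gamma> = lattice_qgroup[OF lat]
  obtain N where N: "N \<in> null_sets lborel"
    "\<And>c u. c \<in> \<Gamma> \<Longrightarrow> c \<noteq> (mat 1, 0) \<Longrightarrow> u \<in> fiber_space \<Longrightarrow> fiber_act c u = u \<Longrightarrow> u \<in> N"
    using fixed_points_countable_null[OF \<Gamma>(4,1)] by blast
  have "\<not> U \<subseteq> N"
  proof
    assume "U \<subseteq> N"
    then have "emeasure lborel U = 0" using N(1) U(1) by (intro null_sets_subset[THEN null_setsD1, of N]) auto
    then show False using emeasure_lborel_open_pos[OF U(1,2)] by simp
  qed
  then obtain p where p: "p \<in> U" "p \<notin> N" by blast
  have pf: "p \<in> fiber_space" using p U by blast
  have "\<exists>n. fiber_injective \<Gamma> (U \<inter> ball p (1 / Suc n))"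
  proof (rule ccontr)
    assume "\<not> ?thesis"
    then have "\<exists>u w g. u \<in> U \<inter> ball p (1 / Suc n) \<and> w \<in> U \<inter> ball p (1 / Suc n) \<and> g \<in> \<Gamma> \<and> fiber_act g u = w \<and> u \<noteq> w" for n
      unfolding fiber_injective_def by blast
    then obtain u w g where uwg: "\<And>n. u n \<in> U \<inter> ball p (1 / Suc n) \<and> w n \<in> U \<inter> ball p (1 / Suc n)
        \<and> g n \<in> \<Gamma> \<and> fiber_act (g n) (u n) = w n \<and> u n \<noteq> w n"
      by metis
    then have
      u: "\<And>n. u n \<in> U" "\<And>n. dist p (u n) < 1 / Suc n" and
      w: "\<And>n. w n \<in> U" "\<And>n. dist p (w n) < 1 / Suc n" and
      g: "\<And>n. g n \<in> \<Gamma>" "\<And>n. fiber_act (g n) (u n) = w n" and uw: "\<And>n. u n \<noteq> w n"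
      by simp_all
    have lim: "f \<longlonglongrightarrow> p" if "\<And>n. dist p (f n) < 1 / Suc n" for f :: "nat \<Rightarrow> real ^ fcoord"
    proof (rule metric_LIMSEQ_I)
      fix r :: real assume "r > 0"
      then obtain m where m: "1 / Suc m < r" using nat_approx_posE by blast
      have "dist (f n) p < r" if "n \<ge> m" for n
      proof -
        have "dist (f n) p < 1 / Suc n" using \<open>\<And>n. dist p (f n) < 1 / Suc n\<close> by (simp add: dist_commute)
        also have "1 / real (Suc n) \<le> 1 / Suc m" using that by (intro divide_left_mono) auto
        finally show ?thesis using m by simp
      qed
      then show "\<exists>m. \<forall>n\<ge>m. dist (f n) p < r" by blast
    qed
    have ul: "u \<longlonglongrightarrow> p" and wl: "w \<longlonglongrightarrow> p" using lim u(2) w(2) by blast+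
    have uf: "u n \<in> fiber_space" and wf: "w n \<in> fiber_space" for n using u w U by blast+
    define A where "A n = fst (g n)" for n
    define \<tau> where "\<tau> n = ftau (u n)" for n
    define \<sigma> where "\<sigma> n = ftau (w n)" for n
    have A: "A n \<in> sl2" for n using g(1)[of n] \<Gamma>(1) by (auto simp: A_def)
    have G: "g n \<in> sl2 \<times> UNIV" for n using g(1)[of n] \<Gamma>(1) by blast
    have \<tau>: "Im (\<tau> n) > 0" and \<sigma>: "Im (\<sigma> n) > 0" for n
      unfolding \<tau>_def \<sigma>_def by (simp_all add: ftau_pos uf wf)
    have \<tau>l: "\<tau> \<longlonglongrightarrow> ftau p" unfolding \<tau>_def by (rule tendsto_ftau[OF ul pf])
    have \<sigma>l: "\<sigma> \<longlonglongrightarrow> ftau p" unfolding \<sigma>_def by (rule tendsto_ftau[OF wl pf])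
    have yl: "(\<lambda>n. fy (u n)) \<longlonglongrightarrow> fy p" and zl: "(\<lambda>n. fy (w n)) \<longlonglongrightarrow> fy p"
      using continuous_on_fy ul wl by (auto intro: tendsto_continuous_1)
    have Imp: "Im (ftau p) > 0" by (rule ftau_pos[OF pf])
    have rpos: "u n $ FR > 0" for n using uf[of n] by (simp add: fiber_space_def)
    have weq: "w n = fpt (cmod (mob_denom (A n) (\<tau> n)) * u n $ FR) (mob (A n) (\<tau> n)) (sl2_lie (A n) (ymul (yexp (snd (g n))) (fy (u n))))" for n
      using g(2)[of n] by (simp add: fiber_act_def A_def \<tau>_def)
    define j where "j n = mob_denom (A n) (\<tau> n)" for n
    have j0: "j n \<noteq> 0" for n unfolding j_def by (rule mob_denom_nonzero[OF A \<tau>])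
    have \<sigma>eq: "\<sigma> n = mob (A n) (\<tau> n)" for n
      unfolding \<sigma>_def weq[of n] using j0[of n] rpos[of n] Im_mob_pos[OF A \<tau>] by (simp add: j_def)
    have zeq: "fy (w n) = sl2_lie (A n) (ymul (yexp (snd (g n))) (fy (u n)))" for n
      by (subst weq) simp
    \<comment> \<open>The square of the modulus of c \<tau> + d is the ratio of the imaginary parts
      before and after. Both sequences have the same limit, so the ratio tends to 1 and the factors
      \<open>j\<close> are bounded.\<close>
    have "cmod (j n) = sqrt (Im (\<tau> n) / Im (\<sigma> n))" for n
      using \<sigma>eq[of n] Im_mob[OF A[of n], of "\<tau> n"] \<tau>[of n] j0[of n] by (simp add: j_def)
    moreover have "(\<lambda>n. sqrt (Im (\<tau> n) / Im (\<sigma> n))) \<longlonglongrightarrow> sqrt (Im (ftau p) / Im (ftau p))"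
      using Imp by (intro tendsto_intros \<tau>l \<sigma>l) simp
    ultimately have "(\<lambda>n. cmod (j n)) \<longlonglongrightarrow> sqrt (Im (ftau p) / Im (ftau p))" by simp
    then have "Bseq (\<lambda>n. cmod (j n))" by (rule convergent_imp_Bseq[OF convergentI])
    then have "Bseq j" by (simp add: Bseq_def)
    then have "bounded (range j)" by (simp add: Bseq_eq_bounded)
    then obtain l r where r: "strict_mono (r :: nat \<Rightarrow> nat)" and l: "(j \<circ> r) \<longlonglongrightarrow> l"
      using bounded_imp_convergent_subsequence by blast
    have sub: "f \<longlonglongrightarrow> a \<Longrightarrow> (\<lambda>n. f (r n)) \<longlonglongrightarrow> a" for f :: "nat \<Rightarrow> 'x::topological_space" and a
      using LIMSEQ_subseq_LIMSEQ[OF _ r, of f a] by (simp add: comp_def)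
    have jl: "(\<lambda>n. j (r n)) \<longlonglongrightarrow> l" using l by (simp add: comp_def)
    \<comment> \<open>The matrix is determined by \<open>j\<close>, \<tau> and \<sigma>: the
      equation c \<tau> + d = j gives the second row, a \<tau> + b = \<sigma> j the first. Hence all
      entries converge along the subsequence.\<close>
    have c: "A n $ 2 $ 1 = Im (j n) / Im (\<tau> n)" for n
      using \<tau>[of n] by (simp add: j_def mob_denom_def)
    have d: "A n $ 2 $ 2 = Re (j n) - A n $ 2 $ 1 * Re (\<tau> n)" for n
      by (simp add: j_def mob_denom_def)
    have ab: "of_real (A n $ 1 $ 1) * \<tau> n + of_real (A n $ 1 $ 2) = \<sigma> n * j n" for n
      using j0[of n] by (simp add: \<sigma>eq mob_def j_def)
    have a: "A n $ 1 $ 1 = Im (\<sigma> n * j n) / Im (\<tau> n)" for n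
      using \<tau>[of n] by (simp add: ab[symmetric])
    have b: "A n $ 1 $ 2 = Re (\<sigma> n * j n) - A n $ 1 $ 1 * Re (\<tau> n)" for n
      by (simp add: ab[symmetric])
    note lims = jl sub[OF \<tau>l] sub[OF \<sigma>l]
    have c': "(\<lambda>n. A (r n) $ 2 $ 1) \<longlonglongrightarrow> Im l / Im (ftau p)"
      unfolding c using Imp by (intro tendsto_intros lims) simp
    have d': "(\<lambda>n. A (r n) $ 2 $ 2) \<longlonglongrightarrow> Re l - Im l / Im (ftau p) * Re (ftau p)"
      unfolding d by (intro tendsto_intros lims c')
    have a': "(\<lambda>n. A (r n) $ 1 $ 1) \<longlonglongrightarrow> Im (ftau p * l) / Im (ftau p)"
      unfolding a using Imp by (intro tendsto_intros lims) simp
    have b': "(\<lambda>n. A (r n) $ 1 $ 2) \<longlonglongrightarrow> Re (ftau p * l) - Im (ftau p * l) / Im (ftau p) * Re (ftau p)"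
      unfolding b by (intro tendsto_intros lims a')
    define A' :: "real ^ 2 ^ 2" where "A' = (\<chi> i j. if i = 1 then if j = 1 then Im (ftau p * l) / Im (ftau p)
        else Re (ftau p * l) - Im (ftau p * l) / Im (ftau p) * Re (ftau p)
      else if j = 1 then Im l / Im (ftau p) else Re l - Im l / Im (ftau p) * Re (ftau p))"
    have Al: "(\<lambda>n. A (r n)) \<longlonglongrightarrow> A'"
    proof (intro vec_tendstoI)
      fix i k show "(\<lambda>n. A (r n) $ i $ k) \<longlonglongrightarrow> A' $ i $ k"
        using two_cases[of i] two_cases[of k] a' b' c' d' by (auto simp: A'_def)
    qed
    have A': "A' \<in> sl2"
      using closed_sl2 Al A by (meson closed_sequentially)
    \<comment> \<open>The nilpotent part is a continuous function of the matrix and of the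
      y-coordinates of both points, so it converges too.\<close>
    have veq: "snd (g n) = ylog (ymul (sl2_lie (sl2_inv (A n)) (fy (w n))) (yinv (fy (u n))))" for n
      using A[of n] by (simp add: zeq ymul_assoc)
    have vl: "(\<lambda>n. snd (g (r n))) \<longlonglongrightarrow> ylog (ymul (sl2_lie (sl2_inv A') (fy p)) (yinv (fy p)))"
      unfolding veq
      by (intro tendsto_continuous_1[where H = ylog] tendsto_continuous_1[where H = yinv]
          tendsto_continuous_1[where H = sl2_inv] tendsto_continuous_2[where H = ymul]
          tendsto_continuous_2[where H = sl2_lie] Al sub[OF yl] sub[OF zl])
         (auto intro!: continuous_intros)
    define v' where "v' = ylog (ymul (sl2_lie (sl2_inv A') (fy p)) (yinv (fy p)))"
    have gl: "(\<lambda>n. g (r n)) \<longlonglongrightarrow> (A', v')"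
      using tendsto_Pair[OF Al vl] by (simp add: A_def v'_def)
    have "(A', v') \<in> sl2 \<times> UNIV" using A' by simp
    then have "\<exists>m. \<forall>n\<ge>m. g (r n) = g (r m)"
      using discrete_subgroup_convergent[OF \<Gamma>(3,2,1) \<Gamma>(5,6) g(1) gl] by metis
    then obtain m where m: "\<And>n. n \<ge> m \<Longrightarrow> g (r n) = g (r m)" by blast
    have "(\<lambda>n. g (r n)) \<longlonglongrightarrow> g (r m)"
      by (rule tendsto_eventually, unfold eventually_sequentially) (use m in blast)
    then have gm: "g (r m) = (A', v')" using gl LIMSEQ_unique by blast
    have "fiber_act (A', v') p = p"
    proof -
      have "mob_denom A' (ftau p) = l"
        using Imp by (simp add: mob_denom_def A'_def complex_eq_iff)
      have jl': "(\<lambda>n. mob_denom (A (r n)) (\<tau> (r n))) \<longlonglongrightarrow> mob_denom A' (ftau p)"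
        unfolding mob_denom_def by (intro tendsto_intros Al sub[OF \<tau>l])
      have jne: "mob_denom A' (ftau p) \<noteq> 0" by (rule mob_denom_nonzero[OF A' Imp])
      have "(\<lambda>n. mob (A (r n)) (\<tau> (r n))) \<longlonglongrightarrow> mob A' (ftau p)"
        unfolding mob_def by (intro tendsto_intros Al jl' jne sub[OF \<tau>l])
      then have 1: "mob A' (ftau p) = ftau p"
        using sub[OF \<sigma>l] LIMSEQ_unique unfolding \<sigma>eq by blast
      have "(\<lambda>n. w (r n) $ FR) \<longlonglongrightarrow> p $ FR" by (intro tendsto_intros sub[OF wl])
      moreover have "w (r n) $ FR = cmod (mob_denom (A (r n)) (\<tau> (r n))) * u (r n) $ FR" for n
        by (subst weq) (simp add: fpt_nth)
      moreover have "(\<lambda>n. cmod (mob_denom (A (r n)) (\<tau> (r n))) * u (r n) $ FR) \<longlonglongrightarrow> cmod (mob_denom A' (ftau p)) * p $ FR"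
        by (intro tendsto_intros jl' sub[OF ul])
      ultimately have 2: "cmod (mob_denom A' (ftau p)) * p $ FR = p $ FR"
        by (metis (no_types, lifting) LIMSEQ_unique ext)
      have 3: "sl2_lie A' (ymul (yexp v') (fy p)) = fy p"
        using A' by (simp add: v'_def ymul_assoc)
      show ?thesis
        using fpt_cases[OF pf] by (simp add: fiber_act_def 1 2 3)
    qed
    then have "(A', v') = (mat 1, 0)"
      using N(2)[of "(A', v')" p] g(1)[of "r m"] gm pf p(2) by auto
    then have "w (r m) = u (r m)" using g(2)[of "r m"] gm fiber_act_one[OF uf] by simp
    then show False using uw by metis
  qed
  then obtain n where "fiber_injective \<Gamma> (U \<inter> ball p (1 / Suc n))" by blast
  moreover have "p \<in> U \<inter> ball p (1 / Suc n)" using p by simp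
  ultimately show ?thesis using that[of "U \<inter> ball p (1 / Suc n)"] U(1) by blast
qed

section \<open>Arc length on the curve\<close>

text \<open>The curve is parametrized by the slope \<open>m = x\<^sub>2/x\<^sub>1\<close>; \<open>arc m\<close> is the resulting elementary
  antiderivative of the line element.\<close>

definition cx :: "real \<Rightarrow> real" where "cx m = (1 - m\<^sup>2) powr (- 1 / 3)"

definition pcurve :: "real \<Rightarrow> real ^ 2" where
  "pcurve m = (\<chi> i. if i = 1 then cx m else m * cx m)"

definition arc_slope :: "real \<Rightarrow> real" where
  "arc_slope m = sqrt (2 / 3) * sqrt (3 + m\<^sup>2) / (1 - m\<^sup>2)"

definition arc :: "real \<Rightarrow> real" where
  "arc m = sqrt (2 / 3) * (2 * artanh (2 * m / sqrt (3 + m\<^sup>2)) - arsinh (m / sqrt 3))"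

lemma one_minus_square_pos: "\<bar>m\<bar> < 1 \<Longrightarrow> 0 < 1 - m\<^sup>2" for m :: real
  by (simp add: abs_square_less_1)

lemma cx_pos: "\<bar>m\<bar> < 1 \<Longrightarrow> cx m > 0"
  using one_minus_square_pos[of m] by (simp add: cx_def)

lemma cx_cube:
  assumes "\<bar>m\<bar> < 1" shows "(cx m) ^ 3 * (1 - m\<^sup>2) = 1"
proof -
  have p: "1 - m\<^sup>2 > 0" by (rule one_minus_square_pos[OF assms])
  have "(cx m) ^ 3 = cx m powr real 3"
    by (rule powr_realpow[OF cx_pos[OF assms], symmetric])
  also have "\<dots> = (1 - m\<^sup>2) powr (- 1)" by (simp add: cx_def powr_powr)
  also have "\<dots> = 1 / (1 - m\<^sup>2)" using p by (simp add: powr_minus_divide)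
  finally show ?thesis using p by simp
qed

lemma cx_eqI: "x > 0 \<Longrightarrow> \<bar>m\<bar> < 1 \<Longrightarrow> x ^ 3 * (1 - m\<^sup>2) = 1 \<Longrightarrow> x = cx m"
  using cx_cube[of m] cx_pos[of m] one_minus_square_pos[of m]
  by (metis less_imp_le mult_right_cancel order_less_irrefl power_eq_imp_eq_base zero_less_numeral)

lemma pcurve_in: "\<bar>m\<bar> < 1 \<Longrightarrow> pcurve m \<in> psr_curve"
  using cx_cube[of m] cx_pos[of m]
  by (simp add: psr_curve_def pcurve_def algebra_simps power2_eq_square power3_eq_cube)

lemma psr_curve_slope:
  assumes "x \<in> psr_curve"
  shows "\<bar>x $ 2 / x $ 1\<bar> < 1" and "x = pcurve (x $ 2 / x $ 1)"
proof -
  have x: "x $ 1 > 0" "x $ 1 * ((x $ 1)\<^sup>2 - (x $ 2)\<^sup>2) = 1" using assms by (auto simp: psr_curve_def)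
  then have "(x $ 2)\<^sup>2 < (x $ 1)\<^sup>2"
    by (smt (verit) mult_nonneg_nonpos)
  then have "\<bar>x $ 2\<bar> < x $ 1" using x by (metis abs_of_pos power2_less_imp_less abs_ge_zero power2_abs less_imp_le)
  then show m: "\<bar>x $ 2 / x $ 1\<bar> < 1" using x by (simp add: abs_divide)
  have "a ^ 3 * (1 - q\<^sup>2) = a * (a\<^sup>2 - (q * a)\<^sup>2)" for a q :: real
    by (simp add: algebra_simps power2_eq_square power3_eq_cube)
  from this[of "x $ 1" "x $ 2 / x $ 1"] have "x $ 1 ^ 3 * (1 - (x $ 2 / x $ 1)\<^sup>2) = 1"
    using x by simp
  then have "x $ 1 = cx (x $ 2 / x $ 1)" using x m by (intro cx_eqI)
  then show "x = pcurve (x $ 2 / x $ 1)"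
    using x by (simp add: vec_eq_iff pcurve_def forall_2) 
qed

lemma cx_deriv:
  assumes "\<bar>m\<bar> < 1"
  shows "(cx has_real_derivative 2 / 3 * m * cx m / (1 - m\<^sup>2)) (at m)"
proof -
  have p: "1 - m\<^sup>2 > 0" by (rule one_minus_square_pos[OF assms])
  have "(cx has_real_derivative
      (- 1 / 3) * (1 - m\<^sup>2) powr (- 1 / 3 - 1) * (- 2 * m)) (at m)"
    unfolding cx_def[abs_def]
    by (rule DERIV_chain2[where f = "\<lambda>z. z powr (- 1 / 3)" and g = "\<lambda>m. 1 - m\<^sup>2", OF has_real_derivative_powr[OF p]]) (auto intro!: derivative_eq_intros)
  also have "(1 - m\<^sup>2) powr (- 1 / 3 - 1) = cx m / (1 - m\<^sup>2)"
    using powr_diff[of "1 - m\<^sup>2" "- 1 / 3" 1] p unfolding cx_def by simp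
  also have "- 1 / 3 * (cx m / (1 - m\<^sup>2)) * (- 2 * m) = 2 / 3 * m * cx m / (1 - m\<^sup>2)" by simp
  finally show ?thesis .
qed

definition pcurve' :: "real \<Rightarrow> real ^ 2" where
  "pcurve' m = (\<chi> i. if i = 1 then 2 / 3 * m * cx m / (1 - m\<^sup>2)
      else cx m + m * (2 / 3 * m * cx m / (1 - m\<^sup>2)))"

lemma pcurve_has_vector_derivative:
  assumes "(f has_real_derivative d) (at s within S)" "\<bar>f s\<bar> < 1"
  shows "((\<lambda>s. pcurve (f s)) has_vector_derivative d *\<^sub>R pcurve' (f s)) (at s within S)"
proof -
  have c: "((\<lambda>s. cx (f s)) has_real_derivative 2 / 3 * f s * cx (f s) / (1 - (f s)\<^sup>2) * d) (at s within S)"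
    by (rule DERIV_chain2[OF cx_deriv[OF assms(2)] assms(1)])
  have "((\<lambda>s. pcurve (f s) $ i) has_real_derivative (d *\<^sub>R pcurve' (f s)) $ i) (at s within S)" for i
    using c DERIV_mult[OF assms(1) c] two_cases[of i]
    by (auto simp: pcurve_def pcurve'_def algebra_simps)
  then show ?thesis by (simp add: has_vector_derivative_vec_iff)
qed

lemma psr_metric_pcurve:
  assumes m: "\<bar>m\<bar> < 1"
  shows "psr_metric (pcurve m) (d *\<^sub>R pcurve' m) (d *\<^sub>R pcurve' m) = (d * arc_slope m)\<^sup>2"
proof -
  \<comment> \<open>The logarithmic derivative of \<open>cx\<close>. With \<open>cx m\<close>
    factored out of the velocity, the metric is \<open>(cx m) ^ 3\<close> times a rational function,
    and the cube is rational as well.\<close>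
  let ?k = "2 / 3 * m / (1 - m\<^sup>2)"
  have p: "1 - m\<^sup>2 > 0" by (rule one_minus_square_pos[OF m])
  have p': "pcurve' m $ 1 = ?k * cx m" "pcurve' m $ 2 = (1 + m * ?k) * cx m"
    by (simp_all add: pcurve'_def algebra_simps)
  have "psr_metric (pcurve m) (d *\<^sub>R pcurve' m) (d *\<^sub>R pcurve' m)
    = d\<^sup>2 * ((cx m) ^ 3 * (- 6 * ?k\<^sup>2 + 4 * m * ?k * (1 + m * ?k) + 2 * (1 + m * ?k)\<^sup>2))"
  proof -
    define k where "k = ?k"
    show ?thesis
      unfolding k_def[symmetric] psr_metric_def pd_pd_hcub vector_scaleR_component UNIV_2
      by (simp add: p'[folded k_def] pcurve_def algebra_simps power2_eq_square power3_eq_cube)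
  qed
  also have "(cx m) ^ 3 = 1 / (1 - m\<^sup>2)" using cx_cube[OF m] p by (simp add: field_simps)
  also have "1 / (1 - m\<^sup>2) * (- 6 * ?k\<^sup>2 + 4 * m * ?k * (1 + m * ?k) + 2 * (1 + m * ?k)\<^sup>2)
      = 2 / 3 * (3 + m\<^sup>2) / (1 - m\<^sup>2)\<^sup>2"
  proof -
    have "- 6 * k\<^sup>2 + 4 * m * k * (1 + m * k) + 2 * (1 + m * k)\<^sup>2 = - 6 * k\<^sup>2 * (1 - m\<^sup>2) + 8 * m * k + 2" for k
      by (simp add: algebra_simps power2_eq_square)
    from this[of ?k] have "- 6 * ?k\<^sup>2 + 4 * m * ?k * (1 + m * ?k) + 2 * (1 + m * ?k)\<^sup>2 = - 6 * ?k\<^sup>2 * (1 - m\<^sup>2) + 8 * m * ?k + 2" .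
    also have "\<dots> = 2 / 3 * (3 + m\<^sup>2) / (1 - m\<^sup>2)"
    proof -
      have "- 6 * (2 / 3 * m / q)\<^sup>2 * q + 8 * m * (2 / 3 * m / q) + 2 = (8 / 3 * m\<^sup>2 + 2 * q) / q" if "q > 0" for q
        using that by (simp add: field_simps power2_eq_square)
      from this[OF p] show ?thesis by (simp add: algebra_simps)
    qed
    finally show ?thesis by (simp add: power2_eq_square)
  qed
  finally show ?thesis
    by (simp add: arc_slope_def power_mult_distrib power_divide)
qed

text \<open>The identity shows that the argument of \<open>artanh\<close> in \<open>arc\<close>
  stays inside ]-1, 1[, and makes the derivative of that term elementary.\<close>

lemma arc_argument:
  assumes "\<bar>m\<bar> < 1"
  shows "\<bar>2 * m / sqrt (3 + m\<^sup>2)\<bar> < 1"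
    and "1 - (2 * m / sqrt (3 + m\<^sup>2))\<^sup>2 = 3 * (1 - m\<^sup>2) / (3 + m\<^sup>2)"
proof -
  have s: "3 + m\<^sup>2 > 0" by (simp add: add_pos_nonneg)
  show eq: "1 - (2 * m / sqrt (3 + m\<^sup>2))\<^sup>2 = 3 * (1 - m\<^sup>2) / (3 + m\<^sup>2)"
    using s by (simp add: power_divide field_simps)
  have "0 < 1 - (2 * m / sqrt (3 + m\<^sup>2))\<^sup>2"
    unfolding eq using s one_minus_square_pos[OF assms] by simp
  then show "\<bar>2 * m / sqrt (3 + m\<^sup>2)\<bar> < 1" by (simp only: diff_gt_0_iff_gt abs_square_less_1)
qed

lemma arc_deriv:
  assumes m: "\<bar>m\<bar> < 1"
  shows "(arc has_real_derivative arc_slope m) (at m)"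
proof -
  let ?q = "sqrt (3 + m\<^sup>2)"
  have s: "3 + m\<^sup>2 > 0" by (simp add: add_pos_nonneg)
  have q: "?q > 0" "?q\<^sup>2 = 3 + m\<^sup>2" using s by simp_all
  have p: "1 - m\<^sup>2 > 0" by (rule one_minus_square_pos[OF m])
  have dq: "((\<lambda>m. sqrt (3 + m\<^sup>2)) has_real_derivative m / ?q) (at m)"
    using s by (auto intro!: derivative_eq_intros simp: field_simps)
  have dw: "((\<lambda>m. 2 * m / sqrt (3 + m\<^sup>2)) has_real_derivative 6 / (?q * (3 + m\<^sup>2))) (at m)"
  proof -
    have "((\<lambda>m. 2 * m / sqrt (3 + m\<^sup>2)) has_real_derivative (2 * ?q - 2 * m * (m / ?q)) / (?q * ?q)) (at m)"
      using q by (intro DERIV_divide dq) (auto intro!: derivative_eq_intros)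
    also have "(2 * ?q - 2 * m * (m / ?q)) / (?q * ?q) = (2 * ?q\<^sup>2 - 2 * m\<^sup>2) / (?q * ?q\<^sup>2)"
      using q(1) by (simp add: field_simps power2_eq_square)
    also have "\<dots> = 6 / (?q * (3 + m\<^sup>2))" unfolding q(2) by simp
    finally show ?thesis .
  qed
  have da: "((\<lambda>m. artanh (2 * m / sqrt (3 + m\<^sup>2))) has_real_derivative 2 / (?q * (1 - m\<^sup>2))) (at m)"
  proof -
    have "((\<lambda>m. artanh (2 * m / sqrt (3 + m\<^sup>2))) has_real_derivative
      1 / (1 - (2 * m / ?q) ^ 2) * (6 / (?q * (3 + m\<^sup>2)))) (at m)"
      by (rule DERIV_chain2[OF artanh_real_has_field_derivative[OF arc_argument(1)[OF m]] dw])
    also have "1 / (1 - (2 * m / ?q) ^ 2) * (6 / (?q * (3 + m\<^sup>2))) = 2 / (?q * (1 - m\<^sup>2))"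
    proof -
      have "1 / (3 * a / b) * (6 / (c * b)) = 2 / (c * a)" if "a > 0" "b > 0" "c > 0" for a b c :: real
        using that by (simp add: field_simps)
      then show ?thesis unfolding arc_argument(2)[OF m] using s p q(1) by blast
    qed
    finally show ?thesis .
  qed
  have db: "((\<lambda>m. arsinh (m / sqrt 3)) has_real_derivative 1 / ?q) (at m)"
  proof -
    have "((\<lambda>m. arsinh (m / sqrt 3)) has_real_derivative 1 / sqrt ((m / sqrt 3)\<^sup>2 + 1) * (1 / sqrt 3)) (at m)"
      by (rule DERIV_chain2[OF arsinh_real_has_field_derivative DERIV_cdivide[OF DERIV_ident]])
    also have "1 / sqrt ((m / sqrt 3)\<^sup>2 + 1) * (1 / sqrt 3) = 1 / sqrt (((m / sqrt 3)\<^sup>2 + 1) * 3)"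
      by (simp only: real_sqrt_mult times_divide_times_eq mult_1)
    also have "((m / sqrt 3)\<^sup>2 + 1) * 3 = 3 + m\<^sup>2" by (simp add: power_divide)
    finally show ?thesis .
  qed
  have "(arc has_real_derivative sqrt (2 / 3) * (2 * (2 / (?q * (1 - m\<^sup>2))) - 1 / ?q)) (at m)"
    unfolding arc_def[abs_def] by (intro DERIV_cmult DERIV_diff da db)
  also have "2 * (2 / (?q * (1 - m\<^sup>2))) - 1 / ?q = ?q / (1 - m\<^sup>2)"
  proof -
    have "2 * (2 / (?q * (1 - m\<^sup>2))) - 1 / ?q = (3 + m\<^sup>2) / (?q * (1 - m\<^sup>2))"
    proof -
      have "2 * (2 / (c * a)) - 1 / c = (4 - a) / (c * a)" if "a > 0" "c > 0" for a c :: real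
        using that by (simp add: field_simps)
      from this[OF p q(1)] show ?thesis by simp
    qed
    also have "\<dots> = ?q / (1 - m\<^sup>2)" 
    proof -
      have "b / (c * a) = c / a" if "c > 0" "c\<^sup>2 = b" for a b c :: real
        using that by (auto simp: power2_eq_square)
      from this[OF q] show ?thesis .
    qed
    finally show ?thesis .
  qed
  finally show ?thesis by (simp add: arc_slope_def)
qed

lemma arc_slope_pos: "\<bar>m\<bar> < 1 \<Longrightarrow> arc_slope m > 0"
  using one_minus_square_pos[of m] by (simp add: arc_slope_def add_pos_nonneg)

lemma arc_strict_mono:
  assumes "\<bar>a\<bar> < 1" "\<bar>b\<bar> < 1" "a < b" shows "arc a < arc b"
proof (rule DERIV_pos_imp_increasing[OF assms(3)])
  fix x assume "a \<le> x" "x \<le> b"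
  then have "\<bar>x\<bar> < 1" using assms by auto
  then show "\<exists>y. (arc has_real_derivative y) (at x) \<and> 0 < y" using arc_deriv arc_slope_pos by blast
qed

lemma arc_0: "arc 0 = 0" by (simp add: arc_def)

lemma arc_uminus: assumes "\<bar>m\<bar> < 1" shows "arc (- m) = - arc m"
  using artanh_minus_real[OF arc_argument(1)[OF assms]] by (simp add: arc_def arsinh_minus_real algebra_simps)

text \<open>Comparison with \<open>artanh\<close>, whose derivative is smaller because sqrt (2/3) *
  sqrt (3 + x^2) \<ge> 1. So both ends have infinite length and \<open>arc\<close> is onto the
  reals.\<close>

lemma arc_ge:
  assumes K: "K \<ge> 0" shows "arc (tanh K) \<ge> K"
proof -
  have "(\<lambda>m. arc m - artanh m) 0 \<le> (\<lambda>m. arc m - artanh m) (tanh K)"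
  proof (rule DERIV_nonneg_imp_nondecreasing[where f = "\<lambda>m. arc m - artanh m"])
    show "0 \<le> tanh K" using K by simp
    fix x :: real assume x: "0 \<le> x" "x \<le> tanh K"
    then have x1: "\<bar>x\<bar> < 1" using tanh_real_lt_1[of K] by simp
    have "1 \<le> sqrt (2 / 3) * sqrt (3 + x\<^sup>2)"
      unfolding real_sqrt_mult[symmetric] by (simp add: algebra_simps)
    then have "1 / (1 - x\<^sup>2) \<le> arc_slope x"
      using one_minus_square_pos[OF x1] by (simp add: arc_slope_def divide_right_mono)
    then show "\<exists>y. ((\<lambda>m. arc m - artanh m) has_real_derivative y) (at x) \<and> 0 \<le> y"
      using DERIV_diff[OF arc_deriv[OF x1] artanh_real_has_field_derivative[OF x1, of UNIV]] by auto
  qed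
  then show ?thesis by (simp add: arc_0 artanh_tanh_real)
qed

lemma arc_surj_nonneg:
  assumes "K \<ge> 0" obtains m where "0 \<le> m" "m < 1" "arc m = K"
proof -
  have "continuous_on {0..tanh K} arc"
  proof (intro continuous_at_imp_continuous_on ballI)
    fix x assume "x \<in> {0..tanh K}"
    then have "\<bar>x\<bar> < 1" using tanh_real_lt_1[of K] by auto
    then show "isCont arc x" by (rule DERIV_isCont[OF arc_deriv])
  qed
  then obtain m where m: "0 \<le> m" "m \<le> tanh K" "arc m = K"
    using IVT'[of arc 0 K "tanh K"] assms arc_ge[OF assms] by (auto simp: arc_0)
  then show ?thesis using that[of m] tanh_real_lt_1[of K] by simp
qed

lemma arc_surj: obtains m where "\<bar>m\<bar> < 1" "arc m = K"
proof (cases "K \<ge> 0")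
  case True
  then obtain m where "0 \<le> m" "m < 1" "arc m = K" by (rule arc_surj_nonneg)
  then show ?thesis using that[of m] by simp
next
  case False
  then have "- K \<ge> 0" by simp
  then obtain m where "0 \<le> m" "m < 1" "arc m = - K" by (rule arc_surj_nonneg)
  then show ?thesis using that[of "- m"] arc_uminus[of m] by simp
qed

definition slope_at :: "real \<Rightarrow> real" where
  "slope_at s = (SOME m. \<bar>m\<bar> < 1 \<and> arc m = s)"

lemma slope_at: "\<bar>slope_at s\<bar> < 1" "arc (slope_at s) = s"
proof -
  have "\<exists>m. \<bar>m\<bar> < 1 \<and> arc m = s" using arc_surj by metis
  then have "\<bar>slope_at s\<bar> < 1 \<and> arc (slope_at s) = s" unfolding slope_at_def by (rule someI_ex)
  then show "\<bar>slope_at s\<bar> < 1" "arc (slope_at s) = s" by auto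
qed

lemma slope_at_arc: "\<bar>m\<bar> < 1 \<Longrightarrow> slope_at (arc m) = m"
  using arc_strict_mono[of m "slope_at (arc m)"] arc_strict_mono[of "slope_at (arc m)" m] slope_at[of "arc m"]
  by linarith

lemma slope_at_strict_mono: "s < t \<Longrightarrow> slope_at s < slope_at t"
  using arc_strict_mono[of "slope_at t" "slope_at s"] slope_at[of s] slope_at[of t]
  by (metis linorder_neqE_linordered_idom order_less_asym order_less_irrefl)

lemma slope_at_0: "slope_at 0 = 0" using slope_at_arc[of 0] by (simp add: arc_0)

lemma slope_at_deriv: "(slope_at has_real_derivative 1 / arc_slope (slope_at s)) (at s)"
proof -
  let ?m = "slope_at s"
  \<comment> \<open>Half the distance to the nearer endpoint of ]-1, 1[, so that \<open>arc\<close>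
    is differentiable on the closed neighbourhood of radius \<open>d\<close>.\<close>
  define d where "d = (1 - \<bar>?m\<bar>) / 2"
  have d: "d > 0" using slope_at(1)[of s] by (simp add: d_def)
  have near: "\<bar>z\<bar> < 1" if "\<bar>z - ?m\<bar> \<le> d" for z
  proof -
    have "\<bar>z\<bar> \<le> \<bar>z - ?m\<bar> + \<bar>?m\<bar>" by arith
    also have "\<dots> \<le> (1 - \<bar>?m\<bar>) / 2 + \<bar>?m\<bar>" using that unfolding d_def by simp
    also have "\<dots> = (1 + \<bar>?m\<bar>) / 2" by (simp add: field_simps)
    finally show ?thesis using slope_at(1)[of s] by simp
  qed
  have "isCont slope_at (arc ?m)"
    by (rule isCont_inverse_function[OF d]) (use near slope_at_arc DERIV_isCont[OF arc_deriv] in blast)+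
  then have "isCont slope_at s" by (simp add: slope_at)
  then have "(slope_at has_real_derivative inverse (arc_slope ?m)) (at s)"
    using arc_slope_pos[OF slope_at(1)[of s]]
    by (intro DERIV_inverse_function[where f = arc and g = slope_at and x = s and a = "s - 1" and b = "s + 1", OF arc_deriv[OF slope_at(1)]]) (auto simp: slope_at)
  then show ?thesis by (simp add: inverse_eq_divide)
qed

lemma slope_at_pos: "s > 0 \<Longrightarrow> slope_at s > 0"
  using slope_at_strict_mono[of 0 s] by (simp add: slope_at_0)

lemma slope_at_tendsto: "(slope_at \<longlongrightarrow> 1) at_top"
proof (rule order_tendstoI)
  fix a :: real assume "a < 1"
  define b where "b = max a 0"
  have b: "\<bar>b\<bar> < 1" "a \<le> b" using \<open>a < 1\<close> by (auto simp: b_def)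
  show "\<forall>\<^sub>F s in at_top. a < slope_at s"
    using eventually_gt_at_top[of "arc b"]
  proof eventually_elim
    case (elim s)
    then show ?case using slope_at_strict_mono[OF elim] slope_at_arc[OF b(1)] b(2) by simp
  qed
next
  fix a :: real assume "1 < a"
  then show "\<forall>\<^sub>F s in at_top. slope_at s < a"
    using slope_at(1) by (intro always_eventually) (metis abs_less_iff order_less_trans)
qed

text \<open>The inverse of \<open>arc\<close> has slope 1 / \<open>arc_slope\<close>, which cancels
  the speed of \<open>pcurve\<close>; the other end is obtained by reflection, under which
  \<open>arc_slope\<close> is even.\<close>

lemma arc_length_end_exists:
  assumes e: "e = 1 \<or> e = - 1"
  shows "arc_length_end e (\<lambda>s. pcurve (e * slope_at s))"
  unfolding arc_length_end_def
proof (intro conjI allI impI)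
  have em: "\<bar>e * slope_at s\<bar> < 1" for s using slope_at(1)[of s] e by auto
  show "pcurve (e * slope_at 0) = vector [1, 0]"
    by (simp add: slope_at_0 pcurve_def cx_def vec_eq_iff forall_2)
  show "pcurve (e * slope_at s) \<in> psr_curve" for s by (rule pcurve_in[OF em])
  show "0 < e * pcurve (e * slope_at s) $ 2" if "s > 0" for s
    using slope_at_pos[OF that] cx_pos[OF em] e by (auto simp: pcurve_def)
  have "((\<lambda>s. pcurve (e * slope_at s)) has_vector_derivative (e * (1 / arc_slope (slope_at s))) *\<^sub>R pcurve' (e * slope_at s)) (at s within {0..})" for s
    by (rule pcurve_has_vector_derivative[OF DERIV_cmult[OF DERIV_subset[OF slope_at_deriv]] em]) simp
  moreover have "psr_metric (pcurve (e * slope_at s)) ((e * (1 / arc_slope (slope_at s))) *\<^sub>R pcurve' (e * slope_at s))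
     ((e * (1 / arc_slope (slope_at s))) *\<^sub>R pcurve' (e * slope_at s)) = 1" for s
  proof -
    have "arc_slope (e * slope_at s) = arc_slope (slope_at s)" "e\<^sup>2 = 1"
      using e by (auto simp: arc_slope_def)
    then show ?thesis
      unfolding psr_metric_pcurve[OF em]
      using arc_slope_pos[OF slope_at(1)[of s]] by (simp add: power_divide)
  qed
  ultimately show "\<exists>\<gamma>'. \<forall>s\<ge>0. ((\<lambda>s. pcurve (e * slope_at s)) has_vector_derivative \<gamma>' s) (at s within {0..}) \<and>
       psr_metric (pcurve (e * slope_at s)) (\<gamma>' s) (\<gamma>' s) = 1"
    by (intro exI[of _ "\<lambda>s. (e * (1 / arc_slope (slope_at s))) *\<^sub>R pcurve' (e * slope_at s)"]) blast
qed

text \<open>A speed-one motion on the half line that stays positive cannot turn back, as it would have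
  to stop at a maximum.\<close>

lemma unit_speed_half_line:
  fixes f :: "real \<Rightarrow> real"
  assumes d: "\<And>s. s \<ge> 0 \<Longrightarrow> (f has_real_derivative f' s) (at s within {0..})"
    and sq: "\<And>s. s \<ge> 0 \<Longrightarrow> (f' s)\<^sup>2 = 1" and f0: "f 0 = 0" and pos: "\<And>s. s > 0 \<Longrightarrow> f s > 0" and s: "s \<ge> 0"
  shows "f s = s"
proof -
  have d': "(f has_real_derivative f' s) (at s)" if "s > 0" for s
  proof -
    have "at s within {0..} = at s" using that by (intro at_within_interior) (simp add: interior_real_atLeast)
    then show ?thesis using d[of s] that by simp
  qed
  have cont: "continuous_on {0..} f" using d by (intro DERIV_continuous_on) auto
  have one: "f' a = 1" if a: "a > 0" for a
  proof (rule ccontr)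
    assume "f' a \<noteq> 1"
    then have neg: "f' a = - 1" using sq[of a] a by (auto simp: power2_eq_1_iff)
    \<comment> \<open>No continuity of \<open>f'\<close> is given, so a change of sign is excluded
      through a maximum on {0..a}: it would be interior, and the derivative would vanish
      there.\<close>
    obtain z where z: "z \<in> {0..a}" "\<And>y. y \<in> {0..a} \<Longrightarrow> f y \<le> f z"
      using continuous_attains_sup[of "{0..a}" f] continuous_on_subset[OF cont, of "{0..a}"] a by auto
    have "z \<noteq> 0" using z(2)[of a] pos[OF a] f0 a by auto
    have "z \<noteq> a"
    proof
      assume "z = a"
      obtain e where e: "e > 0" "\<And>h. 0 < h \<Longrightarrow> h < e \<Longrightarrow> f a < f (a - h)"
        using DERIV_neg_dec_left[OF d'[OF a]] neg by auto
      define h where "h = min (e / 2) (a / 2)"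
      have "0 < h" "h < e" "a - h \<in> {0..a}" using e(1) a by (auto simp: h_def)
      then show False using e(2)[of h] z(2)[of "a - h"] \<open>z = a\<close> by simp
    qed
    have zz: "0 < z" "z < a" using z(1) \<open>z \<noteq> 0\<close> \<open>z \<noteq> a\<close> by auto
    have "f' z = 0"
    proof (rule DERIV_local_max[OF d'[OF zz(1)]])
      show "0 < min z (a - z)" using zz by simp
      show "\<forall>y. \<bar>z - y\<bar> < min z (a - z) \<longrightarrow> f y \<le> f z"
      proof (intro allI impI)
        fix y assume "\<bar>z - y\<bar> < min z (a - z)"
        then have "y \<in> {0..a}" unfolding atLeastAtMost_iff by arith
        then show "f y \<le> f z" by (rule z(2))
      qed
    qed
    then show False using sq[of z] zz by simp
  qed
  show ?thesis
  proof (cases "s = 0")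
    case False
    then have s: "s > 0" using s by simp
    have "continuous_on {0..s} f" by (rule continuous_on_subset[OF cont]) auto
    moreover have "f differentiable (at x)" if "0 < x" for x
      using d'[OF that] real_differentiable_def by blast
    ultimately obtain l z where z: "0 < z" "(f has_real_derivative l) (at z)" "f s - f 0 = (s - 0) * l"
      using MVT[of 0 s f] s by auto
    have "l = 1" using DERIV_unique[OF z(2) d'[OF z(1)]] one[OF z(1)] by simp
    then show ?thesis using z(3) f0 by simp
  qed (simp add: f0)
qed

text \<open>The slope m of \<gamma> inherits differentiability, and unit speed says that
  \<open>arc (e * m s)\<close> has a derivative of modulus one. The half-line lemma identifies this
  function with s, so the parametrization is unique.\<close>

lemma arc_length_end_eq:
  assumes e: "e = 1 \<or> e = - 1" and \<gamma>: "arc_length_end e \<gamma>" and s: "s \<ge> 0"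
  shows "\<gamma> s = pcurve (e * slope_at s)"
proof -
  obtain \<gamma>' where d: "\<And>s. s \<ge> 0 \<Longrightarrow> (\<gamma> has_vector_derivative \<gamma>' s) (at s within {0..})"
    and unit: "\<And>s. s \<ge> 0 \<Longrightarrow> psr_metric (\<gamma> s) (\<gamma>' s) (\<gamma>' s) = 1"
    and g0: "\<gamma> 0 = vector [1, 0]" and gin: "\<And>s. s \<ge> 0 \<Longrightarrow> \<gamma> s \<in> psr_curve"
    and gpos: "\<And>s. s > 0 \<Longrightarrow> e * \<gamma> s $ 2 > 0"
    using \<gamma> unfolding arc_length_end_def by metis
  define m where "m s = \<gamma> s $ 2 / \<gamma> s $ 1" for s
  have ee: "e * e = 1" using e by auto
  have pos1: "\<gamma> s $ 1 > 0" if "s \<ge> 0" for s using gin[OF that] by (simp add: psr_curve_def)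
  have m1: "\<bar>m s\<bar> < 1" and gm: "\<gamma> s = pcurve (m s)" if "s \<ge> 0" for s
    unfolding m_def using psr_curve_slope[OF gin[OF that]] by simp_all
  have em1: "\<bar>e * m s\<bar> < 1" if "s \<ge> 0" for s using m1[OF that] e by auto
  define m' where "m' s = (\<gamma>' s $ 2 * \<gamma> s $ 1 - \<gamma> s $ 2 * \<gamma>' s $ 1) / (\<gamma> s $ 1 * \<gamma> s $ 1)" for s
  have dm: "(m has_real_derivative m' s) (at s within {0..})" if s: "s \<ge> 0" for s
    using d[OF s] pos1[OF s] unfolding m_def[abs_def] m'_def has_vector_derivative_vec_iff
    by (intro DERIV_divide) auto
  have "\<gamma>' s = m' s *\<^sub>R pcurve' (m s)" if s: "s \<ge> 0" for s
  proof -
    have "((\<lambda>s. pcurve (m s)) has_vector_derivative m' s *\<^sub>R pcurve' (m s)) (at s within {0..})"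
      by (rule pcurve_has_vector_derivative[OF dm[OF s] m1[OF s]])
    then have "(\<gamma> has_vector_derivative m' s *\<^sub>R pcurve' (m s)) (at s within {0..})"
      by (rule has_vector_derivative_transform[rotated 2]) (use s gm in auto)
    \<comment> \<open>At s = 0 the derivative is one-sided; its uniqueness needs a nontrivial
      filter.\<close>
    moreover have "at s within {0..} \<noteq> bot"
    proof -
      have "at_right s \<le> at s within {0..}" using s by (intro at_le) auto
      then show ?thesis using trivial_limit_at_right_real[of s] by (metis bot.extremum_uniqueI)
    qed
    ultimately show ?thesis using d[OF s] vector_derivative_unique_within by blast
  qed
  then have speed: "(m' s * arc_slope (m s))\<^sup>2 = 1" if "s \<ge> 0" for s
    using unit[OF that] psr_metric_pcurve[OF m1[OF that]] gm[OF that] that by metis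
  have "arc (e * m s) = s"
  proof (rule unit_speed_half_line[where f' = "\<lambda>s. arc_slope (e * m s) * (e * m' s)", OF _ _ _ _ s])
    fix s :: real assume s: "s \<ge> 0"
    show "((\<lambda>s. arc (e * m s)) has_real_derivative arc_slope (e * m s) * (e * m' s)) (at s within {0..})"
      by (rule DERIV_chain2[OF arc_deriv[OF em1[OF s]] DERIV_cmult[OF dm[OF s]]])
    have "arc_slope (e * m s) = arc_slope (m s)" "e\<^sup>2 = 1" using e by (auto simp: arc_slope_def)
    then show "(arc_slope (e * m s) * (e * m' s))\<^sup>2 = 1"
      using speed[OF s] by (simp add: power_mult_distrib mult.commute)
  next
    show "arc (e * m 0) = 0" by (simp add: m_def g0 arc_0)
    fix s :: real assume s: "s > 0"
    have "0 < e * m s" using gpos[OF s] pos1[of s] s by (simp add: m_def)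
    then show "0 < arc (e * m s)" using arc_strict_mono[of 0 "e * m s"] em1[of s] s by (simp add: arc_0)
  qed
  then have "slope_at s = e * m s" using slope_at_arc[OF em1[OF s]] by simp
  then have "e * slope_at s = m s" using ee by (simp add: mult.assoc[symmetric])
  then show ?thesis using gm[OF s] by simp
qed

section \<open>Exponential growth along the ends\<close>

text \<open>The factor of the fiber density that depends on the base point, normalized to 1 at (1,
  0), where \<open>gD\<close> equals 3.\<close>

definition growth :: "real \<Rightarrow> real" where
  "growth s = sqrt (gD (pcurve (slope_at s)) / 3)"

lemma gD_pcurve: "gD (pcurve m) = (cx m)\<^sup>2 * (3 + m\<^sup>2)"
  by (simp add: gD_def pcurve_def algebra_simps power2_eq_square)

lemma gD_pcurve_sign: "e = 1 \<or> e = - 1 \<Longrightarrow> gD (pcurve (e * m)) = gD (pcurve m)"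
  by (auto simp: gD_pcurve cx_def)

lemma growth_eq: "growth s = cx (slope_at s) * sqrt ((3 + (slope_at s)\<^sup>2) / 3)"
  using cx_pos[OF slope_at(1)[of s]] by (simp add: growth_def gD_pcurve real_sqrt_mult real_sqrt_divide)

lemma growth_pos: "growth s > 0"
  using cx_pos[OF slope_at(1)[of s]] by (simp add: growth_eq add_pos_nonneg)

lemma growth_0: "growth 0 = 1"
  by (simp add: growth_eq slope_at_0 cx_def)

lemma growth_strict_mono: "strict_mono_on {0..} growth"
proof (rule strict_mono_onI)
  fix s t :: real assume st: "s \<in> {0..}" "t \<in> {0..}" "s < t"
  have m: "0 \<le> slope_at s" "slope_at s < slope_at t"
    using slope_at_pos[of s] st slope_at_0 slope_at_strict_mono[OF st(3)] by (cases "s = 0"; simp)+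
  then have sq: "(slope_at s)\<^sup>2 < (slope_at t)\<^sup>2" by (intro power_strict_mono) auto
  have "cx (slope_at s) < cx (slope_at t)"
    unfolding cx_def using sq one_minus_square_pos[OF slope_at(1)[of t]]
    by (intro powr_less_mono2_neg) auto
  moreover have "sqrt ((3 + (slope_at s)\<^sup>2) / 3) < sqrt ((3 + (slope_at t)\<^sup>2) / 3)" using sq by simp
  ultimately show "growth s < growth t"
    unfolding growth_eq using cx_pos[OF slope_at(1)[of s]] by (intro mult_strict_mono) (auto simp: add_nonneg_nonneg)
qed

text \<open>The limit is obtained from the closed form of \<open>arc\<close>: the divergent factors of \<open>growth s\<close> and
  \<open>exp (s / sqrt 6)\<close> cancel exactly, and what remains is continuous at slope \<open>1\<close>.\<close>

definition growth_ratio :: "real \<Rightarrow> real" where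
  "growth_ratio m = sqrt ((3 + m\<^sup>2) / 3) * (3 / ((1 + 2 * m / sqrt (3 + m\<^sup>2))\<^sup>2 * (3 + m\<^sup>2))) powr (1 / 3)
     * exp (arsinh (m / sqrt 3) / 3)"

lemma growth_over_exp: "growth s / exp (1 / sqrt 6 * s) = growth_ratio (slope_at s)"
proof -
  define m where "m = slope_at s"
  define w where "w = 2 * m / sqrt (3 + m\<^sup>2)"
  have m: "\<bar>m\<bar> < 1" and s: "s = arc m" by (simp_all add: m_def slope_at)
  have p: "1 - m\<^sup>2 > 0" by (rule one_minus_square_pos[OF m])
  have b: "3 + m\<^sup>2 > 0" by (simp add: add_pos_nonneg)
  have w: "\<bar>w\<bar> < 1" "1 - w\<^sup>2 = 3 * (1 - m\<^sup>2) / (3 + m\<^sup>2)"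
    unfolding w_def by (rule arc_argument[OF m])+
  \<comment> \<open>The origin of the rate: 1 / sqrt 6 turns the constant sqrt (2/3) of
    \<open>arc\<close> into 1/3, matching the exponent - 1/3 in \<open>cx\<close>.\<close>
  have "1 / sqrt 6 * sqrt (2 / 3) = 1 / 3"
  proof -
    have "1 / sqrt 6 * sqrt (2 / 3) = sqrt (1 / 6 * (2 / 3))" by (simp only: real_sqrt_mult real_sqrt_divide real_sqrt_one)
    also have "1 / 6 * (2 / 3) = (1 / 3 :: real)\<^sup>2" by (simp add: power2_eq_square)
    finally show ?thesis by simp
  qed
  then have "1 / sqrt 6 * s = 1 / 3 * (2 * artanh w - arsinh (m / sqrt 3))"
    unfolding s arc_def w_def[symmetric] mult.assoc[symmetric] by simp
  also have "2 * artanh w = ln ((1 + w) / (1 - w))" by (simp add: artanh_def)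
  \<comment> \<open>Expanding by 1 + w replaces 1 - w by 1 - w^2, a regular multiple of 1 - m^2,
    whose power also appears in \<open>cx\<close>.\<close>
  also have "(1 + w) / (1 - w) = (1 + w)\<^sup>2 * (3 + m\<^sup>2) / (3 * (1 - m\<^sup>2))"
  proof -
    have "(1 + w) / (1 - w) = (1 + w)\<^sup>2 / (1 - w\<^sup>2)"
    proof -
      have "1 - w\<^sup>2 = (1 + w) * (1 - w)" by (simp add: algebra_simps power2_eq_square)
      moreover have "1 + w \<noteq> 0" using w(1) by auto
      ultimately show ?thesis by (simp add: power2_eq_square)
    qed
    then show ?thesis unfolding w(2) using p b by simp
  qed
  finally have ex: "exp (1 / sqrt 6 * s) = ((1 + w)\<^sup>2 * (3 + m\<^sup>2) / (3 * (1 - m\<^sup>2))) powr (1 / 3) / exp (arsinh (m / sqrt 3) / 3)"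
    using w(1) p b by (simp add: powr_def right_diff_distrib exp_diff)
  have "growth s = (1 - m\<^sup>2) powr (- 1 / 3) * sqrt ((3 + m\<^sup>2) / 3)"
    by (simp add: growth_eq m_def cx_def)
  also have "(1 - m\<^sup>2) powr (- 1 / 3) = (3 / ((1 + w)\<^sup>2 * (3 + m\<^sup>2))) powr (1 / 3) * ((1 + w)\<^sup>2 * (3 + m\<^sup>2) / (3 * (1 - m\<^sup>2))) powr (1 / 3)"
  proof -
    have "(3 / ((1 + w)\<^sup>2 * (3 + m\<^sup>2))) * ((1 + w)\<^sup>2 * (3 + m\<^sup>2) / (3 * (1 - m\<^sup>2))) = 1 / (1 - m\<^sup>2)"
    proof -
      have "3 / (a * b) * (a * b / (3 * q)) = 1 / q" if "a > 0" "b > 0" "q > 0" for a b q :: real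
        using that by (simp add: field_simps)
      moreover have "(1 + w)\<^sup>2 > 0" using w(1) by simp
      ultimately show ?thesis using b p by blast
    qed
    then have "(3 / ((1 + w)\<^sup>2 * (3 + m\<^sup>2))) powr (1 / 3) * ((1 + w)\<^sup>2 * (3 + m\<^sup>2) / (3 * (1 - m\<^sup>2))) powr (1 / 3) = (1 / (1 - m\<^sup>2)) powr (1 / 3)"
      using w(1) b p by (subst powr_mult[symmetric]) simp_all
    also have "\<dots> = (1 - m\<^sup>2) powr (- 1 / 3)"
      using p by (simp add: powr_divide powr_minus_divide)
    finally show ?thesis ..
  qed
  finally show ?thesis
  proof -
    assume g: "growth s = (3 / ((1 + w)\<^sup>2 * (3 + m\<^sup>2))) powr (1 / 3) * ((1 + w)\<^sup>2 * (3 + m\<^sup>2) / (3 * (1 - m\<^sup>2))) powr (1 / 3) * sqrt ((3 + m\<^sup>2) / 3)"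
    define X where "X = ((1 + w)\<^sup>2 * (3 + m\<^sup>2) / (3 * (1 - m\<^sup>2))) powr (1 / 3)"
    have "X > 0" using w(1) b p by (simp add: X_def)
    then show ?thesis
      unfolding g ex growth_ratio_def m_def[symmetric] w_def[symmetric] X_def[symmetric] by simp
  qed
qed

lemma growth_increases_exponentially: "increases_exponentially growth"
  unfolding increases_exponentially_def
proof (intro conjI allI impI)
  show "growth s > 0" for s by (rule growth_pos)
  show "strict_mono_on {0..} growth" by (rule growth_strict_mono)
  have "isCont growth_ratio 1"
    unfolding growth_ratio_def[abs_def]
    by (intro isCont_mult continuous_intros) (auto simp: add_pos_nonneg)
  then have "((\<lambda>s. growth_ratio (slope_at s)) \<longlongrightarrow> growth_ratio 1) at_top"
    using isCont_tendsto_compose slope_at_tendsto by blast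
  moreover have "growth_ratio 1 > 0" by (simp add: growth_ratio_def)
  ultimately show "\<exists>\<alpha>>0. \<exists>C>0. ((\<lambda>s. growth s / exp (\<alpha> * s)) \<longlongrightarrow> C) at_top"
    unfolding growth_over_exp[symmetric]
    by (intro exI[of _ "1 / sqrt 6"] exI[of _ "growth_ratio 1"] conjI) simp_all
qed

section \<open>Fiber-wise and total volume\<close>

text \<open>The quotient volume for the density common to all fibers; the base point enters only
  through \<open>fiber_factor\<close>.\<close>

definition fiber_quotient_volume :: "((real ^ 2 ^ 2) \<times> (real ^ lie)) set \<Rightarrow> (real ^ fcoord) set \<Rightarrow> ennreal" where
  "fiber_quotient_volume \<Gamma> E = (SUP D\<in>{D \<in> sets borel. D \<subseteq> E \<and> fiber_injective \<Gamma> D}.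
     \<integral>\<^sup>+u. indicator D u * fiber_density u \<partial>lborel)"

text \<open>The root of 3 g / 32 is split so that the first factor is \<open>growth\<close> when g
  is taken along an end of the curve; 2 ^ 13 is the constant of the fiber density.\<close>

definition fiber_factor :: "real \<Rightarrow> real" where
  "fiber_factor g = sqrt (g / 3) * (sqrt (9 / 32) / 2 ^ 13)"

lemma riem_volume_fiber:
  assumes x: "x \<in> psr_curve" and D: "D \<subseteq> fiber_space" "D \<in> sets borel"
  shows "riem_volume (pullback_metric (fiber_chart x) qmap_metric) D
    = ennreal (fiber_factor (gD x)) * (\<integral>\<^sup>+u. indicator D u * fiber_density u \<partial>lborel)"
proof -
  have "sqrt (det (\<chi> i j. pullback_metric (fiber_chart x) qmap_metric u (axis i 1) (axis j 1)))
      = fiber_factor (gD x) * (1 / ((u $ FR) ^ 3 * (u $ FRho) ^ 5))" if "u \<in> D" for u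
  proof -
    have "sqrt (3 * gD x / 32) = sqrt (gD x / 3) * sqrt (9 / 32)"
      unfolding real_sqrt_mult[symmetric] by simp
    then show ?thesis
      using det_pullback_metric[OF x, of u] that D(1) by (auto simp: fiber_factor_def)
  qed
  note eq = this
  have "ennreal (fiber_factor (gD x) * c) = ennreal (fiber_factor (gD x)) * ennreal c" for c
    using psr_curve_pos[OF x] by (intro ennreal_mult') (simp add: fiber_factor_def)
  note mult = this
  have "riem_volume (pullback_metric (fiber_chart x) qmap_metric) D
    = (\<integral>\<^sup>+u. ennreal (fiber_factor (gD x)) * (indicator D u * fiber_density u) \<partial>lborel)"
    unfolding riem_volume_def
  proof (rule nn_integral_cong)
    fix u :: "real ^ fcoord"
    show "ennreal (sqrt (det (\<chi> i j. pullback_metric (fiber_chart x) qmap_metric u (axis i 1) (axis j 1))))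
        * indicator D u = ennreal (fiber_factor (gD x)) * (indicator D u * fiber_density u)"
    proof (cases "u \<in> D")
      case True
      then show ?thesis
        unfolding eq[OF True] mult fiber_density_def by simp
    qed simp
  qed
  also have "\<dots> = ennreal (fiber_factor (gD x)) * (\<integral>\<^sup>+u. indicator D u * fiber_density u \<partial>lborel)"
    using D(2) by (intro nn_integral_cmult borel_measurable_times_ennreal borel_measurable_indicator) simp_all
  finally show ?thesis .
qed

lemma fiber_volume_eq:
  assumes \<Gamma>: "\<Gamma> \<subseteq> sl2 \<times> UNIV" and x: "x \<in> psr_curve" and E: "E \<subseteq> fiber_space"
  shows "fiber_volume \<Gamma> x E = ennreal (fiber_factor (gD x)) * fiber_quotient_volume \<Gamma> E"
proof -
  have "(\<exists>g\<in>\<Gamma>. act g (fiber_chart x u) = fiber_chart x w) \<longleftrightarrow> (\<exists>g\<in>\<Gamma>. fiber_act g u = w)"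
    if "u \<in> E" "w \<in> E" for u w
  proof (rule bex_cong[OF refl])
    fix g assume "g \<in> \<Gamma>"
    then show "act g (fiber_chart x u) = fiber_chart x w \<longleftrightarrow> fiber_act g u = w"
      using that E \<Gamma> by (intro act_fiber_chart_eq_iff[OF x]) auto
  qed
  then have inj: "(\<forall>u\<in>D. \<forall>w\<in>D. (\<exists>g\<in>\<Gamma>. act g (fiber_chart x u) = fiber_chart x w) \<longrightarrow> u = w)
     \<longleftrightarrow> fiber_injective \<Gamma> D" if "D \<subseteq> E" for D
    unfolding fiber_injective_def using that by (intro ball_cong refl) (auto simp: subset_iff)
  have "fiber_volume \<Gamma> x E = (SUP D\<in>{D \<in> sets borel. D \<subseteq> E \<and> fiber_injective \<Gamma> D}.
     riem_volume (pullback_metric (fiber_chart x) qmap_metric) D)"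
    unfolding fiber_volume_def quotient_volume_def
    by (intro SUP_cong) (auto simp: inj cong: conj_cong)
  also have "\<dots> = (SUP D\<in>{D \<in> sets borel. D \<subseteq> E \<and> fiber_injective \<Gamma> D}.
     ennreal (fiber_factor (gD x)) * (\<integral>\<^sup>+u. indicator D u * fiber_density u \<partial>lborel))"
    using E by (intro SUP_cong riem_volume_fiber[OF x]) auto
  also have "\<dots> = ennreal (fiber_factor (gD x)) * fiber_quotient_volume \<Gamma> E"
    unfolding fiber_quotient_volume_def by (rule SUP_mult_left_ennreal[symmetric])
  finally show ?thesis .
qed

lemma fiber_part_subset: "fiber_part \<epsilon> \<subseteq> fiber_space" by (auto simp: fiber_part_def)

lemma fiber_quotient_volume_finite:
  assumes "lattice_in \<Gamma> qgroup" "\<epsilon> > 0"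
  shows "fiber_quotient_volume \<Gamma> (fiber_part \<epsilon>) < \<infinity>"
proof -
  obtain C where C: "C < \<infinity>"
    "\<And>D. D \<in> sets borel \<Longrightarrow> D \<subseteq> fiber_part \<epsilon> \<Longrightarrow> fiber_injective \<Gamma> D
      \<Longrightarrow> (\<integral>\<^sup>+u. indicator D u * fiber_density u \<partial>lborel) \<le> C"
    using fiber_volume_bound[OF assms] by blast
  have "fiber_quotient_volume \<Gamma> (fiber_part \<epsilon>) \<le> C"
    unfolding fiber_quotient_volume_def using C(2) by (intro SUP_least) auto
  then show ?thesis using C(1) by (rule le_less_trans)
qed

lemma injective_set_of_positive_volume:
  assumes lat: "lattice_in \<Gamma> qgroup"
  obtains D where "D \<in> sets borel" "D \<subseteq> fiber_part \<epsilon>" "fiber_injective \<Gamma> D"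
    "(\<integral>\<^sup>+u. indicator D u * fiber_density u \<partial>lborel) > 0"
proof -
  let ?U = "{u :: real ^ fcoord. 0 < u $ FR \<and> 0 < u $ FRho \<and> \<epsilon> < u $ FRho * u $ FR}"
  have op: "open ?U" by (intro open_Collect_conj open_Collect_less continuous_intros)
  \<comment> \<open>The point with r = \<bar>\<epsilon>\<bar> + 1 and \<open>\<rho>\<close> = 1
    works for either sign of \<epsilon>.\<close>
  have "vec_upd (vec_upd 0 FR (\<bar>\<epsilon>\<bar> + 1)) FRho 1 \<in> ?U" by simp arith
  then have ne: "?U \<noteq> {}" by blast
  have sub: "?U \<subseteq> fiber_part \<epsilon>" "?U \<subseteq> fiber_space" by (auto simp: fiber_part_def fiber_space_def)
  obtain D where D: "open D" "D \<noteq> {}" "D \<subseteq> ?U" "fiber_injective \<Gamma> D"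
    using injective_open_subset[OF lat op ne sub(2)] by blast
  have Dm [measurable]: "D \<in> sets borel" using D(1) by simp
  show ?thesis
  proof (rule that[OF Dm _ D(4)])
    show "D \<subseteq> fiber_part \<epsilon>" using D(3) sub by blast
    show "(\<integral>\<^sup>+u. indicator D u * fiber_density u \<partial>lborel) > 0"
    proof (rule ccontr)
      assume "\<not> ?thesis"
      then have "(\<integral>\<^sup>+u. indicator D u * fiber_density u \<partial>lborel) = 0" by (simp add: not_less)
      then have "AE u in lborel. indicator D u * fiber_density u = 0"
        by (subst (asm) nn_integral_0_iff_AE) auto
      then have "AE u in lborel. u \<notin> D"
      proof eventually_elim
        case (elim u)
        then show ?case using D(3) by (auto simp: indicator_def fiber_density_def)
      qed
      then have "emeasure lborel D = 0"
        by (subst (asm) AE_iff_measurable[where N = D]) auto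
      then show False using emeasure_lborel_open_pos[OF D(1,2)] by simp
    qed
  qed
qed

lemma fiber_quotient_volume_pos:
  assumes "lattice_in \<Gamma> qgroup" shows "fiber_quotient_volume \<Gamma> (fiber_part \<epsilon>) > 0"
proof -
  obtain D where D: "D \<in> sets borel" "D \<subseteq> fiber_part \<epsilon>" "fiber_injective \<Gamma> D"
    "(\<integral>\<^sup>+u. indicator D u * fiber_density u \<partial>lborel) > 0"
    using injective_set_of_positive_volume[OF assms] by blast
  note D(4)
  also have "(\<integral>\<^sup>+u. indicator D u * fiber_density u \<partial>lborel) \<le> fiber_quotient_volume \<Gamma> (fiber_part \<epsilon>)"
    unfolding fiber_quotient_volume_def using D(1-3) by (intro SUP_upper) auto
  finally show ?thesis .
qed

lemma increases_exponentially_cmult: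
  assumes f: "increases_exponentially f" and c: "c > 0" and g: "\<And>s. s \<ge> 0 \<Longrightarrow> g s = f s * c"
  shows "increases_exponentially g"
proof -
  from f obtain \<alpha> C where \<alpha>: "\<alpha> > 0" "C > 0" "((\<lambda>s. f s / exp (\<alpha> * s)) \<longlongrightarrow> C) at_top"
    by (auto simp: increases_exponentially_def)
  have "((\<lambda>s. f s / exp (\<alpha> * s) * c) \<longlongrightarrow> C * c) at_top" by (intro tendsto_intros \<alpha>)
  moreover have "\<forall>\<^sub>F s in at_top. f s / exp (\<alpha> * s) * c = g s / exp (\<alpha> * s)"
    using eventually_ge_at_top[of "0::real"] by eventually_elim (simp add: g)
  ultimately have "((\<lambda>s. g s / exp (\<alpha> * s)) \<longlongrightarrow> C * c) at_top" by (rule Lim_transform_eventually)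
  then have "\<exists>\<alpha>>0. \<exists>C>0. ((\<lambda>s. g s / exp (\<alpha> * s)) \<longlongrightarrow> C) at_top"
    using \<alpha> c by (intro exI[of _ \<alpha>] conjI exI[of _ "C * c"]) auto
  then show ?thesis
    using f c unfolding increases_exponentially_def strict_mono_on_def by (simp add: g)
qed

section \<open>Divergence of the total volume\<close>

text \<open>On ]1 - h, 1[ the integrand is at least its value at 1 - h. As
  \<open>(cx (1 - h)) ^ 3 * (2 * h)\<close> is at least 1, the integral is at least half of
  \<open>cx (1 - h)\<close>, which is unbounded as h tends to 0.\<close>

lemma nn_integral_cx_power_4: "(\<integral>\<^sup>+m. ennreal ((cx m) ^ 4) * indicator {- 1<..<1} m \<partial>lborel) = \<infinity>"
proof (rule ccontr)
  assume "(\<integral>\<^sup>+m. ennreal ((cx m) ^ 4) * indicator {- 1<..<1} m \<partial>lborel) \<noteq> \<infinity>"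
  then obtain I where I: "(\<integral>\<^sup>+m. ennreal ((cx m) ^ 4) * indicator {- 1<..<1} m \<partial>lborel) = ennreal I" "I \<ge> 0"
    by (cases "(\<integral>\<^sup>+m. ennreal ((cx m) ^ 4) * indicator {- 1<..<1} m \<partial>lborel)") auto
  define N where "N = 2 * I + 2"
  \<comment> \<open>Makes 1 / (2 h) equal to N^3, which forces \<open>cx (1 - h)\<close> to be at
    least N; and N / 2 = I + 1 exceeds the supposed value of the integral.\<close>
  define h where "h = 1 / (2 * N ^ 3)"
  have N: "N \<ge> 1" using I by (simp add: N_def)
  have N3: "N ^ 3 \<ge> 1" using N by (rule one_le_power)
  have "1 < 2 * N ^ 3" using N3 by linarith
  then have h: "0 < h" "h < 1" using N by (simp_all add: h_def divide_less_eq)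
  have h1: "\<bar>1 - h\<bar> < 1" using h by simp
  have c0: "cx (1 - h) > 0" by (rule cx_pos[OF h1])
  have c3: "(cx (1 - h)) ^ 3 * (2 * h) \<ge> 1"
  proof -
    have "1 = (cx (1 - h)) ^ 3 * (1 - (1 - h)\<^sup>2)" using cx_cube[OF h1] by simp
    also have "\<dots> \<le> (cx (1 - h)) ^ 3 * (2 * h)"
      using c0 by (intro mult_left_mono) (auto simp: power2_eq_square algebra_simps)
    finally show ?thesis .
  qed
  have cN: "cx (1 - h) \<ge> N"
  proof -
    have "N ^ 3 \<le> (cx (1 - h)) ^ 3" using c3 N by (simp add: h_def field_simps)
    then show ?thesis using c0 by (intro power_le_imp_le_base[of N 2]) (auto simp: eval_nat_numeral)
  qed
  have "ennreal (I + 1) \<le> ennreal ((cx (1 - h)) ^ 4 * h)"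
  proof (rule ennreal_leI)
    have "I + 1 = N / 2" by (simp add: N_def)
    also have "\<dots> \<le> cx (1 - h) / 2 * ((cx (1 - h)) ^ 3 * (2 * h))"
      using mult_mono[OF _ c3, of "N / 2" "cx (1 - h) / 2"] cN c0 by simp
    also have "\<dots> = (cx (1 - h)) ^ 4 * h" by (simp add: eval_nat_numeral)
    finally show "I + 1 \<le> (cx (1 - h)) ^ 4 * h" .
  qed
  also have "\<dots> = (\<integral>\<^sup>+m. ennreal ((cx (1 - h)) ^ 4) * indicator {1 - h<..<1} m \<partial>lborel)"
    using h c0 by (simp add: nn_integral_cmult_indicator ennreal_mult)
  also have "\<dots> \<le> (\<integral>\<^sup>+m. ennreal ((cx m) ^ 4) * indicator {- 1<..<1} m \<partial>lborel)"
  proof (intro nn_integral_mono)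
    fix m :: real
    have "(cx (1 - h)) ^ 4 \<le> (cx m) ^ 4" if m: "1 - h < m" "m < 1"
    proof (rule power_mono)
      have "(1 - h)\<^sup>2 \<le> m\<^sup>2" using m h by (intro power_mono) auto
      moreover have "1 - m\<^sup>2 > 0" using m h by (intro one_minus_square_pos) auto
      ultimately show "cx (1 - h) \<le> cx m"
        unfolding cx_def by (intro powr_mono2') auto
    qed (use c0 in simp)
    then show "ennreal ((cx (1 - h)) ^ 4) * indicator {1 - h<..<1} m \<le> ennreal ((cx m) ^ 4) * indicator {- 1<..<1} m"
      using h by (auto simp: indicator_def intro!: ennreal_leI)
  qed
  also have "\<dots> = ennreal I" by (rule I)
  finally show False using I(2) by simp
qed

text \<open>The total space in the coordinates of the fibers and the slope \<open>m\<close> of the base point: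
  \<open>m\<close> is stored at the index \<open>T 2\<close> and \<open>r\<close> at the index \<open>T 1\<close>.\<close>

definition coord_of :: "real \<times> (real ^ fcoord) \<Rightarrow> real ^ coord" where
  "coord_of = (\<lambda>(m, u). \<chi> i. case i of B a \<Rightarrow> u $ FB a | T a \<Rightarrow> (if a = 1 then u $ FR else m)
     | Rho \<Rightarrow> u $ FRho | Zt j \<Rightarrow> u $ FZt j | Zl j \<Rightarrow> u $ FZl j | Sig \<Rightarrow> u $ FSig)"

definition fcoord_part :: "real ^ coord \<Rightarrow> real \<Rightarrow> real ^ fcoord" where
  "fcoord_part p r = (\<chi> i. case i of FB a \<Rightarrow> p $ B a | FR \<Rightarrow> r | FRho \<Rightarrow> p $ Rho | FZt j \<Rightarrow> p $ Zt j
     | FZl j \<Rightarrow> p $ Zl j | FSig \<Rightarrow> p $ Sig)"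

lemma fcoord_part_coord_of: "fcoord_part (coord_of (m, u)) (u $ FR) = u"
  by (auto simp: fcoord_part_def coord_of_def vec_eq_iff split: fcoord.split)

lemma coord_of_nth: "coord_of (m, u) $ T 1 = u $ FR" "coord_of (m, u) $ T 2 = m" "coord_of (m, u) $ Rho = u $ FRho"
  by (simp_all add: coord_of_def)

lemma fcoord_part_nth: "fcoord_part p r $ FR = r" "fcoord_part p r $ FRho = p $ Rho"
  by (simp_all add: fcoord_part_def)

lemma measurable_fcoord_part [measurable (raw)]:
  assumes [measurable]: "f \<in> borel_measurable M" "g \<in> borel_measurable M"
  shows "(\<lambda>x. fcoord_part (f x) (g x)) \<in> borel_measurable M"
proof (rule borel_measurable_vecI)
  fix i show "(\<lambda>x. fcoord_part (f x) (g x) $ i) \<in> borel_measurable M"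
    by (cases i) (simp_all add: fcoord_part_def)
qed

lemma fiber_chart_fcoord_part: "fiber_chart x (fcoord_part p r) = p" if "\<And>a. p $ T a = r * x $ a"
  using that by (auto simp: fiber_chart_def fcoord_part_def vec_eq_iff split: coord.split)

lemma linear_coord_of: "linear coord_of"
  by (rule linearI) (auto simp: coord_of_def vec_eq_iff split: coord.split)

lemma measurable_coord_of [measurable]: "coord_of \<in> borel_measurable borel"
  using linear_coord_of by (intro borel_measurable_continuous_onI linear_continuous_on)
    (simp add: linear_conv_bounded_linear)

lemma nn_integral_coord_of:
  fixes F :: "real ^ coord \<Rightarrow> ennreal"
  assumes F [measurable]: "F \<in> borel_measurable borel"
  shows "(\<integral>\<^sup>+p. F p \<partial>lborel) = (\<integral>\<^sup>+m. \<integral>\<^sup>+u. F (coord_of (m, u)) \<partial>lborel \<partial>lborel)"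
proof -
  have ax1: "coord_of (1, 0) = axis (T 2) 1"
    unfolding vec_eq_iff
  proof
    fix j show "coord_of (1, 0) $ j = (axis (T 2) 1 :: real ^ coord) $ j"
      using two_cases by (cases j) (auto simp: coord_of_def axis_def)
  qed
  have ax2: "coord_of (0, axis i 1) = axis (fcoord_embed i) 1" for i
    unfolding vec_eq_iff
  proof
    fix j show "coord_of (0, axis i 1) $ j = (axis (fcoord_embed i) 1 :: real ^ coord) $ j"
      by (cases i; cases j) (simp_all add: coord_of_def axis_def)
  qed
  have mem: "(1, 0) \<in> (Basis :: (real \<times> (real ^ fcoord)) set)"
    "(0, axis i 1) \<in> (Basis :: (real \<times> (real ^ fcoord)) set)" for i
    by (auto simp: Basis_prod_def Basis_real_vec)
  have bij: "bij_betw coord_of Basis Basis"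
  proof (rule bij_betw_imageI)
    show "inj_on coord_of Basis"
      by (rule inj_on_inverseI[where g = "\<lambda>p. (p $ T 2, fcoord_part p (p $ T 1))"])
         (auto simp: coord_of_nth fcoord_part_coord_of)
    have "coord_of ` Basis \<subseteq> Basis"
      by (auto simp: Basis_prod_def Basis_real_vec ax1 ax2)
    moreover have "axis i 1 \<in> coord_of ` Basis" for i
    proof (cases "i = T 2")
      case True
      then show ?thesis using ax1 mem(1) by (metis image_eqI)
    next
      case False
      have "\<exists>k. i = fcoord_embed k"
      proof (cases i)
        case (B a) then show ?thesis by (intro exI[of _ "FB a"]) simp
      next
        case (T a) then show ?thesis using False two_cases[of a] by (intro exI[of _ FR]) auto
      next
        case Rho then show ?thesis by (intro exI[of _ FRho]) simp
      next
        case (Zt j) then show ?thesis by (intro exI[of _ "FZt j"]) simp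
      next
        case (Zl j) then show ?thesis by (intro exI[of _ "FZl j"]) simp
      next
        case Sig then show ?thesis by (intro exI[of _ FSig]) simp
      qed
      then show ?thesis using ax2 mem(2) by (metis image_eqI)
    qed
    ultimately show "coord_of ` Basis = Basis" unfolding Basis_real_vec by blast
  qed
  have "(\<integral>\<^sup>+p. F p \<partial>lborel) = (\<integral>\<^sup>+q. F (coord_of q) \<partial>lborel)"
    by (rule nn_integral_lborel_Basis[OF linear_coord_of bij F])
  also have "\<dots> = (\<integral>\<^sup>+m. \<integral>\<^sup>+u. F (coord_of (m, u)) \<partial>lborel \<partial>lborel)"
    by (rule nn_integral_lborel_Pair) measurable
  finally show ?thesis .
qed

lemma measurable_cx [measurable]: "cx \<in> borel_measurable borel"
  unfolding cx_def[abs_def] by measurable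

text \<open>In t = r \<open>cx m\<close> (1, m) the Jacobian r \<open>(cx m)\<^sup>2\<close> comes
  from two scalings, of \<open>T 2\<close> by the first component of t and of \<open>T 1\<close> by
  \<open>cx m\<close>. The region outside r > 0 and \<bar>m\<bar> < 1 is dropped, hence an
  inequality.\<close>

lemma nn_integral_cone_coordinates:
  fixes F :: "real ^ coord \<Rightarrow> ennreal"
  assumes F [measurable]: "F \<in> borel_measurable borel"
  shows "(\<integral>\<^sup>+m. indicator {- 1<..<1} m * (\<integral>\<^sup>+u. indicator {0<..} (u $ FR) * ennreal (u $ FR * (cx m)\<^sup>2)
      * F (fiber_chart (pcurve m) u) \<partial>lborel) \<partial>lborel) \<le> (\<integral>\<^sup>+p. F p \<partial>lborel)"
proof -
  \<comment> \<open>The default 1 off the relevant region keeps both scaling factors nonzero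
    everywhere.\<close>
  define s1 where "s1 p = (if p $ T 1 > 0 then p $ T 1 else 1)" for p :: "real ^ coord"
  define s2 where "s2 p = (if \<bar>p $ T 2\<bar> < 1 then cx (p $ T 2) else 1)" for p :: "real ^ coord"
  have [measurable]: "s1 \<in> borel_measurable borel" "s2 \<in> borel_measurable borel"
    unfolding s1_def[abs_def] s2_def[abs_def] by measurable
  define F1 where "F1 p = ennreal \<bar>s1 p\<bar> * F (vec_upd p (T 2) (0 + s1 p * p $ T 2))" for p
  have [measurable]: "F1 \<in> borel_measurable borel" unfolding F1_def[abs_def] by measurable
  define F2 where "F2 p = ennreal \<bar>s2 p\<bar> * F1 (vec_upd p (T 1) (0 + s2 p * p $ T 1))" for p
  have [measurable]: "F2 \<in> borel_measurable borel" unfolding F2_def[abs_def] by measurable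
  have "(\<integral>\<^sup>+p. F p \<partial>lborel) = (\<integral>\<^sup>+p. F1 p \<partial>lborel)"
    unfolding F1_def by (rule nn_integral_coord_affine[symmetric]) (auto simp: s1_def)
  also have "\<dots> = (\<integral>\<^sup>+p. F2 p \<partial>lborel)"
    unfolding F2_def
    by (rule nn_integral_coord_affine[symmetric]) (auto simp: s2_def dest: cx_pos)
  also have "\<dots> = (\<integral>\<^sup>+m. \<integral>\<^sup>+u. F2 (coord_of (m, u)) \<partial>lborel \<partial>lborel)"
    by (rule nn_integral_coord_of) measurable
  also have "\<dots> \<ge> (\<integral>\<^sup>+m. indicator {- 1<..<1} m * (\<integral>\<^sup>+u. indicator {0<..} (u $ FR) * ennreal (u $ FR * (cx m)\<^sup>2)
      * F (fiber_chart (pcurve m) u) \<partial>lborel) \<partial>lborel)"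
  proof (rule nn_integral_mono)
    fix m :: real
    show "indicator {- 1<..<1} m * (\<integral>\<^sup>+u. indicator {0<..} (u $ FR) * ennreal (u $ FR * (cx m)\<^sup>2)
      * F (fiber_chart (pcurve m) u) \<partial>lborel) \<le> (\<integral>\<^sup>+u. F2 (coord_of (m, u)) \<partial>lborel)"
    proof (cases "\<bar>m\<bar> < 1")
      case True
      have "(\<integral>\<^sup>+u. indicator {0<..} (u $ FR) * ennreal (u $ FR * (cx m)\<^sup>2) * F (fiber_chart (pcurve m) u) \<partial>lborel)
         \<le> (\<integral>\<^sup>+u. F2 (coord_of (m, u)) \<partial>lborel)"
      proof (rule nn_integral_mono)
        fix u :: "real ^ fcoord"
        show "indicator {0<..} (u $ FR) * ennreal (u $ FR * (cx m)\<^sup>2) * F (fiber_chart (pcurve m) u) \<le> F2 (coord_of (m, u))"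
        proof (cases "u $ FR > 0")
          case r: True
          have c: "cx m > 0" by (rule cx_pos[OF True])
          define p where "p = vec_upd (coord_of (m, u)) (T 1) (cx m * u $ FR)"
          have s: "s2 (coord_of (m, u)) = cx m" "s1 p = cx m * u $ FR"
            using True c r by (simp_all add: s2_def s1_def p_def coord_of_nth)
          have "vec_upd p (T 2) (cx m * u $ FR * m) = fiber_chart (pcurve m) u"
            using two_cases by (auto simp: p_def vec_eq_iff coord_of_def fiber_chart_def pcurve_def split: coord.split)
          then have "F2 (coord_of (m, u)) = ennreal (cx m) * (ennreal (cx m * u $ FR) * F (fiber_chart (pcurve m) u))"
            using c r by (simp add: F2_def s coord_of_nth p_def[symmetric] F1_def) (simp add: p_def coord_of_nth)?
          also have "\<dots> = ennreal (u $ FR * (cx m)\<^sup>2) * F (fiber_chart (pcurve m) u)"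
          proof -
            have "ennreal (cx m) * ennreal (cx m * u $ FR) = ennreal (cx m * (cx m * u $ FR))"
              using c r by (intro ennreal_mult[symmetric]) auto
            also have "cx m * (cx m * u $ FR) = u $ FR * (cx m)\<^sup>2" by (simp add: power2_eq_square)
            finally show ?thesis by (simp only: mult.assoc[symmetric])
          qed
          finally show ?thesis using r by simp
        qed simp
      qed
      then show ?thesis using True by (simp add: indicator_def)
    qed (auto simp: indicator_def)
  qed
  finally show ?thesis .
qed

text \<open>One injective set \<open>D\<close> of positive fiber volume, spread over all fibers, is
  injective in the total space because the group preserves base points. Integrating its fiber volume
  over the slope then gives the divergent integral.\<close>

lemma total_volume_part_infinite:
  assumes lat: "lattice_in \<Gamma> qgroup"
  shows "total_volume \<Gamma> (qmap_part \<epsilon>) = \<infinity>"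
proof -
  note \<Gamma> = lattice_qgroup[OF lat]
  obtain D where D [measurable]: "D \<in> sets borel" and Dsub: "D \<subseteq> fiber_part \<epsilon>" and inj: "fiber_injective \<Gamma> D"
    and Dpos: "(\<integral>\<^sup>+u. indicator D u * fiber_density u \<partial>lborel) > 0"
    using injective_set_of_positive_volume[OF lat] by blast
  have Dfs: "D \<subseteq> fiber_space" using Dsub fiber_part_subset by blast
  \<comment> \<open>The union of the images of \<open>D\<close> under all fiber charts, written so
    as to be visibly Borel: r is recovered as the cube root of \<open>hcub\<close>.\<close>
  define E where "E = {p :: real ^ coord. p $ T 1 > 0 \<and> hcub (tpart p) > 0 \<and> fcoord_part p (root 3 (hcub (tpart p))) \<in> D}"
  have hm [measurable]: "(\<lambda>p. hcub (tpart p)) \<in> borel_measurable borel"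
    by (simp add: hcub_def tpart_def)
  have [measurable]: "root 3 \<in> borel_measurable borel"
    by (intro borel_measurable_continuous_onI continuous_on_real_root continuous_on_id)
  have Em [measurable]: "E \<in> sets borel" unfolding E_def by measurable
  have E: "\<exists>x\<in>psr_curve. \<exists>u\<in>D. p = fiber_chart x u" if "p \<in> E" for p
  proof -
    define r where "r = root 3 (hcub (tpart p))"
    have p: "p $ T 1 > 0" "hcub (tpart p) > 0" "fcoord_part p r \<in> D" using that by (auto simp: E_def r_def)
    have r: "r > 0" "r ^ 3 = hcub (tpart p)" using p(2) by (simp_all add: r_def)
    define x where "x = (1 / r) *\<^sub>R tpart p"
    have "hcub x = 1" using p(2) by (simp add: x_def hcub_scaleR power_divide r(2))
    then have "x \<in> psr_curve" using p(1) r(1)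
      by (simp add: psr_curve_def hcub_def x_def tpart_def algebra_simps power2_eq_square power3_eq_cube)
    moreover have "fiber_chart x (fcoord_part p r) = p"
      using r(1) by (intro fiber_chart_fcoord_part) (simp add: x_def tpart_def)
    ultimately show ?thesis using p(3) by metis
  qed
  have chart_in_E: "fiber_chart x u \<in> E" if "x \<in> psr_curve" "u \<in> D" for x u
  proof -
    have u: "u \<in> fiber_space" using that Dfs by blast
    then have r: "u $ FR > 0" by (simp add: fiber_space_def)
    have h: "hcub (tpart (fiber_chart x u)) = (u $ FR) ^ 3"
      using that(1) by (simp add: tpart_fiber_chart hcub_scaleR hcub_psr_curve)
    moreover have "root 3 ((u $ FR) ^ 3) = u $ FR" using r by (simp add: real_root_power_cancel)
    moreover have "fcoord_part (fiber_chart x u) (u $ FR) = u"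
      by (auto simp: fcoord_part_def fiber_chart_def vec_eq_iff split: fcoord.split)
    ultimately show ?thesis
      using r that psr_curve_pos(1)[OF that(1)] by (simp add: E_def fiber_chart_def)
  qed
  have E_part: "E \<subseteq> qmap_part \<epsilon>"
  proof
    fix p assume "p \<in> E"
    then obtain x u where xu: "x \<in> psr_curve" "u \<in> D" "p = fiber_chart x u" using E by blast
    have "u \<in> fiber_part \<epsilon>" "u \<in> fiber_space" using xu(2) Dsub Dfs by blast+
    then show "p \<in> qmap_part \<epsilon>"
      unfolding xu(3) using fiber_chart_in_qmap_part_iff[OF xu(1)] by blast
  qed
  have E_inj: "p = q" if pq: "p \<in> E" "q \<in> E" and g: "g \<in> \<Gamma>" "act g p = q" for p q g
  proof -
    obtain x u where xu: "x \<in> psr_curve" "u \<in> D" "p = fiber_chart x u" using E pq(1) by blast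
    obtain y w where yw: "y \<in> psr_curve" "w \<in> D" "q = fiber_chart y w" using E pq(2) by blast
    have uw: "u \<in> fiber_space" "w \<in> fiber_space" using xu(2) yw(2) Dfs by blast+
    have gG: "g \<in> sl2 \<times> UNIV" using g(1) \<Gamma>(1) by blast
    have eq: "fiber_chart x (fiber_act g u) = fiber_chart y w"
      using g(2) by (simp add: xu(3) yw(3) act_fiber_chart[OF xu(1) uw(1)])
    have "qmap_proj (fiber_chart x (fiber_act g u)) = x"
      by (rule qmap_proj_fiber_chart[OF xu(1) fiber_act_closed[OF gG uw(1)]])
    then have xy: "x = y" using qmap_proj_fiber_chart[OF yw(1) uw(2)] eq by simp
    then have "fiber_act g u = w"
      using eq inj_on_fiber_chart[OF xu(1)] fiber_act_closed[OF gG uw(1)] uw(2) by (simp add: inj_on_def)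
    then have "u = w" using inj xu(2) yw(2) g(1) unfolding fiber_injective_def by blast
    then show ?thesis by (simp add: xu(3) yw(3) xy)
  qed
  define F where "F p = indicator E p * ennreal (gD (tpart p) / (8 * (hcub (tpart p))\<^sup>2) / (2 ^ 13 * (p $ Rho) ^ 5))" for p
  have [measurable]: "F \<in> borel_measurable borel"
  proof -
    have [measurable]: "(\<lambda>p. gD (tpart p)) \<in> borel_measurable borel"
      by (simp add: gD_def tpart_def)
    have [measurable]: "(\<lambda>p :: real ^ coord. p $ Rho) \<in> borel_measurable borel" by simp
    show ?thesis unfolding F_def[abs_def] by measurable
  qed
  have "riem_volume qmap_metric E = (\<integral>\<^sup>+p. F p \<partial>lborel)"
    unfolding riem_volume_def
  proof (rule nn_integral_cong)
    fix p :: "real ^ coord"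
    have "sqrt (det (\<chi> i j. qmap_metric p (axis i 1) (axis j 1)))
      = gD (tpart p) / (8 * (hcub (tpart p))\<^sup>2) / (2 ^ 13 * (p $ Rho) ^ 5)" if p: "p \<in> E"
    proof (rule det_qmap_metric)
      show "hcub (tpart p) > 0" "tpart p $ 1 > 0" using p by (auto simp: E_def tpart_def)
      have "fcoord_part p (root 3 (hcub (tpart p))) \<in> fiber_space" using p Dfs by (auto simp: E_def)
      then show "p $ Rho > 0" by (simp add: fiber_space_def fcoord_part_nth)
    qed
    then show "ennreal (sqrt (det (\<chi> i j. qmap_metric p (axis i 1) (axis j 1)))) * indicator E p = F p"
      by (auto simp: F_def indicator_def)
  qed
  moreover have "(\<integral>\<^sup>+p. F p \<partial>lborel) = \<infinity>"
  proof -
    \<comment> \<open>The density contributes 8 * 2 ^ 13 = 2 ^ 16 and \<open>gD (pcurve m)\<close>,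
      which is at least 3 \<open>(cx m)\<^sup>2\<close>; the Jacobian supplies the other factor
      \<open>(cx m)\<^sup>2\<close> of the fourth power.\<close>
    let ?c = "3 / 2 ^ 16 :: real"
    let ?V = "\<integral>\<^sup>+u. indicator D u * fiber_density u \<partial>lborel"
    have "(\<integral>\<^sup>+m. ennreal ((cx m) ^ 4) * indicator {- 1<..<1} m * (ennreal ?c * ?V) \<partial>lborel)
      \<le> (\<integral>\<^sup>+m. indicator {- 1<..<1} m * (\<integral>\<^sup>+u. indicator {0<..} (u $ FR) * ennreal (u $ FR * (cx m)\<^sup>2)
      * F (fiber_chart (pcurve m) u) \<partial>lborel) \<partial>lborel)"
    proof (rule nn_integral_mono)
      fix m :: real
      show "ennreal ((cx m) ^ 4) * indicator {- 1<..<1} m * (ennreal ?c * ?V)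
        \<le> indicator {- 1<..<1} m * (\<integral>\<^sup>+u. indicator {0<..} (u $ FR) * ennreal (u $ FR * (cx m)\<^sup>2)
      * F (fiber_chart (pcurve m) u) \<partial>lborel)"
      proof (cases "\<bar>m\<bar> < 1")
        case m: True
        have c: "cx m > 0" by (rule cx_pos[OF m])
        have x: "pcurve m \<in> psr_curve" by (rule pcurve_in[OF m])
        have "ennreal ((cx m) ^ 4) * (ennreal ?c * ?V) = (\<integral>\<^sup>+u. ennreal ((cx m) ^ 4) * (ennreal ?c * (indicator D u * fiber_density u)) \<partial>lborel)"
          by (subst nn_integral_cmult, measurable, subst nn_integral_cmult) measurable
        also have "\<dots> \<le> (\<integral>\<^sup>+u. indicator {0<..} (u $ FR) * ennreal (u $ FR * (cx m)\<^sup>2) * F (fiber_chart (pcurve m) u) \<partial>lborel)"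
        proof (rule nn_integral_mono)
          fix u :: "real ^ fcoord"
          show "ennreal ((cx m) ^ 4) * (ennreal ?c * (indicator D u * fiber_density u))
            \<le> indicator {0<..} (u $ FR) * ennreal (u $ FR * (cx m)\<^sup>2) * F (fiber_chart (pcurve m) u)"
          proof (cases "u \<in> D")
            case True
            then have r: "u $ FR > 0" "u $ FRho > 0" using Dfs by (auto simp: fiber_space_def)
            let ?r = "u $ FR" and ?\<rho> = "u $ FRho"
            have t: "tpart (fiber_chart (pcurve m) u) = ?r *\<^sub>R pcurve m" by (rule tpart_fiber_chart)
            have h: "hcub (?r *\<^sub>R pcurve m) = ?r ^ 3" using x by (simp add: hcub_scaleR hcub_psr_curve)
            have F: "F (fiber_chart (pcurve m) u)
              = ennreal (?r\<^sup>2 * ((cx m)\<^sup>2 * (3 + m\<^sup>2)) / (8 * (?r ^ 3)\<^sup>2) / (2 ^ 13 * ?\<rho> ^ 5))"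
              using chart_in_E[OF x True] by (simp add: F_def t h gD_scaleR gD_pcurve) (simp add: fiber_chart_def)
            have "(cx m) ^ 4 * (?c * (1 / (?r ^ 3 * ?\<rho> ^ 5)))
              \<le> ?r * (cx m)\<^sup>2 * (?r\<^sup>2 * ((cx m)\<^sup>2 * (3 + m\<^sup>2)) / (8 * (?r ^ 3)\<^sup>2) / (2 ^ 13 * ?\<rho> ^ 5))"
            proof -
              have "?r * (cx m)\<^sup>2 * (?r\<^sup>2 * ((cx m)\<^sup>2 * (3 + m\<^sup>2)) / (8 * (?r ^ 3)\<^sup>2) / (2 ^ 13 * ?\<rho> ^ 5))
                = (cx m) ^ 4 * ((3 + m\<^sup>2) / 2 ^ 16 * (1 / (?r ^ 3 * ?\<rho> ^ 5)))"
                using r by (simp add: field_simps eval_nat_numeral)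
              moreover have "(cx m) ^ 4 * (?c * (1 / (?r ^ 3 * ?\<rho> ^ 5))) \<le> (cx m) ^ 4 * ((3 + m\<^sup>2) / 2 ^ 16 * (1 / (?r ^ 3 * ?\<rho> ^ 5)))"
              proof (rule mult_left_mono)
                show "?c * (1 / (?r ^ 3 * ?\<rho> ^ 5)) \<le> (3 + m\<^sup>2) / 2 ^ 16 * (1 / (?r ^ 3 * ?\<rho> ^ 5))"
                using r by (intro mult_right_mono divide_right_mono) auto
              qed (use c in simp)
              ultimately show ?thesis by (simp only:)
            qed
            then have "ennreal ((cx m) ^ 4 * (?c * (1 / (?r ^ 3 * ?\<rho> ^ 5))))
              \<le> ennreal (?r * (cx m)\<^sup>2 * (?r\<^sup>2 * ((cx m)\<^sup>2 * (3 + m\<^sup>2)) / (8 * (?r ^ 3)\<^sup>2) / (2 ^ 13 * ?\<rho> ^ 5)))"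
              by (rule ennreal_leI)
            moreover have "ennreal ((cx m) ^ 4) * (ennreal ?c * (indicator D u * fiber_density u))
              = ennreal ((cx m) ^ 4 * (?c * (1 / (?r ^ 3 * ?\<rho> ^ 5))))"
              using True r c by (simp only: fiber_density_def indicator_simps mult_1) (simp add: ennreal_mult[symmetric])
            moreover have "indicator {0<..} ?r * ennreal (?r * (cx m)\<^sup>2) * F (fiber_chart (pcurve m) u)
              = ennreal (?r * (cx m)\<^sup>2 * (?r\<^sup>2 * ((cx m)\<^sup>2 * (3 + m\<^sup>2)) / (8 * (?r ^ 3)\<^sup>2) / (2 ^ 13 * ?\<rho> ^ 5)))"
              unfolding F using r c by (subst (2) ennreal_mult) (auto simp: add_nonneg_nonneg)
            ultimately show ?thesis by (simp only:)
          qed simp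
        qed
        finally show ?thesis using m by (simp add: indicator_def)
      qed (auto simp: indicator_def)
    qed
    also have "\<dots> \<le> (\<integral>\<^sup>+p. F p \<partial>lborel)" by (rule nn_integral_cone_coordinates) measurable
    finally have "(\<integral>\<^sup>+m. ennreal ((cx m) ^ 4) * indicator {- 1<..<1} m \<partial>lborel) * (ennreal ?c * ?V) \<le> (\<integral>\<^sup>+p. F p \<partial>lborel)"
      by (subst nn_integral_multc[symmetric]) measurable
    moreover have "ennreal ?c * ?V \<noteq> 0" using Dpos by (simp add: ennreal_eq_0_iff)
    ultimately show ?thesis unfolding nn_integral_cx_power_4 by (simp add: ennreal_top_mult top_unique)
  qed
  ultimately have "\<infinity> \<le> riem_volume qmap_metric E" by simp
  also have "\<dots> \<le> total_volume \<Gamma> (qmap_part \<epsilon>)"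
    unfolding total_volume_def quotient_volume_def
    using Em E_part E_inj by (intro SUP_upper) blast
  finally show ?thesis by (simp add: top_unique)
qed

lemma total_volume_mono: "E \<subseteq> E' \<Longrightarrow> total_volume \<Gamma> E \<le> total_volume \<Gamma> E'"
  unfolding total_volume_def quotient_volume_def by (intro SUP_subset_mono) auto

theorem corollary3p33:
  fixes \<Gamma> :: "((real ^ 2 ^ 2) \<times> (real ^ lie)) set"
  assumes "lattice_in \<Gamma> qgroup"
  shows "(\<forall>e\<in>{1, - 1}. (\<exists>\<gamma>. arc_length_end e \<gamma>) \<and>
            (\<forall>\<gamma>. arc_length_end e \<gamma> \<longrightarrow>
               (\<exists>f. increases_exponentially f \<and>
                  (\<forall>s\<ge>0. \<forall>E\<in>sets borel. E \<subseteq> fiber_space \<longrightarrow>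
                     fiber_volume \<Gamma> (\<gamma> s) E = ennreal (f s) * fiber_volume \<Gamma> (\<gamma> 0) E)) \<and>
               (\<forall>\<epsilon>>0. increases_exponentially
                  (\<lambda>s. enn2real (fiber_volume \<Gamma> (\<gamma> s) (fiber_part \<epsilon>))))))
       \<and> (\<forall>x\<in>psr_curve. \<forall>\<epsilon>>0. 0 < fiber_volume \<Gamma> x (fiber_part \<epsilon>) \<and>
                                fiber_volume \<Gamma> x (fiber_part \<epsilon>) < \<infinity>)
       \<and> total_volume \<Gamma> qmap_space = \<infinity>
       \<and> (\<forall>\<epsilon>>0. total_volume \<Gamma> (qmap_part \<epsilon>) = \<infinity>)"
proof -
  note \<Gamma> = lattice_qgroup(1)[OF assms]
  have factor_pos: "fiber_factor (gD x) > 0" if "x \<in> psr_curve" for x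
    using psr_curve_pos(3)[OF that] by (simp add: fiber_factor_def)
  have finite: "0 < fiber_volume \<Gamma> x (fiber_part \<epsilon>) \<and> fiber_volume \<Gamma> x (fiber_part \<epsilon>) < \<infinity>"
    if x: "x \<in> psr_curve" and \<epsilon>: "\<epsilon> > 0" for x \<epsilon>
    unfolding fiber_volume_eq[OF \<Gamma> x fiber_part_subset]
    using factor_pos[OF x] fiber_quotient_volume_pos[OF assms, of \<epsilon>] fiber_quotient_volume_finite[OF assms \<epsilon>]
    by (auto simp: ennreal_zero_less_mult_iff ennreal_mult_less_top)
  have ends: "(\<exists>\<gamma>. arc_length_end e \<gamma>) \<and>
            (\<forall>\<gamma>. arc_length_end e \<gamma> \<longrightarrow>
               (\<exists>f. increases_exponentially f \<and>
                  (\<forall>s\<ge>0. \<forall>E\<in>sets borel. E \<subseteq> fiber_space \<longrightarrow>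
                     fiber_volume \<Gamma> (\<gamma> s) E = ennreal (f s) * fiber_volume \<Gamma> (\<gamma> 0) E)) \<and>
               (\<forall>\<epsilon>>0. increases_exponentially (\<lambda>s. enn2real (fiber_volume \<Gamma> (\<gamma> s) (fiber_part \<epsilon>)))))"
    if e: "e = 1 \<or> e = - 1" for e
  proof (intro conjI allI impI)
    show "\<exists>\<gamma>. arc_length_end e \<gamma>" using arc_length_end_exists[OF e] by blast
    fix \<gamma> assume \<gamma>: "arc_length_end e \<gamma>"
    have on: "\<gamma> s \<in> psr_curve" if "s \<ge> 0" for s using \<gamma> that by (simp add: arc_length_end_def)
    \<comment> \<open>Everything that depends on s is \<open>growth s\<close>. Neither the lattice
      nor the part of the fiber enters, and \<open>gD\<close> is even in the slope, so one function
      serves all parts and both ends.\<close>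
    have factor: "fiber_factor (gD (\<gamma> s)) = growth s * fiber_factor (gD (\<gamma> 0))" if s: "s \<ge> 0" for s
    proof -
      have "sqrt (gD (\<gamma> s) / 3) = growth s" if "s \<ge> 0" for s
        unfolding arc_length_end_eq[OF e \<gamma> that] gD_pcurve_sign[OF e] growth_def ..
      then show ?thesis using s growth_0 by (simp add: fiber_factor_def)
    qed
    have vol: "fiber_volume \<Gamma> (\<gamma> s) E = ennreal (growth s) * fiber_volume \<Gamma> (\<gamma> 0) E"
      if "s \<ge> 0" "E \<subseteq> fiber_space" for s E
      unfolding fiber_volume_eq[OF \<Gamma> on[OF that(1)] that(2)] fiber_volume_eq[OF \<Gamma> on[OF order_refl] that(2)] factor[OF that(1)]
      using growth_pos[of s] factor_pos[OF on[OF order_refl]] by (simp add: ennreal_mult mult.assoc)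
    show "\<exists>f. increases_exponentially f \<and>
                  (\<forall>s\<ge>0. \<forall>E\<in>sets borel. E \<subseteq> fiber_space \<longrightarrow>
                     fiber_volume \<Gamma> (\<gamma> s) E = ennreal (f s) * fiber_volume \<Gamma> (\<gamma> 0) E)"
      using growth_increases_exponentially vol by blast
    fix \<epsilon> :: real assume \<epsilon>: "\<epsilon> > 0"
    show "increases_exponentially (\<lambda>s. enn2real (fiber_volume \<Gamma> (\<gamma> s) (fiber_part \<epsilon>)))"
    proof (rule increases_exponentially_cmult[OF growth_increases_exponentially])
      show "enn2real (fiber_volume \<Gamma> (\<gamma> 0) (fiber_part \<epsilon>)) > 0"
        using finite[OF on[OF order_refl] \<epsilon>] by (simp add: enn2real_positive_iff)
      show "enn2real (fiber_volume \<Gamma> (\<gamma> s) (fiber_part \<epsilon>)) = growth s * enn2real (fiber_volume \<Gamma> (\<gamma> 0) (fiber_part \<epsilon>))"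
        if "s \<ge> 0" for s
        using vol[OF that fiber_part_subset] growth_pos[of s] by (simp add: enn2real_mult)
    qed
  qed
  \<comment> \<open>The whole space contains every part, here the one cut off at 1, so its volume is
    infinite by monotonicity.\<close>
  have "qmap_part 1 \<subseteq> qmap_space" by (auto simp: qmap_part_def)
  then have "total_volume \<Gamma> qmap_space = \<infinity>"
    using total_volume_mono[of "qmap_part 1" qmap_space \<Gamma>] total_volume_part_infinite[OF assms, of 1]
    by (simp add: top_unique)
  then show ?thesis using ends finite total_volume_part_infinite[OF assms] by simp
qed

end
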